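(* Let $n\ge2$, $1<p<\infty$, $\gamma\in(0,1]$, let $\Omega\subset\mathbb{R}^n$ be a bounded domain of class $C^{1,\gamma}$, and fix $0<\lambda\le H_p(\Omega)$. Let $\alpha\in\left[\frac{p-1}{p},1\right)$ be such that $\lambda_\alpha=\lambda$, and let $\mathcal U$ be an open neighbourhood of $\partial\Omega$. If $u\in C\big(\overline{\Omega\cap\mathcal U}\setminus\partial\Omega\big)$ is a positive solution of the equation $$-\Delta_pv-\frac{\lambda}{\delta^p}|v|^{p-2}v=0$$ in $\Omega\cap\mathcal U$, then there exists a constant $C>0$ such that $$\delta(x)^\alpha\le C\,u(x)\qquad\text{in }\Omega\cap\mathcal U.$$ Hence, if $u$ is a minimizer for the variational problem defining $H_p(\Omega)$, then $H_p(\Omega)<c_p$.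
   Context: A domain is an open connected set. $\delta(x)=d(x,\partial\Omega)$ is the distance to the boundary. The space $\widetilde W^{1,p}(\Omega)=\{u\in W^{1,p}_{\rm loc}(\Omega): \int_\Omega |u|^p\delta^{-p}\,dx<\infty,\ \int_\Omega|\nabla u|^p\,dx<\infty\}$. The $L^p$ Hardy constant is $$H_p(\Omega)=\inf_{u\in\widetilde W^{1,p}(\Omega),\,u\neq0}\frac{\int_\Omega|\nabla u|^p\,dx}{\int_\Omega|u|^p\delta^{-p}\,dx},$$ which is the best constant $c$ in $\int_\Omega|\nabla u|^p\,dx\ge c\int_\Omega|u|^p\delta^{-p}\,dx$ for all $u\in C_c^\infty(\Omega)$. For bounded domains of class $C^1$ one has $\widetilde W^{1,p}(\Omega)=W^{1,p}_0(\Omega)$. A minimizer is a nonzero function attaining this infimum. $c_p=\left(\frac{p-1}{p}\right)^p$ and, for $\alpha\in[0,1]$, $\lambda_\alpha=(p-1)\alpha^{p-1}(1-\alpha)$. $\Delta_p u=\mathrm{div}(|\nabla u|^{p-2}\nabla u)$. For an open set $D$ and $V\in L^\infty_{\rm loc}(D)$, a (weak) solution of $-\Delta_pu+V|u|^{p-2}u=0$ in $D$ is a function $u\in W^{1,p}_{\rm loc}(D)$ with $\int_D|\nabla u|^{p-2}\nabla u\cdot\nabla\varphi\,dx+\int_DV|u|^{p-2}u\varphi\,dx=0$ for all $\varphi\in C_c^\infty(D)$.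
   Formalization: The solution u is assumed positive on all of the closure of Ω∩U minus ∂Ω, where it is continuous, not only in Ω∩U: if u vanished at a point of Ω on the boundary of U, the bound δ^α ≤ Cu would fail near that point. *)

theory Defs
  imports "HOL-Analysis.Analysis"
begin

abbreviation bdry_dist :: "'a::euclidean_space set \<Rightarrow> 'a \<Rightarrow> real" where
  "bdry_dist \<Omega> x \<equiv> infdist x (frontier \<Omega>)"

text \<open>A \<open>C\<^sup>1\<close> function with Hoelder continuous gradient. The Hoelder bound is global; for the graph
  functions below this is no restriction, since they only matter near one boundary point.\<close>

definition C1_holder :: "real \<Rightarrow> ('a::euclidean_space \<Rightarrow> real) \<Rightarrow> bool" where
  "C1_holder \<gamma> g \<longleftrightarrow>
     (\<exists>G :: 'a \<Rightarrow> 'a. (\<forall>x. GDERIV g x :> G x) \<and>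
        (\<exists>M. \<forall>x y. norm (G x - G y) \<le> M * dist x y powr \<gamma>))"

text \<open>The boundary is locally the graph of a \<open>C1_holder\<close> function over the hyperplane orthogonal to a
  unit vector \<open>\<nu>\<close>, with the set lying strictly above the graph. The graph function is evaluated only
  at the projection of \<open>x\<close> to that hyperplane, so it is in effect a function of \<open>DIM('a) - 1\<close>
  variables (a function on the hyperplane extends constantly in direction \<open>\<nu>\<close>).\<close>

definition C1_holder_boundary :: "real \<Rightarrow> 'a::euclidean_space set \<Rightarrow> bool" where
  "C1_holder_boundary \<gamma> \<Omega> \<longleftrightarrow>
     (\<forall>z \<in> frontier \<Omega>. \<exists>r>0. \<exists>\<nu> g. norm \<nu> = 1 \<and> C1_holder \<gamma> g \<and>
        (\<forall>x \<in> ball z r. x \<in> \<Omega> \<longleftrightarrow> g (x - (x \<bullet> \<nu>) *\<^sub>R \<nu>) < x \<bullet> \<nu>))"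

primrec Ck :: "nat \<Rightarrow> ('a::euclidean_space \<Rightarrow> real) \<Rightarrow> bool" where
  "Ck 0 f \<longleftrightarrow> continuous_on UNIV f"
| "Ck (Suc k) f \<longleftrightarrow> (\<forall>x. f differentiable (at x)) \<and> (\<forall>v. Ck k (\<lambda>x. frechet_derivative f (at x) v))"

text \<open>\<open>C\<^sub>c\<^sup>\<infinity>(D)\<close>, whose elements are identified with their extensions by zero.\<close>

definition test_functions :: "'a::euclidean_space set \<Rightarrow> ('a \<Rightarrow> real) set" where
  "test_functions D =
     {\<phi>. (\<forall>k. Ck k \<phi>) \<and> compact (closure {x. \<phi> x \<noteq> 0}) \<and> closure {x. \<phi> x \<noteq> 0} \<subseteq> D}"

definition grad :: "('a::euclidean_space \<Rightarrow> real) \<Rightarrow> 'a \<Rightarrow> 'a" where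
  "grad f x = (\<Sum>b\<in>Basis. frechet_derivative f (at x) b *\<^sub>R b)"

definition Lp_loc :: "real \<Rightarrow> 'a::euclidean_space set \<Rightarrow> ('a \<Rightarrow> 'b::euclidean_space) \<Rightarrow> bool" where
  "Lp_loc p D f \<longleftrightarrow> f \<in> borel_measurable (lebesgue_on D) \<and>
     (\<forall>K. compact K \<and> K \<subseteq> D \<longrightarrow> set_integrable lebesgue K (\<lambda>x. norm (f x) powr p))"

definition has_weak_gradient :: "'a::euclidean_space set \<Rightarrow> ('a \<Rightarrow> real) \<Rightarrow> ('a \<Rightarrow> 'a) \<Rightarrow> bool" where
  "has_weak_gradient D u G \<longleftrightarrow> Lp_loc 1 D u \<and> Lp_loc 1 D G \<and>
     (\<forall>\<phi> \<in> test_functions D.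
        (LINT x:D|lebesgue. u x *\<^sub>R grad \<phi> x) = - (LINT x:D|lebesgue. \<phi> x *\<^sub>R G x))"

text \<open>Weak gradients are unique up to a null set, so the choice of representative is immaterial.\<close>

definition weak_grad :: "'a::euclidean_space set \<Rightarrow> ('a \<Rightarrow> real) \<Rightarrow> 'a \<Rightarrow> 'a" where
  "weak_grad D u = (SOME G. has_weak_gradient D u G)"

definition W1p_loc :: "real \<Rightarrow> 'a::euclidean_space set \<Rightarrow> ('a \<Rightarrow> real) set" where
  "W1p_loc p D = {u. Lp_loc p D u \<and> (\<exists>G. has_weak_gradient D u G) \<and> Lp_loc p D (weak_grad D u)}"

text \<open>The space \<open>W~\<^sup>1\<^sup>,\<^sup>p(\<Omega>)\<close>.\<close>

definition W1p_tilde :: "real \<Rightarrow> 'a::euclidean_space set \<Rightarrow> ('a \<Rightarrow> real) set" where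
  "W1p_tilde p \<Omega> = {u \<in> W1p_loc p \<Omega>.
     set_integrable lebesgue \<Omega> (\<lambda>x. \<bar>u x\<bar> powr p * bdry_dist \<Omega> x powr (- p)) \<and>
     set_integrable lebesgue \<Omega> (\<lambda>x. norm (weak_grad \<Omega> u x) powr p)}"

definition hardy_quotient :: "real \<Rightarrow> 'a::euclidean_space set \<Rightarrow> ('a \<Rightarrow> real) \<Rightarrow> real" where
  "hardy_quotient p \<Omega> u =
     (LINT x:\<Omega>|lebesgue. norm (weak_grad \<Omega> u x) powr p) /
     (LINT x:\<Omega>|lebesgue. \<bar>u x\<bar> powr p * bdry_dist \<Omega> x powr (- p))"

text \<open>\<open>u \<noteq> 0\<close> is meant in the space of classes of functions, i.e. \<open>u\<close> does not vanish almost everywhere.\<close>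

definition hardy_admissible :: "real \<Rightarrow> 'a::euclidean_space set \<Rightarrow> ('a \<Rightarrow> real) set" where
  "hardy_admissible p \<Omega> = {u \<in> W1p_tilde p \<Omega>. \<not> (AE x in lebesgue_on \<Omega>. u x = 0)}"

definition hardy_const :: "real \<Rightarrow> 'a::euclidean_space set \<Rightarrow> real" where
  "hardy_const p \<Omega> = (INF u \<in> hardy_admissible p \<Omega>. hardy_quotient p \<Omega> u)"

definition hardy_minimizer :: "real \<Rightarrow> 'a::euclidean_space set \<Rightarrow> ('a \<Rightarrow> real) \<Rightarrow> bool" where
  "hardy_minimizer p \<Omega> u \<longleftrightarrow> u \<in> hardy_admissible p \<Omega> \<and> hardy_quotient p \<Omega> u = hardy_const p \<Omega>"

text \<open>Weak solutions of \<open>- \<Delta>\<^sub>p u + V \<bar>u\<bar>\<^bsup>p - 2\<^esup> u = 0\<close> in \<open>D\<close>. Since \<open>0 powr s = 0\<close>, for \<open>p < 2\<close> the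
  expressions \<open>\<bar>\<xi>\<bar>\<^bsup>p - 2\<^esup> \<xi>\<close> are read as \<open>0\<close> at \<open>\<xi> = 0\<close>.\<close>

definition weak_solution ::
  "real \<Rightarrow> 'a::euclidean_space set \<Rightarrow> ('a \<Rightarrow> real) \<Rightarrow> ('a \<Rightarrow> real) \<Rightarrow> bool" where
  "weak_solution p D V u \<longleftrightarrow> u \<in> W1p_loc p D \<and>
     (\<forall>\<phi> \<in> test_functions D.
        (LINT x:D|lebesgue. norm (weak_grad D u x) powr (p - 2) * (weak_grad D u x \<bullet> grad \<phi> x)) +
        (LINT x:D|lebesgue. V x * \<bar>u x\<bar> powr (p - 2) * u x * \<phi> x) = 0)"

definition hardy_c :: "real \<Rightarrow> real" where
  "hardy_c p = ((p - 1) / p) powr p"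

definition hardy_lambda :: "real \<Rightarrow> real \<Rightarrow> real" where
  "hardy_lambda p \<alpha> = (p - 1) * \<alpha> powr (p - 1) * (1 - \<alpha>)"

end

(* Everything is done by comparison, without regularity theory: a classical strict subsolution with
nonvanishing gradient cannot touch a positive weak supersolution from below. Near a boundary point x0 with normal n
the subsolutions are F(l), l = (x - x0) . n - const |x - x0|^(1 + gamma), where F(t) is t^alpha up to factors that absorb
the errors of relative size t^gamma. Small multiples of them lie below u; a continuity argument in the
multiplier, run simultaneously over all x0, raises these to a multiple independent of the cutoff of F.
If hardy_const were >= hardy_c, the modulus of a minimizer would be a weak supersolution, positive by a De Giorgi
argument and propagation of positivity, hence u >= c delta^((p-1)/p); but 1/delta is not integrable. *)
theory Submission
 imports Defs "HOL-Computational_Algebra.Polynomial"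
begin

text \<open>For \<gamma> < 1 the distance function is in general not differentiable near the
  boundary, so it cannot be inserted into a one-dimensional profile. The explicit functions
  \<open>level\<close> replace it, at the price of errors of size |x - x0|^\<gamma>, which are
  harmless only where |x - x0| is comparable to the value t of \<open>level\<close>. Using the
  barriers of all boundary points at once forces this: if the touching barrier is at least as high
  as the one based at a nearest boundary point, then x lies in a cone over x0; otherwise the barrier
  of the nearest point is strictly larger and touching is impossible. A second obstacle is the
  critical exponent (p - 1)/p, at which the radial equation gives no first-order gain. The factor
  exp(th t^\<gamma>) supplies strictness of order t^\<gamma>, while the extra exponent
  \<open>ze\<close> and the cutoff at \<open>ey\<close> cost only terms that a quadratic gain
  absorbs, uniformly in both. The multiplier reaches 1 for every cutoff because the normalisation
  \<open>cc\<close> comes from a fixed compact part of the boundary layer.\<close>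

abbreviation lborel_integral (binder "LI " 10) where "lborel_integral f \<equiv> integral\<^sup>L lborel f"
abbreviation lborel_integrable (binder "ILI " 10) where "lborel_integrable f \<equiv> integrable lborel f"
abbreviation lborel_ae (binder "AEL " 10) where "lborel_ae P \<equiv> almost_everywhere lborel P"
abbreviation "BM \<equiv> borel_measurable borel"
notation scaleR (infixr "*R" 75)
notation divideR (infixl "'/R" 70)
notation inner (infixl "<.>" 70)
notation tendsto (infixr "--->" 55)
abbreviation lborel_nn_integral (binder "NLI " 10) where "lborel_nn_integral f == nn_integral lborel f"
notation LIMSEQ ("((_)/ ----> (_))" [60, 60] 60)

lemmas bint_bound = Bochner_Integration.integrable_bound
 and bint_add = Bochner_Integration.integrable_add
 and bint_plus = Bochner_Integration.integral_add
 and bint_nonneg = Bochner_Integration.integral_nonneg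
 and bint_minus = Bochner_Integration.integral_diff
 and bint_diff = Bochner_Integration.integrable_diff
 and bint_cong = Bochner_Integration.integral_cong

section \<open>Flat functions and smooth bumps\<close>

lemma poly_times_exp_neg_tendsto_0:
 fixes P :: "real poly"
 shows "((%x. poly P x * exp (- x)) ---> 0) at_top"
proof -
 \<comment> \<open>The power \<open>x ^ n\<close> strengthens the claim for the induction: peeling
   off one coefficient turns \<open>n\<close> into \<open>Suc n\<close>.\<close>
 have "((%x. x ^ n * poly P x * exp (- x)) ---> 0) at_top" for n
 proof (induction P arbitrary: n)
 case 0
 then show ?case by simp
 next
 case (pCons a P)
 have "((%x::real. a * (x ^ n / exp x)) ---> a * 0) at_top"
 by (intro tendsto_intros tendsto_power_div_exp_0)
 then have "((%x::real. a * (x ^ n / exp x) + x ^ Suc n * poly P x * exp (- x)) ---> 0 + 0) at_top"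
 by (intro tendsto_add pCons.IH) simp
 then show ?case
 by (simp add: field_simps exp_minus)
 qed
 from this[of 0] show ?thesis by simp
qed

text \<open>The classical flat function exp(-1/t), with a polynomial in 1/t in front so that the
  family is closed under differentiation.\<close>

definition flat_exp :: "real poly => real => real" where
 "flat_exp P t = (if 0 < t then poly P (1 / t) * exp (- (1 / t)) else 0)"

lemma flat_exp_right_limit: "(flat_exp P ---> 0) (at_right 0)"
proof -
 have "((%t. poly P (inverse t) * exp (- inverse t)) ---> 0) (at_right 0)"
 by (rule filterlim_compose[OF poly_times_exp_neg_tendsto_0 filterlim_inverse_at_top_right])
 then show ?thesis
 by (rule Lim_transform_eventually)
 (auto simp: flat_exp_def eventually_at_right_field inverse_eq_divide intro!: exI[of _ 1])
qed

text \<open>For t > 0 the product rule gives t^(-2) (P - P')(1/t) exp(-1/t), and t^(-2) is the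
  polynomial \<open>[:0, 0, 1:]\<close> in 1/t. Only t = 0 requires a limit.\<close>

lemma flat_exp_has_derivative:
 "(flat_exp P has_real_derivative flat_exp ([:0, 0, 1:] * (P - pderiv P)) t) (at t)"
proof (cases t "0 :: real" rule: linorder_cases)
 case greater
 have "((%t. poly P (1 / t) * exp (- (1 / t))) has_real_derivative
 flat_exp ([:0, 0, 1:] * (P - pderiv P)) t) (at t)"
 using greater unfolding flat_exp_def
 by (auto intro!: derivative_eq_intros simp: field_simps power2_eq_square)
 moreover have "eventually (%s. flat_exp P s = poly P (1 / s) * exp (- (1 / s))) (nhds t)"
 using eventually_nhds_in_open[of "{0<..}" t] greater
 by (auto elim!: eventually_mono simp: flat_exp_def)
 ultimately show ?thesis
 using DERIV_cong_ev[of t t "flat_exp P" "%t. poly P (1 / t) * exp (- (1 / t))"] by auto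
next
 case less
 have "eventually (%s. flat_exp P s = 0) (nhds t)"
 using eventually_nhds_in_open[of "{..<0}" t] less
 by (auto elim!: eventually_mono simp: flat_exp_def)
 then show ?thesis
 using DERIV_cong_ev[of t t "flat_exp P" "%_. 0"] less by (simp add: flat_exp_def)
next
 case equal
 \<comment> \<open>Division by \<open>h\<close> multiplies the polynomial by its variable, so the
   right difference quotient at 0 is again a \<open>flat_exp\<close>.\<close>
 have "((%h. flat_exp P h / h) ---> 0) (at_right 0)"
 proof (rule Lim_transform_eventually[OF flat_exp_right_limit[of "[:0, 1:] * P"]])
 show "\<forall>\<^sub>F x in at_right 0. flat_exp ([:0, 1:] * P) x = flat_exp P x / x"
 by (auto simp: flat_exp_def eventually_at_right_field intro!: exI[of _ 1])
 qed
 moreover have "((%h. flat_exp P h / h) ---> 0) (at_left 0)"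
 by (rule tendsto_eventually) (auto simp: flat_exp_def eventually_at_left_field intro!: exI[of _ "-1"])
 ultimately have "((%h. flat_exp P h / h) ---> 0) (at 0)"
 by (simp add: filterlim_split_at)
 then show ?thesis
 using equal by (simp add: DERIV_def flat_exp_def)
qed

lemma flat_exp_1_pos: "0 < t ==> 0 < flat_exp 1 t" and flat_exp_1_nonneg: "0 <= flat_exp 1 t"
 and flat_exp_nonpos: "t <= 0 ==> flat_exp P t = 0"
 by (auto simp: flat_exp_def)

text \<open>This class contains the radial bump of radius \<open>1 / sqrt c\<close> and is closed under directional
 derivatives, which makes all its members \<open>C\<^sup>\<infinity>\<close>.\<close>

inductive_set bump_algebra :: "real => ('a::euclidean_space => real) set" for c where
 flat: "(%x. flat_exp P (1 - c * (x <.> x))) : bump_algebra c"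
| const: "(%x. k) : bump_algebra c"
| lin: "(%x. x <.> b) : bump_algebra c"
| add: "f : bump_algebra c ==> g : bump_algebra c ==> (%x. f x + g x) : bump_algebra c"
| mult: "f : bump_algebra c ==> g : bump_algebra c ==> (%x. f x * g x) : bump_algebra c"

lemma bump_algebra_derivative:
 assumes "f : bump_algebra c"
 shows "EX f'. (ALL x. (f has_derivative f' x) (at x)) & (ALL v. (%x. f' x v) : bump_algebra c)"
 using assms
proof induction
 case (flat P)
 let ?Q = "[:0, 0, 1:] * (P - pderiv P)"
 let ?f' = "%x v :: 'a. flat_exp ?Q (1 - c * (x <.> x)) * ((- 2 * c) * (x <.> v))"
 have "((%x. flat_exp P (1 - c * (x <.> x))) has_derivative ?f' x) (at x)" for x :: 'a
 by (rule has_derivative_eq_rhs, rule has_derivative_compose[where g = "flat_exp P",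
 OF _ flat_exp_has_derivative[THEN has_field_derivative_imp_has_derivative]])
 (auto intro!: derivative_eq_intros simp: inner_commute algebra_simps)
 moreover have "(%x. ?f' x v) : bump_algebra c" for v
 by (intro bump_algebra.intros)
 ultimately show ?case by (intro exI[of _ ?f']) blast
next
 case (const k)
 show ?case by (rule exI[of _ "%x v. 0"]) (auto intro: bump_algebra.const)
next
 case (lin b)
 show ?case
 by (rule exI[of _ "%x v. v <.> b"]) (auto intro: bump_algebra.const intro!: derivative_eq_intros)
next
 case (add f g)
 then obtain f' g' where *: "ALL x. (f has_derivative f' x) (at x)" "ALL v. (%x. f' x v) : bump_algebra c"
 "ALL x. (g has_derivative g' x) (at x)" "ALL v. (%x. g' x v) : bump_algebra c" by blast
 show ?case
 by (rule exI[of _ "%x v. f' x v + g' x v"])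
 (use * in "auto intro!: derivative_eq_intros bump_algebra.add")
next
 case (mult f g)
 then obtain f' g' where *: "ALL x. (f has_derivative f' x) (at x)" "ALL v. (%x. f' x v) : bump_algebra c"
 "ALL x. (g has_derivative g' x) (at x)" "ALL v. (%x. g' x v) : bump_algebra c" by blast
 show ?case
 by (rule exI[of _ "%x v. f x * g' x v + f' x v * g x"])
 (use * mult.hyps in "auto intro!: derivative_eq_intros bump_algebra.add bump_algebra.mult")
qed

lemma bump_algebra_Ck: "f : bump_algebra c ==> Ck k f"
proof (induction k arbitrary: f)
 case 0
 then obtain f' where "ALL x. (f has_derivative f' x) (at x)"
 using bump_algebra_derivative by blast
 then show ?case
 by (auto intro!: continuous_at_imp_continuous_on has_derivative_continuous)
next
 case (Suc k)
 then obtain f' where f': "ALL x. (f has_derivative f' x) (at x)" "ALL v. (%x. f' x v) : bump_algebra c"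
 using bump_algebra_derivative by blast
 then have "frechet_derivative f (at x) = f' x" for x
 by (simp add: frechet_derivative_at[symmetric])
 with f' Suc.IH show ?case
 by (auto simp: differentiable_def)
qed

section \<open>Gradients, smooth functions and compactly supported C^1 functions\<close>

lemma GDERIV_grad:
 assumes "f differentiable (at x)"
 shows "GDERIV f x :> grad f x"
proof -
 let ?F = "frechet_derivative f (at x)"
 have F: "(f has_derivative ?F) (at x)"
 using assms by (simp add: frechet_derivative_works)
 then interpret linear ?F by (rule has_derivative_linear)
 have "?F h = h <.> grad f x" for h
 proof -
 have "?F h = ?F (SUM b:Basis. (h <.> b) *R b)" by (simp add: euclidean_representation)
 also have "... = h <.> grad f x"
 by (simp add: sum scale grad_def inner_sum_right mult.commute)
 finally show ?thesis .
 qed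
 then have "?F = (%h. h <.> grad f x)" by blast
 with F show ?thesis by (simp add: gderiv_def)
qed

lemma inner_right_eqI: "(!!h. h <.> (a::'a::euclidean_space) = h <.> b) ==> a = b"
 by (metis euclidean_eqI inner_commute)

lemma GDERIV_unique: "GDERIV f (x::'a::euclidean_space) :> D ==> GDERIV f x :> E ==> D = E"
 unfolding gderiv_def by (rule inner_right_eqI) (metis has_derivative_unique)

lemma GDERIV_imp_differentiable: "GDERIV f x :> D ==> f differentiable (at x)"
 by (auto simp: gderiv_def differentiable_def)

lemma grad_eqI: "GDERIV f x :> D ==> grad f x = D"
 by (metis GDERIV_grad GDERIV_unique GDERIV_imp_differentiable)

lemma frechet_derivative_GDERIV: "GDERIV f x :> D ==> frechet_derivative f (at x) = (%h. h <.> D)"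
 by (metis gderiv_def frechet_derivative_at)

definition smooth :: "('a::euclidean_space => real) => bool" where
 "smooth f \<longleftrightarrow> (ALL k. Ck k f)"

lemma smooth_differentiable: "smooth f ==> f differentiable (at x)"
 unfolding smooth_def by (metis Ck.simps(2))

lemma smooth_directional: "smooth f ==> smooth (%x. frechet_derivative f (at x) v)"
 unfolding smooth_def by (metis Ck.simps(2))

lemma smooth_continuous: "smooth f ==> continuous_on UNIV f"
 unfolding smooth_def by (metis Ck.simps(1))

lemma smooth_GDERIV: "smooth f ==> GDERIV f x :> grad f x"
 by (simp add: GDERIV_grad smooth_differentiable)

lemma smooth_continuous_grad: "smooth f ==> continuous_on UNIV (grad f)"
 unfolding grad_def[abs_def]
 by (intro continuous_on_sum continuous_on_scaleR continuous_on_const smooth_continuous smooth_directional)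

lemma Ck_reflect: "Ck k f ==> Ck k (%y. f (x - y))"
proof (induction k arbitrary: f)
 case 0
 then show ?case
 by (auto intro!: continuous_on_compose2[of UNIV f] continuous_intros)
next
 case (Suc k)
 have D: "((%y. f (x - y)) has_derivative (%v. frechet_derivative f (at (x - y)) (- v))) (at y)" for y
 proof (rule has_derivative_compose[where g = f and f = "%y. x - y"])
 show "((%y. x - y) has_derivative (%v. - v)) (at y)" by (auto intro!: derivative_eq_intros)
 show "(f has_derivative frechet_derivative f (at (x - y))) (at (x - y))"
 using Suc.prems by (simp add: frechet_derivative_works)
 qed
 have "Ck k (%y. frechet_derivative f (at (x - y)) (- v))" for v
 using Suc by auto
 then show ?case
 using D by (auto simp: differentiable_def frechet_derivative_at[OF D, symmetric])
qed

lemma smooth_reflect: "smooth f ==> smooth (%y. f (x - y))"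
 by (simp add: smooth_def Ck_reflect)

text \<open>\<open>K\<close> is any compact set containing the support. The nonlinear test functions
  used below are composed with \<open>hinge\<close>, which is only C^1, so smooth functions alone
  would not suffice.\<close>

definition C1_supp :: "'a set => ('a::euclidean_space => real) => ('a => 'a) => bool" where
 "C1_supp K f g \<longleftrightarrow> compact K & (ALL x. GDERIV f x :> g x) & continuous_on UNIV g & (ALL x. x ~: K --> f x = 0)"

lemma C1_supp_continuous: "C1_supp K f g ==> continuous_on UNIV f"
 unfolding C1_supp_def gderiv_def
 by (auto intro!: continuous_at_imp_continuous_on has_derivative_continuous)

lemma GDERIV_eq_0_open:
 assumes "open S" "!!x. x : S ==> f x = 0" "x : S"
 shows "GDERIV f x :> 0"
proof -
 have "((%_. 0) has_derivative (%h. 0)) (at x)" by simp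
 then have "(f has_derivative (%h. 0)) (at x)"
 by (rule has_derivative_transform_within_open[OF _ assms(1,3)]) (use assms(2) in auto)
 then show ?thesis by (simp add: gderiv_def)
qed

lemma C1_supp_grad_0:
 assumes "C1_supp K f g" "x ~: K"
 shows "g x = 0"
proof -
 have "GDERIV f x :> 0"
 by (rule GDERIV_eq_0_open[of "- K"]) (use assms in "auto simp: C1_supp_def compact_imp_closed")
 then show ?thesis
 using assms GDERIV_unique unfolding C1_supp_def by blast
qed

lemma integrable_continuous_supp:
 fixes f :: "'a::euclidean_space => 'b::euclidean_space"
 assumes "continuous_on UNIV f" "compact K" "!!x. x ~: K ==> f x = 0"
 shows "integrable lborel f"
proof -
 have "ILI x. indicator K x *R f x"
 by (rule borel_integrable_compact) (use assms in "auto intro: continuous_on_subset")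
 moreover have "(%x. indicator K x *R f x) = f"
 using assms(3) by (auto simp: indicator_def fun_eq_iff)
 ultimately show ?thesis by simp
qed

lemma bounded_continuous_supp:
 fixes f :: "'a::euclidean_space => 'b::euclidean_space"
 assumes "continuous_on UNIV f" "compact K" "!!x. x ~: K ==> f x = 0"
 shows "EX B>0. ALL x. norm (f x) <= B"
proof -
 have "compact (f ` K)" using assms by (auto intro!: compact_continuous_image intro: continuous_on_subset)
 then obtain B where "B > 0" "ALL y:f ` K. norm y <= B" using bounded_pos compact_imp_bounded by metis
 then show ?thesis using assms(3) by (intro exI[of _ B]) (metis imageI less_imp_le norm_zero)
qed

lemma C1_supp_bounds:
 assumes "C1_supp K f g"
 shows "EX B>0. (ALL x. \<bar>f x\<bar> <= B) & (ALL x. norm (g x) <= B)"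
proof -
 obtain B1 where "B1 > 0" "ALL x. norm (f x) <= B1"
 using bounded_continuous_supp[of f K] C1_supp_continuous[OF assms] assms by (auto simp: C1_supp_def)
 moreover obtain B2 where "B2 > 0" "ALL x. norm (g x) <= B2"
 using bounded_continuous_supp[of g K] C1_supp_grad_0[OF assms] assms by (auto simp: C1_supp_def)
 ultimately show ?thesis
 by (intro exI[of _ "max B1 B2"]) (auto simp: le_max_iff_disj)
qed

lemma uniformly_continuous_supp:
 fixes f :: "'a::euclidean_space => 'b::euclidean_space"
 assumes cont: "continuous_on UNIV f" and K: "compact K" and 0: "!!x. x ~: K ==> f x = 0" and "0 < e"
 shows "EX d>0. ALL x y. dist x y < d --> dist (f x) (f y) < e"
proof -
 \<comment> \<open>Of two points at distance below 1, either both lie in \<open>L\<close> or both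
   values vanish; uniform continuity on the compact set \<open>L\<close> is therefore
   enough.\<close>
 define L where "L = {x + y | x y. x : K & y : cball 0 (1::real)}"
 have "compact L" unfolding L_def using K by (intro compact_sums) auto
 then have "uniformly_continuous_on L f"
 by (intro compact_uniformly_continuous) (use cont in "auto intro: continuous_on_subset")
 then obtain d where d: "d > 0" "!!x y. x : L ==> y : L ==> dist x y < d ==> dist (f x) (f y) < e"
 using \<open>0 < e\<close> unfolding uniformly_continuous_on_def by metis
 have "dist (f x) (f y) < e" if "dist x y < min d 1" for x y
 proof -
 have L: "z : L" if "z' : K" "dist z z' < 1" for z z'
 proof -
 have "z = z' + (z - z')" "z - z' : cball 0 1" using that by (auto simp: dist_norm norm_minus_commute)
 then show ?thesis unfolding L_def using that(1) by blast
 qed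
 consider "x : K" | "y : K" | "x ~: K" "y ~: K" by blast
 then show ?thesis
 proof cases
 case 1 then show ?thesis using L[OF 1, of x] L[OF 1, of y] that d(2) by (auto simp: dist_commute)
 next
 case 2 then show ?thesis using L[OF 2, of x] L[OF 2, of y] that d(2) by auto
 next
 case 3 then show ?thesis using 0 \<open>0 < e\<close> by simp
 qed
 qed
 then show ?thesis using d(1) by (intro exI[of _ "min d 1"]) auto
qed

lemma GDERIV_bound:
 assumes "!!x. GDERIV f x :> g x" "!!x. norm (g x) <= B"
 shows "\<bar>f (x + h) - f (x::'a::euclidean_space)\<bar> <= B * norm h"
proof -
 have "norm (f (x + h) - f x) <= B * norm (x + h - x)"
 proof (rule differentiable_bound[of UNIV f "%x h. h <.> g x"])
 show "(f has_derivative (%h. h <.> g x)) (at x within UNIV)" for x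
 using assms(1) by (simp add: gderiv_def)
 show "onorm (%h. h <.> g x) <= B" for x
 using assms(2)[of x] onorm_inner_left[OF bounded_linear_ident, of "g x"]
 by (simp add: onorm_id)
 qed auto
 then show ?thesis by simp
qed

text \<open>The gradient vanishes off \<open>K\<close> and is uniformly continuous on the whole
  space, so the mean value inequality on \<open>ball x d\<close> has an error independent of
  \<open>x\<close>.\<close>

lemma C1_supp_uniform_linearization:
 assumes f: "C1_supp K f g" and "0 < e"
 shows "EX d>0. ALL x h. norm h < d --> \<bar>f (x + h) - f x - h <.> g x\<bar> <= e * norm h"
proof -
 have g: "continuous_on UNIV g" "compact K" using f by (auto simp: C1_supp_def)
 obtain d where d: "d > 0" "!!x y. dist x y < d ==> dist (g x) (g y) < e"
 using uniformly_continuous_supp[OF g C1_supp_grad_0[OF f] \<open>0 < e\<close>] by blast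
 have "\<bar>f (x + h) - f x - h <.> g x\<bar> <= e * norm h" if "norm h < d" for x h
 proof -
 have "norm (f (x + h) - f x - (%h. h <.> g x) (x + h - x)) <= norm (x + h - x) * e"
 proof (rule differentiable_bound_linearization[where S = "ball x d" and f' = "%y h. h <.> g y"])
 show "x + t *R (x + h - x) : ball x d" if "t : {0..1}" for t
 using that \<open>norm h < d\<close> by (auto simp: dist_norm abs_mult) (smt (verit) mult_left_le_one_le norm_ge_zero)
 show "(f has_derivative (%h. h <.> g y)) (at y within ball x d)" for y
 using f by (auto simp: C1_supp_def gderiv_def intro: has_derivative_at_withinI)
 show "onorm ((%v. v <.> g y) - (%v. v <.> g x)) <= e" if "y : ball x d" for y
 proof -
 have "onorm ((%v. v <.> g y) - (%v. v <.> g x)) = onorm (%v. v <.> (g y - g x))"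
 by (simp add: inner_diff_right fun_diff_def)
 also have "... <= norm (g y - g x)"
 using onorm_inner_left[OF bounded_linear_ident, of "g y - g x"] by (simp add: onorm_id)
 also have "... <= e" using d(2)[of y x] that by (simp add: dist_norm dist_commute norm_minus_commute)
 finally show ?thesis .
 qed
 show "x : ball x d" using d(1) by simp
 qed
 then show ?thesis by (simp add: mult.commute)
 qed
 then show ?thesis using d(1) by blast
qed

lemma smooth_C1_supp: "smooth f ==> compact K ==> (!!x. x ~: K ==> f x = 0) ==> C1_supp K f (grad f)"
 by (auto simp: C1_supp_def smooth_GDERIV smooth_continuous_grad)

lemma test_functionsI:
 assumes "smooth vp" "compact K" "K <= D" "!!x. x ~: K ==> vp x = 0"
 shows "vp : test_functions D"
proof -
 have "closure {x. vp x ~= 0} <= K"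
 using assms by (intro closure_minimal) (auto simp: compact_imp_closed)
 moreover from this have "compact (closure {x. vp x ~= 0})"
 using assms(2) compact_Int_closed[OF assms(2) closed_closure, of "{x. vp x ~= 0}"]
 by (simp add: inf.absorb2)
 ultimately show ?thesis
 using assms by (auto simp: test_functions_def smooth_def)
qed

lemma test_functionsE:
 assumes "vp : test_functions D"
 obtains K where "smooth vp" "compact K" "K <= D" "!!x. x ~: K ==> vp x = 0" "C1_supp K vp (grad vp)"
proof
 let ?K = "closure {x. vp x ~= 0}"
 show "smooth vp" "compact ?K" "?K <= D" using assms by (auto simp: test_functions_def smooth_def)
 show *: "vp x = 0" if "x ~: ?K" for x using that closure_subset[of "{x. vp x ~= 0}"] by blast
 show "C1_supp ?K vp (grad vp)" by (rule smooth_C1_supp) fact+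
qed

subsection \<open>Integration by parts\<close>

lemma integrable_translate:
 fixes f :: "'a::euclidean_space => 'b::euclidean_space"
 shows "integrable lborel f ==> (ILI x. f (x + z))"
 and "(LI x. f (x + z)) = (LI x. f x)"
proof -
 have e: "(LI x. f (z + x)) = (LI x. f x)" if [measurable]: "f : BM"
 by (subst (2) lborel_distr_plus[of z, symmetric], subst integral_distr) auto
 have i: "(ILI x. f (z + x)) \<longleftrightarrow> integrable lborel f" if [measurable]: "f : BM" for f :: "'a => 'b" and z
 by (subst (2) lborel_distr_plus[of z, symmetric], subst integrable_distr_eq) auto
 show "integrable lborel f ==> (ILI x. f (x + z))"
 using i[of f z] borel_measurable_integrable[of lborel f] by (simp add: add.commute)
 have m: "g : BM" if "integrable lborel g" for g :: "'a => 'b"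
 using borel_measurable_integrable[OF that] by simp
 show "(LI x. f (x + z)) = (LI x. f x)"
 proof (cases "integrable lborel f")
 case True
 then show ?thesis using e m by (simp add: add.commute)
 next
 \<comment> \<open>The identity survives without integrability: the translate is then not integrable
   either, and both integrals take the default value 0.\<close>
 case False
 have "~ (ILI x. f (z + x))"
 proof
 assume *: "ILI x. f (z + x)"
 from m[OF this] i[of "%x. f (z + x)" "- z"] this False show False by simp
 qed
 then show ?thesis using False by (simp add: not_integrable_integral_eq add.commute)
 qed
qed

text \<open>By translation invariance every difference quotient of \<open>f\<close> has integral 0.
  The quotients are dominated by a constant on a compact thickening of \<open>K\<close>, so the
  limit also has integral 0.\<close>

lemma integral_directional_derivative_0:
 assumes f: "C1_supp K f g"
 shows "(LI x. g x <.> b) = 0"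
proof -
 obtain B where B: "B > 0" "!!x. norm (g x) <= B" using C1_supp_bounds[OF f] by blast
 have K: "compact K" and G: "!!x. GDERIV f x :> g x" and cg: "continuous_on UNIV g"
 using f by (auto simp: C1_supp_def)
 define t where "t n = inverse (real (Suc n))" for n
 have t: "0 < t n" "t n <= 1" for n unfolding t_def by (auto simp: inverse_le_1_iff)
 define L where "L = {x + y | x y. x : K & y : cball 0 (norm b)}"
 have L: "compact L" unfolding L_def using K by (intro compact_sums) auto
 have fi: "integrable lborel f"
 by (rule integrable_continuous_supp[OF C1_supp_continuous[OF f] K]) (use f in "auto simp: C1_supp_def")
 have [measurable]: "f : BM" "g : BM"
 using C1_supp_continuous[OF f] cg by (auto intro: borel_measurable_continuous_onI)
 have "(%n. (LI x. (f (x + t n *R b) - f x) / t n)) ----> (LI x. g x <.> b)"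
 proof (rule integral_dominated_convergence[where w = "%x. indicator L x * (B * norm b)"])
 show "ILI x. indicator L x * (B * norm b)"
 using borel_integrable_compact[OF L, of "%_. B * norm b"] by auto
 show "AEL x. (%n. (f (x + t n *R b) - f x) / t n) ----> g x <.> b"
 proof (rule AE_I2)
 fix x
 have "((%t. f (x + t *R b)) has_real_derivative (g x <.> b)) (at 0)"
 proof -
 have "((%t. f (x + t *R b)) has_derivative (%s. (s *R b) <.> g x)) (at 0)"
 by (rule has_derivative_compose[where g = f])
 (use G[of x] in "auto simp: gderiv_def intro!: derivative_eq_intros")
 then show ?thesis by (simp add: has_field_derivative_def inner_commute mult.commute[of _ "_ <.> _"] cong: if_cong)
 qed
 then have "((%h. (f (x + h *R b) - f x) / h) ---> g x <.> b) (at 0)"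
 by (simp add: DERIV_def)
 moreover have "filterlim t (at 0) sequentially"
 unfolding filterlim_at t_def using LIMSEQ_inverse_real_of_nat by auto
 ultimately show "(%n. (f (x + t n *R b) - f x) / t n) ----> g x <.> b"
 by (rule filterlim_compose)
 qed
 show "AEL x. norm ((f (x + t n *R b) - f x) / t n) <= indicator L x * (B * norm b)" for n
 proof (rule AE_I2)
 fix x
 show "norm ((f (x + t n *R b) - f x) / t n) <= indicator L x * (B * norm b)"
 proof (cases "x : L")
 case True
 have "\<bar>f (x + t n *R b) - f x\<bar> <= B * norm (t n *R b)"
 by (rule GDERIV_bound[OF G B(2)])
 then have "\<bar>f (x + t n *R b) - f x\<bar> / t n <= B * norm b"
 using t[of n] by (simp add: field_simps)
 then show ?thesis using True t[of n] by simp
 next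
 case False
 have "x + t n *R b ~: K"
 proof
 assume a: "x + t n *R b : K"
 have "norm (t n *R b) <= norm b" using t[of n] by (simp add: mult_left_le_one_le)
 with a have "x : L" unfolding L_def
 by (intro CollectI exI[of _ "x + t n *R b"] exI[of _ "- (t n *R b)"]) auto
 with False show False by blast
 qed
 moreover have "x ~: K"
 proof
 assume "x : K"
 then have "x : L" unfolding L_def by (intro CollectI exI[of _ x] exI[of _ 0]) auto
 with False show False by blast
 qed
 ultimately show ?thesis using f False by (simp add: C1_supp_def)
 qed
 qed
 qed auto
 moreover have "(LI x. (f (x + t n *R b) - f x) / t n) = 0" for n
 proof -
 have "(LI x. f (x + t n *R b) - f x) = 0"
 using fi integrable_translate[of f "t n *R b"] by simp
 then show ?thesis by simp
 qed
 ultimately have "(%n. 0 :: real) ----> (LI x. g x <.> b)" by (simp only:)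
 then show ?thesis by (simp add: LIMSEQ_const_iff)
qed

text \<open>This turns almost everywhere inequalities between continuous functions into pointwise
  ones.\<close>

lemma AE_not_in_open:
 assumes "AEL x. x ~: (S :: 'a::euclidean_space set)" "open S"
 shows "S = {}"
proof (rule ccontr)
 assume "S ~= {}"
 have "S : null_sets lborel"
 using assms by (subst AE_iff_null_sets) auto
 then have "negligible S"
 by (simp add: negligible_iff_null_sets null_sets_completionI)
 then show False using open_not_negligible \<open>open S\<close> \<open>S ~= {}\<close> by blast
qed

lemma continuous_on_translate:
 fixes g :: "'a::real_normed_vector => 'b::topological_space"
 shows "continuous_on UNIV g ==> continuous_on UNIV (%y. g (x + s *R y))"
 by (rule continuous_on_compose2[of UNIV g]) (auto intro!: continuous_intros)

lemma integrable_mult_bounded_continuous: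
 fixes f :: "'a::euclidean_space => real" and g :: "'a => 'b::euclidean_space"
 assumes "integrable lborel f" "continuous_on UNIV g" "!!x. norm (g x) <= B"
 shows "ILI x. f x *R g x"
proof (rule bint_bound[where f = "%x. f x * B"])
 show "ILI x. f x * B" using assms(1) by simp
 have [measurable]: "f : BM" "g : BM"
 using assms(1,2) by (auto intro: borel_measurable_continuous_onI)
 show "(%x. f x *R g x) : borel_measurable lborel" by measurable
 have "B \<ge> 0" using assms(3) norm_ge_zero order_trans by blast
 then show "AEL x. norm (f x *R g x) <= norm (f x * B)"
 using assms(3) by (auto simp: abs_mult intro!: mult_left_mono)
qed

text \<open>All regularity is taken from \<open>vp\<close>. The scalar \<open>s\<close> covers both
  uses: s = -1 is convolution of an integrable \<open>f\<close> with a smooth kernel, s = 1 averages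
  translates of a C^1 function against the mollifier.\<close>

lemma GDERIV_integral_translates:
 fixes f :: "'a::euclidean_space => real"
 assumes f: "integrable lborel f" and phi: "C1_supp K vp vp'"
 shows "GDERIV (%x. (LI y. f y * vp (x + s *R y))) x :> (LI y. f y *R vp' (x + s *R y))"
 unfolding gderiv_def has_derivative_iff_norm
proof (rule conjI)
 obtain B where B: "!!x. \<bar>vp x\<bar> <= B" "!!x. norm (vp' x) <= B"
 using C1_supp_bounds[OF phi] by blast
 have cont: "continuous_on UNIV vp" "continuous_on UNIV vp'"
 using C1_supp_continuous[OF phi] phi by (auto simp: C1_supp_def)
 have i1: "ILI y. f y * vp (x + s *R y)" for x
 using integrable_mult_bounded_continuous[OF f, of "%y. vp (x + s *R y)" B] B
 continuous_on_translate[OF cont(1)] by simp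
 have i2: "ILI y. f y *R vp' (x + s *R y)" for x
 using integrable_mult_bounded_continuous[OF f, of "%y. vp' (x + s *R y)" B] B
 continuous_on_translate[OF cont(2)] by simp
 show "bounded_linear (%h. h <.> (LI y. f y *R vp' (x + s *R y)))"
 by (rule bounded_linear_inner_left)
 define M where "M = (LI y. \<bar>f y\<bar>)"
 have M: "M \<ge> 0" unfolding M_def by simp
 let ?R = "%h. (LI y. f y * vp (x + h + s *R y)) - (LI y. f y * vp (x + s *R y))
 - h <.> (LI y. f y *R vp' (x + s *R y))"
 have R: "EX d>0. ALL h. norm h < d --> \<bar>?R h\<bar> <= e * norm h" if "e > 0" for e
 proof -
 obtain d where d: "d > 0" "!!x h. norm h < d ==> \<bar>vp (x + h) - vp x - h <.> vp' x\<bar> <= e / (M + 1) * norm h"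
 using C1_supp_uniform_linearization[OF phi, of "e / (M + 1)"] \<open>e > 0\<close> M by auto
 have "\<bar>?R h\<bar> <= e * norm h" if "norm h < d" for h
 proof -
 have "?R h = (LI y. f y * (vp (x + s *R y + h) - vp (x + s *R y) - h <.> vp' (x + s *R y)))"
 proof -
 have "h <.> (LI y. f y *R vp' (x + s *R y)) = (LI y. h <.> (f y *R vp' (x + s *R y)))"
 using i2 by (subst integral_inner_right) auto
 moreover have "ILI y. h <.> (f y *R vp' (x + s *R y))" using i2 by (intro integrable_inner_right)
 ultimately show ?thesis
 using i1[of x] i1[of "x + h"] by (simp add: algebra_simps flip: bint_minus)
 qed
 also have "\<bar>...\<bar> <= (LI y. \<bar>f y\<bar> * (e / (M + 1) * norm h))"
 proof (rule order_trans[OF integral_abs_bound integral_mono])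
 have "ILI y. f y * (vp (x + s *R y + h) - vp (x + s *R y) - h <.> vp' (x + s *R y))"
 proof -
 have "ILI y. f y * vp (x + h + s *R y) - f y * vp (x + s *R y) - h <.> (f y *R vp' (x + s *R y))"
 using i1[of x] i1[of "x + h"] i2 by (intro bint_diff integrable_inner_right) auto
 then show ?thesis by (simp add: algebra_simps)
 qed
 then show "ILI y. \<bar>f y * (vp (x + s *R y + h) - vp (x + s *R y) - h <.> vp' (x + s *R y))\<bar>"
 by simp
 show "ILI y. \<bar>f y\<bar> * (e / (M + 1) * norm h)" using f by simp
 show "\<bar>f y * (vp (x + s *R y + h) - vp (x + s *R y) - h <.> vp' (x + s *R y))\<bar> <= \<bar>f y\<bar> * (e / (M + 1) * norm h)" for y
 unfolding abs_mult by (rule mult_left_mono[OF d(2)[OF that]]) simp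
 qed
 also have "... = M * (e / (M + 1) * norm h)" by (simp add: M_def)
 also have "... <= e * norm h"
 using M \<open>e > 0\<close> by (simp add: field_simps mult_left_mono)
 finally show ?thesis .
 qed
 then show ?thesis using d(1) by blast
 qed
 show "((%y. norm ((LI ya. f ya * vp (y + s *R ya)) - (LI y. f y * vp (x + s *R y))
 - (y - x) <.> (LI y. f y *R vp' (x + s *R y))) / norm (y - x)) ---> 0) (at x)"
 proof (rule LIM_I)
 fix e :: real assume "e > 0"
 then obtain d where d: "d > 0" "!!h. norm h < d ==> \<bar>?R h\<bar> <= e / 2 * norm h"
 using R[of "e / 2"] by auto
 have "norm (\<bar>?R (y - x)\<bar> / norm (y - x)) < e" if "y ~= x" "norm (y - x) < d" for y
 proof -
 have "\<bar>?R (y - x)\<bar> / norm (y - x) <= e / 2"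
 using d(2)[OF that(2)] that(1) by (simp add: divide_le_eq)
 then have "\<bar>?R (y - x)\<bar> / norm (y - x) < e" using \<open>e > 0\<close> by linarith
 then show ?thesis by simp
 qed
 then show "EX d>0. ALL y. y ~= x & norm (y - x) < d -->
 norm (norm ((LI ya. f ya * vp (y + s *R ya)) - (LI y. f y * vp (x + s *R y))
 - (y - x) <.> (LI y. f y *R vp' (x + s *R y))) / norm (y - x) - 0) < e"
 using d(1) by (intro exI[of _ d]) (auto simp: add.assoc)
 qed
qed

lemma continuous_integral_translates:
 fixes f :: "'a::euclidean_space => real" and g :: "'a => 'b::euclidean_space"
 assumes f: "integrable lborel f" and g: "continuous_on UNIV g" "compact K" "!!x. x ~: K ==> g x = 0"
 shows "continuous_on UNIV (%x. (LI y. f y *R g (x + s *R y)))"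
 unfolding continuous_on_iff
proof (intro ballI allI impI)
 fix x :: 'a and e :: real assume "0 < e"
 define M where "M = (LI y. \<bar>f y\<bar>)"
 have M: "M \<ge> 0" unfolding M_def by simp
 have "e / (M + 1) > 0" using M \<open>e > 0\<close> by simp
 then obtain d where d: "d > 0" "!!x y. dist x y < d ==> dist (g x) (g y) < e / (M + 1)"
 using uniformly_continuous_supp[OF g] by blast
 obtain B where B: "!!x. norm (g x) <= B" using bounded_continuous_supp[OF g] by blast
 have i: "ILI y. f y *R g (x + s *R y)" for x
 using integrable_mult_bounded_continuous[OF f, of "%y. g (x + s *R y)" B] B
 continuous_on_translate[OF g(1)] by simp
 have "dist (LI y. f y *R g (x' + s *R y)) (LI y. f y *R g (x + s *R y)) < e"
 if "dist x' x < d" for x'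
 proof -
 have "dist (LI y. f y *R g (x' + s *R y)) (LI y. f y *R g (x + s *R y))
 = norm (LI y. f y *R (g (x' + s *R y) - g (x + s *R y)))"
 using i[of x] i[of x'] by (simp add: dist_norm scaleR_diff_right)
 also have "... <= (LI y. \<bar>f y\<bar> * (e / (M + 1)))"
 proof (rule order_trans[OF integral_norm_bound integral_mono])
 show "ILI y. norm (f y *R (g (x' + s *R y) - g (x + s *R y)))"
 using i[of x] i[of x'] by (intro integrable_norm) (simp add: scaleR_diff_right)
 show "ILI y. \<bar>f y\<bar> * (e / (M + 1))" using f by simp
 show "norm (f y *R (g (x' + s *R y) - g (x + s *R y))) <= \<bar>f y\<bar> * (e / (M + 1))" for y
 using d(2)[of "x' + s *R y" "x + s *R y"] that
 unfolding norm_scaleR by (intro mult_left_mono) (auto simp: dist_norm)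
 qed
 also have "... = M * (e / (M + 1))" by (simp add: M_def)
 also have "... < e" using M \<open>e > 0\<close> by (simp add: field_simps)
 finally show ?thesis .
 qed
 then show "EX d>0. ALL x':UNIV. dist x' x < d -->
 dist (LI y. f y *R g (x' + s *R y)) (LI y. f y *R g (x + s *R y)) < e"
 using d(1) by blast
qed

lemma smooth_integral_translates:
 fixes f :: "'a::euclidean_space => real"
 assumes f: "integrable lborel f" and "smooth vp" "compact K" "!!x. x ~: K ==> vp x = 0"
 shows "smooth (%x. (LI y. f y * vp (x + s *R y)))"
proof -
 have "Ck k (%x. (LI y. f y * vp (x + s *R y)))" for k
 using assms(2-4)
 proof (induction k arbitrary: vp)
 case 0
 then show ?case
 using continuous_integral_translates[OF f, of vp K s] smooth_continuous[OF 0(1)] 0(2,3) by simp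
 next
 case (Suc k)
 have C: "C1_supp K vp (grad vp)" by (rule smooth_C1_supp[OF Suc.prems])
 note G = GDERIV_integral_translates[OF f C]
 have i2: "ILI y. f y *R grad vp (x + s *R y)" for x
 using integrable_mult_bounded_continuous[OF f, of "%y. grad vp (x + s *R y)"] C1_supp_bounds[OF C]
 continuous_on_translate[OF smooth_continuous_grad[OF Suc.prems(1)]] by blast
 have d: "frechet_derivative vp (at x) v = v <.> grad vp x" for x v
 using frechet_derivative_GDERIV[OF smooth_GDERIV[OF Suc.prems(1)]] by simp
 have "frechet_derivative (%x. (LI y. f y * vp (x + s *R y))) (at x) v
 = (LI y. f y * frechet_derivative vp (at (x + s *R y)) v)" for x v
 proof -
 have "frechet_derivative (%x. (LI y. f y * vp (x + s *R y))) (at x) v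
 = v <.> (LI y. f y *R grad vp (x + s *R y))"
 using frechet_derivative_GDERIV[OF G] by simp
 also have "... = (LI y. v <.> (f y *R grad vp (x + s *R y)))"
 using i2 by (subst integral_inner_right) auto
 finally show ?thesis by (simp add: d)
 qed
 moreover have "Ck k (%x. (LI y. f y * frechet_derivative vp (at (x + s *R y)) v))" for v
 proof (rule Suc.IH)
 show "smooth (%x. frechet_derivative vp (at x) v)" by (rule smooth_directional[OF Suc.prems(1)])
 show "frechet_derivative vp (at x) v = 0" if "x ~: K" for x
 using C1_supp_grad_0[OF C that] d by simp
 qed fact
 ultimately show ?case using GDERIV_imp_differentiable[OF G] by simp
 qed
 then show ?thesis by (simp add: smooth_def)
qed

subsection \<open>Mollifiers\<close>

definition bump :: "real => 'a::euclidean_space => real" where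
 "bump e x = flat_exp 1 (1 - (1 / e^2) * (x <.> x))"

text \<open>A product with the constant \<open>inverse\<close> of the mass, rather than a quotient,
  so that membership in \<open>bump_algebra\<close> and hence smoothness is immediate.\<close>

definition mollifier :: "real => 'a::euclidean_space => real" where
 "mollifier e x = bump e x * inverse (LI y. bump e (y::'a))"

context
 fixes e :: real assumes e: "0 < e"
begin

lemma bump_eq_0: "x ~: cball 0 e ==> bump e x = 0"
proof -
 assume "x ~: cball 0 e"
 then have "e^2 <= (norm x)^2" using e by (intro power_mono) auto
 then show ?thesis
 unfolding bump_def using e by (intro flat_exp_nonpos) (simp add: power2_norm_eq_inner field_simps)
qed

lemma smooth_bump: "smooth (bump e)"
 unfolding smooth_def bump_def[abs_def] by (intro allI bump_algebra_Ck[OF bump_algebra.flat])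

lemma bump_nonneg: "0 <= bump e x" by (simp add: bump_def flat_exp_1_nonneg)

lemma bump_pos: "norm x < e ==> 0 < bump e x"
proof -
 assume "norm x < e"
 then have "(norm x)^2 < e^2" by (intro power_strict_mono) auto
 then show ?thesis
 unfolding bump_def using e by (intro flat_exp_1_pos) (simp add: power2_norm_eq_inner field_simps)
qed

lemma integrable_bump: "integrable lborel (bump e :: 'a::euclidean_space => real)"
 by (rule integrable_continuous_supp[OF smooth_continuous[OF smooth_bump] compact_cball bump_eq_0])

lemma integral_bump_pos: "0 < (LI y. bump e (y::'a::euclidean_space))"
proof -
 have "(LI y. bump e (y::'a)) ~= 0"
 proof
 assume "(LI y. bump e (y::'a)) = 0"
 then have "AEL y. bump e (y::'a) = 0"
 using integral_nonneg_eq_0_iff_AE[OF integrable_bump] bump_nonneg by auto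
 then have "AEL y. (y::'a) ~: ball 0 e"
 by eventually_elim (use bump_pos in force)
 from AE_not_in_open[OF this] show False using e by simp
 qed
 then show ?thesis by (simp add: bump_nonneg less_le)
qed

lemma mollifier_smooth: "smooth (mollifier e :: 'a::euclidean_space => real)"
 unfolding smooth_def mollifier_def[abs_def] bump_def[abs_def]
 by (intro allI bump_algebra_Ck[OF bump_algebra.mult[OF bump_algebra.flat bump_algebra.const]])

lemma mollifier_eq_0: "x ~: cball 0 e ==> mollifier e x = 0"
 by (simp add: mollifier_def bump_eq_0)

lemma mollifier_nonneg: "0 <= mollifier e x"
 using bump_nonneg integral_bump_pos[where 'a = 'a] unfolding mollifier_def
 by (intro mult_nonneg_nonneg) (auto simp: less_imp_le)

lemma integrable_mollifier: "integrable lborel (mollifier e :: 'a::euclidean_space => real)"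
 by (simp add: mollifier_def[abs_def] integrable_bump)

lemma integral_mollifier: "(LI y. mollifier e (y::'a::euclidean_space)) = 1"
 using integral_bump_pos[where 'a = 'a] by (simp add: mollifier_def integrable_bump)

lemma mollifier_minus: "mollifier e (- x) = mollifier e x"
 by (simp add: mollifier_def bump_def)

lemma mollifier_C1_supp: "C1_supp (cball 0 e) (mollifier e) (grad (mollifier e))"
 by (rule smooth_C1_supp[OF mollifier_smooth compact_cball mollifier_eq_0])

lemma mollifier_measurable [measurable]: "mollifier e : BM"
 by (rule borel_measurable_continuous_onI[OF smooth_continuous[OF mollifier_smooth]])

end

subsection \<open>Continuity of translations in the mean\<close>

lemma integrable_translate_diff:
 fixes f :: "'a::euclidean_space => 'b::euclidean_space"
 assumes "integrable lborel f"
 shows "ILI x. norm (f (x + z) - f x)"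
 using integrable_translate(1)[OF assms, of z] assms by simp

text \<open>Outer regularity gives an open \<open>U\<close> slightly larger than \<open>A\<close>. A
  point of \<open>A\<close> stays in \<open>U\<close> under small translations, so dominated
  convergence controls the mass that leaves \<open>U\<close>, and the rest sits in
  \<open>U - A\<close>.\<close>

lemma L1_translation_continuous_indicator:
 fixes A :: "'a::euclidean_space set" and c :: "'b::euclidean_space"
 assumes A: "A : sets lborel" "emeasure lborel A < \<infinity>" and "0 < e"
 shows "EX d>0. ALL z. norm z < d -->
 (LI x. norm (indicator A (x + z) *R c - indicator A x *R c)) < e"
proof -
 define e' where "e' = e / (4 * (norm c + 1))"
 have e': "e' > 0" using \<open>0 < e\<close> by (simp add: e'_def add_nonneg_pos)
 obtain U where U: "open U" "A <= U" "emeasure lborel (U - A) < e'"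
 using outer_regular_lborel[of A e'] A e' by auto
 have [measurable]: "A : sets borel" "U : sets borel" using A U by auto
 have iA: "integrable lborel (indicator A :: 'a => real)"
 using A by (simp add: integrable_indicator_iff)
 have iU: "integrable lborel (indicator (U - A) :: 'a => real)"
 using order_less_trans[OF U(3) ennreal_less_top] by (simp add: integrable_indicator_iff)
 have UA: "(LI x. indicator (U - A) x) < e'"
 using U(3) e' order_less_trans[OF U(3) ennreal_less_top]
 by (simp add: measure_def enn2real_less_iff)
 have iAt: "ILI x. (indicator A x * (1 - indicator U (x + z)) :: real)" for z
 by (rule bint_bound[OF iA]) (auto split: split_indicator)
 have lim: "((%z. (LI x. indicator A x * (1 - indicator U (x + z)))) ---> (0::real)) (at 0)"
 unfolding tendsto_at_iff_sequentially comp_def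
 proof (intro allI impI)
 fix X :: "nat => 'a" assume X: "X ----> 0"
 have "(%i. (LI x. indicator A x * (1 - indicator U (x + X i)))) ----> (\<integral>x. (0::real) \<partial>(lborel :: 'a measure))"
 proof (rule integral_dominated_convergence[where w = "indicator A"])
 show "AEL x. (%i. indicator A x * (1 - indicator U (x + X i))) ----> (0::real)"
 proof (intro AE_I2)
 fix x
 show "(%i. indicator A x * (1 - indicator U (x + X i))) ----> (0::real)"
 proof (cases "x : A")
 case True
 have "(%i. x + X i) ----> x + 0" by (intro tendsto_intros X)
 then have "\<forall>\<^sub>F i in sequentially. x + X i : U"
 using U True by (intro topological_tendstoD) auto
 then have "\<forall>\<^sub>F i in sequentially. indicator A x * (1 - indicator U (x + X i)) = (0::real)"
 by eventually_elim simp
 then show ?thesis by (rule tendsto_eventually)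
 qed simp
 qed
 qed (use iA in "auto split: split_indicator")
 then show "(%i. (LI x. indicator A x * (1 - indicator U (x + X i)))) ----> (0::real)" by simp
 qed
 then have "\<forall>\<^sub>F z in at 0. (LI x. indicator A x * (1 - indicator U (x + z))) < e'"
 by (rule order_tendstoD) fact
 then obtain d where d: "d > 0" "!!z. z ~= 0 ==> norm z < d ==> (LI x. indicator A x * (1 - indicator U (x + z))) < e'"
 by (auto simp: eventually_at)
 have "(LI x. norm (indicator A (x + z) *R c - indicator A x *R c)) < e" if z: "norm z < d" for z
 proof (cases "z = 0")
 case False
 let ?i = "%x. indicator A x :: real"
 have iAz: "ILI x. ?i (x + z)" "(LI x. ?i (x + z)) = (LI x. ?i x)"
 using integrable_translate(1)[OF iA, of z] integrable_translate(2)[of ?i z] by auto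
 have iUz: "ILI x. (indicator (U - A) (x + z) :: real)"
 "(LI x. indicator (U - A) (x + z)) = ((LI x. indicator (U - A) x) :: real)"
 using integrable_translate(1)[OF iU, of z] integrable_translate(2)[of "indicat_real (U - A)" z] by blast+
 have eq: "(LI x. norm (indicator A (x + z) *R c - indicator A x *R c))
 = norm c * (LI x. \<bar>?i (x + z) - ?i x\<bar>)"
 by (simp flip: scaleR_diff_left add: mult.commute)
 \<comment> \<open>The difference has integral 0, so its modulus integrates to twice its negative
   part. Only the mass leaving \<open>A\<close> has to be estimated; the last summand contributes
   nothing.\<close>
 have "(LI x. \<bar>?i (x + z) - ?i x\<bar>)
 <= (LI x. 2 * (indicator A x * (1 - indicator U (x + z)) + indicator (U - A) (x + z)) + (?i (x + z) - ?i x))"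
 proof (rule integral_mono)
 show "ILI x. \<bar>?i (x + z) - ?i x\<bar>" using iA iAz by auto
 show "ILI x. 2 * (indicator A x * (1 - indicator U (x + z)) + indicator (U - A) (x + z)) + (?i (x + z) - ?i x)"
 using iA iAz iUz iAt[of z] by auto
 qed (use U(2) in "auto split: split_indicator")
 also have "... = 2 * ((LI x. indicator A x * (1 - indicator U (x + z))) + (LI x. indicator (U - A) x))"
 using iA iAz iUz iAt[of z] by simp
 also have "... < 4 * e'"
 using d(2)[OF False z] UA by simp
 finally have "(LI x. norm (indicator A (x + z) *R c - indicator A x *R c)) <= norm c * (4 * e')"
 unfolding eq by (intro mult_left_mono) auto
 also have "... < e" using \<open>0 < e\<close> by (simp add: e'_def divide_simps add_nonneg_pos)
 finally show ?thesis .
 qed (use \<open>0 < e\<close> in simp)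
 then show ?thesis using d(1) by blast
qed

text \<open>Induction along simple approximations. In the limit step the L^1 distance between
  \<open>s i\<close> and \<open>f\<close> is translation invariant, which yields the usual three
  thirds of \<open>e\<close>.\<close>

lemma L1_translation_continuous:
 fixes f :: "'a::euclidean_space => 'b::euclidean_space"
 assumes "integrable lborel f" "0 < e"
 shows "EX d>0. ALL z. norm z < d --> (LI x. norm (f (x + z) - f x)) < e"
 using assms
proof (induction arbitrary: e)
 case (base A c)
 then show ?case using L1_translation_continuous_indicator by blast
next
 case (add f g)
 obtain d1 where d1: "d1 > 0" "!!z. norm z < d1 ==> (LI x. norm (f (x + z) - f x)) < e / 2"
 using add.IH(1)[of "e / 2"] add.prems by auto
 obtain d2 where d2: "d2 > 0" "!!z. norm z < d2 ==> (LI x. norm (g (x + z) - g x)) < e / 2"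
 using add.IH(2)[of "e / 2"] add.prems by auto
 have "(LI x. norm (f (x + z) + g (x + z) - (f x + g x))) < e" if "norm z < min d1 d2" for z
 proof -
 note i = integrable_translate_diff[OF add.hyps(1), of z] integrable_translate_diff[OF add.hyps(2), of z]
 integrable_translate_diff[OF bint_add[OF add.hyps], of z]
 have "(LI x. norm (f (x + z) + g (x + z) - (f x + g x)))
 <= (LI x. norm (f (x + z) - f x) + norm (g (x + z) - g x))"
 using i by (intro integral_mono) (auto simp: add_diff_add norm_triangle_ineq)
 also have "... < e" using d1(2)[of z] d2(2)[of z] that i by simp
 finally show ?thesis .
 qed
 then show ?case using d1(1) d2(1) by (intro exI[of _ "min d1 d2"]) auto
next
 case (lim f s)
 have "(%i. (LI x. norm (s i x - f x))) ----> (\<integral>x. norm (0::'b) \<partial>(lborel :: 'a measure))"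
 proof (rule integral_dominated_convergence[where w = "%x. 3 * norm (f x)"])
 have [measurable]: "f : BM" "s i : BM" for i
 using lim.hyps(1,4) borel_measurable_integrable by fastforce+
 show "(%x. norm (s i x - f x)) : borel_measurable lborel" for i by measurable
 show "AEL x. (%i. norm (s i x - f x)) ----> norm (0::'b)"
 proof (intro AE_I2 tendsto_norm)
 fix x
 have "(%i. s i x - f x) ----> f x - f x" by (intro tendsto_intros lim.hyps(2)) simp
 then show "(%i. s i x - f x) ----> 0" by simp
 qed
 show "AEL x. norm (norm (s i x - f x)) <= 3 * norm (f x)" for i
 proof (intro AE_I2)
 fix x show "norm (norm (s i x - f x)) <= 3 * norm (f x)"
 using norm_triangle_ineq4[of "s i x" "f x"] lim.hyps(3)[of x i] by simp
 qed
 qed (use lim.hyps in auto)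
 then have "\<forall>\<^sub>F i in sequentially. (LI x. norm (s i x - f x)) < e / 3"
 using lim.prems by (intro order_tendstoD) auto
 then obtain i where i: "(LI x. norm (s i x - f x)) < e / 3"
 by (auto simp: eventually_sequentially)
 obtain d where d: "d > 0" "!!z. norm z < d ==> (LI x. norm (s i (x + z) - s i x)) < e / 3"
 using lim.IH[of "e / 3" i] lim.prems by auto
 have "(LI x. norm (f (x + z) - f x)) < e" if "norm z < d" for z
 proof -
 have h: "ILI x. norm (s i x - f x)" using lim.hyps by auto
 note h' = integrable_translate(1)[OF h, of z] integrable_translate(2)[of "%x. norm (s i x - f x)" z]
 note k = integrable_translate_diff[OF lim.hyps(1), of i z] integrable_translate_diff[OF lim.hyps(4), of z]
 have "(LI x. norm (f (x + z) - f x)) <=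
 (LI x. norm (s i (x + z) - f (x + z)) + norm (s i (x + z) - s i x) + norm (s i x - f x))"
 proof (rule integral_mono)
 show "norm (f (x + z) - f x) <= norm (s i (x + z) - f (x + z)) + norm (s i (x + z) - s i x) + norm (s i x - f x)" for x
 by norm
 qed (use h h' k in auto)
 also have "... < e" using h h' k i d(2)[OF that] by simp
 finally show ?thesis .
 qed
 then show ?case using d(1) by blast
qed

section \<open>Mollification measured against weights in the dual Lebesgue space\<close>

lemma Young_simple:
 fixes a b :: real
 assumes "1 < p" "0 <= a" "0 <= b"
 shows "a * b <= a powr (p / (p - 1)) + b powr p"
proof -
 have "a * b <= a powr (p / (p - 1)) / (p / (p - 1)) + b powr p / p"
 using assms by (intro Youngs_inequality) (auto simp: field_simps)
 also have "... <= a powr (p / (p - 1)) + b powr p"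
 using assms mult_right_mono[of 1 p "b powr p"] mult_right_mono[of "p - 1" p "a powr (p / (p - 1))"]
 by (intro add_mono) (auto simp: divide_le_eq mult.commute)
 finally show ?thesis .
qed

lemma powr_add_le:
 fixes a b p :: real
 assumes "0 <= a" "0 <= b" "0 <= p"
 shows "(a + b) powr p <= 2 powr p * (a powr p + b powr p)"
proof -
 have "(a + b) powr p <= (2 * max a b) powr p"
 using assms by (intro powr_mono2) auto
 also have "... = 2 powr p * (max a b) powr p" using assms by (simp add: powr_mult)
 also have "... <= 2 powr p * (a powr p + b powr p)"
 by (intro mult_left_mono) (auto simp: max_def)
 finally show ?thesis .
qed

lemma integrable_mult_Young:
 fixes xe f :: "'a => real"
 assumes [measurable]: "xe : borel_measurable M" "f : borel_measurable M"
 and "!!x. 0 <= xe x" "!!x. 0 <= f x" and p: "1 < p"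
 and "integrable M (%x. xe x powr (p / (p - 1)))" "integrable M (%x. f x powr p)"
 shows "integrable M (%x. xe x * f x)"
proof (rule bint_bound[OF bint_add[OF assms(6,7)]])
 show "AE x in M. norm (xe x * f x) <= norm (xe x powr (p / (p - 1)) + f x powr p)"
 using Young_simple[OF p] assms(3,4) by (intro AE_I2) simp
qed measurable

lemma translate_diff_powr:
 fixes f :: "'a::euclidean_space => 'b::euclidean_space"
 assumes p: "1 < p" and f: "integrable lborel f" "ILI x. norm (f x) powr p"
 shows "ILI x. norm (f (x + z) - f x) powr p"
 and "(LI x. norm (f (x + z) - f x) powr p) <= 2 powr p * (2 * (LI x. norm (f x) powr p))"
proof -
 have [measurable]: "f : BM" using f borel_measurable_integrable by fastforce
 have le: "norm (f (x + z) - f x) powr p <= 2 powr p * (norm (f (x + z)) powr p + norm (f x) powr p)" for x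
 proof -
 have "norm (f (x + z) - f x) powr p <= (norm (f (x + z)) + norm (f x)) powr p"
 using p by (intro powr_mono2 norm_triangle_ineq4) auto
 also have "... <= 2 powr p * (norm (f (x + z)) powr p + norm (f x) powr p)"
 using p by (intro powr_add_le) auto
 finally show ?thesis .
 qed
 have i: "ILI x. norm (f (x + z)) powr p"
 using integrable_translate(1)[OF f(2), of z] by auto
 then have i': "ILI x. 2 powr p * (norm (f (x + z)) powr p + norm (f x) powr p)"
 using f(2) by auto
 show it: "ILI x. norm (f (x + z) - f x) powr p"
 proof (rule bint_bound[OF i'])
 show "AEL x. norm (norm (f (x + z) - f x) powr p) <= norm (2 powr p * (norm (f (x + z)) powr p + norm (f x) powr p))"
 using le by (intro AE_I2) (simp add: abs_of_nonneg)
 qed measurable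
 have "(LI x. norm (f (x + z) - f x) powr p) <= (LI x. 2 powr p * (norm (f (x + z)) powr p + norm (f x) powr p))"
 by (rule integral_mono[OF it i' le])
 also have "... = 2 powr p * (2 * (LI x. norm (f x) powr p))"
 using i integrable_translate(2)[of "%x. norm (f x) powr p" z] f(2) by simp
 finally show "(LI x. norm (f (x + z) - f x) powr p) <= 2 powr p * (2 * (LI x. norm (f x) powr p))" .
qed

text \<open>A substitute for continuity of translations in L^p. Where the weight is at most
  \<open>N\<close>, continuity in L^1 applies; the part above \<open>N\<close> has small L^(p/(p-1))
  norm and is paired with the L^p bound by Young's inequality with parameter
  \<open>ta\<close>.\<close>

lemma weighted_translation_continuous:
 fixes f :: "'a::euclidean_space => 'b::euclidean_space"
 assumes p: "1 < p" and f: "integrable lborel f" "ILI x. norm (f x) powr p"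
 and [measurable]: "xe : BM" and xi: "!!x. 0 <= xe x"
 "ILI x. xe x powr (p / (p - 1))" and "0 < e"
 shows "EX d>0. ALL z. norm z < d --> (LI x. xe x * norm (f (x + z) - f x)) < e"
proof -
 have [measurable]: "f : BM" using f borel_measurable_integrable by fastforce
 define q where "q = p / (p - 1)"
 have q: "q > 0" unfolding q_def using p by simp
 define F where "F = (LI x. norm (f x) powr p)"
 have F: "F \<ge> 0" unfolding F_def by simp
 \<comment> \<open>Chosen so that \<open>ta powr p\<close> times the bound
   \<open>2 powr p * (2 * F)\<close>, valid for all translations, stays strictly below e/3.\<close>
 define ta where "ta = (e / (3 * (2 powr p * (2 * F) + 1))) powr (1 / p)"
 have ta: "ta > 0"
 proof -
 have "6 * (2 powr p * F) + 3 > 0" using F by (intro add_nonneg_pos) auto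
 then show ?thesis using \<open>0 < e\<close> unfolding ta_def by simp
 qed
 have taF: "ta powr p * (2 powr p * (2 * F)) < e / 3"
 proof -
 have "ta powr p = e / (3 * (2 powr p * (2 * F) + 1))"
 unfolding ta_def using \<open>0 < e\<close> F p by (simp add: powr_powr add_nonneg_pos)
 moreover have "6 * (2 powr p * F) + 3 > 0" using F by (intro add_nonneg_pos) auto
 ultimately have "ta powr p * (6 * (2 powr p * F) + 3) = e" by (simp add: divide_simps)
 then have "6 * (ta powr p * (2 powr p * F)) + 3 * ta powr p = e" by (simp add: algebra_simps)
 moreover have "3 * ta powr p > 0" using ta by simp
 ultimately have "6 * (ta powr p * (2 powr p * F)) < e" by linarith
 then show ?thesis by simp
 qed
 note it = translate_diff_powr(1)[OF p f] and itF = translate_diff_powr(2)[OF p f, folded F_def]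
 have "(%n. (LI x. (if xe x > real n then xe x powr q else 0))) ----> (\<integral>x. 0 \<partial>(lborel :: 'a measure))"
 proof (rule integral_dominated_convergence[where w = "%x. xe x powr q"])
 show "AEL x. (%n. if xe x > real n then xe x powr q else 0) ----> 0"
 proof (intro AE_I2 tendsto_eventually)
 fix x
 obtain N where "xe x <= real N" using real_arch_simple by blast
 then show "\<forall>\<^sub>F n in sequentially. (if xe x > real n then xe x powr q else 0) = 0"
 by (auto simp: eventually_sequentially intro!: exI[of _ N])
 qed
 qed (use xi in "auto simp: q_def")
 then have "\<forall>\<^sub>F n in sequentially. (LI x. (if xe x > real n then xe x powr q else 0)) < (e / 3) * ta powr q"
 using \<open>0 < e\<close> ta by (intro order_tendstoD) auto
 then obtain N where N: "(LI x. (if xe x > real N then xe x powr q else 0)) < (e / 3) * ta powr q"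
 by (auto simp: eventually_sequentially)
 have iN: "ILI x. if xe x > real N then xe x powr q else 0"
 by (rule bint_bound[OF xi(2)[folded q_def]]) auto
 obtain d where d: "d > 0" "!!z. norm z < d ==> (LI x. norm (f (x + z) - f x)) < e / (3 * (real N + 1))"
 using L1_translation_continuous[OF f(1), of "e / (3 * (real N + 1))"] \<open>0 < e\<close> by auto
 have "(LI x. xe x * norm (f (x + z) - f x)) < e" if "norm z < d" for z
 proof -
 let ?D = "%x. norm (f (x + z) - f x)"
 let ?X = "%x. if xe x > real N then xe x powr q else 0"
 have i0: "integrable lborel ?D" by (rule integrable_translate_diff[OF f(1)])
 have "(LI x. xe x * ?D x) <= (LI x. real N * ?D x + (ta powr (- q) * ?X x + ta powr p * ?D x powr p))"
 proof (rule integral_mono)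
 show "ILI x. xe x * ?D x"
 using it[of z] by (intro integrable_mult_Young[OF _ _ _ _ p]) (auto intro: xi)
 show "ILI x. real N * ?D x + (ta powr (- q) * ?X x + ta powr p * ?D x powr p)"
 using i0 iN it[of z] by auto
 fix x
 show "xe x * ?D x <= real N * ?D x + (ta powr (- q) * ?X x + ta powr p * ?D x powr p)"
 proof (cases "xe x > real N")
 case True
 have "xe x * ?D x = (xe x / ta) * (ta * ?D x)" using ta by simp
 also have "... <= (xe x / ta) powr q + (ta * ?D x) powr p"
 unfolding q_def using ta xi by (intro Young_simple p) auto
 also have "... = ta powr (- q) * xe x powr q + ta powr p * ?D x powr p"
 using ta xi by (simp add: powr_divide powr_mult powr_minus field_simps)
 finally show ?thesis using True by (simp add: add_increasing)
 next
 case False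
 then show ?thesis by (simp add: add_increasing2 mult_right_mono)
 qed
 qed
 also have "... = real N * (LI x. ?D x) + (ta powr (- q) * (LI x. ?X x) + ta powr p * (LI x. ?D x powr p))"
 using i0 iN it[of z] by simp
 also have "... < e / 3 + (e / 3 + e / 3)"
 proof -
 have "real N * (LI x. ?D x) <= real N * (e / (3 * (real N + 1)))"
 by (intro mult_left_mono less_imp_le[OF d(2)[OF that]]) simp
 also have "... <= e / 3" using \<open>0 < e\<close> by (simp add: field_simps)
 finally have *: "real N * (LI x. ?D x) <= e / 3" .
 have "ta powr (- q) * (LI x. ?X x) < ta powr (- q) * ((e / 3) * ta powr q)"
 using N ta by (intro mult_strict_left_mono) auto
 then have **: "ta powr (- q) * (LI x. ?X x) < e / 3"
 using ta by (simp add: powr_minus field_simps)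
 have "ta powr p * (LI x. ?D x powr p) <= ta powr p * (2 powr p * (2 * F))"
 by (intro mult_left_mono itF) simp
 with taF have "ta powr p * (LI x. ?D x powr p) <= e / 3" by linarith
 with * ** show ?thesis by linarith
 qed
 finally show ?thesis by simp
 qed
 then show ?thesis using d(1) by blast
qed

text \<open>Averaging over \<open>x + z\<close> is the usual convolution because the mollifier is
  even; this form shows mollification as an average of translates.\<close>

definition mollify :: "real => ('a::euclidean_space => 'b::euclidean_space) => 'a => 'b" where
 "mollify e f x = (LI z. mollifier e z *R f (x + z))"

lemma mollify_measurable [measurable]:
 assumes [measurable]: "f : BM" and "0 < e"
 shows "mollify e f : BM"
proof -
 note [measurable] = mollifier_measurable[OF \<open>0 < e\<close>]
 show ?thesis unfolding mollify_def[abs_def] by measurable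
qed

text \<open>Tonelli's theorem bounds the weighted error by the average, with respect to the
  mollifier, of the weighted translation errors, all of which are below \<open>ei\<close> once the
  support radius is below \<open>d\<close>.\<close>

lemma mollify_weighted:
 fixes f :: "'a::euclidean_space => 'b::euclidean_space"
 assumes f: "integrable lborel f" and [measurable]: "xe : BM" and xi: "!!x. 0 <= xe x" and "0 < ei"
 and d: "d > 0" "!!z. norm z < d ==> (LI x. xe x * norm (f (x + z) - f x)) < ei"
 and it: "!!z. (ILI x. xe x * norm (f (x + z) - f x))"
 shows "EX d>0. ALL e. 0 < e & e < d --> (ILI x. xe x * norm (mollify e f x - f x)) &
 (LI x. xe x * norm (mollify e f x - f x)) <= ei"
proof -
 have [measurable]: "f : BM" using f borel_measurable_integrable by fastforce
 have "(ILI x. xe x * norm (mollify e f x - f x)) &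
 (LI x. xe x * norm (mollify e f x - f x)) <= ei" if e: "0 < e" "e < d" for e
 proof -
 note [measurable] = mollifier_measurable[OF e(1)] mollify_measurable[OF _ e(1), of f]
 note ker = integrable_mollifier[OF e(1), where 'a = 'a] integral_mollifier[OF e(1), where 'a = 'a]
 mollifier_nonneg[OF e(1), where 'a = 'a]
 have "EX B. ALL z. norm (mollifier e (z::'a)) <= B"
 using C1_supp_bounds[OF mollifier_C1_supp[OF e(1)]] by auto
 then obtain B where B: "!!z::'a. \<bar>mollifier e z\<bar> <= B" by auto
 have pt: "ennreal (norm (mollify e f x - f x)) <= (NLI z. ennreal (mollifier e z * norm (f (x + z) - f x)))" for x
 proof -
 have i1: "ILI z. mollifier e z *R f (x + z)"
 proof (rule bint_bound)
 show "ILI z. B * norm (f (z + x))"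
 using integrable_translate(1)[OF f(1), of x] by auto
 show "AEL z. norm (mollifier e z *R f (x + z)) <= norm (B * norm (f (z + x)))"
 proof (intro AE_I2)
 fix z
 have "\<bar>mollifier e z\<bar> * norm (f (x + z)) <= B * norm (f (x + z))"
 by (intro mult_right_mono B) simp
 also have "... <= \<bar>B * norm (f (x + z))\<bar>" by simp
 finally show "norm (mollifier e z *R f (x + z)) <= norm (B * norm (f (z + x)))"
 by (simp add: add.commute)
 qed
 qed measurable
 have i2: "ILI z. mollifier e z *R f x" using integrable_mollifier[OF e(1)] by (intro integrable_scaleR_left) blast
 have "mollify e f x - f x = (LI z. mollifier e z *R (f (x + z) - f x))"
 unfolding scaleR_diff_right using ker
 by (subst bint_minus[OF i1 i2], subst integral_scaleR_left) (simp_all add: mollify_def)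
 also have "ennreal (norm ...) <= (NLI z. ennreal (norm (mollifier e z *R (f (x + z) - f x))))"
 unfolding scaleR_diff_right by (rule integral_norm_bound_ennreal[OF bint_diff[OF i1 i2]])
 finally show ?thesis using ker by simp
 qed
 have "(NLI x. ennreal (xe x * norm (mollify e f x - f x)))
 <= (NLI x. (NLI z. ennreal (mollifier e z) * ennreal (xe x * norm (f (x + z) - f x))))"
 proof (rule nn_integral_mono)
 fix x
 have "ennreal (xe x * norm (mollify e f x - f x)) <= ennreal (xe x) * (NLI z. ennreal (mollifier e z * norm (f (x + z) - f x)))"
 using xi(1)[of x] by (simp add: ennreal_mult pt mult_left_mono)
 also have "... = (NLI z. ennreal (xe x) * ennreal (mollifier e z * norm (f (x + z) - f x)))"
 by (intro nn_integral_cmult[symmetric]) measurable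
 also have "... = (NLI z. ennreal (mollifier e z) * ennreal (xe x * norm (f (x + z) - f x)))"
 using ker xi(1) by (simp add: ennreal_mult mult.left_commute)
 finally show "ennreal (xe x * norm (mollify e f x - f x)) <= (NLI z. ennreal (mollifier e z) * ennreal (xe x * norm (f (x + z) - f x)))" .
 qed
 also have "... = (NLI z. (NLI x. ennreal (mollifier e z) * ennreal (xe x * norm (f (x + z) - f x))))"
 by (rule lborel_pair.Fubini') measurable
 also have "... = (NLI z. ennreal (mollifier e z) * (NLI x. ennreal (xe x * norm (f (x + z) - f x))))"
 by (intro nn_integral_cong nn_integral_cmult) measurable
 also have "... <= (NLI z. ennreal (mollifier e (z::'a)) * ennreal ei)"
 proof (rule nn_integral_mono)
 fix z :: 'a
 show "ennreal (mollifier e z) * (NLI x. ennreal (xe x * norm (f (x + z) - f x))) <= ennreal (mollifier e z) * ennreal ei"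
 proof (cases "z : cball 0 e")
 case True
 then have "norm z < d" using e by simp
 then have "(LI x. xe x * norm (f (x + z) - f x)) <= ei" using d(2) less_imp_le by blast
 then have "(NLI x. ennreal (xe x * norm (f (x + z) - f x))) <= ennreal ei"
 using it[of z] xi(1) by (subst nn_integral_eq_integral) (auto simp: ennreal_leI)
 then show ?thesis by (rule mult_left_mono) simp
 next
 case False
 then show ?thesis by (simp add: mollifier_eq_0[OF e(1)])
 qed
 qed
 also have "... = (NLI z. ennreal (mollifier e (z::'a))) * ennreal ei"
 by (rule nn_integral_multc) measurable
 also have "(NLI z. ennreal (mollifier e (z::'a))) = 1"
 using ker by (subst nn_integral_eq_integral) auto
 finally have *: "(NLI x. ennreal (xe x * norm (mollify e f x - f x))) <= ennreal ei" by simp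
 have i: "ILI x. xe x * norm (mollify e f x - f x)"
 using * xi(1) by (intro integrableI_bounded) (auto simp: abs_mult intro: le_less_trans)
 then have "ennreal (LI x. xe x * norm (mollify e f x - f x)) <= ennreal ei"
 using * xi(1) by (subst nn_integral_eq_integral[symmetric]) auto
 then have "(LI x. xe x * norm (mollify e f x - f x)) <= ei"
 using \<open>0 < ei\<close> by (simp add: ennreal_le_iff)
 with i show ?thesis by blast
 qed
 then show ?thesis using d(1) by blast
qed

lemma mollify_converges:
 fixes f :: "'a::euclidean_space => 'b::euclidean_space"
 assumes p: "1 < p" and f: "integrable lborel f" "ILI x. norm (f x) powr p"
 and [measurable]: "xe : BM" and xi: "!!x. 0 <= xe x"
 "ILI x. xe x powr (p / (p - 1))" and "0 < ei"
 shows "EX d>0. ALL e. 0 < e & e < d --> (ILI x. xe x * norm (mollify e f x - f x)) &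
 (LI x. xe x * norm (mollify e f x - f x)) <= ei"
proof -
 have [measurable]: "f : BM" using f borel_measurable_integrable by fastforce
 obtain d where d: "d > 0" "!!z. norm z < d ==> (LI x. xe x * norm (f (x + z) - f x)) < ei"
 using weighted_translation_continuous[OF p f _ xi \<open>0 < ei\<close>] by auto
 have it: "ILI x. xe x * norm (f (x + z) - f x)" for z
 using translate_diff_powr(1)[OF p f, of z] by (intro integrable_mult_Young[OF _ _ xi(1) _ p xi(2)]) auto
 show ?thesis by (rule mollify_weighted[OF f(1) _ xi(1) \<open>0 < ei\<close> d it]) auto
qed

subsection \<open>Extension of the class of test functions\<close>

lemma compact_thickening:
 assumes "compact K" "K <= D" "open (D :: 'a::euclidean_space set)"
 obtains d K' where "0 < d" "compact K'" "K' <= D" "!!x. x : K ==> cball x d <= K'" "K <= K'"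
 "!!x y. x : K ==> norm (y - x) <= d ==> y : K'"
proof -
 obtain d where d: "0 < d" "(UN x:K. cball x d) <= D"
 using compact_subset_open_imp_cball_epsilon_subset[OF assms(1,3,2)] by blast
 define K' where "K' = {x + y | x y. x : K & y : cball 0 d}"
 have K': "compact K'" unfolding K'_def using assms by (intro compact_sums) auto
 have *: "y : K'" if "x : K" "norm (y - x) <= d" for x y
 proof -
 have "y = x + (y - x)" "y - x : cball 0 d" using that by auto
 then show ?thesis unfolding K'_def using that(1) by blast
 qed
 have **: "cball x d <= K'" if "x : K" for x
 proof
 fix y assume "y : cball x d"
 then show "y : K'" using *[OF that, of y] by (simp add: dist_norm norm_minus_commute)
 qed
 have 1: "K' <= D"
 proof
 fix z assume "z : K'"
 then obtain x y where "x : K" "norm y <= d" "z = x + y" unfolding K'_def by auto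
 then have "z : (UN x:K. cball x d)" by (auto simp: dist_norm intro!: bexI[of _ x])
 then show "z : D" using d(2) by blast
 qed
 have 2: "K <= K'"
 proof
 fix x assume "x : K"
 then show "x : K'" using *[of x x] d(1) by simp
 qed
 show ?thesis by (rule that[OF d(1) K' 1 ** 2 *])
qed

lemma mollify_eq_convolution:
 fixes f :: "'a::euclidean_space => 'b::euclidean_space"
 assumes e: "0 < e"
 shows "mollify e f x = (LI y. mollifier e (x - y) *R f y)"
proof -
 have "(LI y. mollifier e (x - y) *R f y) = (LI y. mollifier e (x - (y + x)) *R f (y + x))"
 by (rule integrable_translate(2)[symmetric])
 also have "... = mollify e f x"
 proof -
 have "mollifier e (- y) = mollifier e y" for y :: 'a by (rule mollifier_minus[OF e])
 then show ?thesis by (simp add: mollify_def add.commute)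
 qed
 finally show ?thesis by simp
qed

lemma C1_supp_mollify:
 assumes f: "C1_supp K vp vp'" and e: "0 < e"
 shows "smooth (mollify e vp)" "GDERIV (mollify e vp) x :> mollify e vp' x"
proof -
 have i: "integrable lborel vp"
 by (rule integrable_continuous_supp[OF C1_supp_continuous[OF f], of K])
 (use f in "auto simp: C1_supp_def")
 have "smooth (%x. (LI y. vp y * mollifier e (x + (-1) *R y)))"
 by (rule smooth_integral_translates[OF i mollifier_smooth[OF e] compact_cball mollifier_eq_0[OF e]])
 moreover have "mollify e vp = (%x. (LI y. vp y * mollifier e (x + (-1) *R y)))"
 proof
 fix x
 have "(LI y. vp y * mollifier e (x + (-1) *R y)) = (LI y. mollifier e (x - y) *R vp y)"
 by (intro bint_cong) (simp_all add: mult.commute)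
 then show "mollify e vp x = (LI y. vp y * mollifier e (x + (-1) *R y))"
 using mollify_eq_convolution[OF e, of vp x] by (simp only:)
 qed
 ultimately show "smooth (mollify e vp)" by simp
 have "GDERIV (%x. (LI z. mollifier e z * vp (x + 1 *R z))) x :> (LI z. mollifier e z *R vp' (x + 1 *R z))"
 by (rule GDERIV_integral_translates[OF integrable_mollifier[OF e] f])
 then show "GDERIV (mollify e vp) x :> mollify e vp' x"
 by (simp add: mollify_def[abs_def])
qed

lemma mollify_uniform:
 fixes f :: "'a::euclidean_space => 'b::euclidean_space"
 assumes f: "continuous_on UNIV f" "compact K" "!!x. x ~: K ==> f x = 0" and e: "0 < e"
 and close: "!!z. norm z <= e ==> norm (f (x + z) - f x) <= ei"
 shows "norm (mollify e f x - f x) <= ei"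
proof -
 note ker = integrable_mollifier[OF e, where 'a = 'a] integral_mollifier[OF e, where 'a = 'a]
 obtain B where B: "!!x. norm (f x) <= B" using bounded_continuous_supp[OF f] by metis
 have i1: "ILI z. mollifier e z *R f (x + z)"
 using integrable_mult_bounded_continuous[OF ker(1), of "%z. f (x + z)" B] B
 continuous_on_translate[OF f(1), of x 1] by simp
 have i2: "ILI z::'a. mollifier e z *R f x"
 by (rule integrable_scaleR_left[OF ker(1)])
 have "mollify e f x - f x = (LI z. mollifier e z *R (f (x + z) - f x))"
 unfolding scaleR_diff_right using ker
 by (subst bint_minus[OF i1 i2], subst integral_scaleR_left) (simp_all add: mollify_def)
 also have "norm ... <= (LI z. mollifier e (z::'a) * ei)"
 proof (rule order_trans[OF integral_norm_bound integral_mono])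
 show "ILI z. norm (mollifier e z *R (f (x + z) - f x))"
 unfolding scaleR_diff_right by (rule integrable_norm[OF bint_diff[OF i1 i2]])
 show "ILI z. mollifier e (z::'a) * ei" by (rule integrable_mult_left[OF ker(1)])
 show "norm (mollifier e z *R (f (x + z) - f x)) <= mollifier e z * ei" for z
 proof (cases "z : cball 0 e")
 case True
 then have "norm (f (x + z) - f x) <= ei" by (intro close) simp
 then show ?thesis using mollifier_nonneg[OF e, of z] by (simp add: mult_left_mono)
 qed (simp add: mollifier_eq_0[OF e])
 qed
 also have "... = ei" using ker by simp
 finally show ?thesis .
qed

lemma mollify_converges_pointwise:
 fixes f :: "'a::euclidean_space => 'b::euclidean_space"
 assumes f: "continuous_on UNIV f" "compact K" "!!x. x ~: K ==> f x = 0"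
 and e: "!!n. 0 < e n" "e ----> 0"
 shows "(%n. mollify (e n) f x) ----> f x"
proof (rule LIMSEQ_I)
 fix r :: real assume "0 < r"
 then obtain d where d: "d > 0" "!!x y. dist x y < d ==> dist (f x) (f y) < r / 2"
 using uniformly_continuous_supp[OF f, of "r / 2"] by auto
 have "\<forall>\<^sub>F n in sequentially. e n < d" using order_tendstoD(2)[OF e(2) d(1)] .
 then obtain N where N: "!!n. n \<ge> N ==> e n < d" by (auto simp: eventually_sequentially)
 have "norm (mollify (e n) f x - f x) <= r / 2" if "n \<ge> N" for n
 proof (rule mollify_uniform[OF f e(1)])
 fix z :: 'a assume "norm z <= e n"
 then show "norm (f (x + z) - f x) <= r / 2"
 using d(2)[of "x + z" x] N[OF that] by (simp add: dist_norm)
 qed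
 then show "EX no. \<forall>n\<ge>no. norm (mollify (e n) f x - f x) < r"
 using \<open>0 < r\<close> by (intro exI[of _ N] allI impI) (smt (verit) field_sum_of_halves)
qed

lemma mollify_bound:
 fixes f :: "'a::euclidean_space => 'b::euclidean_space"
 assumes f: "continuous_on UNIV f" and B: "!!x. norm (f x) <= B" and e: "0 < e"
 shows "norm (mollify e f x) <= B"
proof -
 note ker = integrable_mollifier[OF e, where 'a = 'a] integral_mollifier[OF e, where 'a = 'a]
 have i1: "ILI z. mollifier e z *R f (x + z)"
 using integrable_mult_bounded_continuous[OF ker(1), of "%z. f (x + z)" B] B
 continuous_on_translate[OF f(1), of x 1] by simp
 have "norm (mollify e f x) <= (LI z. mollifier e (z::'a) * B)"
 unfolding mollify_def
 proof (rule order_trans[OF integral_norm_bound integral_mono])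
 show "ILI z. norm (mollifier e z *R f (x + z))" using i1 by (rule integrable_norm)
 show "ILI z. mollifier e (z::'a) * B" by (rule integrable_mult_left[OF ker(1)])
 show "norm (mollifier e z *R f (x + z)) <= mollifier e z * B" for z
 using mult_left_mono[OF B[of "x + z"] mollifier_nonneg[OF e, of z]] mollifier_nonneg[OF e, of z] by simp
 qed
 also have "... = B" using ker by simp
 finally show ?thesis .
qed

lemma mollify_eq_0:
 assumes e: "0 < e" and "!!z. norm z <= e ==> f (x + z) = 0"
 shows "mollify e f x = 0"
proof -
 have "(%z. mollifier e z *R f (x + z)) = (%z. 0)"
 proof
 fix z show "mollifier e z *R f (x + z) = 0"
 using assms mollifier_eq_0[OF e, of z] by (cases "norm z <= e") auto
 qed
 then show ?thesis unfolding mollify_def by (simp only: integral_zero)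
qed

text \<open>Mollification at scales below the distance from \<open>K\<close> to the complement of
  \<open>D\<close> keeps all supports in one compact \<open>K'\<close>. The common bound
  \<open>B\<close> is what dominated convergence requires, and the last clause preserves
  nonnegativity.\<close>

lemma C1_supp_approximation:
 assumes f: "C1_supp K vp vp'" and D: "K <= D" "open D"
 obtains K' cs B where "compact K'" "K' <= D" "!!n. cs n : test_functions D"
 "!!n x. x ~: K' ==> cs n x = 0" "!!n x. x ~: K' ==> grad (cs n) x = 0"
 "!!n x. \<bar>cs n x\<bar> <= B" "!!n x. norm (grad (cs n) x) <= B"
 "!!x. (%n. cs n x) ----> vp x" "!!x. (%n. grad (cs n) x) ----> vp' x"
 "(ALL x. 0 <= vp x) --> (ALL n x. 0 <= cs n x)"
proof -
 have K: "compact K" using f by (simp add: C1_supp_def)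
 obtain d K' where dK: "0 < d" "compact K'" "K' <= D" and "!!x. x : K ==> cball x d <= K'" "K <= K'"
 and dK': "!!x y. x : K ==> norm (y - x) <= d ==> y : K'"
 proof (rule compact_thickening[OF K D], goal_cases)
 case (1 d K')
 show ?case by (rule 1(1)[OF 1(2-7)])
 qed
 define e where "e n = d / real (Suc n)" for n
 have e: "0 < e n" "e n <= d" for n
 using dK(1) by (auto simp: e_def field_simps)
 have e0: "e ----> 0" unfolding e_def by (rule LIMSEQ_Suc[OF lim_const_over_n])
 define cs where "cs n = mollify (e n) vp" for n
 have gr: "grad (cs n) x = mollify (e n) vp' x" for n x
 unfolding cs_def by (rule grad_eqI[OF C1_supp_mollify(2)[OF f e(1)]])
 note c = C1_supp_continuous[OF f]
 have c': "continuous_on UNIV vp'" using f by (simp add: C1_supp_def)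
 have z: "vp x = 0" if "x ~: K" for x using f that by (simp add: C1_supp_def)
 note z' = C1_supp_grad_0[OF f]
 obtain B where B: "!!x. norm (vp x) <= B" "!!x. norm (vp' x) <= B"
 using C1_supp_bounds[OF f] by auto
 have out: "x + z ~: K" if "x ~: K'" "norm z <= e n" for x z n
 using dK'[of "x + z" x] that e(2)[of n] by auto
 have 0: "cs n x = 0" if "x ~: K'" for n x
 unfolding cs_def by (rule mollify_eq_0[OF e(1)]) (use out[OF that] z in auto)
 show ?thesis
 proof (rule that[OF dK(2,3), of cs B])
 show "cs n : test_functions D" for n
 by (rule test_functionsI[OF _ dK(2,3) 0]) (auto simp: cs_def intro: C1_supp_mollify(1)[OF f e(1)])
 show "cs n x = 0" if "x ~: K'" for n x by (rule 0[OF that])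
 show "grad (cs n) x = 0" if "x ~: K'" for n x
 unfolding gr by (rule mollify_eq_0[OF e(1)]) (use out[OF that] z' in auto)
 show "\<bar>cs n x\<bar> <= B" for n x
 using mollify_bound[OF c B(1) e(1), of n x] by (simp add: cs_def)
 show "norm (grad (cs n) x) <= B" for n x
 unfolding gr by (rule mollify_bound[OF c' B(2) e(1)])
 show "(%n. cs n x) ----> vp x" for x
 unfolding cs_def by (rule mollify_converges_pointwise[OF c K z e(1) e0])
 show "(%n. grad (cs n) x) ----> vp' x" for x
 unfolding gr by (rule mollify_converges_pointwise[OF c' K z' e(1) e0])
 show "(ALL x. 0 <= vp x) --> (ALL n x. 0 <= cs n x)"
 unfolding cs_def mollify_def
 by (intro impI allI bint_nonneg) (auto intro!: mult_nonneg_nonneg mollifier_nonneg[OF e(1)])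
 qed
qed

definition loc_integrable :: "'a::euclidean_space set => ('a => real) => bool" where
 "loc_integrable D h \<longleftrightarrow> h : BM &
 (ALL K. compact K --> K <= D --> (ILI x. indicator K x * h x))"

lemma test_integrals_converge:
 fixes X :: "'a::euclidean_space => 'b::euclidean_space" and g :: "nat => 'a => 'b"
 assumes [measurable]: "X : BM" and X: "loc_integrable D (%x. norm (X x))"
 and K: "compact K" "K <= D" and [measurable]: "!!n. g n : BM"
 and g: "!!n x. x ~: K ==> g n x = 0" "!!n x. norm (g n x) <= B" "!!x. (%n. g n x) ----> g' x"
 shows "(%n. (LI x. X x <.> g n x)) ----> (LI x. X x <.> g' x)"
proof -
 have [measurable]: "g' : BM"
 by (rule borel_measurable_LIMSEQ_metric[OF _ g(3)]) auto
 show ?thesis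
 proof (rule integral_dominated_convergence[where w = "%x. B * (indicator K x * norm (X x))"])
 show "ILI x. B * (indicator K x * norm (X x))"
 using X K by (simp add: loc_integrable_def)
 show "AEL x. (%n. X x <.> g n x) ----> X x <.> g' x"
 by (intro AE_I2 tendsto_intros g)
 show "AEL x. norm (X x <.> g n x) <= B * (indicator K x * norm (X x))" for n
 proof (intro AE_I2)
 fix x
 show "norm (X x <.> g n x) <= B * (indicator K x * norm (X x))"
 proof (cases "x : K")
 case True
 have "norm (X x <.> g n x) <= norm (X x) * norm (g n x)" by (simp add: Cauchy_Schwarz_ineq2)
 also have "... <= norm (X x) * B" by (intro mult_left_mono g) auto
 finally show ?thesis using True by (simp add: mult.commute)
 qed (simp add: g)
 qed
 qed measurable
qed

text \<open>A weak inequality known for smooth test functions passes to C^1 test functions by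
  dominated convergence on the fixed compact set carrying the mollifications.\<close>

lemma test_inequality_extend:
 fixes X :: "'a::euclidean_space => 'a"
 assumes D: "open D" and [measurable]: "X : BM" and X: "loc_integrable D (%x. norm (X x))"
 and h: "loc_integrable D h"
 and test: "!!vp. vp : test_functions D ==> (!!x. 0 <= vp x) ==>
 (LI x. h x * vp x) <= (LI x. X x <.> grad vp x)"
 and f: "C1_supp K vp vp'" and K: "K <= D" and pos: "!!x. 0 <= vp x"
 shows "(LI x. h x * vp x) <= (LI x. X x <.> vp' x)"
proof -
 have [measurable]: "h : BM" using h by (simp add: loc_integrable_def)
 have h': "loc_integrable D (%x. norm (h x))"
 unfolding loc_integrable_def
 proof (intro conjI allI impI)
 fix K assume "compact K" "K <= D"
 then have "ILI x. norm (indicator K x * h x)"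
 using h by (intro integrable_norm) (simp add: loc_integrable_def)
 then show "ILI x. indicator K x * norm (h x)" by (simp add: abs_mult)
 qed measurable
 obtain K' cs B where cs: "compact K'" "K' <= D" "!!n. cs n : test_functions D"
 "!!n x. x ~: K' ==> cs n x = 0" "!!n x. x ~: K' ==> grad (cs n) x = 0"
 "!!n x. \<bar>cs n x\<bar> <= B" "!!n x. norm (grad (cs n) x) <= B"
 "!!x. (%n. cs n x) ----> vp x" "!!x. (%n. grad (cs n) x) ----> vp' x"
 "(ALL x. 0 <= vp x) --> (ALL n x. 0 <= cs n x)"
 proof (rule C1_supp_approximation[OF f K D], goal_cases)
 case (1 K' cs B)
 show ?case by (rule 1(1)[OF 1(2-11)])
 qed
 have sm: "smooth (cs n)" for n using cs(3)[of n] by (auto elim: test_functionsE)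
 have [measurable]: "cs n : BM" "grad (cs n) : BM" for n
 by (auto intro!: borel_measurable_continuous_onI smooth_continuous smooth_continuous_grad sm)
 have 1: "(%n. (LI x. h x <.> cs n x)) ----> (LI x. h x <.> vp x)"
 by (rule test_integrals_converge[OF _ h' cs(1,2) _ cs(4) _ cs(8)]) (use cs(6) in auto)
 have 2: "(%n. (LI x. X x <.> grad (cs n) x)) ----> (LI x. X x <.> vp' x)"
 by (rule test_integrals_converge[OF _ X cs(1,2) _ cs(5) _ cs(9)]) (use cs(7) in auto)
 from 1 2 have "(LI x. h x <.> vp x) <= (LI x. X x <.> vp' x)"
 by (rule LIMSEQ_le) (use test[OF cs(3)] cs(10) pos in auto)
 then show ?thesis by simp
qed

text \<open>Each product \<open>(Y x <.> b) * vp x\<close> extends by zero to a compactly supported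
  C^1 function on the whole space, and its derivative in direction \<open>b\<close> integrates to 0.
  Summation over the basis gives the divergence.\<close>

lemma integral_by_parts:
 fixes Y :: "'a::euclidean_space => 'a"
 assumes f: "C1_supp K vp vp'" and W: "open W" "K <= W"
 and Y: "!!x. x : W ==> (Y has_derivative Y' x) (at x)" and cY: "!!v. continuous_on W (%x. Y' x v)"
 shows "(LI x. Y x <.> vp' x) = - (LI x. (SUM b:Basis. Y' x b <.> b) * vp x)"
 and "ILI x. Y x <.> vp' x" and "ILI x. (SUM b:Basis. Y' x b <.> b) * vp x"
proof -
 have K: "compact K" and G: "!!x. GDERIV vp x :> vp' x" and c': "continuous_on UNIV vp'" and z: "!!x. x ~: K ==> vp x = 0"
 using f by (auto simp: C1_supp_def)
 note c = C1_supp_continuous[OF f] and z' = C1_supp_grad_0[OF f]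
 have cYW: "continuous_on W Y"
 using Y W by (auto intro!: continuous_at_imp_continuous_on has_derivative_continuous)
 have glue: "continuous_on UNIV F" if "continuous_on W F" "!!x. x ~: K ==> F x = 0" for F :: "'a => 'b::real_normed_vector"
 proof -
 have "continuous_on (- K) F"
 using that(2) by (subst continuous_on_cong[where g = "%_. 0"]) auto
 then have "continuous_on (W \<union> - K) F"
 using that(1) W K by (intro continuous_on_open_Un) (auto simp: compact_imp_closed)
 moreover have "W \<union> - K = UNIV" using W by auto
 ultimately show ?thesis by simp
 qed
 have cont1: "continuous_on UNIV (%x. Y x <.> vp' x)"
 by (rule glue, intro continuous_intros cYW continuous_on_subset[OF c' subset_UNIV]) (simp add: z')
 have cont2: "continuous_on UNIV (%x. (SUM b:Basis. Y' x b <.> b) * vp x)"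
 by (rule glue, intro continuous_intros cY continuous_on_subset[OF c subset_UNIV]) (simp add: z)
 show i1: "ILI x. Y x <.> vp' x"
 by (rule integrable_continuous_supp[OF cont1 K]) (simp add: z')
 show i2: "ILI x. (SUM b:Basis. Y' x b <.> b) * vp x"
 by (rule integrable_continuous_supp[OF cont2 K]) (simp add: z)
 have b: "(LI x. (Y x <.> b) * (vp' x <.> b) + (Y' x b <.> b) * vp x) = 0"
 and ib: "ILI x. (Y x <.> b) * (vp' x <.> b) + (Y' x b <.> b) * vp x" if "b : Basis" for b
 proof -
 \<comment> \<open>The full gradient of \<open>Y <.> b * vp\<close>; only its component along
   \<open>b\<close> enters the sum.\<close>
 define g where "g x = (Y x <.> b) *R vp' x + vp x *R (SUM v:Basis. (Y' x v <.> b) *R v)" for x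
 have gb: "g x <.> b = (Y x <.> b) * (vp' x <.> b) + (Y' x b <.> b) * vp x" for x
 using that by (simp add: g_def inner_add_left inner_sum_left_Basis mult.commute)
 have D: "GDERIV (%x. Y x <.> b * vp x) x :> g x" for x
 proof (cases "x : K")
 case True
 then have x: "x : W" using W by blast
 interpret L: linear "Y' x" using Y[OF x] by (rule has_derivative_linear)
 have rep: "Y' x h <.> b = h <.> (SUM v:Basis. (Y' x v <.> b) *R v)" for h
 proof -
 have "Y' x h = Y' x (SUM v:Basis. (h <.> v) *R v)" by (simp add: euclidean_representation)
 also have "... = (SUM v:Basis. (h <.> v) *R Y' x v)" by (simp only: L.sum L.scale)
 finally have "Y' x h = (SUM v:Basis. (h <.> v) *R Y' x v)" .
 then have "Y' x h <.> b = (SUM v:Basis. (h <.> v) * (Y' x v <.> b))" by (simp only: inner_sum_left inner_scaleR_left)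
 then show ?thesis by (simp only: inner_sum_right inner_scaleR_right mult.commute)
 qed
 have a: "((%x. Y x <.> b) has_derivative (%h. Y' x h <.> b)) (at x)"
 using Y[OF x] by (rule bounded_linear.has_derivative[OF bounded_linear_inner_left])
 have c: "(vp has_derivative (%h. h <.> vp' x)) (at x)" by (rule G[of x, unfolded gderiv_def])
 have "((%x. Y x <.> b * vp x) has_derivative (%h. (Y x <.> b) * (h <.> vp' x) + (Y' x h <.> b) * vp x)) (at x)"
 by (rule has_derivative_mult[OF a c])
 moreover have "(%h. (Y x <.> b) * (h <.> vp' x) + (Y' x h <.> b) * vp x) = (%h. h <.> g x)"
 proof
 fix h
 show "(Y x <.> b) * (h <.> vp' x) + (Y' x h <.> b) * vp x = h <.> g x"
 using rep[of h] unfolding g_def inner_add_right inner_scaleR_right by (metis mult.commute)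
 qed
 ultimately show ?thesis by (simp only: gderiv_def)
 next
 case False
 then have "g x = 0" by (simp add: g_def z z')
 moreover have "GDERIV (%x. Y x <.> b * vp x) x :> 0"
 by (rule GDERIV_eq_0_open[of "- K"]) (use K False in "auto simp: z compact_imp_closed")
 ultimately show ?thesis by simp
 qed
 have cg: "continuous_on UNIV g"
 unfolding g_def
 by (rule glue, intro continuous_intros cYW cY continuous_on_subset[OF c' subset_UNIV]
 continuous_on_subset[OF c subset_UNIV]) (simp add: z z')
 have C: "C1_supp K (%x. Y x <.> b * vp x) g"
 using D cg K by (simp add: C1_supp_def z)
 from integral_directional_derivative_0[OF C, of b] gb
 show "(LI x. (Y x <.> b) * (vp' x <.> b) + (Y' x b <.> b) * vp x) = 0" by simp
 have "integrable lborel g" by (rule integrable_continuous_supp[OF cg K C1_supp_grad_0[OF C]])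
 then have "ILI x. g x <.> b" by (rule integrable_inner_left)
 then show "ILI x. (Y x <.> b) * (vp' x <.> b) + (Y' x b <.> b) * vp x" by (simp add: gb)
 qed
 have "0 = (SUM b:Basis. (LI x. (Y x <.> b) * (vp' x <.> b) + (Y' x b <.> b) * vp x))"
 using b by simp
 also have "... = (LI x. (SUM b:Basis. (Y x <.> b) * (vp' x <.> b) + (Y' x b <.> b) * vp x))"
 by (rule Bochner_Integration.integral_sum[symmetric]) (rule ib)
 also have "... = (LI x. Y x <.> vp' x + (SUM b:Basis. Y' x b <.> b) * vp x)"
 by (simp only: sum.distrib sum_distrib_right euclidean_inner[of "Y x" "vp' x" for x])
 also have "... = (LI x. Y x <.> vp' x) + (LI x. (SUM b:Basis. Y' x b <.> b) * vp x)"
 by (rule bint_plus[OF i1 i2])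
 finally show "(LI x. Y x <.> vp' x) = - (LI x. (SUM b:Basis. Y' x b <.> b) * vp x)" by simp
qed

subsection \<open>Functions with weak gradients\<close>

text \<open>The function and its weak gradient are Borel representatives on the whole space, so that
  all later integrals are over \<open>lborel\<close>; outside \<open>D\<close> their values are
  harmless because test functions vanish there.\<close>

locale weak_diff =
 fixes D :: "'a::euclidean_space set" and p :: real and u :: "'a => real" and G :: "'a => 'a"
 assumes p: "1 < p" and open_D: "open D"
 and u_measurable [measurable]: "u : BM"
 and G_measurable [measurable]: "G : BM"
 and u_integrable: "!!K. compact K ==> K <= D ==> (ILI x. indicator K x * \<bar>u x\<bar> powr p)"
 and G_integrable: "!!K. compact K ==> K <= D ==> (ILI x. indicator K x * norm (G x) powr p)"
 and weak: "!!vp. vp : test_functions D ==>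
 (LI x. u x *R grad vp x) = - (LI x. vp x *R G x)"

lemma integrable_indicator_powr_le:
 fixes f :: "'a::euclidean_space => 'b::euclidean_space"
 assumes K: "compact K" and [measurable]: "f : BM" and p: "0 < q" "q <= p"
 and f: "ILI x. indicator K x * norm (f x) powr p"
 shows "ILI x. indicator K x * norm (f x) powr q"
proof (rule bint_bound)
 have [measurable]: "K : sets borel" using K by (auto intro: borel_compact)
 have "integrable lborel (indicator K :: 'a => real)"
 using emeasure_compact_finite[OF K] K by (auto simp: integrable_indicator_iff borel_compact)
 then show "ILI x. indicator K x + indicator K x * norm (f x) powr p"
 using f by (intro bint_add)
 show "(%x. indicator K x * norm (f x) powr q) : borel_measurable lborel" by measurable
 show "AEL x. norm (indicator K x * norm (f x) powr q) <= norm (indicator K x + indicator K x * norm (f x) powr p)"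
 proof (intro AE_I2)
 fix x
 have "norm (f x) powr q <= 1 + norm (f x) powr p"
 proof (cases "norm (f x) <= 1")
 case True
 then have "norm (f x) powr q <= 1 powr q" using p by (intro powr_mono2) auto
 then show ?thesis by (simp add: add_increasing2)
 next
 case False
 then have "norm (f x) powr q <= norm (f x) powr p" using p by (intro powr_mono) auto
 then show ?thesis by simp
 qed
 then show "norm (indicator K x * norm (f x) powr q) <= norm (indicator K x + indicator K x * norm (f x) powr p)"
 by (simp split: split_indicator)
 qed
qed

lemma integrable_restrict_compact:
 fixes f :: "'a::euclidean_space => 'b::euclidean_space"
 assumes K: "compact K" and [measurable]: "f : BM" and p: "1 <= p"
 and f: "ILI x. indicator K x * norm (f x) powr p"
 shows "ILI x. indicator K x *R f x"
proof (rule bint_bound)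
 have [measurable]: "K : sets borel" using K by (auto intro: borel_compact)
 show "ILI x. indicator K x * norm (f x) powr 1"
 by (rule integrable_indicator_powr_le[OF K _ _ p f]) auto
 show "(%x. indicator K x *R f x) : borel_measurable lborel" by measurable
qed auto

lemma tendsto_0_if_eventually_bounded:
 fixes X :: "nat => real"
 assumes "e ----> (0::real)" "!!n. 0 < e n" "!!n. 0 <= X n"
 and "!!ei. 0 < ei ==> EX d>0. ALL n. e n < d --> X n <= ei"
 shows "X ----> 0"
proof (rule LIMSEQ_I)
 fix r :: real assume "0 < r"
 then obtain d where d: "d > 0" "!!n. e n < d ==> X n <= r / 2" using assms(4)[of "r / 2"] by auto
 obtain N where "!!n. n \<ge> N ==> e n < d"
 using order_tendstoD(2)[OF assms(1) d(1)] by (auto simp: eventually_sequentially)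
 then have "norm (X n - 0) < r" if "n \<ge> N" for n
 using d(2)[of n] assms(3)[of n] that \<open>0 < r\<close> by auto
 then show "EX no. \<forall>n\<ge>no. norm (X n - 0) < r" by blast
qed

context weak_diff
begin

lemma u_restrict: "compact K ==> K <= D ==> (ILI x. indicator K x * u x)"
 using integrable_restrict_compact[OF _ u_measurable, of K p] u_integrable[of K] p by simp

lemma G_restrict: "compact K ==> K <= D ==> (ILI x. indicator K x *R G x)"
 using integrable_restrict_compact[OF _ G_measurable, of K p] G_integrable[of K] p by simp

text \<open>The gradients converge only after pairing with weights in the dual space. This is what
  pairing with fluxes requires, and it follows from the weighted mollification estimate.\<close>

definition approximating where
 "approximating K w g \<longleftrightarrow> (ALL j x. GDERIV (w j) x :> g j x) & (ALL j. continuous_on UNIV (g j)) &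
 (AEL x. x : K --> (%j. w j x) ----> u x) &
 (ALL xe. xe : BM --> (ALL x. 0 <= xe x) -->
 (ILI x. indicator K x * xe x powr (p / (p - 1))) -->
 (%j. (LI x. indicator K x * xe x * norm (g j x - G x))) ----> 0)"

text \<open>The truncations of \<open>u\<close> and \<open>G\<close> to a compact neighbourhood
  \<open>K'\<close> of \<open>K\<close> are mollified. On \<open>K\<close> the gradient of the
  mollified function is the mollified weak gradient, which gives the convergence.\<close>

lemma smooth_approximation:
 assumes K: "compact K" "K <= D"
 shows "EX w g. approximating K w g"
proof -
 obtain d K' where d: "0 < d" and K': "compact K'" "K' <= D" "K <= K'" and KK': "!!x. x : K ==> cball x d <= K'"
 proof (rule compact_thickening[OF K open_D], goal_cases)
 case (1 d K') show ?case by (rule 1(1)[OF 1(2,3,4,6,5)])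
 qed
 have [measurable]: "K : sets borel" "K' : sets borel" using K K' by (auto intro: borel_compact)
 define u' where "u' x = indicator K' x * u x" for x
 define G' where "G' x = indicator K' x *R G x" for x
 have u': "integrable lborel u'" unfolding u'_def by (rule u_restrict[OF K'(1,2)])
 have G': "integrable lborel G'" unfolding G'_def by (rule G_restrict[OF K'(1,2)])
 have pow: "(indicator K' x * a) powr p = indicator K' x * a powr p" for x and a :: real
 by (auto split: split_indicator)
 have u'p: "ILI x. norm (u' x) powr p"
 using u_integrable[OF K'(1,2)] by (simp add: u'_def abs_mult pow)
 have G'p: "ILI x. norm (G' x) powr p"
 using G_integrable[OF K'(1,2)] by (simp add: G'_def pow)
 define e where "e n = d / real (Suc n)" for n
 have e: "0 < e n" "e n <= d" for n
 using d by (auto simp: e_def field_simps)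
 have e0: "e ----> 0" unfolding e_def by (rule LIMSEQ_Suc[OF lim_const_over_n])
 define v where "v n x = (LI y. u' y * mollifier (e n) (x + (-1) *R y))" for n x
 define g where "g n x = (LI y. u' y *R grad (mollifier (e n)) (x + (-1) *R y))" for n x
 have vG: "GDERIV (v n) x :> g n x" for n x
 unfolding v_def[abs_def] g_def by (rule GDERIV_integral_translates[OF u' mollifier_C1_supp[OF e(1)]])
 have gc: "continuous_on UNIV (g n)" for n
 unfolding g_def[abs_def]
 by (rule continuous_integral_translates[OF u' smooth_continuous_grad[OF mollifier_smooth[OF e(1)]] compact_cball
 C1_supp_grad_0[OF mollifier_C1_supp[OF e(1)]]])
 have v: "v n x = mollify (e n) u' x" for n x
 unfolding mollify_eq_convolution[OF e(1)] v_def by (simp add: mult.commute)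
 \<comment> \<open>The weak gradient identity is tested with the reflected mollifier centred at
   \<open>x\<close>. Its support lies in \<open>K'\<close> for x in \<open>K\<close>, so truncation
   changes nothing.\<close>
 have g: "g n x = mollify (e n) G' x" if x: "x : K" for n x
 proof -
 let ?m = "mollifier (e n) :: 'a => real"
 define vp where "vp y = ?m (x - y)" for y
 have sub: "cball x (e n) <= K'" using KK'[OF x] e(2)[of n] by auto
 have 0: "vp y = 0" if "y ~: cball x (e n)" for y
 unfolding vp_def using that by (intro mollifier_eq_0[OF e(1)]) (simp add: dist_norm norm_minus_commute)
 have C: "C1_supp (cball x (e n)) vp (grad vp)"
 by (rule smooth_C1_supp[OF _ compact_cball 0]) (auto simp: vp_def[abs_def] intro: smooth_reflect mollifier_smooth[OF e(1)])
 have gr: "grad vp y = - grad ?m (x - y)" for y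
 proof (rule grad_eqI)
 have a: "((%y. x - y) has_derivative (%h. - h)) (at y)" by (auto intro!: derivative_eq_intros)
 have b: "(?m has_derivative (%h. h <.> grad ?m (x - y))) (at (x - y))"
 using smooth_GDERIV[OF mollifier_smooth[OF e(1)], of n "x - y"] unfolding gderiv_def .
 show "GDERIV vp y :> - grad ?m (x - y)"
 using has_derivative_compose[OF a b] by (simp add: gderiv_def vp_def[abs_def])
 qed
 have test: "vp : test_functions D"
 by (rule test_functionsI[OF _ compact_cball _ 0])
 (use sub K' in "auto simp: vp_def[abs_def] intro: smooth_reflect mollifier_smooth[OF e(1)]")
 have "(LI y. u y *R grad vp y) = (LI y. - (u' y *R grad ?m (x + (-1) *R y)))"
 proof (rule bint_cong)
 fix y
 show "u y *R grad vp y = - (u' y *R grad ?m (x + (-1) *R y))"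
 proof (cases "y : K'")
 case True then show ?thesis by (simp add: u'_def gr)
 next
 case False
 then have "grad vp y = 0" using sub by (intro C1_supp_grad_0[OF C]) auto
 then show ?thesis using False by (simp add: u'_def)
 qed
 qed simp
 then have 1: "(LI y. u y *R grad vp y) = - g n x" by (simp add: g_def)
 have "(LI y. vp y *R G y) = (LI y. ?m (x - y) *R G' y)"
 proof (rule bint_cong)
 fix y
 show "vp y *R G y = ?m (x - y) *R G' y"
 using sub 0[of y] by (cases "y : K'") (auto simp: G'_def vp_def subset_eq)
 qed simp
 then have 2: "(LI y. vp y *R G y) = mollify (e n) G' x"
 by (simp add: mollify_eq_convolution[OF e(1)])
 show ?thesis using weak[OF test] 1 2 by simp
 qed
 have iK: "integrable lborel (indicator K :: 'a => real)"
 using emeasure_compact_finite[OF K(1)] by (auto simp: integrable_indicator_iff)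
 have [measurable]: "u' : BM" "G' : BM"
 unfolding u'_def[abs_def] G'_def[abs_def] by measurable
 have lim: "(%n. (LI x. xe x * norm (mollify (e n) f x - f x))) ----> 0"
 if f: "integrable lborel f" "ILI x. norm (f x) powr p"
 and xi: "xe : BM" "!!x. 0 <= xe x" "ILI x. xe x powr (p / (p - 1))"
 for f :: "'a => 'c::euclidean_space" and xe
 proof (rule tendsto_0_if_eventually_bounded[OF e0 e(1)])
 show "0 <= (LI x. xe x * norm (mollify (e n) f x - f x))" for n
 by (intro bint_nonneg) (simp add: xi)
 show "EX d>0. ALL n. e n < d --> (LI x. xe x * norm (mollify (e n) f x - f x)) <= ei" if "0 < ei" for ei
 using mollify_converges[OF p f xi that] e(1) by blast
 qed
 have int: "ILI x. indicator K x * (v n x - u' x)" for n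
 proof -
 have "continuous_on UNIV (v n)"
 using vG unfolding gderiv_def by (intro continuous_at_imp_continuous_on ballI has_derivative_continuous) blast
 then have "ILI x. indicator K x *R v n x"
 by (intro borel_integrable_compact[OF K(1)]) (rule continuous_on_subset, auto)
 moreover have "ILI x. indicator K x * u' x"
 by (rule bint_bound[OF u']) (auto split: split_indicator)
 ultimately show ?thesis by (simp add: right_diff_distrib)
 qed
 have "(%n. (LI x. norm (indicator K x * (v n x - u' x)))) ----> 0"
 proof -
 have ip: "ILI x. indicat_real K x powr (p / (p - 1))"
 by (rule bint_bound[OF iK]) (auto split: split_indicator)
 have "(%n. (LI x. indicat_real K x * norm (mollify (e n) u' x - u' x))) ----> 0"
 by (rule lim[OF u' u'p _ _ ip]) auto
 then show ?thesis by (simp add: v abs_mult)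
 qed
 \<comment> \<open>Convergence in L^1 yields pointwise convergence almost everywhere only along a
   subsequence; the gradient statement is inherited by it.\<close>
 from tendsto_L1_AE_subseq[OF int this] obtain r :: "nat => nat" where
 r: "strict_mono r" "AEL x. (%n. indicator K x * (v (r n) x - u' x)) ----> 0" by blast
 have "approximating K (%j. v (r j)) (%j. g (r j))"
 unfolding approximating_def
 proof (intro conjI allI impI)
 show "GDERIV (v (r j)) x :> g (r j) x" for j x by (rule vG)
 show "continuous_on UNIV (g (r j))" for j by (rule gc)
 show "AEL x. x : K --> (%j. v (r j) x) ----> u x"
 using r(2)
 proof eventually_elim
 case (elim x)
 show ?case
 proof
 assume "x : K"
 then have "(%n. v (r n) x - u x) ----> 0" using elim K' by (auto simp: u'_def subset_eq)
 then show "(%j. v (r j) x) ----> u x" by (simp add: LIM_zero_iff)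
 qed
 qed
 fix xe :: "'a => real"
 assume xi [measurable]: "xe : BM" and xi0: "ALL x. 0 <= xe x"
 and xii: "ILI x. indicator K x * xe x powr (p / (p - 1))"
 have ip: "ILI x. (indicat_real K x * xe x) powr (p / (p - 1))"
 by (rule bint_bound[OF xii]) (auto split: split_indicator)
 have "(%n. (LI x. indicat_real K x * xe x * norm (mollify (e n) G' x - G' x))) ----> 0"
 by (rule lim[OF G' G'p _ _ ip]) (use xi0 in auto)
 moreover have "indicat_real K x * xe x * norm (mollify (e n) G' x - G' x) = indicat_real K x * xe x * norm (g n x - G x)" for n x
 using g[of x n] K'(3) by (cases "x : K") (auto simp: G'_def subset_eq)
 ultimately have "(%n. (LI x. indicat_real K x * xe x * norm (g n x - G x))) ----> 0" by simp
 then show "(%j. (LI x. indicator K x * xe x * norm (g (r j) x - G x))) ----> 0"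
 using r(1) LIMSEQ_subseq_LIMSEQ unfolding comp_def by blast
 qed
 then show ?thesis by blast
qed

end

section \<open>The flux of the p-Laplacian and nonlinear test functions\<close>

definition pflux :: "real => 'a::euclidean_space => 'a" where
 "pflux p xe = norm xe powr (p - 2) *R xe"

lemma norm_pflux: "norm (pflux p xe) = norm xe powr (p - 1)"
proof (cases "xe = 0")
 case False
 have "norm (pflux p xe) = norm xe powr (p - 2) * norm xe powr 1" by (simp add: pflux_def)
 also have "... = norm xe powr (p - 2 + 1)" by (rule powr_add[symmetric])
 finally show ?thesis by simp
qed (simp add: pflux_def)

lemma pflux_inner_self: "pflux p xe <.> xe = norm xe powr p"
proof (cases "xe = 0")
 case False
 have "pflux p xe <.> xe = norm xe powr (p - 2) * norm xe powr 2"
 by (simp add: pflux_def dot_square_norm)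
 also have "... = norm xe powr (p - 2 + 2)" by (rule powr_add[symmetric])
 finally show ?thesis by simp
qed (simp add: pflux_def)

lemma pflux_measurable [measurable]: "pflux p : BM"
 unfolding pflux_def[abs_def] by measurable

text \<open>The gradient inequality of the convex function |.|^p, obtained from Cauchy-Schwarz and
  Young. Exchanging \<open>a\<close> and \<open>b\<close> and adding gives monotonicity of the
  flux.\<close>

lemma pflux_convexity:
 assumes p: "1 < p"
 shows "p * (pflux p a <.> (b - a)) <= norm b powr p - norm a powr p"
proof -
 have "pflux p a <.> b <= norm a powr (p - 1) * norm b"
 using norm_cauchy_schwarz[of "pflux p a" b] by (simp add: norm_pflux)
 also have "... <= (norm a powr (p - 1)) powr (p / (p - 1)) / (p / (p - 1)) + norm b powr p / p"
 using p by (intro Youngs_inequality) (auto simp: field_simps)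
 also have "... = (p - 1) / p * norm a powr p + norm b powr p / p"
 using p by (simp add: powr_powr)
 finally have "p * (pflux p a <.> b) <= p * ((p - 1) / p * norm a powr p + norm b powr p / p)"
 using p by (intro mult_left_mono) auto
 also have "... = (p - 1) * norm a powr p + norm b powr p" using p by (simp add: field_simps)
 finally show ?thesis by (simp add: inner_diff_right pflux_inner_self algebra_simps)
qed

lemma pflux_monotone: "1 < p ==> 0 <= (pflux p a - pflux p b) <.> (a - b)"
proof -
 assume p: "1 < p"
 have "p * (pflux p a <.> (b - a)) + p * (pflux p b <.> (a - b)) <= 0"
 using pflux_convexity[OF p, of a b] pflux_convexity[OF p, of b a] by simp
 then have "p * ((pflux p a - pflux p b) <.> (a - b)) \<ge> 0"
 by (simp add: inner_diff_left inner_diff_right algebra_simps)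
 then show ?thesis using p by (simp add: zero_le_mult_iff)
qed

text \<open>The chain-rule gradient of \<open>cs * H (a - w)\<close>, with the value and gradient of
  \<open>w\<close> entered as \<open>s\<close> and \<open>xe\<close>. The same formula then serves
  for smooth approximants and for the weakly differentiable function itself.\<close>

definition test_grad :: "('a::euclidean_space => real) => ('a => 'a) => (real => real) => (real => real) =>
 ('a => real) => ('a => 'a) => 'a => real => 'a => 'a" where
 "test_grad cs cs' H H' a a' x s xe = H (a x - s) *R cs' x + (cs x * H' (a x - s)) *R (a' x - xe)"

lemma integrable_dominated:
 fixes f :: "'a => 'b::{banach, second_countable_topology}"
 assumes "integrable M g" "f : borel_measurable M" "!!x. norm (f x) <= g x"
 shows "integrable M f"
proof (rule bint_bound[OF assms(1,2)])
 show "AE x in M. norm (f x) <= norm (g x)"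
 unfolding real_norm_def by (intro AE_I2 order_trans[OF assms(3) abs_ge_self])
qed

lemma continuous_on_glue:
 fixes F :: "'a::euclidean_space => 'b::real_normed_vector"
 assumes "open W" "compact K" "K <= W" "continuous_on W F" "!!x. x ~: K ==> F x = 0"
 shows "continuous_on UNIV F"
proof -
 have "continuous_on (- K) F"
 using assms(5) by (subst continuous_on_cong[where g = "%_. 0"]) auto
 then have "continuous_on (W \<union> - K) F"
 using assms by (intro continuous_on_open_Un) (auto simp: compact_imp_closed)
 moreover have "W \<union> - K = UNIV" using assms by auto
 ultimately show ?thesis by simp
qed

lemma C1_supp_compose:
 assumes chi: "C1_supp K cs cs'" and W: "open W" "K <= W"
 and a: "!!x. x : W ==> GDERIV a x :> a' x" "continuous_on W a'"
 and H: "!!t. (H has_real_derivative H' t) (at t)" "continuous_on UNIV H'"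
 and w: "!!x. GDERIV w x :> g x" "continuous_on UNIV g"
 shows "C1_supp K (%x. cs x * H (a x - w x)) (%x. test_grad cs cs' H H' a a' x (w x) (g x))"
proof -
 have K: "compact K" and z: "!!x. x ~: K ==> cs x = 0" and chi': "!!x. GDERIV cs x :> cs' x" "continuous_on UNIV cs'"
 using chi by (auto simp: C1_supp_def)
 note c = C1_supp_continuous[OF chi] and z' = C1_supp_grad_0[OF chi]
 have cw: "continuous_on UNIV w"
 using w(1) unfolding gderiv_def by (intro continuous_at_imp_continuous_on ballI has_derivative_continuous) blast
 have ca: "continuous_on W a"
 using a(1) unfolding gderiv_def by (intro continuous_at_imp_continuous_on ballI has_derivative_continuous) blast
 have cH: "continuous_on UNIV H"
 using H(1) by (intro DERIV_continuous_on) (auto intro: has_field_derivative_at_within)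
 have d: "continuous_on W (%x. a x - w x)"
 by (intro continuous_intros ca continuous_on_subset[OF cw subset_UNIV])
 have "continuous_on UNIV (%x. test_grad cs cs' H H' a a' x (w x) (g x))"
 unfolding test_grad_def
 by (rule continuous_on_glue[OF W(1) K W(2)],
 intro continuous_intros continuous_on_compose2[OF cH d] continuous_on_compose2[OF H(2) d] a(2)
 continuous_on_subset[OF c subset_UNIV] continuous_on_subset[OF chi'(2) subset_UNIV]
 continuous_on_subset[OF w(2) subset_UNIV]) (simp_all add: z z')
 moreover have "GDERIV (%x. cs x * H (a x - w x)) x :> test_grad cs cs' H H' a a' x (w x) (g x)" for x
 proof (cases "x : K")
 case True
 then have x: "x : W" using W by blast
 have 1: "(cs has_derivative (%h. h <.> cs' x)) (at x)" by (rule chi'(1)[of x, unfolded gderiv_def])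
 have 2: "((%x. a x - w x) has_derivative (%h. h <.> a' x - h <.> g x)) (at x)"
 by (rule has_derivative_diff[OF a(1)[OF x, unfolded gderiv_def] w(1)[of x, unfolded gderiv_def]])
 have 3: "((%x. H (a x - w x)) has_derivative (%h. H' (a x - w x) * (h <.> a' x - h <.> g x))) (at x)"
 by (rule has_derivative_compose[OF 2 H(1)[of "a x - w x", unfolded has_field_derivative_def]])
 have "((%x. cs x * H (a x - w x)) has_derivative
 (%h. cs x * (H' (a x - w x) * (h <.> a' x - h <.> g x)) + (h <.> cs' x) * H (a x - w x))) (at x)"
 by (rule has_derivative_mult[OF 1 3])
 moreover have "(%h. cs x * (H' (a x - w x) * (h <.> a' x - h <.> g x)) + (h <.> cs' x) * H (a x - w x))
 = (%h. h <.> test_grad cs cs' H H' a a' x (w x) (g x))"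
 by (simp add: fun_eq_iff test_grad_def inner_add_right inner_diff_right)
 ultimately show ?thesis by (simp add: gderiv_def)
 next
 case False
 then have "test_grad cs cs' H H' a a' x (w x) (g x) = 0" by (simp add: test_grad_def z z')
 moreover have "GDERIV (%x. cs x * H (a x - w x)) x :> 0"
 by (rule GDERIV_eq_0_open[of "- K"]) (use K False in "auto simp: z compact_imp_closed")
 ultimately show ?thesis by simp
 qed
 ultimately show ?thesis using K z by (simp add: C1_supp_def)
qed

context weak_diff
begin

lemma G_dual_integrable:
 assumes "compact K" "K <= D"
 shows "ILI x. indicator K x * norm (pflux p (G x)) powr (p / (p - 1))"
 using G_integrable[OF assms] p by (simp add: norm_pflux powr_powr)

lemma pflux_loc_integrable: "loc_integrable D (%x. norm (pflux p (G x)))"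
 unfolding loc_integrable_def
proof (intro conjI allI impI)
 fix K assume "compact K" "K <= D"
 then show "ILI x. indicator K x * norm (pflux p (G x))"
 unfolding norm_pflux using p by (intro integrable_indicator_powr_le[OF _ _ _ _ G_integrable]) auto
qed measurable

text \<open>The bundle of hypotheses under which \<open>cs H(a - u)\<close> is an admissible test function.\<close>

definition admissible_test where
 "admissible_test K cs cs' W H H' a a' \<longleftrightarrow> C1_supp K cs cs' & open W & K <= W & W <= D &
 (ALL x:W. GDERIV a x :> a' x) & continuous_on W a' & a : BM & a' : BM &
 (ALL t. (H has_real_derivative H' t) (at t)) & continuous_on UNIV H' &
 (EX B. ALL t. \<bar>H t\<bar> <= B & \<bar>H' t\<bar> <= B)"

definition test_field where
 "test_field cs cs' H H' a a' x = test_grad cs cs' H H' a a' x (u x) (G x)"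

text \<open>The existential clause records that every approximant inherits the sign of
  \<open>cs\<close> and \<open>H\<close> and the zeros of \<open>cs\<close>. The remaining clauses
  are convergence against locally integrable functions and against dual weights.\<close>

definition approximates where
 "approximates K cs H a vp vp' T \<longleftrightarrow> (ALL j. C1_supp K (vp j) (vp' j)) & (ALL j x. EX t. vp j x = cs x * H t) &
 (ALL h. loc_integrable D h -->
 (ILI x. h x * (cs x * H (a x - u x))) &
 (%j. (LI x. h x * vp j x)) ----> (LI x. h x * (cs x * H (a x - u x)))) &
 (ALL xe. xe : BM --> (ALL x. 0 <= xe x) -->
 (ILI x. indicator K x * xe x powr (p / (p - 1))) -->
 (ALL j. (ILI x. xe x * norm (vp' j x - T x))) &
 (ILI x. xe x * norm (T x)) &
 (%j. (LI x. xe x * norm (vp' j x - T x))) ----> 0)"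

text \<open>This is the chain rule for weakly differentiable \<open>u\<close>, stated through
  approximation: replacing \<open>u\<close> by smooth \<open>w j\<close> gives C^1 test functions
  whose gradients converge against every dual weight.\<close>

lemma admissible_approximation:
 assumes adm: "admissible_test K cs cs' W H H' a a'"
 shows "EX vp vp'. approximates K cs H a vp vp' (test_field cs cs' H H' a a')"
 and "test_field cs cs' H H' a a' : BM"
 and "x ~: K ==> test_field cs cs' H H' a a' x = 0"
proof -
 from adm have chi: "C1_supp K cs cs'" and W: "open W" "K <= W" "W <= D"
 and a: "!!x. x : W ==> GDERIV a x :> a' x" "continuous_on W a'"
 and am [measurable]: "a : BM" "a' : BM"
 and H: "!!t. (H has_real_derivative H' t) (at t)" "continuous_on UNIV H'"
 and "EX B. ALL t. \<bar>H t\<bar> <= B & \<bar>H' t\<bar> <= B"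
 by (auto simp: admissible_test_def)
 then obtain B where B: "!!t. \<bar>H t\<bar> <= B" "!!t. \<bar>H' t\<bar> <= B" by blast
 have B0: "0 <= B" using B(1)[of 0] by simp
 have K: "compact K" and KD: "K <= D" and z: "!!x. x ~: K ==> cs x = 0"
 using chi W by (auto simp: C1_supp_def)
 note z' = C1_supp_grad_0[OF chi]
 have cH: "continuous_on UNIV H"
 using H(1) by (intro DERIV_continuous_on) (auto intro: has_field_derivative_at_within)
 have [measurable]: "K : sets borel" using K by (auto intro: borel_compact)
 have [measurable]: "cs : BM" "cs' : BM" "H : BM" "H' : BM"
 using C1_supp_continuous[OF chi] chi cH H(2) by (auto intro: borel_measurable_continuous_onI simp: C1_supp_def)
 obtain C where C: "C > 0" "!!x. \<bar>cs x\<bar> <= C" "!!x. norm (cs' x) <= C" using C1_supp_bounds[OF chi] by metis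
 have "compact (a' ` K)" using a(2) K W by (intro compact_continuous_image) (auto intro: continuous_on_subset)
 then obtain A where A: "A > 0" "!!x. x : K ==> norm (a' x) <= A"
 using bounded_pos compact_imp_bounded by (metis imageI)
 obtain w g where ap: "approximating K w g"
 using smooth_approximation[OF K KD] by blast
 have wg: "!!j x. GDERIV (w j) x :> g j x" "!!j. continuous_on UNIV (g j)"
 "AEL x. x : K --> (%j. w j x) ----> u x"
 by (rule ap[unfolded approximating_def, THEN conjunct1, rule_format],
 rule ap[unfolded approximating_def, THEN conjunct2, THEN conjunct1, rule_format],
 rule ap[unfolded approximating_def, THEN conjunct2, THEN conjunct2, THEN conjunct1])
 have wg4: "(%j. (LI x. indicator K x * xe x * norm (g j x - G x))) ----> 0"
 if "xe : BM" "!!x. 0 <= xe x"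
 "ILI x. indicator K x * xe x powr (p / (p - 1))" for xe
 by (rule ap[unfolded approximating_def, THEN conjunct2, THEN conjunct2, THEN conjunct2, rule_format, OF that])
 have cw: "continuous_on UNIV (w j)" for j
 using wg(1) unfolding gderiv_def by (intro continuous_at_imp_continuous_on ballI has_derivative_continuous) blast
 have [measurable]: "w j : BM" "g j : BM" for j
 using cw wg(2) by (auto intro: borel_measurable_continuous_onI)
 define vp where "vp j x = cs x * H (a x - w j x)" for j x
 define vp' where "vp' j x = test_grad cs cs' H H' a a' x (w j x) (g j x)" for j x
 define T where "T x = test_grad cs cs' H H' a a' x (u x) (G x)" for x
 have [measurable]: "T : BM" "vp' j : BM" "vp j : BM" for j
 unfolding T_def[abs_def] vp'_def[abs_def] vp_def[abs_def] test_grad_def by measurable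
 have contH: "(%j. H (a x - w j x)) ----> H (a x - u x)" "(%j. H' (a x - w j x)) ----> H' (a x - u x)"
 if "(%j. w j x) ----> u x" for x
 proof -
 have "(%j. a x - w j x) ----> a x - u x" by (intro tendsto_intros that)
 from continuous_on_tendsto_compose[OF cH this] continuous_on_tendsto_compose[OF H(2) this]
 show "(%j. H (a x - w j x)) ----> H (a x - u x)" "(%j. H' (a x - w j x)) ----> H' (a x - u x)"
 by simp_all
 qed
 have hh: "ILI x. h x * (cs x * H (a x - u x))"
 "(%j. (LI x. h x * vp j x)) ----> (LI x. h x * (cs x * H (a x - u x)))"
 if h: "loc_integrable D h" for h
 proof -
 have [measurable]: "h : BM" using h by (simp add: loc_integrable_def)
 have ih: "ILI x. C * B * norm (indicator K x * h x)"
 using h K KD by (intro integrable_mult_right integrable_norm) (simp add: loc_integrable_def)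
 have bd: "norm (h x * (cs x * H t)) <= C * B * norm (indicator K x * h x)" for x t
 proof (cases "x : K")
 case True
 have "\<bar>cs x\<bar> * \<bar>H t\<bar> <= C * B" using B C by (intro mult_mono) auto
 then show ?thesis using True by (simp add: abs_mult mult.commute mult_left_mono)
 qed (simp add: z)
 show "ILI x. h x * (cs x * H (a x - u x))"
 by (rule integrable_dominated[OF ih _ bd]) measurable
 show "(%j. (LI x. h x * vp j x)) ----> (LI x. h x * (cs x * H (a x - u x)))"
 proof (rule integral_dominated_convergence[OF _ _ ih])
 show "AEL x. (%j. h x * vp j x) ----> h x * (cs x * H (a x - u x))"
 using wg(3)
 proof eventually_elim
 case (elim x)
 show ?case
 proof (cases "x : K")
 case True
 then show ?thesis unfolding vp_def using elim by (intro tendsto_intros contH) auto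
 qed (simp add: vp_def z)
 qed
 show "AEL x. norm (h x * vp j x) <= C * B * norm (indicator K x * h x)" for j
 unfolding vp_def using bd by (intro AE_I2)
 qed measurable
 qed
 have xx: "ILI x. xe x * norm (vp' j x - T x)" "ILI x. xe x * norm (T x)"
 "(%j. (LI x. xe x * norm (vp' j x - T x))) ----> 0"
 if xi [measurable]: "xe : BM" and xi0: "!!x. 0 <= xe x"
 and xii: "ILI x. indicator K x * xe x powr (p / (p - 1))" for xe j
 proof -
 have i1: "ILI x. indicator K x * xe x"
 proof -
 have "ILI x. indicator K x * norm (xe x) powr (p / (p - 1))" using xii xi0 by simp
 from integrable_restrict_compact[OF K xi _ this] show ?thesis using p by simp
 qed
 have i2: "ILI x. indicator K x * xe x * norm (G x)"
 proof -
 have e: "(indicator K x * xe x) powr (p / (p - 1)) = indicator K x * xe x powr (p / (p - 1))"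
 "(indicator K x * norm (G x)) powr p = indicator K x * norm (G x) powr p" for x
 by (auto split: split_indicator)
 have "ILI x. (indicator K x * xe x) * (indicator K x * norm (G x))"
 by (rule integrable_mult_Young[OF _ _ _ _ p]) (use xi0 xii G_integrable[OF K KD] in "auto simp: e")
 moreover have "(indicator K x * xe x) * (indicator K x * norm (G x)) = indicator K x * xe x * norm (G x)" for x
 by (auto split: split_indicator)
 ultimately show ?thesis by simp
 qed
 have ig: "ILI x. indicator K x * xe x * norm (g j x)" for j
 proof -
 have "compact (g j ` K)" using wg(2) K by (intro compact_continuous_image) (auto intro: continuous_on_subset)
 then obtain M where M: "M > 0" "!!x. x : K ==> norm (g j x) <= M"
 using bounded_pos compact_imp_bounded by (metis imageI)
 show ?thesis
 proof (rule bint_bound)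
 show "ILI x. M * (indicator K x * xe x)" using i1 by simp
 show "AEL x. norm (indicator K x * xe x * norm (g j x)) <= norm (M * (indicator K x * xe x))"
 proof (intro AE_I2)
 fix x show "norm (indicator K x * xe x * norm (g j x)) <= norm (M * (indicator K x * xe x))"
 using mult_left_mono[OF M(2) xi0, of x x] M(1) xi0[of x] by (cases "x : K") (auto simp: abs_mult mult.commute)
 qed
 qed measurable
 qed
 have igG: "ILI x. indicator K x * xe x * norm (g j x - G x)" for j
 proof (rule bint_bound[OF bint_add[OF ig[of j] i2]])
 show "AEL x. norm (indicator K x * xe x * norm (g j x - G x)) <=
 norm (indicator K x * xe x * norm (g j x) + indicator K x * xe x * norm (G x))"
 proof (intro AE_I2)
 fix x
 have "indicator K x * xe x * norm (g j x - G x) <= indicator K x * xe x * (norm (g j x) + norm (G x))"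
 using xi0 by (intro mult_left_mono norm_triangle_ineq4) auto
 then show "norm (indicator K x * xe x * norm (g j x - G x)) <=
 norm (indicator K x * xe x * norm (g j x) + indicator K x * xe x * norm (G x))"
 using xi0 by (simp add: abs_mult distrib_left)
 qed
 qed measurable
 \<comment> \<open>The part of the error in which only the values \<open>w j x\<close> and
   \<open>u x\<close> differ. It tends to 0 almost everywhere because \<open>H\<close> and
   \<open>H'\<close> are continuous, with a majorant coming from their boundedness.\<close>
 define P where "P j x = \<bar>H (a x - w j x) - H (a x - u x)\<bar> * C + C * \<bar>H' (a x - w j x) - H' (a x - u x)\<bar> * (A + norm (G x))" for j x
 have [measurable]: "P j : BM" for j unfolding P_def[abs_def] by measurable
 define Q where "Q x = 2 * B * C * (indicator K x * xe x) + C * (2 * B) * (A * (indicator K x * xe x) + indicator K x * xe x * norm (G x))" for x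
 have iQ: "integrable lborel Q" unfolding Q_def[abs_def] using i1 i2 by (intro bint_add integrable_mult_right)
 have H2: "\<bar>H s - H t\<bar> <= 2 * B" "\<bar>H' s - H' t\<bar> <= 2 * B" for s t
 using B(1)[of s] B(1)[of t] B(2)[of s] B(2)[of t] by auto
 have P0: "0 <= P j x" for j x unfolding P_def using C(1) A(1) by (intro add_nonneg_nonneg mult_nonneg_nonneg) auto
 have PQ: "indicator K x * xe x * P j x <= Q x" for j x
 proof -
 have "P j x <= 2 * B * C + C * (2 * B) * (A + norm (G x))"
 unfolding P_def using H2 C(1) A(1) by (intro add_mono mult_right_mono mult_left_mono) auto
 then have "indicator K x * xe x * P j x <= indicator K x * xe x * (2 * B * C + C * (2 * B) * (A + norm (G x)))"
 using xi0 by (intro mult_left_mono) auto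
 then show ?thesis by (simp add: Q_def algebra_simps)
 qed
 have iP: "ILI x. indicator K x * xe x * P j x" for j
 proof (rule integrable_dominated[OF iQ])
 show "norm (indicator K x * xe x * P j x) <= Q x" for x
 using PQ[of x j] P0[of j x] xi0[of x] by (simp add: abs_mult)
 qed measurable
 have limP: "(%j. (LI x. indicator K x * xe x * P j x)) ----> (\<integral>x. 0 \<partial>(lborel :: 'a measure))"
 proof (rule integral_dominated_convergence[OF _ _ iQ])
 show "AEL x. (%j. indicator K x * xe x * P j x) ----> 0"
 using wg(3)
 proof eventually_elim
 case (elim x)
 show ?case
 proof (cases "x : K")
 case True
 have "(%j. indicator K x * xe x * P j x) ----> indicator K x * xe x * (\<bar>H (a x - u x) - H (a x - u x)\<bar> * C + C * \<bar>H' (a x - u x) - H' (a x - u x)\<bar> * (A + norm (G x)))"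
 unfolding P_def using elim True by (intro tendsto_intros contH) auto
 then show ?thesis by simp
 qed simp
 qed
 show "AEL x. norm (indicator K x * xe x * P j x) <= Q x" for j
 using PQ P0 xi0 by (intro AE_I2) (simp add: abs_mult)
 qed measurable
 \<comment> \<open>The remaining error is linear in \<open>g j x - G x\<close>, so its weighted
   integral vanishes by the choice of the smooth approximation.\<close>
 have diff: "norm (vp' j x - T x) <= indicator K x * (P j x + C * B * norm (g j x - G x))" for j x
 proof (cases "x : K")
 case True
 have e: "vp' j x - T x = (H (a x - w j x) - H (a x - u x)) *R cs' x
 + (cs x * (H' (a x - w j x) - H' (a x - u x))) *R (a' x - G x) - (cs x * H' (a x - w j x)) *R (g j x - G x)"
 unfolding vp'_def T_def test_grad_def by (simp add: algebra_simps)
 have "norm (vp' j x - T x) <= norm ((H (a x - w j x) - H (a x - u x)) *R cs' x)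
 + norm ((cs x * (H' (a x - w j x) - H' (a x - u x))) *R (a' x - G x)) + norm ((cs x * H' (a x - w j x)) *R (g j x - G x))"
 unfolding e by (rule order_trans[OF norm_triangle_ineq4 add_right_mono[OF norm_triangle_ineq]])
 also have "... <= \<bar>H (a x - w j x) - H (a x - u x)\<bar> * C + C * \<bar>H' (a x - w j x) - H' (a x - u x)\<bar> * (A + norm (G x)) + C * B * norm (g j x - G x)"
 proof (intro add_mono)
 show "norm ((H (a x - w j x) - H (a x - u x)) *R cs' x) <= \<bar>H (a x - w j x) - H (a x - u x)\<bar> * C"
 by (simp add: C mult_left_mono)
 have "norm (a' x - G x) <= A + norm (G x)" using norm_triangle_ineq4[of "a' x" "G x"] A(2)[OF True] by linarith
 then show "norm ((cs x * (H' (a x - w j x) - H' (a x - u x))) *R (a' x - G x)) <= C * \<bar>H' (a x - w j x) - H' (a x - u x)\<bar> * (A + norm (G x))"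
 unfolding norm_scaleR abs_mult using C by (intro mult_mono) auto
 show "norm ((cs x * H' (a x - w j x)) *R (g j x - G x)) <= C * B * norm (g j x - G x)"
 unfolding norm_scaleR abs_mult using C B B0 by (intro mult_mono) auto
 qed
 finally show ?thesis using True by (simp add: P_def)
 next
 case False
 then show ?thesis by (simp add: vp'_def T_def test_grad_def z z')
 qed
 have le: "xe x * norm (vp' j x - T x) <= indicator K x * xe x * P j x + C * B * (indicator K x * xe x * norm (g j x - G x))" for j x
 using mult_left_mono[OF diff[of j x] xi0[of x]] by (simp add: algebra_simps)
 have iR: "ILI x. indicator K x * xe x * P j x + C * B * (indicator K x * xe x * norm (g j x - G x))" for j
 using iP igG by (intro bint_add integrable_mult_right)
 show id: "ILI x. xe x * norm (vp' j x - T x)" for j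
 proof (rule integrable_dominated[OF iR[of j]])
 show "norm (xe x * norm (vp' j x - T x)) <= indicator K x * xe x * P j x + C * B * (indicator K x * xe x * norm (g j x - G x))" for x
 using le[of x j] xi0[of x] by (simp add: abs_mult)
 qed measurable
 have leT: "xe x * norm (T x) <= B * C * (indicator K x * xe x) + C * B * (A * (indicator K x * xe x) + indicator K x * xe x * norm (G x))" for x
 proof (cases "x : K")
 case True
 have "norm (T x) <= norm (H (a x - u x) *R cs' x) + norm ((cs x * H' (a x - u x)) *R (a' x - G x))"
 unfolding T_def test_grad_def by (rule norm_triangle_ineq)
 also have "... <= B * C + C * B * (A + norm (G x))"
 proof (rule add_mono)
 show "norm (H (a x - u x) *R cs' x) <= B * C"
 unfolding norm_scaleR using B C B0 by (intro mult_mono) auto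
 have "norm (a' x - G x) <= A + norm (G x)" using norm_triangle_ineq4[of "a' x" "G x"] A(2)[OF True] by linarith
 then show "norm ((cs x * H' (a x - u x)) *R (a' x - G x)) <= C * B * (A + norm (G x))"
 unfolding norm_scaleR abs_mult using C B B0 by (intro mult_mono) auto
 qed
 finally have "xe x * norm (T x) <= xe x * (B * C + C * B * (A + norm (G x)))" using xi0 by (intro mult_left_mono)
 then show ?thesis using True by (simp add: algebra_simps)
 next
 case False
 then show ?thesis by (simp add: T_def test_grad_def z z')
 qed
 show "ILI x. xe x * norm (T x)"
 proof (rule integrable_dominated)
 show "ILI x. B * C * (indicator K x * xe x) + C * B * (A * (indicator K x * xe x) + indicator K x * xe x * norm (G x))"
 using i1 i2 by (intro bint_add integrable_mult_right)
 show "norm (xe x * norm (T x)) <= B * C * (indicator K x * xe x) + C * B * (A * (indicator K x * xe x) + indicator K x * xe x * norm (G x))" for x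
 using leT[of x] xi0[of x] by (simp add: abs_mult)
 qed measurable
 show "(%j. (LI x. xe x * norm (vp' j x - T x))) ----> 0"
 proof (rule tendsto_sandwich[OF _ _ tendsto_const])
 show "\<forall>\<^sub>F j in sequentially. 0 <= (LI x. xe x * norm (vp' j x - T x))"
 using xi0 by (intro always_eventually allI bint_nonneg) auto
 show "\<forall>\<^sub>F j in sequentially. (LI x. xe x * norm (vp' j x - T x))
 <= (LI x. indicator K x * xe x * P j x) + C * B * (LI x. indicator K x * xe x * norm (g j x - G x))"
 proof (intro always_eventually allI)
 fix j
 have "(LI x. xe x * norm (vp' j x - T x)) <= (LI x. indicator K x * xe x * P j x + C * B * (indicator K x * xe x * norm (g j x - G x)))"
 by (rule integral_mono[OF id iR le])
 also have "... = (LI x. indicator K x * xe x * P j x) + C * B * (LI x. indicator K x * xe x * norm (g j x - G x))"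
 using bint_plus[OF iP[of j] integrable_mult_right[OF igG[of j], of "C * B"]] by (simp only: integral_mult_right_zero)
 finally show "(LI x. xe x * norm (vp' j x - T x)) <= (LI x. indicator K x * xe x * P j x) + C * B * (LI x. indicator K x * xe x * norm (g j x - G x))" .
 qed
 have "(%j. (LI x. indicator K x * xe x * P j x) + C * B * (LI x. indicator K x * xe x * norm (g j x - G x)))
 ----> (\<integral>x. 0 \<partial>(lborel :: 'a measure)) + C * B * 0"
 by (intro tendsto_intros limP wg4 xi xi0 xii)
 then show "(%j. (LI x. indicator K x * xe x * P j x) + C * B * (LI x. indicator K x * xe x * norm (g j x - G x))) ----> 0"
 by simp
 qed
 qed
 have "C1_supp K (vp j) (vp' j)" for j
 unfolding vp_def[abs_def] vp'_def[abs_def] by (rule C1_supp_compose[OF chi W(1,2) a H wg(1,2)])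
 moreover have "EX t. vp j x = cs x * H t" for j x unfolding vp_def by blast
 moreover have T: "test_field cs cs' H H' a a' = T" by (simp add: fun_eq_iff T_def test_field_def)
 ultimately have "approximates K cs H a vp vp' (test_field cs cs' H H' a a')"
 unfolding approximates_def T by (intro conjI allI impI hh xx) blast+
 then show "EX vp vp'. approximates K cs H a vp vp' (test_field cs cs' H H' a a')" by blast
 show "test_field cs cs' H H' a a' : BM" unfolding T by measurable
 show "test_field cs cs' H H' a a' x = 0" if "x ~: K"
 using that by (simp add: test_field_def test_grad_def z z')
qed

end

text \<open>The translation by \<open>z\<close> is cut into \<open>N\<close> equal steps, each with
  the same L^1 error by translation invariance. For large \<open>N\<close> each step is governed by
  the uniform linearisation, and no integration along segments occurs.\<close>

lemma C1_supp_translation_bound: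
 fixes vp :: "'a::euclidean_space => real"
 assumes f: "C1_supp K vp vp'"
 shows "(LI x. \<bar>vp (x + z) - vp x\<bar>) <= norm z * (LI x. norm (vp' x))"
proof -
 have K: "compact K" and G: "!!x. GDERIV vp x :> vp' x" and c': "continuous_on UNIV vp'" and 0: "!!x. x ~: K ==> vp x = 0"
 using f by (auto simp: C1_supp_def)
 note c = C1_supp_continuous[OF f] and z0 = C1_supp_grad_0[OF f]
 have i: "integrable lborel vp" by (rule integrable_continuous_supp[OF c K 0])
 have i': "ILI x. norm (vp' x)" by (rule integrable_norm[OF integrable_continuous_supp[OF c' K z0]])
 have it: "ILI x. \<bar>vp (x + z) - vp x\<bar>" for z
 using integrable_translate_diff[OF i, of z] by simp
 \<comment> \<open>The triangle inequality telescopes the \<open>N\<close> steps; translation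
   invariance makes all summands equal.\<close>
 have tele: "(LI x. \<bar>vp (x + real N *R h) - vp x\<bar>) <= real N * (LI x. \<bar>vp (x + h) - vp x\<bar>)" for N h
 proof (induction N)
 case (Suc N)
 let ?t = "real N *R h"
 have ish: "ILI x. \<bar>vp (x + ?t + h) - vp (x + ?t)\<bar>"
 using integrable_translate(1)[OF it[of h], of ?t] by simp
 have "(LI x. \<bar>vp (x + real (Suc N) *R h) - vp x\<bar>) <= (LI x. \<bar>vp (x + ?t + h) - vp (x + ?t)\<bar> + \<bar>vp (x + ?t) - vp x\<bar>)"
 by (rule integral_mono[OF it bint_add[OF ish it]]) (simp add: algebra_simps)
 also have "... = (LI x. \<bar>vp (x + ?t + h) - vp (x + ?t)\<bar>) + (LI x. \<bar>vp (x + ?t) - vp x\<bar>)"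
 by (rule bint_plus[OF ish it])
 also have "(LI x. \<bar>vp (x + ?t + h) - vp (x + ?t)\<bar>) = (LI x. \<bar>vp (x + h) - vp x\<bar>)"
 using integrable_translate(2)[of "%x. \<bar>vp (x + h) - vp x\<bar>" ?t] by simp
 finally show ?case using Suc by (simp add: algebra_simps)
 qed simp
 define L where "L = {x + y | x y. x : K & y : cball 0 (1::real)}"
 have L: "compact L" unfolding L_def using K by (intro compact_sums) auto
 have inL: "x : L" if "norm h <= 1" "x : K \<or> x + h : K" for x h
 proof -
 from that(2) show ?thesis
 proof
 assume "x : K"
 moreover have "x = x + 0" by simp
 ultimately show ?thesis unfolding L_def using mem_cball_0[of 0 1] by fastforce
 next
 assume "x + h : K"
 moreover have "x = (x + h) + (- h)" "- h : cball 0 1" using that(1) by auto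
 ultimately show ?thesis unfolding L_def by blast
 qed
 qed
 have iL: "integrable lborel (indicator L :: 'a => real)"
 using emeasure_compact_finite[OF L] L by (auto simp: integrable_indicator_iff borel_compact)
 have "(LI x. \<bar>vp (x + z) - vp x\<bar>) <= norm z * (LI x. norm (vp' x)) + ei * (norm z * (LI x. indicator L x))"
 if eps: "0 < ei" for ei
 proof -
 obtain d where d: "d > 0" "!!x h. norm h < d ==> \<bar>vp (x + h) - vp x - h <.> vp' x\<bar> <= ei * norm h"
 using C1_supp_uniform_linearization[OF f eps] by blast
 obtain N where N: "norm z / min d 1 < real N" using reals_Archimedean2 by blast
 have N0: "N > 0"
 proof (rule ccontr)
 assume "~ 0 < N"
 then have "norm z / min d 1 < 0" using N by simp
 moreover have "norm z / min d 1 \<ge> 0" using d(1) by (intro divide_nonneg_pos) auto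
 ultimately show False by linarith
 qed
 define h where "h = z /R real N"
 have hz: "real N *R h = z" using N0 by (simp add: h_def)
 have nh: "norm h = norm z / real N" using N0 by (simp add: h_def field_simps)
 have hd: "norm h < min d 1"
 proof -
 have "norm z < real N * min d 1" using N d(1) by (simp add: pos_divide_less_eq)
 moreover have "norm z / real N < m" if "norm z < real N * m" for m
 using that N0 by (simp add: pos_divide_less_eq mult.commute)
 ultimately show ?thesis unfolding nh by blast
 qed
 have pt: "\<bar>vp (x + h) - vp x\<bar> <= norm h * norm (vp' x) + ei * norm h * indicator L x" for x
 proof (cases "x : L")
 case True
 have "\<bar>h <.> vp' x\<bar> <= norm h * norm (vp' x)" by (rule Cauchy_Schwarz_ineq2)
 moreover have "\<bar>vp (x + h) - vp x - h <.> vp' x\<bar> <= ei * norm h" using d(2) hd by simp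
 ultimately show ?thesis using True by simp
 next
 case False
 then have "x ~: K" "x + h ~: K" using inL[of h x] hd by auto
 then show ?thesis using 0 False by simp
 qed
 have "(LI x. \<bar>vp (x + z) - vp x\<bar>) <= real N * (LI x. \<bar>vp (x + h) - vp x\<bar>)"
 using tele[of N h] hz by simp
 also have "... <= real N * (LI x. norm h * norm (vp' x) + ei * norm h * indicator L x)"
 proof (rule mult_left_mono[OF integral_mono[OF it _ pt]])
 show "ILI x. norm h * norm (vp' x) + ei * norm h * indicator L x"
 by (intro bint_add integrable_mult_right i' iL)
 qed simp
 also have "(LI x. norm h * norm (vp' x) + ei * norm h * indicator L x)
 = norm h * (LI x. norm (vp' x)) + ei * norm h * (LI x. indicator L x)"
 by (subst bint_plus[OF integrable_mult_right[OF i'] integrable_mult_right[OF iL]])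
 (simp only: integral_mult_right_zero)
 also have "real N * ... = norm z * (LI x. norm (vp' x)) + ei * (norm z * (LI x. indicator L x))"
 using N0 by (simp add: nh field_simps)
 finally show ?thesis .
 qed
 then have *: "(LI x. \<bar>vp (x + z) - vp x\<bar>) <= norm z * (LI x. norm (vp' x)) + ei * c"
 if "0 < ei" "c = norm z * (LI x. indicator L x)" for ei c using that by blast
 show ?thesis
 proof (rule field_le_epsilon)
 fix e :: real assume "0 < e"
 define c where "c = norm z * ((LI x. indicator L x) :: real)"
 have c0: "c \<ge> 0" unfolding c_def by (intro mult_nonneg_nonneg bint_nonneg) auto
 have "e / (c + 1) * c <= e" using c0 \<open>0 < e\<close> by (simp add: field_simps)
 moreover have "(LI x. \<bar>vp (x + z) - vp x\<bar>) <= norm z * (LI x. norm (vp' x)) + e / (c + 1) * c"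
 proof (rule *)
 show "0 < e / (c + 1)" using \<open>0 < e\<close> c0 by simp
 qed (rule c_def)
 ultimately show "(LI x. \<bar>vp (x + z) - vp x\<bar>) <= norm z * (LI x. norm (vp' x)) + e" by linarith
 qed
qed

text \<open>Averaging the translates of \<open>f\<close> over a ball whose volume is twice that of the support replaces the
 Sobolev inequality.\<close>

lemma Faber_Krahn_L1:
 fixes f :: "'a::euclidean_space => real"
 assumes f: "integrable lborel f" "!!x. 0 <= f x" "!!x. x ~: A ==> f x = 0"
 and A: "A : sets borel" and M: "!!z. (LI x. \<bar>f (x + z) - f x\<bar>) <= norm z * M" and "0 <= M"
 and s: "0 < s" "emeasure lborel A * 2 <= emeasure lborel (ball (0::'a) s)"
 shows "(LI x. f x) <= 2 * s * M"
proof -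
 have [measurable]: "f : BM" "A : sets borel" using f A borel_measurable_integrable by fastforce+
 have [measurable]: "ball (0::'a) s : sets borel" by simp
 define m where "m = measure lborel (ball (0::'a) s)"
 have fin: "emeasure lborel (ball (0::'a) s) < \<infinity>" by (rule emeasure_bounded_finite) simp
 then have em: "emeasure lborel (ball (0::'a) s) = ennreal m" unfolding m_def by (simp add: emeasure_eq_ennreal_measure)
 have m0: "m > 0"
 unfolding m_def using s(1) content_ball_pos[of s 0] by simp
 have Afin: "emeasure lborel A < \<infinity>"
 proof -
 have "emeasure lborel A <= emeasure lborel A * 2" by (simp add: mult_2_right)
 with s(2) fin show ?thesis by (meson le_less_trans)
 qed
 define a where "a = measure lborel A"
 have ea: "emeasure lborel A = ennreal a" unfolding a_def using Afin by (simp add: emeasure_eq_ennreal_measure)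
 have am: "a * 2 <= m"
 proof -
 have "ennreal (a * 2) <= ennreal m" using s(2) unfolding em ea by (simp add: ennreal_mult a_def)
 then show ?thesis using m0 by (simp add: ennreal_le_iff)
 qed
 have Atr: "emeasure lborel {z. x + z : A} = ennreal a" for x
 proof -
 have "emeasure lborel A = emeasure (distr lborel borel ((+) x)) A" by (simp add: lborel_distr_plus)
 also have "... = emeasure lborel {z. x + z : A}" by (subst emeasure_distr) (auto simp: vimage_def)
 finally show ?thesis using ea by simp
 qed
 \<comment> \<open>For every \<open>x\<close> at least half of the translates \<open>x + z\<close>
   leave \<open>A\<close>. There \<open>f\<close> vanishes, so the difference is \<open>f x\<close>
   itself; integrating over \<open>z\<close> and \<open>x\<close> compares the mass of
   \<open>f\<close> with its translation errors.\<close>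
 have low: "ennreal (m / 2) <= emeasure lborel {z : ball 0 s. x + z ~: A}" for x
 proof -
 have "ennreal m <= emeasure lborel ({z : ball 0 s. x + z ~: A} \<union> {z. x + z : A})"
 unfolding em[symmetric] by (intro emeasure_mono) auto
 also have "... <= emeasure lborel {z : ball 0 s. x + z ~: A} + emeasure lborel {z. x + z : A}"
 by (intro emeasure_subadditive) measurable
 finally have "ennreal m <= emeasure lborel {z : ball 0 s. x + z ~: A} + ennreal a" unfolding Atr .
 then have "ennreal m - ennreal a <= emeasure lborel {z : ball 0 s. x + z ~: A}"
 by (simp add: ennreal_minus_le_iff add.commute)
 moreover have "ennreal m - ennreal a = ennreal (m - a)" by (simp add: ennreal_minus a_def)
 moreover have "ennreal (m / 2) <= ennreal (m - a)" using am by (intro ennreal_leI) simp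
 ultimately show ?thesis by (metis order_trans)
 qed
 have "ennreal (m / 2) * (NLI x. ennreal (f x)) = (NLI x. ennreal (m / 2) * ennreal (f x))"
 by (rule nn_integral_cmult[symmetric]) measurable
 also have "... <= (NLI x. (NLI z. indicator (ball 0 s) z * ennreal \<bar>f (x + z) - f x\<bar>))"
 proof (rule nn_integral_mono)
 fix x
 have "ennreal (m / 2) * ennreal (f x) <= emeasure lborel {z : ball 0 s. x + z ~: A} * ennreal (f x)"
 by (intro mult_right_mono low) simp
 also have "... = (NLI z. ennreal (f x) * indicator {z : ball 0 s. x + z ~: A} z)"
 by (subst nn_integral_cmult_indicator) (auto simp: mult.commute)
 also have "... <= (NLI z. indicator (ball 0 s) z * ennreal \<bar>f (x + z) - f x\<bar>)"
 by (intro nn_integral_mono) (auto simp: f(2,3) split: split_indicator)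
 finally show "ennreal (m / 2) * ennreal (f x) <= (NLI z. indicator (ball 0 s) z * ennreal \<bar>f (x + z) - f x\<bar>)" .
 qed
 also have "... = (NLI z. (NLI x. indicator (ball 0 s) z * ennreal \<bar>f (x + z) - f x\<bar>))"
 by (rule lborel_pair.Fubini'[symmetric]) measurable
 also have "... <= (NLI z. ennreal (s * M) * indicator (ball (0::'a) s) z)"
 proof (rule nn_integral_mono)
 fix z :: 'a
 show "(NLI x. indicator (ball 0 s) z * ennreal \<bar>f (x + z) - f x\<bar>) <= ennreal (s * M) * indicator (ball 0 s) z"
 proof (cases "z : ball 0 s")
 case True
 have "(NLI x. ennreal \<bar>f (x + z) - f x\<bar>) = ennreal (LI x. \<bar>f (x + z) - f x\<bar>)"
 using integrable_translate_diff[OF f(1), of z] by (intro nn_integral_eq_integral) auto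
 also have "... <= ennreal (s * M)"
 using True \<open>0 <= M\<close> by (intro ennreal_leI order_trans[OF M] mult_right_mono) auto
 finally show ?thesis using True by simp
 qed simp
 qed
 also have "... = ennreal (s * M) * ennreal m" by (subst nn_integral_cmult_indicator) (auto simp: em)
 also have "(NLI x. ennreal (f x)) = ennreal (LI x. f x)"
 using f(1,2) by (intro nn_integral_eq_integral) auto
 also have "ennreal (m / 2) * ... = ennreal (m / 2 * (LI x. f x))"
 using m0 f(2) by (intro ennreal_mult[symmetric]) auto
 also have "ennreal (s * M) * ennreal m = ennreal (s * M * m)"
 using m0 s \<open>0 <= M\<close> by (intro ennreal_mult[symmetric]) auto
 finally have "m / 2 * (LI x. f x) <= s * M * m"
 using m0 s \<open>0 <= M\<close> by (subst (asm) ennreal_le_iff) auto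
 then have "m * (LI x. f x) <= m * (2 * s * M)" by (simp add: mult.commute mult.left_commute)
 then show ?thesis using m0 by (simp add: mult_le_cancel_left)
qed

context weak_diff
begin

text \<open>The right-hand side is a given function and not an expression in \<open>u\<close>, so it
  may be lowered independently, down to 0 or to a local constant.\<close>

definition supersolution :: "('a => real) => bool" where
 "supersolution h \<longleftrightarrow> loc_integrable D h & (ALL vp:test_functions D. (ALL x. 0 <= vp x) -->
 (LI x. h x * vp x) <= (LI x. pflux p (G x) <.> grad vp x))"

lemma integral_inner_converges:
 fixes X T :: "'a => 'a"
 assumes [measurable]: "X : BM" "T : BM"
 and gm: "!!j. g j : BM"
 and i: "!!j. (ILI x. norm (X x) * norm (g j x - T x))" "ILI x. norm (X x) * norm (T x)"
 and l: "(%j. (LI x. norm (X x) * norm (g j x - T x))) ----> 0"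
 shows "ILI x. X x <.> T x" "(%j. (LI x. X x <.> g j x)) ----> (LI x. X x <.> T x)"
proof -
 note [measurable] = gm
 show iT: "ILI x. X x <.> T x"
 proof (rule integrable_dominated[OF i(2)])
 show "norm (X x <.> T x) <= norm (X x) * norm (T x)" for x by (simp add: Cauchy_Schwarz_ineq2)
 qed measurable
 have id: "ILI x. X x <.> (g j x - T x)" for j
 proof (rule integrable_dominated[OF i(1)[of j]])
 show "norm (X x <.> (g j x - T x)) <= norm (X x) * norm (g j x - T x)" for x by (simp add: Cauchy_Schwarz_ineq2)
 qed measurable
 have ig: "ILI x. X x <.> g j x" for j
 using bint_add[OF id[of j] iT] by (simp add: inner_diff_right)
 have "(%j. (LI x. X x <.> (g j x - T x))) ----> 0"
 proof (rule tendsto_rabs_zero_cancel, rule tendsto_sandwich[OF _ _ tendsto_const l])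
 show "\<forall>\<^sub>F j in sequentially. \<bar>(LI x. X x <.> (g j x - T x))\<bar> <= (LI x. norm (X x) * norm (g j x - T x))"
 proof (intro always_eventually allI)
 fix j
 have "\<bar>(LI x. X x <.> (g j x - T x))\<bar> <= (LI x. \<bar>X x <.> (g j x - T x)\<bar>)" by (rule integral_abs_bound)
 also have "... <= (LI x. norm (X x) * norm (g j x - T x))"
 by (rule integral_mono[OF integrable_abs[OF id] i(1) Cauchy_Schwarz_ineq2])
 finally show "\<bar>(LI x. X x <.> (g j x - T x))\<bar> <= (LI x. norm (X x) * norm (g j x - T x))" .
 qed
 qed simp
 moreover have "(LI x. X x <.> (g j x - T x)) = (LI x. X x <.> g j x) - (LI x. X x <.> T x)" for j
 unfolding inner_diff_right by (rule bint_minus[OF ig iT])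
 ultimately show "(%j. (LI x. X x <.> g j x)) ----> (LI x. X x <.> T x)"
 by (simp add: LIM_zero_iff)
qed

lemma
 assumes "approximates K cs H a vp vp' T"
 shows approximates_C1_supp: "C1_supp K (vp j) (vp' j)"
 and approximates_range: "EX t. vp j x = cs x * H t"
 and approximates_integrable: "loc_integrable D h ==> (ILI x. h x * (cs x * H (a x - u x)))"
 and approximates_lim: "loc_integrable D h ==>
 (%j. (LI x. h x * vp j x)) ----> (LI x. h x * (cs x * H (a x - u x)))"
 using assms unfolding approximates_def by blast+

lemma approximates_weighted:
 assumes "approximates K cs H a vp vp' T" "xe : BM" "!!x. 0 <= xe x"
 and "ILI x. indicator K x * xe x powr (p / (p - 1))"
 shows "!!j. (ILI x. xe x * norm (vp' j x - T x))"
 "ILI x. xe x * norm (T x)"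
 "(%j. (LI x. xe x * norm (vp' j x - T x))) ----> 0"
proof -
 have "(ALL j. (ILI x. xe x * norm (vp' j x - T x))) &
 (ILI x. xe x * norm (T x)) &
 (%j. (LI x. xe x * norm (vp' j x - T x))) ----> 0"
 using assms(1)[unfolded approximates_def, THEN conjunct2, THEN conjunct2, THEN conjunct2] assms(2-4) by simp
 then show "!!j. (ILI x. xe x * norm (vp' j x - T x))"
 "ILI x. xe x * norm (T x)"
 "(%j. (LI x. xe x * norm (vp' j x - T x))) ----> 0" by simp_all
qed

lemma admissible_integral_converges:
 assumes adm: "admissible_test K cs cs' W H H' a a'" and [measurable]: "X : BM"
 and X: "ILI x. indicator K x * norm (X x) powr (p / (p - 1))"
 and ap: "approximates K cs H a vp vp' (test_field cs cs' H H' a a')"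
 shows "ILI x. X x <.> test_field cs cs' H H' a a' x"
 "(%j. (LI x. X x <.> vp' j x)) ----> (LI x. X x <.> test_field cs cs' H H' a a' x)"
proof -
 have m: "vp' j : BM" for j
 using approximates_C1_supp[OF ap, of j] by (auto simp: C1_supp_def intro: borel_measurable_continuous_onI)
 have X': "(%x. norm (X x)) : BM" by measurable
 note w = approximates_weighted[OF ap X' norm_ge_zero X]
 show "ILI x. X x <.> test_field cs cs' H H' a a' x"
 by (rule integral_inner_converges(1)[OF _ admissible_approximation(2)[OF adm] m w]) simp
 show "(%j. (LI x. X x <.> vp' j x)) ----> (LI x. X x <.> test_field cs cs' H H' a a' x)"
 by (rule integral_inner_converges(2)[OF _ admissible_approximation(2)[OF adm] m w]) simp
qed

text \<open>The approximants are nonnegative C^1 test functions supported in \<open>K\<close>, so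
  the inequality holds for each of them. Since the flux lies locally in the dual Lebesgue space,
  both sides converge.\<close>

lemma supersolution_test:
 assumes sup: "supersolution h" and adm: "admissible_test K cs cs' W H H' a a'"
 and pos: "!!x. 0 <= cs x" "!!t. 0 <= H t"
 shows "(LI x. h x * (cs x * H (a x - u x))) <= (LI x. pflux p (G x) <.> test_field cs cs' H H' a a' x)"
 "ILI x. h x * (cs x * H (a x - u x))"
 "ILI x. pflux p (G x) <.> test_field cs cs' H H' a a' x"
proof -
 obtain vp vp' where ap: "approximates K cs H a vp vp' (test_field cs cs' H H' a a')"
 using admissible_approximation(1)[OF adm] by blast
 have K: "compact K" "K <= D" using adm by (auto simp: admissible_test_def C1_supp_def)
 have h: "loc_integrable D h" using sup by (simp add: supersolution_def)
 have X: "(%x. pflux p (G x)) : BM" by measurable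
 note c = admissible_integral_converges[OF adm X G_dual_integrable[OF K] ap]
 show "ILI x. pflux p (G x) <.> test_field cs cs' H H' a a' x" by (rule c(1))
 show "ILI x. h x * (cs x * H (a x - u x))" by (rule approximates_integrable[OF ap h])
 show "(LI x. h x * (cs x * H (a x - u x))) <= (LI x. pflux p (G x) <.> test_field cs cs' H H' a a' x)"
 proof (rule LIMSEQ_le[OF approximates_lim[OF ap h] c(2)], intro exI allI impI)
 fix j
 show "(LI x. h x * vp j x) <= (LI x. pflux p (G x) <.> vp' j x)"
 proof (rule test_inequality_extend[OF open_D X pflux_loc_integrable h _ approximates_C1_supp[OF ap] K(2)])
 show "(LI x. h x * vp x) <= (LI x. pflux p (G x) <.> grad vp x)"
 if "vp : test_functions D" "!!x. 0 <= vp x" for vp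
 using sup that by (simp add: supersolution_def)
 show "0 <= vp j x" for x using approximates_range[OF ap, of j x] pos by auto
 qed
 qed
qed

text \<open>The counterpart for a classical vector field: integration by parts holds for the
  approximants and passes to the limit.\<close>

lemma field_test:
 fixes Y :: "'a => 'a"
 assumes adm: "admissible_test K cs cs' W H H' a a'"
 and Y: "!!x. x : W ==> (Y has_derivative Y' x) (at x)" and cY: "!!v. continuous_on W (%x. Y' x v)"
 shows "(LI x. Y x <.> test_field cs cs' H H' a a' x)
 = - (LI x. (SUM b:Basis. Y' x b <.> b) * (cs x * H (a x - u x)))"
 "ILI x. Y x <.> test_field cs cs' H H' a a' x"
 "ILI x. (SUM b:Basis. Y' x b <.> b) * (cs x * H (a x - u x))"
proof -
 obtain vp vp' where ap: "approximates K cs H a vp vp' (test_field cs cs' H H' a a')"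
 using admissible_approximation(1)[OF adm] by blast
 have K: "compact K" "K <= W" and W: "open W" and chi: "C1_supp K cs cs'"
 using adm by (auto simp: admissible_test_def C1_supp_def)
 have chi0: "cs x = 0" if "x ~: K" for x using chi that by (simp add: C1_supp_def)
 have cYW: "continuous_on W Y"
 using Y by (intro continuous_at_imp_continuous_on ballI has_derivative_continuous) blast
 \<comment> \<open>\<open>Y\<close> is controlled only on \<open>W\<close>. Restricted to
   \<open>K\<close> it is Borel, bounded and integrable to the dual power, and the pairing is
   unchanged because all gradients vanish off \<open>K\<close>.\<close>
 define X where "X x = indicator K x *R Y x" for x
 have X [measurable]: "X : BM"
 unfolding X_def[abs_def] using K continuous_on_subset[OF cYW K(2)]
 by (intro borel_measurable_continuous_on_indicator borel_compact) auto
 define h where "h x = indicator K x * (SUM b:Basis. Y' x b <.> b)" for x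
 have cdiv: "continuous_on K (%x. SUM b:Basis. Y' x b <.> b)"
 by (intro continuous_intros continuous_on_subset[OF cY K(2)])
 have [measurable]: "h : BM"
 using borel_measurable_continuous_on_indicator[OF borel_compact[OF K(1)] cdiv] by (simp add: h_def[abs_def])
 have h: "loc_integrable D h"
 unfolding loc_integrable_def
 proof (intro conjI allI impI)
 fix L :: "'a set" assume L: "compact L"
 have "ILI x. indicator K x *R (SUM b:Basis. Y' x b <.> b)"
 by (rule borel_integrable_compact[OF K(1) cdiv])
 then have ih: "integrable lborel h" by (simp add: h_def[abs_def])
 have [measurable]: "L : sets borel" using L by (rule borel_compact)
 show "ILI x. indicator L x * h x"
 by (rule bint_bound[OF ih]) (measurable, auto split: split_indicator)
 qed measurable
 have "compact (X ` K)"
 using K continuous_on_subset[OF cYW K(2)] unfolding X_def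
 by (intro compact_continuous_image) (auto cong: continuous_on_cong)
 then obtain B where B: "B > 0" "!!x. x : K ==> norm (X x) <= B" using bounded_pos compact_imp_bounded by (metis imageI)
 have iK: "integrable lborel (indicator K :: 'a => real)"
 using emeasure_compact_finite[OF K(1)] K by (auto simp: integrable_indicator_iff borel_compact)
 have Xq: "ILI x. indicator K x * norm (X x) powr (p / (p - 1))"
 proof (rule integrable_dominated[OF integrable_mult_right[OF iK, of "B powr (p / (p - 1))"]])
 show "norm (indicator K x * norm (X x) powr (p / (p - 1))) <= B powr (p / (p - 1)) * indicator K x" for x
 using B p by (cases "x : K") (auto intro!: powr_mono2)
 qed (use K in "auto intro!: borel_measurable_times borel_measurable_indicator borel_compact")
 note c = admissible_integral_converges[OF adm X Xq ap]
 have XY: "X x <.> test_field cs cs' H H' a a' x = Y x <.> test_field cs cs' H H' a a' x" for x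
 using admissible_approximation(3)[OF adm, of x] by (cases "x : K") (auto simp: X_def)
 have XYj: "X x <.> vp' j x = Y x <.> vp' j x" for j x
 using C1_supp_grad_0[OF approximates_C1_supp[OF ap]] by (cases "x : K") (auto simp: X_def)
 have hY: "h x * (cs x * t) = (SUM b:Basis. Y' x b <.> b) * (cs x * t)" for x t
 using chi0 by (cases "x : K") (auto simp: h_def)
 have hYj: "h x * vp j x = (SUM b:Basis. Y' x b <.> b) * vp j x" for x j
 proof -
 obtain t where "vp j x = cs x * H t" using approximates_range[OF ap, of j x] by blast
 then show ?thesis by (simp only: hY)
 qed
 show "ILI x. Y x <.> test_field cs cs' H H' a a' x" using c(1) by (simp only: XY)
 show "ILI x. (SUM b:Basis. Y' x b <.> b) * (cs x * H (a x - u x))"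
 using approximates_integrable[OF ap h] by (simp only: hY)
 have "(LI x. X x <.> vp' j x) = - (LI x. h x * vp j x)" for j
 unfolding XYj hYj by (rule integral_by_parts(1)[OF approximates_C1_supp[OF ap] W K(2) Y cY])
 then have "(%j. (LI x. X x <.> vp' j x)) ----> - (LI x. h x * (cs x * H (a x - u x)))"
 using tendsto_minus[OF approximates_lim[OF ap h]] by simp
 from LIMSEQ_unique[OF c(2) this]
 show "(LI x. Y x <.> test_field cs cs' H H' a a' x)
 = - (LI x. (SUM b:Basis. Y' x b <.> b) * (cs x * H (a x - u x)))"
 by (simp only: XY hY)
qed

text \<open>The bound of \<open>C1_supp_translation_bound\<close> survives the weak limit. It is the
  gradient information which the measure estimate for level sets consumes.\<close>

lemma translation_test:
 assumes adm: "admissible_test K cs cs' W H H' a a'"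
 defines "f \<equiv> %x. cs x * H (a x - u x)"
 shows "integrable lborel f"
 "ILI x. norm (test_field cs cs' H H' a a' x)"
 "(LI x. \<bar>f (x + z) - f x\<bar>) <= norm z * (LI x. norm (test_field cs cs' H H' a a' x))"
proof -
 obtain vp vp' where ap: "approximates K cs H a vp vp' (test_field cs cs' H H' a a')"
 using admissible_approximation(1)[OF adm] by blast
 have K: "compact K" "K <= D" and chi: "C1_supp K cs cs'" and B: "EX B. ALL t. \<bar>H t\<bar> <= B"
 using adm by (auto simp: admissible_test_def C1_supp_def)
 define T where "T = test_field cs cs' H H' a a'"
 have iK: "integrable lborel (indicator K :: 'a => real)"
 using emeasure_compact_finite[OF K(1)] K by (auto simp: integrable_indicator_iff borel_compact)
 have 1: "loc_integrable D (%x. 1)"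
 unfolding loc_integrable_def
 using emeasure_compact_finite by (auto simp: integrable_indicator_iff borel_compact)
 have i1: "ILI x. indicator K x * (1::real) powr (p / (p - 1))" using iK by simp
 note w = approximates_weighted[OF ap _ _ i1, folded T_def, simplified]
 show iT: "ILI x. norm (test_field cs cs' H H' a a' x)" using w(2) by (simp add: T_def)
 show i: "integrable lborel f" using approximates_integrable[OF ap 1] by (simp add: f_def)
 have C: "C1_supp K (vp j) (vp' j)" for j by (rule approximates_C1_supp[OF ap])
 have ij: "integrable lborel (vp j)" and ij': "ILI x. norm (vp' j x)" for j
 proof -
 show "integrable lborel (vp j)"
 by (rule integrable_continuous_supp[OF C1_supp_continuous[OF C] K(1)]) (use C[of j] in "simp add: C1_supp_def")
 show "ILI x. norm (vp' j x)"
 by (rule integrable_norm[OF integrable_continuous_supp[OF _ K(1) C1_supp_grad_0[OF C]]])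
 (use C[of j] in "simp add: C1_supp_def")
 qed
 text \<open>Signed weights \<open>sgn (f (x + z) - f x)\<close> turn the weak convergence of \<open>vp j\<close> into the estimate.\<close>
 have [measurable]: "f : BM" using i borel_measurable_integrable by fastforce
 define si where "si x = sgn (f (x + z) - f x)" for x
 have [measurable]: "si : BM" unfolding si_def[abs_def] by measurable
 have s1: "\<bar>si x\<bar> <= 1" for x unfolding si_def by (simp add: sgn_if)
 have ls: "loc_integrable D (%x. si (x + y))" for y
 unfolding loc_integrable_def
 proof (intro conjI allI impI)
 fix L :: "'a set" assume L: "compact L"
 have "integrable lborel (indicator L :: 'a => real)"
 using emeasure_compact_finite[OF L] L by (auto simp: integrable_indicator_iff borel_compact)
 moreover have [measurable]: "L : sets borel" using L by (rule borel_compact)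
 ultimately show "ILI x. indicator L x * si (x + y)"
 by (rule_tac bint_bound) (measurable, use s1 in "auto split: split_indicator")
 qed measurable
 have shift: "(LI x. si x * F (x + z)) = (LI x. si (x - z) * F x)" for F :: "'a => real"
 using integrable_translate(2)[of "%x. si (x - z) * F x" z] by simp
 have isF: "ILI x. si (x + y) * F x" if "integrable lborel F" for F y
 by (rule bint_bound[OF that])
 (use that borel_measurable_integrable[OF that] s1 in "auto simp: abs_mult mult_left_le_one_le")
 have dif: "(LI x. si x * (F (x + z) - F x)) = (LI x. si (x - z) * F x) - (LI x. si x * F x)"
 and idif: "ILI x. si x * (F (x + z) - F x)"
 if F: "integrable lborel F" for F
 proof -
 have a: "ILI x. si x * F (x + z)" using isF[OF integrable_translate(1)[OF F, of z], of 0] by simp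
 have b: "ILI x. si x * F x" using isF[OF F, of 0] by simp
 show "ILI x. si x * (F (x + z) - F x)" unfolding right_diff_distrib by (rule bint_diff[OF a b])
 show "(LI x. si x * (F (x + z) - F x)) = (LI x. si (x - z) * F x) - (LI x. si x * F x)"
 unfolding right_diff_distrib by (subst bint_minus[OF a b]) (simp only: shift)
 qed
 have "(%j. (LI x. si (x + (- z)) * vp j x) - (LI x. si (x + 0) * vp j x)) ---->
 (LI x. si (x + (- z)) * f x) - (LI x. si (x + 0) * f x)"
 unfolding f_def by (intro tendsto_diff approximates_lim[OF ap ls])
 then have L: "(%j. (LI x. si x * (vp j (x + z) - vp j x))) ----> (LI x. si x * (f (x + z) - f x))"
 using dif[OF ij] dif[OF i] by simp
 have R: "(%j. norm z * ((LI x. norm (vp' j x - T x)) + (LI x. norm (T x)))) ----> norm z * (0 + (LI x. norm (T x)))"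
 by (intro tendsto_intros w(3))
 have "(LI x. si x * (f (x + z) - f x)) <= norm z * (0 + (LI x. norm (T x)))"
 proof (rule LIMSEQ_le[OF L R], intro exI allI impI)
 fix j
 have "(LI x. si x * (vp j (x + z) - vp j x)) <= (LI x. \<bar>vp j (x + z) - vp j x\<bar>)"
 proof (rule integral_mono[OF idif[OF ij]])
 show "ILI x. \<bar>vp j (x + z) - vp j x\<bar>" using integrable_translate_diff[OF ij[of j], of z] by simp
 show "si x * (vp j (x + z) - vp j x) <= \<bar>vp j (x + z) - vp j x\<bar>" for x
 using abs_ge_self[of "si x * (vp j (x + z) - vp j x)"] mult_right_mono[OF s1[of x], of "\<bar>vp j (x + z) - vp j x\<bar>"]
 by (simp add: abs_mult)
 qed
 also have "... <= norm z * (LI x. norm (vp' j x))" by (rule C1_supp_translation_bound[OF C])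
 also have "(LI x. norm (vp' j x)) <= (LI x. norm (vp' j x - T x) + norm (T x))"
 proof (rule integral_mono[OF ij' bint_add[OF w(1) w(2)]])
 show "norm (vp' j x) <= norm (vp' j x - T x) + norm (T x)" for x
 using norm_triangle_ineq[of "vp' j x - T x" "T x"] by simp
 qed
 also have "... = (LI x. norm (vp' j x - T x)) + (LI x. norm (T x))"
 by (rule bint_plus[OF w(1) w(2)])
 finally show "(LI x. si x * (vp j (x + z) - vp j x)) <= norm z * ((LI x. norm (vp' j x - T x)) + (LI x. norm (T x)))"
 by (simp add: mult_left_mono)
 qed
 then show "(LI x. \<bar>f (x + z) - f x\<bar>) <= norm z * (LI x. norm (test_field cs cs' H H' a a' x))"
 by (simp add: si_def T_def linordered_idom_class.abs_sgn mult.commute)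
qed

end

subsection \<open>Comparison with classical strict subsolutions\<close>

text \<open>A bounded C^1 substitute for the squared positive part. On [0, 1] it is comparable to
  t^2 and its derivative to t; both stay bounded, as \<open>admissible_test\<close> demands.\<close>

definition hinge :: "real => real" where "hinge t = (if 0 < t then t^2 / (1 + t^2) else 0)"
definition hinge' :: "real => real" where "hinge' t = (if 0 < t then 2 * t / (1 + t^2)^2 else 0)"

lemma one_plus_square_pos: "0 < 1 + (t::real)^2"
 using zero_le_power2[of t] by linarith

lemma hinge_nonneg: "0 <= hinge t" and hinge'_nonneg: "0 <= hinge' t" and hinge_pos: "0 < t ==> 0 < hinge t"
 and hinge_nonpos: "t <= 0 ==> hinge t = 0" and hinge'_nonpos: "t <= 0 ==> hinge' t = 0"
 by (auto simp: hinge_def hinge'_def one_plus_square_pos)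

lemma hinge_le: "0 <= t ==> hinge t <= t^2" and hinge_ge: "0 <= t ==> t <= 1 ==> t^2 / 2 <= hinge t"
 and hinge'_le: "0 <= t ==> hinge' t <= 2 * t" and hinge'_ge: "0 <= t ==> t <= 1 ==> t / 2 <= hinge' t"
proof -
 assume t: "0 <= t"
 have t1: "1 <= 1 + t^2" by simp
 then have t2: "1 <= (1 + t^2)^2" by (metis one_le_power)
 have "t^2 / (1 + t^2) <= t^2 / 1" using t1 by (intro divide_left_mono) (auto simp: one_plus_square_pos)
 then show "hinge t <= t^2" by (simp add: hinge_def)
 have "2 * t / (1 + t^2)^2 <= 2 * t / 1"
 using t t2 one_plus_square_pos[of t] by (intro divide_left_mono) auto
 then show "hinge' t <= 2 * t" using t by (simp add: hinge'_def)
 assume t3: "t <= 1"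
 then have sq: "t^2 <= 1" using t by (simp add: power_le_one)
 have "t^2 / 2 <= t^2 / (1 + t^2)"
 proof (rule divide_left_mono)
 show "0 < 2 * (1 + t^2)" using one_plus_square_pos[of t] by (intro mult_pos_pos) auto
 qed (use sq in auto)
 then show "t^2 / 2 <= hinge t" using t by (simp add: hinge_def)
 have "(1 + t^2)^2 <= 2^2" using sq by (intro power_mono) auto
 then have "2 * t / 2^2 <= 2 * t / (1 + t^2)^2" using t t2 one_plus_square_pos[of t] by (intro divide_left_mono) auto
 then show "t / 2 <= hinge' t" using t by (simp add: hinge'_def)
qed

lemma hinge_bounds: "\<bar>hinge t\<bar> <= 2" "\<bar>hinge' t\<bar> <= 2"
proof -
 have "t^2 / (1 + t^2) <= 1" by (simp add: one_plus_square_pos)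
 then show "\<bar>hinge t\<bar> <= 2" by (simp add: hinge_def)
 have "2 * t <= 2 * (1 + t^2)^2"
 proof -
 have "0 <= t^2 + 1 - 2 * t" using zero_le_power2[of "t - 1"] by (simp add: power2_diff)
 then have "t <= 1 + t^2" using zero_le_power2[of t] by linarith
 also have "1 + t^2 <= (1 + t^2)^2" using power_increasing[of 1 2 "1 + t^2"] by simp
 finally show ?thesis by simp
 qed
 then have "2 * t / (1 + t^2)^2 <= 2" using one_plus_square_pos[of t] by (simp add: pos_divide_le_eq)
 then show "\<bar>hinge' t\<bar> <= 2" by (simp add: hinge'_def)
qed

lemma hinge_DERIV: "(hinge has_real_derivative hinge' t) (at t)"
proof (cases t "0 :: real" rule: linorder_cases)
 case greater
 have "((%t. t^2 / (1 + t^2)) has_real_derivative hinge' t) (at t)"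
 using greater one_plus_square_pos[of t] unfolding hinge'_def
 by (auto intro!: derivative_eq_intros simp: power2_eq_square field_simps)
 moreover have "eventually (%s. hinge s = s^2 / (1 + s^2)) (nhds t)"
 using eventually_nhds_in_open[of "{0<..}" t] greater
 by (auto elim!: eventually_mono simp: hinge_def)
 ultimately show ?thesis
 using DERIV_cong_ev[of t t hinge "%t. t^2 / (1 + t^2)"] by auto
next
 case less
 have "eventually (%s. hinge s = 0) (nhds t)"
 using eventually_nhds_in_open[of "{..<0}" t] less
 by (auto elim!: eventually_mono simp: hinge_def)
 then show ?thesis
 using DERIV_cong_ev[of t t hinge "%_. 0"] less by (simp add: hinge'_def)
next
 case equal
 have "((%h. hinge h / h) ---> 0) (at 0)"
 proof (rule tendsto_rabs_zero_cancel, rule tendsto_sandwich[of "%_. 0" _ _ "%h. \<bar>h\<bar>"])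
 show "\<forall>\<^sub>F h in at 0. \<bar>hinge h / h\<bar> <= \<bar>h\<bar>"
 proof (intro always_eventually allI)
 fix h :: real
 have "h^2 / (1 + h^2) / h <= h" if "h > 0"
 proof -
 have "h^2 / (1 + h^2) / h = h / (1 + h^2)" using that by (simp add: power2_eq_square)
 also have "... <= h / 1" using that one_plus_square_pos[of h] by (intro divide_left_mono) auto
 finally show ?thesis by simp
 qed
 then show "\<bar>hinge h / h\<bar> <= \<bar>h\<bar>" by (auto simp: hinge_def)
 qed
 show "((%h::real. \<bar>h\<bar>) ---> 0) (at 0)" by (rule tendsto_rabs_zero) simp
 qed auto
 then show ?thesis using equal by (simp add: DERIV_def hinge_def hinge'_def)
qed

lemma hinge'_continuous: "continuous_on UNIV hinge'"
proof -
 have "hinge' = (%t. 2 * max t 0 / (1 + t^2)^2)" by (auto simp: hinge'_def max_def fun_eq_iff)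
 moreover have "continuous_on UNIV (%t::real. 2 * max t 0 / (1 + t^2)^2)"
 using one_plus_square_pos by (intro continuous_intros) (auto simp: add_nonneg_eq_0_iff)
 ultimately show ?thesis by (simp only:)
qed

text \<open>The indicator of the d/2-neighbourhood of \<open>K\<close> is mollified at scale d/4.
  The result equals 1 on a neighbourhood of \<open>K\<close>, which is why its gradient vanishes on
  \<open>K\<close>.\<close>

lemma C1_cutoff:
 fixes K :: "'a::euclidean_space set"
 assumes K: "compact K" "K <= W" "open W"
 shows "EX K1 cs cs'. C1_supp K1 cs cs' & K1 <= W & (ALL x. 0 <= cs x) & (ALL x:K. cs x = 1 & cs' x = 0)"
proof -
 obtain d where d: "0 < d" "(UN x:K. cball x d) <= W"
 using compact_subset_open_imp_cball_epsilon_subset[OF K(1,3,2)] by blast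
 define K2 where "K2 = {x + y | x y. x : K & y : cball 0 (d / 2)}"
 have K2: "compact K2" unfolding K2_def using K by (intro compact_sums) auto
 have inK2: "y : K2" if "x : K" "norm (y - x) <= d / 2" for x y
 proof -
 have "y = x + (y - x)" "y - x : cball 0 (d / 2)" using that by auto
 then show ?thesis unfolding K2_def using that(1) by blast
 qed
 define K1 where "K1 = {x + y | x y. x : K & y : cball 0 d}"
 have K1: "compact K1" unfolding K1_def using K by (intro compact_sums) auto
 have K1W: "K1 <= W"
 proof
 fix z assume "z : K1"
 then obtain x y where "x : K" "norm y <= d" "z = x + y" unfolding K1_def by auto
 then have "z : (UN x:K. cball x d)" by (auto simp: dist_norm intro!: bexI[of _ x])
 then show "z : W" using d(2) by blast
 qed
 define f where "f = (indicator K2 :: 'a => real)"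
 have f: "integrable lborel f"
 unfolding f_def using emeasure_compact_finite[OF K2] K2 by (auto simp: integrable_indicator_iff borel_compact)
 define e where "e = d / 4"
 have e: "0 < e" using d by (simp add: e_def)
 define cs where "cs = mollify e f"
 have cs: "cs = (%x. (LI y. f y * mollifier e (x + (-1) *R y)))"
 proof
 fix x
 have "(LI y. f y * mollifier e (x + (-1) *R y)) = (LI y. mollifier e (x - y) *R f y)"
 by (intro bint_cong) (simp_all add: mult.commute)
 then show "cs x = (LI y. f y * mollifier e (x + (-1) *R y))"
 using mollify_eq_convolution[OF e, of f x] by (simp only: cs_def)
 qed
 have sm: "smooth cs"
 unfolding cs by (rule smooth_integral_translates[OF f mollifier_smooth[OF e] compact_cball mollifier_eq_0[OF e]])
 have 0: "cs x = 0" if "x ~: K1" for x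
 unfolding cs_def
 proof (rule mollify_eq_0[OF e])
 fix z :: 'a assume z: "norm z <= e"
 have "x + z ~: K2"
 proof
 assume "x + z : K2"
 then obtain x' y where *: "x' : K" "norm y <= d / 2" "x + z = x' + y" unfolding K2_def by auto
 have "norm (y - z) <= d" using norm_triangle_ineq4[of y z] *(2) z d(1) by (simp add: e_def)
 moreover have "x = x' + (y - z)" using *(3) by (simp add: algebra_simps)
 ultimately have "x : K1" unfolding K1_def using *(1) by auto
 with that show False by blast
 qed
 then show "f (x + z) = 0" by (simp add: f_def)
 qed
 have 1: "cs y = 1" if x: "x : K" and y: "y : ball x e" for x y
 proof -
 have "mollifier e z *R f (y + z) = mollifier e z" for z
 proof (cases "z : cball 0 e")
 case True
 have "norm (y + z - x) <= norm (y - x) + norm z" using norm_triangle_ineq[of "y - x" z] by (simp add: algebra_simps)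
 also have "... <= d / 2" using True y by (simp add: e_def dist_norm norm_minus_commute)
 finally have "y + z : K2" by (intro inK2[OF x])
 then show ?thesis by (simp add: f_def)
 qed (simp add: mollifier_eq_0[OF e])
 then show ?thesis unfolding cs_def mollify_def by (simp only: integral_mollifier[OF e])
 qed
 have C: "C1_supp K1 cs (grad cs)" by (rule smooth_C1_supp[OF sm K1 0])
 have g0: "grad cs x = 0" if x: "x : K" for x
 proof (rule grad_eqI)
 have "((%_. 1::real) has_derivative (%h. 0)) (at x)" by simp
 then have "(cs has_derivative (%h. 0)) (at x)"
 by (rule has_derivative_transform_within_open[OF _ open_ball[of x e]]) (use 1[OF x] e in auto)
 then show "GDERIV cs x :> 0" by (simp add: gderiv_def)
 qed
 have "0 <= cs x" for x
 unfolding cs_def mollify_def f_def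
 by (intro bint_nonneg) (auto intro!: mult_nonneg_nonneg mollifier_nonneg[OF e])
 then show ?thesis using C K1W 1 g0 e by (intro exI[of _ K1] exI[of _ cs] exI[of _ "grad cs"]) force
qed

text \<open>\<open>plap p (\<nabla>v) (D^2v)\<close> is \<open>\<Delta>\<^sub>p v\<close>, for a linear map \<open>D^2v\<close> and \<open>\<nabla>v ~= 0\<close>.\<close>

definition plap :: "real => 'a::euclidean_space => ('a => 'a) => real" where
 "plap p g h = norm g powr (p - 2) * (SUM b:Basis. h b <.> b) + (p - 2) * norm g powr (p - 4) * (SUM b:Basis. (g <.> h b) * (g <.> b))"

definition pflux' :: "real => 'a::euclidean_space => 'a => 'a" where
 "pflux' p xe e = norm xe powr (p - 2) *R e + ((p - 2) * norm xe powr (p - 4) * (xe <.> e)) *R xe"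

lemma pflux_has_derivative:
 assumes "xe ~= 0"
 shows "(pflux p has_derivative pflux' p xe) (at xe)"
proof -
 have n: "norm xe > 0" using assms by simp
 have 1: "(norm has_derivative (%e. e <.> sgn xe)) (at xe)"
 using GDERIV_norm[OF assms] by (simp add: gderiv_def)
 have 2: "((%t. t powr (p - 2)) has_derivative (%s. ((p - 2) * norm xe powr (p - 2 - 1)) * s)) (at (norm xe))"
 using has_real_derivative_powr[OF n, of "p - 2"] unfolding has_field_derivative_def by simp
 have 3: "((%xe. norm xe powr (p - 2)) has_derivative (%e. (p - 2) * norm xe powr (p - 2 - 1) * (e <.> sgn xe))) (at xe)"
 by (rule has_derivative_compose[OF 1 2])
 have 4: "((%xe. norm xe powr (p - 2) *R xe) has_derivative
 (%e. norm xe powr (p - 2) *R e + ((p - 2) * norm xe powr (p - 2 - 1) * (e <.> sgn xe)) *R xe)) (at xe)"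
 by (rule has_derivative_scaleR[OF 3 has_derivative_ident])
 have "norm xe powr (p - 2 - 1) * (e <.> sgn xe) = norm xe powr (p - 4) * (xe <.> e)" for e
 proof -
 have "norm xe powr (p - 2 - 1) = norm xe powr (p - 4 + 1)" by simp
 also have "... = norm xe powr (p - 4) * norm xe powr 1" by (rule powr_add)
 finally have "norm xe powr (p - 2 - 1) = norm xe powr (p - 4) * norm xe" using n by simp
 then show ?thesis using n by (simp only:) (simp add: sgn_div_norm inner_commute)
 qed
 then have "(%e. norm xe powr (p - 2) *R e + ((p - 2) * norm xe powr (p - 2 - 1) * (e <.> sgn xe)) *R xe) = pflux' p xe"
 unfolding pflux'_def by (auto simp: mult.assoc)
 with 4 show ?thesis by (simp add: pflux_def[abs_def])
qed

lemma plap_eq_divergence: "(SUM b:Basis. pflux' p g (h b) <.> b) = plap p g h"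
 unfolding pflux'_def plap_def
 by (simp add: inner_add_left sum.distrib sum_distrib_left mult.assoc)

lemma pflux'_tendsto:
 assumes "(g ---> g0) F" "g0 ~= 0" "(e ---> e0) F"
 shows "((%x. pflux' p (g x) (e x)) ---> pflux' p g0 e0) F"
 unfolding pflux'_def using assms by (intro tendsto_intros) auto

lemma plap_tendsto:
 assumes "(g ---> g0) F" "g0 ~= 0" "!!b. b : Basis ==> ((%x. h x b) ---> h0 b) F"
 shows "((%x. plap p (g x) (h x)) ---> plap p g0 h0) F"
 unfolding plap_eq_divergence[symmetric] using assms by (intro tendsto_intros pflux'_tendsto)

definition C2_data :: "'a set => ('a::euclidean_space => real) => ('a => 'a) => ('a => 'a => 'a) => bool" where
 "C2_data W v g h \<longleftrightarrow> open W & v : BM & g : BM &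
 (ALL x:W. GDERIV v x :> g x & (g has_derivative h x) (at x)) & (ALL b. continuous_on W (%x. h x b))"

context weak_diff
begin

text \<open>The supersolution inequality and the equation of \<open>v\<close> are tested with
  \<open>cs * hinge (v - u)\<close> and subtracted. Monotonicity of the flux makes the difference
  nonnegative, while the strict inequality for \<open>v\<close> makes it nonpositive, so
  \<open>hinge (v - u)\<close> vanishes on \<open>K\<close>.\<close>

lemma comparison:
 assumes sup: "supersolution h" and W: "W <= D" and v: "C2_data W v g hess" and g0: "!!x. x : W ==> g x ~= 0"
 and sub: "!!x. x : W ==> 0 < plap p (g x) (hess x) + be"
 and h: "AEL x. x : W --> be <= h x"
 and K: "compact K" "K <= W" "AEL x. x : W --> u x < v x --> x : K"
 shows "AEL x. x : W --> v x <= u x"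
proof -
 have oW: "open W" and [measurable]: "v : BM" "g : BM"
 and vG: "!!x. x : W ==> GDERIV v x :> g x" and gH: "!!x. x : W ==> (g has_derivative hess x) (at x)"
 and cH: "!!b. continuous_on W (%x. hess x b)"
 using v by (auto simp: C2_data_def)
 have cg: "continuous_on W g"
 using gH by (intro continuous_at_imp_continuous_on ballI has_derivative_continuous) blast
 obtain K1 cs cs' where psi: "C1_supp K1 cs cs'" "K1 <= W" "!!x. 0 <= cs x" "!!x. x : K ==> cs x = 1" "!!x. x : K ==> cs' x = 0"
 using C1_cutoff[OF K(1,2) oW] by blast
 have psi0: "cs x = 0" if "x ~: W" for x using psi(1,2) that by (auto simp: C1_supp_def)
 have psi0': "cs' x = 0" if "x ~: W" for x using C1_supp_grad_0[OF psi(1), of x] psi(2) that by blast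
 have adm: "admissible_test K1 cs cs' W hinge hinge' v g"
 unfolding admissible_test_def
 using psi oW W vG cg hinge_DERIV hinge'_continuous hinge_bounds by (auto intro!: exI[of _ 2])
 let ?T = "test_field cs cs' hinge hinge' v g"
 let ?f = "%x. cs x * hinge (v x - u x)"
 define Y where "Y x = pflux p (g x)" for x
 have dY: "(Y has_derivative (%e. pflux' p (g x) (hess x e))) (at x)" if "x : W" for x
 unfolding Y_def[abs_def] by (rule has_derivative_compose[OF gH[OF that] pflux_has_derivative[OF g0[OF that]]])
 have cY: "continuous_on W (%x. pflux' p (g x) (hess x b))" for b
 unfolding continuous_on_def
 by (intro ballI pflux'_tendsto g0) (use cg cH in "auto simp: continuous_on_def")
 note S = supersolution_test[OF sup adm psi(3) hinge_nonneg]
 note F = field_test[OF adm dY cY, unfolded plap_eq_divergence]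
 \<comment> \<open>The gradient of the cutoff drops out: where v > u the point lies in
   \<open>K\<close>, on which \<open>cs' = 0\<close>; elsewhere in \<open>W\<close> the factor
   \<open>hinge\<close> is 0, and off \<open>W\<close> the cutoff gradient is 0.\<close>
 have T: "AEL x. ?T x = (cs x * hinge' (v x - u x)) *R (g x - G x)"
 using K(3)
 proof eventually_elim
 case (elim x)
 have "hinge (v x - u x) *R cs' x = 0"
 using elim psi(5)[of x] psi0'[of x] hinge_nonpos[of "v x - u x"] by (cases "x : W") force+
 then show ?case by (simp add: test_field_def test_grad_def)
 qed
 have "0 <= (LI x. (Y x - pflux p (G x)) <.> ?T x)"
 proof (rule integral_nonneg_AE)
 show "AEL x. 0 <= (Y x - pflux p (G x)) <.> ?T x"
 using T
 proof eventually_elim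
 case (elim x)
 have "0 <= (cs x * hinge' (v x - u x)) * ((Y x - pflux p (G x)) <.> (g x - G x))"
 unfolding Y_def by (intro mult_nonneg_nonneg psi(3) hinge'_nonneg pflux_monotone[OF p])
 then show ?case unfolding elim by simp
 qed
 qed
 also have "... = (LI x. Y x <.> ?T x) - (LI x. pflux p (G x) <.> ?T x)"
 unfolding inner_diff_left by (rule bint_minus[OF F(2) S(3)])
 also have "... <= - (LI x. plap p (g x) (hess x) * ?f x) - (LI x. h x * ?f x)"
 using F(1) S(1) by linarith
 also have "... = - (LI x. plap p (g x) (hess x) * ?f x + h x * ?f x)"
 by (simp only: bint_plus[OF F(3) S(2)])
 finally have le: "(LI x. plap p (g x) (hess x) * ?f x + h x * ?f x) <= 0" by simp
 have i: "ILI x. plap p (g x) (hess x) * ?f x + h x * ?f x"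
 by (rule bint_add[OF F(3) S(2)])
 have f0: "0 <= ?f x" for x by (intro mult_nonneg_nonneg psi(3) hinge_nonneg)
 have nn: "AEL x. 0 <= plap p (g x) (hess x) * ?f x + h x * ?f x"
 using h
 proof eventually_elim
 case (elim x)
 show ?case
 proof (cases "x : W")
 case True
 then have "0 <= plap p (g x) (hess x) + h x" using sub[of x] elim by simp
 then have "0 <= (plap p (g x) (hess x) + h x) * ?f x" using f0 by (rule mult_nonneg_nonneg)
 then show ?thesis by (simp only: distrib_right)
 qed (simp add: psi0)
 qed
 have "AEL x. plap p (g x) (hess x) * ?f x + h x * ?f x = 0"
 using integral_nonneg_eq_0_iff_AE[OF i nn] le integral_nonneg_AE[OF nn] by linarith
 then show ?thesis
 using h K(3)
 proof eventually_elim
 case (elim x)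
 show ?case
 proof (intro impI, rule ccontr)
 assume x: "x : W" and "~ v x <= u x"
 then have lt: "u x < v x" by simp
 then have "x : K" using elim x by blast
 then have "0 < ?f x" using psi(4) hinge_pos[of "v x - u x"] lt by simp
 moreover have "0 < plap p (g x) (hess x) + h x" using sub[OF x] elim x by simp
 ultimately have "0 < (plap p (g x) (hess x) + h x) * ?f x" by simp
 then show False using elim by (simp only: distrib_right)
 qed
 qed
qed

text \<open>This replaces a strong maximum principle. The strictness at \<open>x0\<close> leaves
  room to subtract a small paraboloid and to add a constant; comparison on a small ball keeps the
  perturbed function below \<open>u\<close>, hence \<open>u\<close> is strictly above
  \<open>v\<close> near \<open>x0\<close>.\<close>

lemma strong_touching:
 assumes sup: "supersolution h" and W: "W <= D" and v: "C2_data W v g hess" and x0: "x0 : W" and g0: "g x0 ~= 0"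
 and sub: "0 < plap p (g x0) (hess x0) + be"
 and h: "AEL x. x : W --> be <= h x"
 and le: "AEL x. x : W --> v x <= u x"
 shows "EX r>0. EX s>0. AEL x. x : ball x0 r --> v x + s <= u x"
proof -
 have oW: "open W" and [measurable]: "v : BM" "g : BM"
 and vG: "!!x. x : W ==> GDERIV v x :> g x" and gH: "!!x. x : W ==> (g has_derivative hess x) (at x)"
 and cH: "!!b. continuous_on W (%x. hess x b)"
 using v by (auto simp: C2_data_def)
 have cg: "continuous_on W g"
 using gH by (intro continuous_at_imp_continuous_on ballI has_derivative_continuous) blast
 \<comment> \<open>Both the point and the opening \<open>k\<close> of the paraboloid vary: a limit
   in the product filter gives one ball and one \<open>k\<close> for which strictness and
   nonvanishing gradient persist.\<close>
 let ?F = "nhds x0 \<times>\<^sub>F nhds (0::real)"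
 have fx: "((%q. F (fst q)) ---> F x0) ?F" if "continuous_on W F" for F :: "'a => 'a"
 proof -
 have "(F ---> F x0) (nhds x0)"
 using that oW x0 by (simp add: continuous_on_eq_continuous_at isCont_def tendsto_at_iff_tendsto_nhds)
 then show ?thesis using filterlim_fst by (rule filterlim_compose)
 qed
 have id: "((%q. fst q) ---> x0) ?F" "((%q. snd q) ---> 0) ?F"
 using filterlim_fst[of "nhds x0" "nhds (0::real)"] filterlim_snd[of "nhds (0::real)" "nhds x0"] by auto
 have G1: "((%q. g (fst q) - (2 * snd q) *R (fst q - x0)) ---> g x0 - (2 * 0) *R (x0 - x0)) ?F"
 by (intro tendsto_intros fx cg id)
 have H1: "((%q. hess (fst q) b - (2 * snd q) *R b) ---> hess x0 b - (2 * 0) *R b) ?F" for b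
 by (intro tendsto_intros fx[of "%x. hess x b"] cH id)
 have "((%q. plap p (g (fst q) - (2 * snd q) *R (fst q - x0)) (%b. hess (fst q) b - (2 * snd q) *R b)) ---> plap p (g x0) (hess x0)) ?F"
 by (rule plap_tendsto) (use G1 H1 g0 in auto)
 then have ev1: "\<forall>\<^sub>F q in ?F. - be < plap p (g (fst q) - (2 * snd q) *R (fst q - x0)) (%b. hess (fst q) b - (2 * snd q) *R b)"
 using sub by (intro order_tendstoD) auto
 have ev2: "\<forall>\<^sub>F q in ?F. g (fst q) - (2 * snd q) *R (fst q - x0) ~= 0"
 using G1 g0 by (intro tendsto_imp_eventually_ne) auto
 have ev3: "\<forall>\<^sub>F q in ?F. fst q : W"
 using id(1) oW x0 by (rule topological_tendstoD)
 obtain P Q where PQ: "eventually P (nhds x0)" "eventually Q (nhds 0)"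
 "!!x k. P x ==> Q k ==> - be < plap p (g x - (2 * k) *R (x - x0)) (%b. hess x b - (2 * k) *R b) &
 g x - (2 * k) *R (x - x0) ~= 0 & x : W"
 using eventually_conj[OF ev1 eventually_conj[OF ev2 ev3]] unfolding eventually_prod_filter by auto
 obtain r where r: "r > 0" "!!x. dist x x0 < r ==> P x" using PQ(1) by (auto simp: eventually_nhds_metric)
 obtain d where d: "d > 0" "!!k. dist k 0 < d ==> Q k" using PQ(2) by (auto simp: eventually_nhds_metric)
 define k where "k = d / 2"
 have k: "k > 0" "Q k" using d by (auto simp: k_def)
 define B where "B = ball x0 r"
 have B: "- be < plap p (g x - (2 * k) *R (x - x0)) (%b. hess x b - (2 * k) *R b)" "g x - (2 * k) *R (x - x0) ~= 0" "x : W" if "x : B" for x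
 using PQ(3)[OF r(2) k(2), of x] that by (auto simp: B_def dist_commute)
 \<comment> \<open>With this height the perturbed function \<open>w\<close> lies below
   \<open>v\<close> outside the ball of radius r/2, so any contact with \<open>u\<close> is confined
   to a compact subset of \<open>B\<close>.\<close>
 define s where "s = k * (r / 2)^2"
 have s: "s > 0" using k r by (simp add: s_def)
 define w where "w x = v x - k * ((x - x0) <.> (x - x0)) + s" for x
 have wC: "C2_data B w (%x. g x - (2 * k) *R (x - x0)) (%x b. hess x b - (2 * k) *R b)"
 unfolding C2_data_def
 proof (intro conjI ballI allI)
 show "open B" by (simp add: B_def)
 show "w : BM" unfolding w_def[abs_def] by measurable
 show "(%x. g x - (2 * k) *R (x - x0)) : BM" by measurable
 fix x assume x: "x : B"
 have 1: "(v has_derivative (%h. h <.> g x)) (at x)" by (rule vG[OF B(3)[OF x], unfolded gderiv_def])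
 have 2: "((%x. k * ((x - x0) <.> (x - x0))) has_derivative (%h. h <.> ((2 * k) *R (x - x0)))) (at x)"
 by (auto intro!: derivative_eq_intros simp: inner_commute algebra_simps)
 have "((%x. v x - k * ((x - x0) <.> (x - x0)) + s) has_derivative (%h. h <.> g x - h <.> ((2 * k) *R (x - x0)) + 0)) (at x)"
 by (rule has_derivative_add[OF has_derivative_diff[OF 1 2] has_derivative_const])
 then show "GDERIV w x :> g x - (2 * k) *R (x - x0)" by (simp add: gderiv_def w_def[abs_def] inner_diff_right)
 have 3: "((%x. (2 * k) *R (x - x0)) has_derivative (%b. (2 * k) *R b)) (at x)"
 by (auto intro!: derivative_eq_intros)
 show "((%x. g x - (2 * k) *R (x - x0)) has_derivative (%b. hess x b - (2 * k) *R b)) (at x)"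
 by (rule has_derivative_diff[OF gH[OF B(3)[OF x]] 3])
 next
 show "continuous_on B (%x. hess x b - (2 * k) *R b)" for b
 by (intro continuous_intros continuous_on_subset[OF cH]) (use B in blast)
 qed
 have BW: "B <= W" using B by blast
 have "AEL x. x : B --> w x <= u x"
 proof (rule comparison[OF sup _ wC])
 show "B <= D" using BW W by blast
 show "g x - (2 * k) *R (x - x0) ~= 0" if "x : B" for x using B(2)[OF that] .
 show "0 < plap p (g x - (2 * k) *R (x - x0)) (%b. hess x b - (2 * k) *R b) + be" if "x : B" for x using B(1)[OF that] by simp
 show "AEL x. x : B --> be <= h x" using h by eventually_elim (use BW in blast)
 show "compact (cball x0 (r / 2))" by simp
 show "cball x0 (r / 2) <= B" using r by (auto simp: B_def)
 show "AEL x. x : B --> u x < w x --> x : cball x0 (r / 2)"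
 using le
 proof eventually_elim
 case (elim x)
 show ?case
 proof (intro impI)
 assume "x : B" "u x < w x"
 then have "k * ((x - x0) <.> (x - x0)) < k * (r / 2)^2" using elim BW by (auto simp: w_def s_def)
 then have "(norm (x - x0))^2 < (r / 2)^2" using k(1) by (simp add: power2_norm_eq_inner)
 then have "norm (x - x0) < r / 2" by (rule power_less_imp_less_base) (use r in simp)
 then show "x : cball x0 (r / 2)" by (simp add: dist_norm norm_minus_commute)
 qed
 qed
 qed
 then have "AEL x. x : ball x0 (r / 4) --> v x + s / 2 <= u x"
 proof eventually_elim
 case (elim x)
 show ?case
 proof
 assume x: "x : ball x0 (r / 4)"
 then have "x : B" using r by (simp add: B_def)
 then have "w x <= u x" using elim by blast
 \<comment> \<open>On the ball of radius r/4 the paraboloid uses up at most half of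
   \<open>s\<close>; the other half is the gain.\<close>
 moreover have "k * ((x - x0) <.> (x - x0)) <= s / 2"
 proof -
 have "(norm (x - x0))^2 <= (r / 4)^2" using x by (intro power_mono) (auto simp: dist_norm norm_minus_commute)
 also have "... <= (r / 2)^2 / 2" by (simp add: power2_eq_square)
 finally have "k * (norm (x - x0))^2 <= k * ((r / 2)^2 / 2)" using k(1) by (intro mult_left_mono) auto
 then show ?thesis by (simp add: s_def power2_norm_eq_inner)
 qed
 ultimately show "v x + s / 2 <= u x" by (simp add: w_def)
 qed
 qed
 then show ?thesis using r(1) s by (intro exI[of _ "r / 4"] conjI exI[of _ "s / 2"]) auto
qed

end

text \<open>The Hessian of a composition is F'' N N^T + F' La, with \<open>N\<close> and
  \<open>La\<close> the gradient and Hessian of the inner function. The normal second derivative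
  enters both the trace and the term with p - 2, which produces the factor p - 1.\<close>

lemma plap_composition:
 fixes N :: "'a::euclidean_space"
 assumes "F1 ~= 0" "N ~= 0"
 shows "plap p (F1 *R N) (%b. (F2 * (N <.> b)) *R N + F1 *R La b) =
 (\<bar>F1\<bar> * norm N) powr (p - 2) * ((p - 1) * F2 * (norm N)^2 +
 F1 * ((SUM b:Basis. La b <.> b) + (p - 2) * (SUM b:Basis. (N <.> La b) * (N <.> b)) / (norm N)^2))"
proof -
 let ?t = "SUM b:Basis. La b <.> b" and ?s = "SUM b:Basis. (N <.> La b) * (N <.> b)"
 have nn: "(norm N)^2 = (SUM b:Basis. (N <.> b) * (N <.> b))"
 by (simp add: power2_norm_eq_inner euclidean_inner[of N N])
 have tr: "(SUM b:Basis. ((F2 * (N <.> b)) *R N + F1 *R La b) <.> b) = F2 * (norm N)^2 + F1 * ?t"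
 unfolding nn by (simp add: inner_add_left sum.distrib sum_distrib_left mult.assoc)
 have "(F1 *R N <.> ((F2 * (N <.> b)) *R N + F1 *R La b)) * (F1 *R N <.> b)
 = F1^2 * (F2 * (norm N)^2 * ((N <.> b) * (N <.> b)) + F1 * ((N <.> La b) * (N <.> b)))" for b
 by (simp add: inner_add_right dot_square_norm power2_eq_square algebra_simps)
 then have q: "(SUM b:Basis. (F1 *R N <.> ((F2 * (N <.> b)) *R N + F1 *R La b)) * (F1 *R N <.> b))
 = F1^2 * (F2 * (norm N)^2 * (norm N)^2 + F1 * ?s)"
 by (simp only: sum_distrib_left[symmetric] sum.distrib nn[symmetric])
 let ?m = "\<bar>F1\<bar> * norm N"
 have m: "?m > 0" using assms by simp
 have "?m powr (p - 2) = ?m powr (p - 4 + 2)" by simp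
 also have "... = ?m powr (p - 4) * ?m powr 2" by (rule powr_add)
 also have "?m powr 2 = F1^2 * (norm N)^2" using m by (simp add: power_mult_distrib)
 finally have pw: "?m powr (p - 4) * F1^2 = ?m powr (p - 2) / (norm N)^2" using assms by (simp add: field_simps)
 have "plap p (F1 *R N) (%b. (F2 * (N <.> b)) *R N + F1 *R La b) =
 ?m powr (p - 2) * (F2 * (norm N)^2 + F1 * ?t) + (p - 2) * (?m powr (p - 4) * F1^2) * (F2 * (norm N)^2 * (norm N)^2 + F1 * ?s)"
 unfolding plap_def tr q by simp
 also have "... = ?m powr (p - 2) * ((F2 * (norm N)^2 + F1 * ?t) + (p - 2) * (F2 * (norm N)^2 + F1 * ?s / (norm N)^2))"
 unfolding pw using assms by (simp add: field_simps power2_eq_square)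
 also have "... = ?m powr (p - 2) * ((p - 1) * F2 * (norm N)^2 + F1 * (?t + (p - 2) * ?s / (norm N)^2))"
 by (simp add: algebra_simps)
 finally show ?thesis .
qed

lemma C2_data_compose:
 assumes ro: "C2_data W ro N La" and I: "open I" "!!x. x : W ==> ro x : I"
 and F: "!!t. t : I ==> (F has_real_derivative F1 t) (at t)" "!!t. t : I ==> (F1 has_real_derivative F2 t) (at t)"
 "continuous_on I F2"
 and [measurable]: "F : BM" "F1 : BM"
 shows "C2_data W (%x. F (ro x)) (%x. F1 (ro x) *R N x)
 (%x b. (F2 (ro x) * (N x <.> b)) *R N x + F1 (ro x) *R La x b)"
 unfolding C2_data_def
proof (intro conjI ballI allI)
 have oW: "open W" and [measurable]: "ro : BM" "N : BM"
 and G: "!!x. x : W ==> GDERIV ro x :> N x" and H: "!!x. x : W ==> (N has_derivative La x) (at x)"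
 and c: "!!b. continuous_on W (%x. La x b)"
 using ro by (auto simp: C2_data_def)
 show "open W" by (rule oW)
 show "(%x. F (ro x)) : BM" by measurable
 show "(%x. F1 (ro x) *R N x) : BM" by measurable
 have cN: "continuous_on W N" using H by (intro continuous_at_imp_continuous_on ballI has_derivative_continuous) blast
 have cro: "continuous_on W ro" using G unfolding gderiv_def by (intro continuous_at_imp_continuous_on ballI has_derivative_continuous) blast
 have cF1: "continuous_on I F1" using F(2) by (intro DERIV_continuous_on) (auto intro: has_field_derivative_at_within)
 {
 fix x assume x: "x : W"
 have d: "(ro has_derivative (%h. h <.> N x)) (at x)" by (rule G[OF x, unfolded gderiv_def])
 have "((%x. F (ro x)) has_derivative (%h. F1 (ro x) * (h <.> N x))) (at x)"
 by (rule has_derivative_compose[OF d F(1)[OF I(2)[OF x], unfolded has_field_derivative_def]])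
 then show "GDERIV (%x. F (ro x)) x :> F1 (ro x) *R N x" by (simp add: gderiv_def)
 have "((%x. F1 (ro x)) has_derivative (%h. F2 (ro x) * (h <.> N x))) (at x)"
 by (rule has_derivative_compose[OF d F(2)[OF I(2)[OF x], unfolded has_field_derivative_def]])
 from has_derivative_scaleR[OF this H[OF x]]
 have "((%x. F1 (ro x) *R N x) has_derivative (%h. F1 (ro x) *R La x h + (F2 (ro x) * (h <.> N x)) *R N x)) (at x)" .
 moreover have "(%h. F1 (ro x) *R La x h + (F2 (ro x) * (h <.> N x)) *R N x)
 = (%b. (F2 (ro x) * (N x <.> b)) *R N x + F1 (ro x) *R La x b)"
 by (simp add: inner_commute add.commute)
 ultimately show "((%x. F1 (ro x) *R N x) has_derivative (%b. (F2 (ro x) * (N x <.> b)) *R N x + F1 (ro x) *R La x b)) (at x)"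
 by simp
 }
 show "continuous_on W (%x. (F2 (ro x) * (N x <.> b)) *R N x + F1 (ro x) *R La x b)" for b
 by (intro continuous_intros cN c continuous_on_compose2[OF F(3) cro] continuous_on_compose2[OF cF1 cro]) (use I(2) in auto)
qed

subsection \<open>Propagation of positivity\<close>

context weak_diff
begin

lemma supersolution_mono:
 assumes "supersolution h" "loc_integrable D h'" "AEL x. x : D --> h' x <= h x"
 shows "supersolution h'"
 unfolding supersolution_def
proof (intro conjI ballI impI)
 show "loc_integrable D h'" by fact
 fix vp assume vp: "vp : test_functions D" "ALL x. 0 <= vp x"
 obtain K where K: "smooth vp" "compact K" "K <= D" "!!x. x ~: K ==> vp x = 0"
 using vp(1) by (elim test_functionsE) blast
 obtain B where B: "!!x. norm (vp x) <= B"
 using bounded_continuous_supp[OF smooth_continuous[OF K(1)] K(2,4)] by blast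
 have i: "ILI x. k x * vp x" if k: "loc_integrable D k" for k
 proof -
 have "ILI x. (indicator K x * k x) *R vp x"
 by (rule integrable_mult_bounded_continuous[OF _ smooth_continuous[OF K(1)] B])
 (use k K in "simp add: loc_integrable_def")
 moreover have "(%x. (indicator K x * k x) *R vp x) = (%x. k x * vp x)"
 proof
 show "(indicator K x * k x) *R vp x = k x * vp x" for x using K(4)[of x] by (cases "x : K") auto
 qed
 ultimately show ?thesis by (simp only:)
 qed
 have "(LI x. h' x * vp x) <= (LI x. h x * vp x)"
 proof (rule integral_mono_AE[OF i[OF assms(2)] i])
 show "loc_integrable D h" using assms(1) by (simp add: supersolution_def)
 show "AEL x. h' x * vp x <= h x * vp x"
 using assms(3)
 proof eventually_elim
 case (elim x)
 show ?case
 proof (cases "x : K")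
 case True then show ?thesis using elim K(3) vp(2) by (intro mult_right_mono) auto
 qed (simp add: K(4))
 qed
 qed
 also have "... <= (LI x. pflux p (G x) <.> grad vp x)"
 using assms(1) vp by (simp add: supersolution_def)
 finally show "(LI x. h' x * vp x) <= (LI x. pflux p (G x) <.> grad vp x)" .
qed

text \<open>The barrier is a(|x - y|^(-2q) - R^(-2q)) on the domain minus a small ball. It is below
  \<open>c\<close> there, negative beyond radius \<open>R\<close>, and a strict subsolution for
  large \<open>q\<close>; its positive value at radius \<open>R'\<close> becomes the new
  bound.\<close>

lemma ball_expansion:
 assumes sup: "supersolution (%_. 0)" and u0: "AEL x. x : D --> 0 <= u x"
 and s: "0 < s" "AEL x. x : ball y s --> c <= u x" "0 < c"
 and R: "0 < R'" "R' < R" "cball y R <= D"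
 shows "EX c'>0. AEL x. x : ball y R' --> c' <= u x"
proof -
 \<comment> \<open>Large enough for the radial second derivative to dominate the trace and the p - 2
   term; \<open>qbig\<close> is exactly the resulting inequality for the bracket.\<close>
 define q where "q = real DIM('a) + \<bar>p\<bar> + real DIM('a) / (p - 1) + 1"
 have q: "q > 0" unfolding q_def using p by (intro add_pos_nonneg add_nonneg_pos) auto
 have qbig: "4 * (p - 1) * (q + 1) - 2 * (real DIM('a) + (p - 2)) > 0"
 proof -
 have "(p - 1) * (q + 1) = (p - 1) * (real DIM('a) + \<bar>p\<bar> + 2) + (p - 1) * (real DIM('a) / (p - 1))"
 by (simp add: q_def algebra_simps)
 also have "(p - 1) * (real DIM('a) / (p - 1)) = real DIM('a)" using p by simp
 finally have e: "(p - 1) * (q + 1) = (p - 1) * (real DIM('a) + \<bar>p\<bar> + 2) + real DIM('a)" .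
 have "(p - 1) * (real DIM('a) + \<bar>p\<bar> + 2) \<ge> (p - 1) * 2" using p by (intro mult_left_mono) auto
 then have "(p - 1) * (q + 1) \<ge> (p - 1) * 2 + real DIM('a)" unfolding e by simp
 moreover define X where "X = (p - 1) * (q + 1)"
 ultimately have X: "X \<ge> (p - 1) * 2 + real DIM('a)" by (simp only: X_def)
 have "4 * (p - 1) * (q + 1) = 4 * X" by (simp add: X_def)
 moreover have "real DIM('a) > 0" by simp
 ultimately show ?thesis using p X by (simp add: algebra_simps)
 qed
 \<comment> \<open>Normalised so that the barrier is at most \<open>c\<close> outside the ball of
   radius s/2.\<close>
 define a where "a = c * (s / 2)\<^sup>2 powr q"
 have a: "a > 0" unfolding a_def using s by simp
 define F where "F t = a * (t powr (- q) - R\<^sup>2 powr (- q))" for t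
 define F1 where "F1 t = a * (- q * t powr (- q - 1))" for t
 define F2 where "F2 t = a * (q * (q + 1) * t powr (- q - 2))" for t
 \<comment> \<open>Removing radius s/2 instead of \<open>s\<close> keeps the pole away and leaves a
   margin: contact can occur only at radii between \<open>s\<close> and \<open>R\<close>, which form
   a compact subset of \<open>W\<close>.\<close>
 define W where "W = {x : D. (s / 2)^2 < (x - y) <.> (x - y)}"
 have oW: "open W"
 unfolding W_def by (intro open_Collect_conj open_D open_Collect_less continuous_intros) (simp add: open_D)
 have rho: "C2_data W (%x. (x - y) <.> (x - y)) (%x. 2 *R (x - y)) (%x b. 2 *R b)"
 unfolding C2_data_def
 proof (intro conjI ballI allI)
 fix x
 have "((%x. (x - y) <.> (x - y)) has_derivative (%h. h <.> (2 *R (x - y)))) (at x)"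
 by (auto intro!: derivative_eq_intros simp: inner_commute algebra_simps)
 then show "GDERIV (%x. (x - y) <.> (x - y)) x :> 2 *R (x - y)" by (simp add: gderiv_def)
 show "((%x. 2 *R (x - y)) has_derivative (%b. 2 *R b)) (at x)" by (auto intro!: derivative_eq_intros)
 qed (auto intro: oW)
 have Wpos: "0 < (x - y) <.> (x - y)" if "x : W" for x
 using that zero_le_power2[of "s / 2"] unfolding W_def by (simp only: mem_Collect_eq) linarith
 have C2: "C2_data W (%x. F ((x - y) <.> (x - y))) (%x. F1 ((x - y) <.> (x - y)) *R (2 *R (x - y)))
 (%x b. (F2 ((x - y) <.> (x - y)) * (2 *R (x - y) <.> b)) *R (2 *R (x - y)) + F1 ((x - y) <.> (x - y)) *R (2 *R b))"
 proof (rule C2_data_compose[OF rho, of "{0<..}"])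
 show "(F has_real_derivative F1 t) (at t)" if "t : {0<..}" for t
 unfolding F_def[abs_def] F1_def using that by (auto intro!: derivative_eq_intros)
 show "(F1 has_real_derivative F2 t) (at t)" if "t : {0<..}" for t
 unfolding F1_def[abs_def] F2_def using that
 by (auto intro!: derivative_eq_intros simp: diff_diff_eq) (simp add: algebra_simps)
 show "continuous_on {0<..} F2" unfolding F2_def[abs_def] by (intro continuous_intros) auto
 qed (use Wpos in "auto simp: F_def[abs_def] F1_def[abs_def]")
 have mono: "t powr (- q) <= t' powr (- q)" if "0 < t'" "t' <= t" for t t' :: real
 using that q by (intro powr_mono2') auto
 have Fle: "F ((x - y) <.> (x - y)) <= c" if "x : W" for x
 proof -
 have "((x - y) <.> (x - y)) powr (- q) <= (s / 2)\<^sup>2 powr (- q)" using that s by (intro mono) (auto simp: W_def)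
 then have "((x - y) <.> (x - y)) powr (- q) - R\<^sup>2 powr (- q) <= (s / 2)\<^sup>2 powr (- q)"
 using powr_ge_zero[of "R^2" "- q"] by linarith
 then have "F ((x - y) <.> (x - y)) <= a * (s / 2)\<^sup>2 powr (- q)"
 unfolding F_def using a by (intro mult_left_mono) auto
 also have "... = c" using s by (simp add: a_def powr_minus)
 finally show ?thesis .
 qed
 have Fneg: "F ((x - y) <.> (x - y)) <= 0" if "R < norm (x - y)" for x
 proof -
 have "R^2 <= (norm (x - y))^2" using that R by (intro power_mono) auto
 then have "((x - y) <.> (x - y)) powr (- q) <= R\<^sup>2 powr (- q)"
 using R by (intro mono) (auto simp: power2_norm_eq_inner)
 then show ?thesis unfolding F_def using a by (simp add: mult_le_0_iff)
 qed
 define K where "K = cball y R \<inter> {x. s^2 <= (x - y) <.> (x - y)}"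
 have "AEL x. x : W --> F ((x - y) <.> (x - y)) <= u x"
 proof (rule comparison[OF sup _ C2, of 0 K])
 show "W <= D" by (auto simp: W_def)
 fix x assume x: "x : W"
 let ?t = "(x - y) <.> (x - y)"
 have t: "?t > 0" using Wpos[OF x] .
 have F1: "F1 ?t ~= 0" using a q t by (simp add: F1_def)
 have N: "2 *R (x - y) ~= 0" using t by auto
 have "F1 ?t *R (2 *R (x - y)) ~= 0" using F1 N by (simp only: scaleR_eq_0_iff) simp
 then show "F1 ((x - y) <.> (x - y)) *R (2 *R (x - y)) ~= 0" .
 have n2: "(norm (2 *R (x - y)))^2 = 4 * ?t" by (simp add: power2_norm_eq_inner)
 have tr: "(SUM b:(Basis :: 'a set). (2 *R b) <.> b) = 2 * real DIM('a)" by simp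
 have sq: "(SUM b:(Basis :: 'a set). (2 *R (x - y) <.> (2 *R b)) * (2 *R (x - y) <.> b)) = 2 * (4 * ?t)"
 proof -
 have "(SUM b:(Basis :: 'a set). (2 *R (x - y) <.> (2 *R b)) * (2 *R (x - y) <.> b)) = 8 * (SUM b:Basis. ((x - y) <.> b) * ((x - y) <.> b))"
 by (simp add: sum_distrib_left mult.assoc)
 also have "(SUM b:Basis. ((x - y) <.> b) * ((x - y) <.> b)) = ?t" by (rule euclidean_inner[symmetric])
 finally show ?thesis by simp
 qed
 have F12: "F2 ?t * ?t = a * q * (q + 1) * ?t powr (- q - 1)"
 proof -
 have e: "- q - 1 = - q - 2 + 1" by simp
 have "?t powr (- q - 1) = ?t powr (- q - 2) * ?t powr 1" unfolding e by (rule powr_add)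
 also have "... = ?t powr (- q - 2) * ?t" using t by simp
 finally show ?thesis by (simp add: F2_def)
 qed
 have pos: "0 < (\<bar>F1 ?t\<bar> * norm (2 *R (x - y))) powr (p - 2)" using F1 N by simp
 have br: "(p - 1) * F2 ?t * (4 * ?t) + F1 ?t * (2 * real DIM('a) + (p - 2) * (2 * (4 * ?t)) / (4 * ?t))
 = a * q * ?t powr (- q - 1) * (4 * (p - 1) * (q + 1) - 2 * (real DIM('a) + (p - 2)))"
 proof -
 define P where "P = ?t powr (- q - 1)"
 have e1: "(p - 1) * F2 ?t * (4 * ?t) = 4 * (p - 1) * (a * q * (q + 1) * P)"
 proof -
 have "(p - 1) * F2 ?t * (4 * ?t) = 4 * (p - 1) * (F2 ?t * ?t)" by (simp only: mult_ac)
 then show ?thesis by (simp only: F12 P_def)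
 qed
 have e2: "(p - 2) * (2 * (4 * ?t)) / (4 * ?t) = 2 * (p - 2)" using t by simp
 have e3: "F1 ?t = - (a * q * P)" by (simp add: F1_def P_def)
 show ?thesis unfolding e1 e2 e3 P_def[symmetric] by (simp add: algebra_simps)
 qed
 show "0 < plap p (F1 ?t *R (2 *R (x - y))) (%b. (F2 ?t * (2 *R (x - y) <.> b)) *R (2 *R (x - y)) + F1 ?t *R (2 *R b)) + 0"
 unfolding plap_composition[OF F1 N] n2 tr sq br
 using pos a q t qbig by simp
 next
 show "compact K" unfolding K_def
 by (intro compact_Int_closed compact_cball closed_Collect_le continuous_intros)
 show "K <= W"
 proof
 fix x assume x: "x : K"
 have "(s / 2)^2 < s^2" using s by (intro power_strict_mono) auto
 then show "x : W" using x R by (auto simp: K_def W_def)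
 qed
 show "AEL x. x : W --> u x < F ((x - y) <.> (x - y)) --> x : K"
 using u0 s(2)
 proof eventually_elim
 case (elim x)
 show ?case
 proof (intro impI)
 assume x: "x : W" and lt: "u x < F ((x - y) <.> (x - y))"
 have "x : D" using x by (simp add: W_def)
 then have "0 <= u x" using elim by blast
 then have "~ R < norm (x - y)" using Fneg[of x] lt by auto
 then have 1: "x : cball y R" by (simp add: dist_norm norm_minus_commute)
 have "x ~: ball y s" using elim Fle[OF x] lt by auto
 then have "s <= norm (x - y)" by (simp add: dist_norm norm_minus_commute)
 then have "s^2 <= (norm (x - y))^2" using s by (intro power_mono) auto
 with 1 show "x : K" by (simp add: K_def power2_norm_eq_inner)
 qed
 qed
 qed auto
 moreover define c' where "c' = min c (F (R'^2))"
 have "c' > 0"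
 proof -
 have "R'^2 < R^2" using R by (intro power_strict_mono) auto
 then have "R\<^sup>2 powr (- q) < R'\<^sup>2 powr (- q)" using q R by (intro powr_less_mono2_neg) auto
 then show ?thesis using a s by (simp add: c'_def F_def)
 qed
 ultimately show ?thesis
 proof (intro exI[of _ c'] conjI)
 assume "AEL x. x : W --> F ((x - y) <.> (x - y)) <= u x"
 then show "AEL x. x : ball y R' --> c' <= u x"
 using s(2)
 proof eventually_elim
 case (elim x)
 show ?case
 proof
 assume x: "x : ball y R'"
 show "c' <= u x"
 proof (cases "x : ball y s")
 case True then show ?thesis using elim by (simp add: c'_def)
 next
 case False
 then have "s <= norm (x - y)" by (simp add: dist_norm norm_minus_commute)
 then have "(s / 2)^2 < (norm (x - y))^2" using s by (intro power_strict_mono) auto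
 moreover have "x : D" using x R by (auto simp: subset_eq)
 ultimately have xW: "x : W" by (simp add: W_def power2_norm_eq_inner)
 have "norm (x - y) <= R'" using x by (simp add: dist_norm norm_minus_commute)
 then have "(norm (x - y))^2 <= R'^2" by (intro power_mono) auto
 then have "R'\<^sup>2 powr (- q) <= ((x - y) <.> (x - y)) powr (- q)"
 using Wpos[OF xW] by (intro mono) (auto simp: power2_norm_eq_inner)
 then have "F (R'^2) <= F ((x - y) <.> (x - y))" unfolding F_def using a by (intro mult_left_mono) auto
 then show ?thesis using elim xW by (auto simp: c'_def)
 qed
 qed
 qed
 qed
qed

text \<open>The points with a locally positive essential lower bound form an open set, relatively
  closed by \<open>ball_expansion\<close>; connectedness makes it all of \<open>D\<close>, and a
  finite subcover makes the bound uniform on \<open>K\<close>.\<close>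

lemma positive_on_compact:
 assumes conn: "connected D" and sup: "supersolution (%_. 0)" and u0: "AEL x. x : D --> 0 <= u x"
 and start: "0 < s" "ball y s <= D" "0 < c" "AEL x. x : ball y s --> c <= u x"
 and K: "compact K" "K <= D"
 shows "EX c>0. AEL x. x : K --> c <= u x"
proof -
 define P where "P = {x : D. EX r>0. EX c>0. AEL z. z : ball x r --> c <= u z}"
 have oP: "open P"
 unfolding open_contains_ball
 proof
 fix x assume "x : P"
 then obtain r c where x: "x : D" "r > 0" "c > 0" "AEL z. z : ball x r --> c <= u z"
 by (auto simp: P_def)
 obtain r' where r': "r' > 0" "ball x r' <= D" using open_D x(1) by (auto simp: open_contains_ball)
 have "ball x (min r' (r / 2)) <= P"
 proof
 fix x' assume x': "x' : ball x (min r' (r / 2))"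
 have sub: "ball x' (r / 2) <= ball x r"
 proof
 fix z assume "z : ball x' (r / 2)"
 then show "z : ball x r" using x' dist_triangle[of x z x'] by (auto simp: dist_commute)
 qed
 have "AEL z. z : ball x' (r / 2) --> c <= u z"
 using x(4) by eventually_elim (use sub in blast)
 moreover have "x' : D" using x' r' by auto
 ultimately show "x' : P" using x unfolding P_def
 by (intro CollectI conjI exI[of _ "r / 2"] exI[of _ c]) auto
 qed
 then show "EX e>0. ball x e <= P" using r' x by (intro exI[of _ "min r' (r / 2)"]) auto
 qed
 have closed: "x : P" if x: "x : D" "x : closure P" for x
 proof -
 obtain r where r: "r > 0" "ball x r <= D" using open_D x(1) by (auto simp: open_contains_ball)
 \<comment> \<open>A nearby good centre \<open>y\<close> at distance below r/4 has the ball of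
   radius 2R inside \<open>D\<close>, while radius 3R/2 around \<open>y\<close> still covers a
   neighbourhood of \<open>x\<close>.\<close>
 define R where "R = r / 4"
 have R: "R > 0" using r by (simp add: R_def)
 obtain y where y: "y : P" "dist y x < R" using x(2) R by (auto simp: closure_approachable)
 obtain s c where yc: "s > 0" "c > 0" "AEL z. z : ball y s --> c <= u z" using y(1) by (auto simp: P_def)
 have "cball y (2 * R) <= D"
 proof
 fix z assume "z : cball y (2 * R)"
 then have "z : ball x r" using y(2) dist_triangle[of x z y] R by (auto simp: R_def dist_commute)
 then show "z : D" using r by blast
 qed
 then obtain c' where c': "c' > 0" "AEL z. z : ball y (3 / 2 * R) --> c' <= u z"
 using ball_expansion[OF sup u0 yc(1,3,2), of "3 / 2 * R" "2 * R"] R by auto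
 have sub: "ball x (R / 2) <= ball y (3 / 2 * R)"
 proof
 fix z assume "z : ball x (R / 2)"
 then show "z : ball y (3 / 2 * R)" using y(2) dist_triangle[of y z x] by auto
 qed
 have "AEL z. z : ball x (R / 2) --> c' <= u z" using c'(2) by eventually_elim (use sub in blast)
 then show ?thesis using x(1) c'(1) R unfolding P_def
 by (intro CollectI conjI exI[of _ "R / 2"] exI[of _ c']) auto
 qed
 have "y : P" using start unfolding P_def by (intro CollectI conjI exI[of _ s] exI[of _ c]) auto
 have "P = D"
 proof -
 have "openin (top_of_set D) P" using oP by (intro open_subset) (auto simp: P_def)
 moreover have "closedin (top_of_set D) P"
 proof -
 have "P <= D" by (auto simp: P_def)
 then have "P = D \<inter> closure P" using closed closure_subset[of P] by blast
 then show ?thesis by (metis closedin_closed_Int closed_closure)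
 qed
 ultimately show ?thesis using conn \<open>y : P\<close> by (metis connected_clopen empty_iff)
 qed
 then have ex: "ALL x:K. EX r>0. EX c>0. AEL z. z : ball x r --> c <= u z"
 proof (intro ballI)
 fix x assume "x : K"
 then have "x : P" using K(2) \<open>P = D\<close> by blast
 then show "EX r>0. EX c>0. AEL z. z : ball x r --> c <= u z" by (simp only: P_def mem_Collect_eq)
 qed
 define \<C> where "\<C> = {B. open B & (EX c>0. AEL z. z : B --> c <= u z)}"
 have "K <= \<Union>\<C>"
 proof
 fix x assume "x : K"
 then obtain r where "r > 0" "EX c>0. AEL z. z : ball x r --> c <= u z" using ex by blast
 then have "ball x r : \<C>" "x : ball x r" unfolding \<C>_def by (simp_all only: mem_Collect_eq open_ball centre_in_ball simp_thms)
 then show "x : \<Union>\<C>" by blast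
 qed
 moreover have "open B" if "B : \<C>" for B using that by (simp only: \<C>_def mem_Collect_eq)
 ultimately obtain T where T: "T <= \<C>" "finite T" "K <= \<Union>T" using compactE[OF K(1)] by metis
 have "EX c>0. AEL z. z : \<Union>T --> c <= u z"
 using T(2,1)
 proof (induction T)
 case empty
 show ?case by (rule exI[of _ 1]) simp
 next
 case (insert B T)
 then obtain c where c: "c > 0" "AEL z. z : \<Union>T --> c <= u z" by blast
 have "B : \<C>" using insert.prems by blast
 then obtain c' where c': "c' > 0" "AEL z. z : B --> c' <= u z" unfolding \<C>_def by blast
 have "AEL z. z : \<Union>(insert B T) --> min c c' <= u z"
 using c(2) c'(2) by eventually_elim auto
 then show ?case using c(1) c'(1) by (intro exI[of _ "min c c'"]) simp
 qed
 then obtain c where "c > 0" "AEL z. z : \<Union>T --> c <= u z" by blast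
 moreover from this(2) have "AEL z. z : K --> c <= u z" by eventually_elim (use T(3) in blast)
 ultimately show ?thesis by blast
qed

end

subsection \<open>The De Giorgi argument\<close>

lemma smooth_power_DERIV:
 assumes "2 <= m"
 shows "((%t. max 0 t ^ m) has_real_derivative real m * max 0 t ^ (m - 1)) (at (t::real))"
proof (cases t "0 :: real" rule: linorder_cases)
 case greater
 have "((%t. t ^ m) has_real_derivative real m * max 0 t ^ (m - 1)) (at t)"
 using greater by (auto intro!: derivative_eq_intros)
 moreover have "eventually (%s. max 0 s ^ m = s ^ m) (nhds t)"
 using eventually_nhds_in_open[of "{0<..}" t] greater by (auto elim!: eventually_mono)
 ultimately show ?thesis using DERIV_cong_ev[of t t "%t. max 0 t ^ m" "%t. t ^ m"] by auto
next
 case less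
 have "eventually (%s. max 0 s ^ m = 0) (nhds t)"
 using eventually_nhds_in_open[of "{..<0}" t] less assms by (auto elim!: eventually_mono)
 then have "((%t. max 0 t ^ m) has_real_derivative 0) (at t)"
 using DERIV_cong_ev[of t t "%t. max 0 t ^ m" "%_. 0"] by simp
 moreover have "real m * max 0 t ^ (m - 1) = 0" using less assms by simp
 ultimately show ?thesis by (simp only:)
next
 case equal
 have "((%h::real. max 0 h ^ m / h) ---> 0) (at 0)"
 proof (rule tendsto_rabs_zero_cancel, rule tendsto_sandwich[of "%_. 0" _ _ "%h. \<bar>h\<bar>"])
 have "\<forall>\<^sub>F h in at (0::real). h : {-1<..<1}"
 by (rule eventually_at_in_open') auto
 then show "\<forall>\<^sub>F h in at (0::real). \<bar>max 0 h ^ m / h\<bar> <= \<bar>h\<bar>"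
 proof (rule eventually_mono)
 fix h :: real assume elim: "h : {-1<..<1}"
 show "\<bar>max 0 h ^ m / h\<bar> <= \<bar>h\<bar>"
 proof (cases "h > 0")
 case True
 have "h ^ m <= h ^ 2" using True elim assms by (intro power_decreasing) auto
 then have "h ^ m / h <= h ^ 2 / h" using True by (intro divide_right_mono) auto
 then show ?thesis using True by (simp add: power2_eq_square)
 next
 case False
 then have "max 0 h ^ m / h = 0" using assms by (simp add: max_absorb1)
 then show ?thesis by (simp only: abs_zero abs_ge_zero)
 qed
 qed
 show "((%h::real. \<bar>h\<bar>) ---> 0) (at 0)" by (rule tendsto_rabs_zero) simp
 qed auto
 then show ?thesis using equal assms by (simp add: DERIV_def zero_power)
qed

text \<open>The power \<open>m \<ge> p\<close> gives the cutoff the property \<open>\<bar>\<nabla>cs\<bar> <= L cs\<^bsup>(p - 1)/p\<^esup>\<close>.\<close>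

definition cap :: "nat => 'a::euclidean_space => real => 'a => real" where
 "cap m x0 r x = max 0 (1 - ((x - x0) <.> (x - x0)) / r^2) ^ m"

definition cap' :: "nat => 'a::euclidean_space => real => 'a => 'a" where
 "cap' m x0 r x = (real m * max 0 (1 - ((x - x0) <.> (x - x0)) / r^2) ^ (m - 1) * (- 2 / r^2)) *R (x - x0)"

lemma cap_bounds: "0 < r ==> 0 <= cap m x0 r x" "0 < r ==> cap m x0 r x <= 1"
proof -
 assume "0 < r"
 then have "1 - ((x - x0) <.> (x - x0)) / r^2 <= 1" by simp
 then show "cap m x0 r x <= 1" unfolding cap_def by (intro power_le_one) auto
qed (simp add: cap_def)

lemma cap_eq_0: "0 < r ==> 0 < m ==> x ~: ball x0 r ==> cap m x0 r x = 0"
proof -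
 assume r: "0 < r" "0 < m" and "x ~: ball x0 r"
 then have "r <= norm (x - x0)" by (simp add: dist_norm norm_minus_commute)
 then have "r^2 <= (norm (x - x0))^2" using r by (intro power_mono) auto
 then have "1 - ((x - x0) <.> (x - x0)) / r^2 <= 0" using r by (simp add: power2_norm_eq_inner)
 then have "max 0 (1 - ((x - x0) <.> (x - x0)) / r^2) = 0" by simp
 then show ?thesis unfolding cap_def using r by (simp only: zero_power)
qed

lemma cap_lower: "0 < r ==> 0 <= ro ==> ro <= r ==> x : ball x0 ro ==> (1 - ro / r) ^ m <= cap m x0 r x"
proof -
 assume r: "0 < r" "0 <= ro" "ro <= r" and "x : ball x0 ro"
 then have "norm (x - x0) <= ro" by (simp add: dist_norm norm_minus_commute)
 then have "(norm (x - x0))^2 <= ro^2" by (intro power_mono) auto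
 then have "((x - x0) <.> (x - x0)) / r^2 <= (ro / r)^2"
 using r by (simp add: power2_norm_eq_inner power_divide divide_right_mono)
 also have "... <= ro / r" using r unfolding power2_eq_square by (intro mult_left_le) auto
 finally show ?thesis unfolding cap_def using r by (intro power_mono) auto
qed

lemma C1_supp_cap:
 assumes r: "0 < r" and m: "2 <= m"
 shows "C1_supp (cball x0 r) (cap m x0 r) (cap' m x0 r)"
 unfolding C1_supp_def
proof (intro conjI allI impI)
 show "compact (cball x0 r)" by simp
 show "continuous_on UNIV (cap' m x0 r)"
 unfolding cap'_def[abs_def] using r by (intro continuous_intros) auto
 show "cap m x0 r x = 0" if "x ~: cball x0 r" for x using that r m by (intro cap_eq_0) auto
 fix x
 have 1: "((%x. 1 - ((x - x0) <.> (x - x0)) / r^2) has_derivative (%h. - (2 / r^2) * (h <.> (x - x0)))) (at x)"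
 using r by (auto intro!: derivative_eq_intros simp: inner_commute field_simps)
 show "GDERIV (cap m x0 r) x :> cap' m x0 r x"
 using has_derivative_compose[OF 1 smooth_power_DERIV[OF m, unfolded has_field_derivative_def]]
 by (simp add: gderiv_def cap_def[abs_def] cap'_def mult.assoc)
qed

lemma cap'_bound:
 assumes r: "0 < r" and m: "2 <= m" "p <= real m" and p: "1 < p"
 shows "norm (cap' m x0 r x) <= (2 * real m / r) * cap m x0 r x powr ((p - 1) / p)"
proof (cases "x : ball x0 r")
 case True
 define b where "b = max 0 (1 - ((x - x0) <.> (x - x0)) / r^2)"
 have b: "0 <= b" "b <= 1" using r by (auto simp: b_def)
 have b0: "0 < b"
 proof -
 have "norm (x - x0) < r" using True by (simp add: dist_norm norm_minus_commute)
 then have "(norm (x - x0))^2 < r^2" by (intro power_strict_mono) auto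
 then show ?thesis using r by (simp add: b_def power2_norm_eq_inner)
 qed
 have "norm (cap' m x0 r x) = real m * b ^ (m - 1) * (2 / r^2) * norm (x - x0)"
 using b r by (simp add: cap'_def b_def[symmetric] abs_mult)
 also have "... <= real m * b ^ (m - 1) * (2 / r^2) * r"
 using True b by (intro mult_left_mono) (auto simp: dist_norm norm_minus_commute)
 also have "... = (2 * real m / r) * b ^ (m - 1)" using r by (simp add: power2_eq_square)
 also have "... <= (2 * real m / r) * (b ^ m) powr ((p - 1) / p)"
 proof (rule mult_left_mono)
 have "b ^ (m - 1) = b powr (real m - 1)" using b0 m by (simp add: powr_realpow[symmetric])
 \<comment> \<open>Since 0 < b <= 1, this amounts to m - 1 >= m(p - 1)/p, that is, to m >=
   p.\<close>
 also have "... <= b powr (real m * ((p - 1) / p))"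
 proof (rule powr_mono')
 have "real m * ((p - 1) / p) = real m - real m / p" using p by (simp add: field_simps)
 also have "... <= real m - 1" using m p by (simp add: field_simps)
 finally show "real m * ((p - 1) / p) <= real m - 1" .
 qed (use b in auto)
 also have "... = (b ^ m) powr ((p - 1) / p)" using b0 by (simp add: powr_realpow[symmetric] powr_powr)
 finally show "b ^ (m - 1) <= (b ^ m) powr ((p - 1) / p)" .
 qed (use r in simp)
 finally show ?thesis by (simp add: cap_def b_def)
next
 case False
 then have "cap m x0 r x = 0" using r m by (intro cap_eq_0) auto
 moreover have "max 0 (1 - ((x - x0) <.> (x - x0)) / r^2) = 0"
 proof -
 have "r <= norm (x - x0)" using False by (simp add: dist_norm norm_minus_commute)
 then have "r^2 <= (norm (x - x0))^2" using r by (intro power_mono) auto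
 then show ?thesis using r by (simp add: power2_norm_eq_inner)
 qed
 then have "cap' m x0 r x = 0" using m by (simp add: cap'_def)
 ultimately show ?thesis by simp
qed

text \<open>Both bounds follow by comparing \<open>y\<close> with the threshold 4kL. It is chosen so
  that the error absorbs only half of the good term y^p/(2k) of the energy estimate.\<close>

lemma Young_absorb:
 fixes y L k p :: real
 assumes p: "1 < p" and y: "0 <= y" and k: "0 < k" and L: "0 < L"
 shows "L * y powr (p - 1) <= y powr p / (4 * k) + (4 * k * L) powr p / (4 * k)"
 and "y <= 4 * k * L + y powr p * (4 * k * L) powr (1 - p)"
proof -
 define X where "X = 4 * k * L"
 have X: "X > 0" using k L by (simp add: X_def)
 have LX: "L = X / (4 * k)" using k by (simp add: X_def)
 have split: "z powr p = z * z powr (p - 1)" if "0 < z" for z :: real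
 using that powr_add[of z 1 "p - 1"] by simp
 show "L * y powr (p - 1) <= y powr p / (4 * k) + (4 * k * L) powr p / (4 * k)"
 proof (cases "X <= y")
 case True
 then have y0: "0 < y" using X by simp
 have "X * y powr (p - 1) <= y * y powr (p - 1)" using True by (intro mult_right_mono) auto
 also have "... = y powr p" by (rule split[OF y0, symmetric])
 also have "... <= y powr p + X powr p" by simp
 finally show ?thesis unfolding LX using k by (simp add: field_simps)
 next
 case False
 then have "y powr (p - 1) <= X powr (p - 1)" using y p by (intro powr_mono2) auto
 then have "X * y powr (p - 1) <= X * X powr (p - 1)" using X by (intro mult_left_mono) auto
 also have "... = X powr p" by (rule split[OF X, symmetric])
 also have "... <= y powr p + X powr p" by simp
 finally show ?thesis unfolding LX using k by (simp add: field_simps)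
 qed
 show "y <= 4 * k * L + y powr p * (4 * k * L) powr (1 - p)"
 proof (cases "X <= y")
 case True
 then have y0: "0 < y" using X by simp
 have "1 <= (y / X) powr (p - 1)" using True X p by (intro ge_one_powr_ge_zero) auto
 then have "y * 1 <= y * (y / X) powr (p - 1)" using y0 by (intro mult_left_mono) auto
 also have "... = y powr p * X powr (1 - p)"
 proof -
 have "X powr (1 - p) = inverse (X powr (p - 1))" using powr_minus[of X "p - 1"] by simp
 then show ?thesis using X y0 unfolding split[OF y0] by (simp add: powr_divide) (simp add: divide_inverse)
 qed
 finally have "y <= y powr p * X powr (1 - p)" by simp
 then show ?thesis using X unfolding X_def by linarith
 next
 case False
 have "0 <= y powr p * X powr (1 - p)" by simp
 then show ?thesis using False unfolding X_def by linarith
 qed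
qed

context weak_diff
begin

text \<open>Testing with a power cutoff times \<open>hinge ((k - u) / k)\<close> bounds the weighted
  energy on the sublevel set, hence the L^1 norm of the gradient of the test function.
  \<open>Faber_Krahn_L1\<close> turns this into a bound for its integral, which on the smaller
  sublevel set is bounded below.\<close>

lemma level_set_estimate:
 assumes sup: "supersolution (%_. 0)" and u0: "AEL x. x : D --> 0 <= u x"
 and r: "0 < r" "cball x0 r <= D" and ro: "0 <= ro" "ro <= r" and k: "0 < k" "0 < k'" "k' <= k"
 and m: "2 <= m" "p <= real m" and s: "0 < s"
 and big: "emeasure lborel {x : ball x0 r. u x < k} * 2 <= emeasure lborel (ball (0::'a) s)"
 shows "measure lborel {x : ball x0 ro. u x < k'} * ((1 - ro / r) ^ m * ((1 - k' / k)^2 / 2))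
 <= 2 * s * (17 * (2 * real m / r) * measure lborel {x : ball x0 r. u x < k})"
proof -
 define A where "A = {x : ball x0 r. u x < k}"
 define L where "L = 2 * real m / r"
 have L: "L > 0" using m r by (simp add: L_def)
 have [measurable]: "ball x0 r : sets borel" "ball x0 ro : sets borel" by auto
 have [measurable]: "A : sets borel" unfolding A_def by measurable
 have Afin: "emeasure lborel A < \<infinity>"
 by (rule emeasure_bounded_finite) (auto simp: A_def intro: bounded_subset[OF bounded_ball])
 have iA: "integrable lborel (indicator A :: 'a => real)" using Afin by (simp add: integrable_indicator_iff)
 have mA: "(LI x. indicator A x) = measure lborel A" by simp
 let ?cs = "cap m x0 r" and ?cs' = "cap' m x0 r"
 let ?H = "%t. hinge (t / k)" and ?H' = "%t. hinge' (t / k) / k"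
 have C: "C1_supp (cball x0 r) ?cs ?cs'" by (rule C1_supp_cap[OF r(1) m(1)])
 have adm: "admissible_test (cball x0 r) ?cs ?cs' D ?H ?H' (%_. k) (%_. 0)"
 unfolding admissible_test_def
 proof (intro conjI ballI allI)
 show "GDERIV (%_. k) x :> 0" for x by (simp add: gderiv_def)
 show "(?H has_real_derivative ?H' t) (at t)" for t
 proof -
 have "((%t. t / k) has_real_derivative 1 / k) (at t)" using k by (auto intro!: derivative_eq_intros)
 from DERIV_chain'[OF this hinge_DERIV] show ?thesis by simp
 qed
 show "continuous_on UNIV ?H'"
 using k by (intro continuous_intros continuous_on_compose2[OF hinge'_continuous]) auto
 show "EX B. ALL t. \<bar>?H t\<bar> <= B & \<bar>?H' t\<bar> <= B"
 proof (intro exI allI conjI)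
 fix t
 have "2 <= 2 + 2 / k" using k by simp
 then show "\<bar>?H t\<bar> <= 2 + 2 / k" using hinge_bounds(1)[of "t / k"] by linarith
 have "\<bar>?H' t\<bar> = \<bar>hinge' (t / k)\<bar> / k" using k by simp
 also have "... <= 2 / k" using k by (intro divide_right_mono hinge_bounds) auto
 finally show "\<bar>?H' t\<bar> <= 2 + 2 / k" by simp
 qed
 qed (use C r open_D in auto)
 let ?T = "test_field ?cs ?cs' ?H ?H' (%_. k) (%_. 0)"
 define f where "f x = ?cs x * ?H (k - u x)" for x
 define ta where "ta x = (k - u x) / k" for x
 \<comment> \<open>The energy density that the estimate controls. The weight \<open>ta\<close>,
   comparable to the derivative of \<open>hinge\<close> up to the factor k, makes it appear in both
   the good and the bad terms.\<close>
 define e where "e x = indicator A x * (ta x * (?cs x * norm (G x) powr p))" for x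
 have psi: "0 <= ?cs x" "?cs x <= 1" for x using cap_bounds[OF r(1)] by auto
 note S = supersolution_test[OF sup adm psi(1) hinge_nonneg]
 have T0: "?T x = 0" if "x ~: A" for x
 proof (cases "x : cball x0 r")
 case True
 show ?thesis
 proof (cases "u x < k")
 case True
 then have "x ~: ball x0 r" using that by (simp add: A_def)
 then have "?cs x = 0" by (intro cap_eq_0[OF r(1)]) (use m in auto)
 then have "?cs' x = 0" using cap'_bound[OF r(1) m p, of x0 x] by simp
 with \<open>?cs x = 0\<close> show ?thesis by (simp add: test_field_def test_grad_def)
 next
 case False
 then have "(k - u x) / k <= 0" using k by (simp add: divide_le_0_iff)
 then show ?thesis by (simp add: test_field_def test_grad_def hinge_nonpos hinge'_nonpos)
 qed
 next
 case False then show ?thesis by (rule admissible_approximation(3)[OF adm])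
 qed
 have AD: "A <= D" using r by (auto simp: A_def)
 have y: "?cs x * norm (G x) powr p = (?cs x powr (1 / p) * norm (G x)) powr p" for x
 using p psi(1)[of x] by (simp add: powr_mult powr_powr)
 have pt: "AEL x. pflux p (G x) <.> ?T x <= (1 / (4 * k)) * ((4 * k * L) powr p * indicator A x - e x) &
 norm (?T x) <= 9 * L * indicator A x + (2 / k) * (4 * k * L) powr (1 - p) * e x &
 0 <= e x & e x <= indicator (cball x0 r) x * norm (G x) powr p"
 using u0
 proof eventually_elim
 case (elim x)
 show ?case
 proof (cases "x : A")
 case False
 then show ?thesis using T0[OF False] by (auto simp: e_def split: split_indicator)
 next
 case True
 then have x: "x : ball x0 r" "u x < k" "0 <= u x" using elim AD by (auto simp: A_def)
 have t: "0 <= ta x" "ta x <= 1" using x k by (auto simp: ta_def)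
 define Y where "Y = ?cs x powr (1 / p) * norm (G x)"
 have Y: "0 <= Y" by (simp add: Y_def)
 have eY: "e x = ta x * Y powr p" using True by (simp add: e_def y Y_def)
 have h1: "hinge (ta x) <= (ta x)^2" and h2: "ta x / 2 <= hinge' (ta x)" and h3: "hinge' (ta x) <= 2 * ta x"
 by (rule hinge_le[OF t(1)], rule hinge'_ge[OF t], rule hinge'_le[OF t(1)])
 have sq: "(ta x)^2 <= ta x" using t by (simp add: power2_eq_square mult_left_le)
 have Tx: "?T x = hinge (ta x) *R ?cs' x - (?cs x * (hinge' (ta x) / k)) *R G x"
 by (simp add: test_field_def test_grad_def ta_def)
 have dpsi: "norm (?cs' x) <= L * ?cs x powr ((p - 1) / p)"
 unfolding L_def by (rule cap'_bound[OF r(1) m p])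
 have Yp: "?cs x powr ((p - 1) / p) * norm (G x) powr (p - 1) = Y powr (p - 1)"
 unfolding Y_def using psi(1)[of x] by (simp add: powr_mult powr_powr)
 have "pflux p (G x) <.> ?T x = hinge (ta x) * (pflux p (G x) <.> ?cs' x) - (?cs x * (hinge' (ta x) / k)) * norm (G x) powr p"
 unfolding Tx by (simp add: inner_diff_right pflux_inner_self)
 also have "... <= ta x * (L * Y powr (p - 1)) - ta x / (2 * k) * Y powr p"
 proof (rule diff_mono)
 have "pflux p (G x) <.> ?cs' x <= norm (pflux p (G x)) * norm (?cs' x)" by (rule norm_cauchy_schwarz)
 also have "... <= norm (G x) powr (p - 1) * (L * ?cs x powr ((p - 1) / p))"
 unfolding norm_pflux by (intro mult_left_mono dpsi) auto
 also have "... = L * Y powr (p - 1)" using Yp by (simp add: mult.commute mult.left_commute)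
 finally have "hinge (ta x) * (pflux p (G x) <.> ?cs' x) <= hinge (ta x) * (L * Y powr (p - 1))"
 by (intro mult_left_mono hinge_nonneg)
 also have "... <= ta x * (L * Y powr (p - 1))"
 using h1 sq L by (intro mult_right_mono) auto
 finally show "hinge (ta x) * (pflux p (G x) <.> ?cs' x) <= ta x * (L * Y powr (p - 1))" .
 have "ta x / (2 * k) * Y powr p = (ta x / 2) / k * (?cs x * norm (G x) powr p)" by (simp add: y Y_def)
 also have "... <= hinge' (ta x) / k * (?cs x * norm (G x) powr p)"
 using h2 k psi by (intro mult_right_mono divide_right_mono) auto
 finally show "ta x / (2 * k) * Y powr p <= (?cs x * (hinge' (ta x) / k)) * norm (G x) powr p"
 by (simp add: mult.commute mult.left_commute)
 qed
 also have "... <= ta x * (Y powr p / (4 * k) + (4 * k * L) powr p / (4 * k)) - ta x / (2 * k) * Y powr p"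
 using t by (intro diff_right_mono mult_left_mono Young_absorb[OF p Y k(1) L]) auto
 also have "... = (1 / (4 * k)) * (ta x * (4 * k * L) powr p - ta x * Y powr p)" using k by (simp add: field_simps)
 also have "... <= (1 / (4 * k)) * ((4 * k * L) powr p - ta x * Y powr p)"
 using t k by (intro mult_left_mono diff_right_mono) (auto simp: mult_left_le_one_le)
 finally have 1: "pflux p (G x) <.> ?T x <= (1 / (4 * k)) * ((4 * k * L) powr p * indicator A x - e x)"
 using True eY by simp
 have "norm (?T x) <= norm (hinge (ta x) *R ?cs' x) + norm ((?cs x * (hinge' (ta x) / k)) *R G x)"
 unfolding Tx by (rule norm_triangle_ineq4)
 also have "... = hinge (ta x) * norm (?cs' x) + hinge' (ta x) / k * (?cs x * norm (G x))"
 using psi(1)[of x] hinge_nonneg[of "ta x"] hinge'_nonneg[of "ta x"] k by (simp add: abs_mult)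
 also have "... <= ta x * L + 2 * ta x / k * (4 * k * L + Y powr p * (4 * k * L) powr (1 - p))"
 proof (rule add_mono)
 have "?cs x powr ((p - 1) / p) <= 1 powr ((p - 1) / p)" using psi p by (intro powr_mono2) auto
 then have "L * ?cs x powr ((p - 1) / p) <= L * 1" using L by (intro mult_left_mono) auto
 then have "norm (?cs' x) <= L" using dpsi by simp
 then show "hinge (ta x) * norm (?cs' x) <= ta x * L"
 using h1 sq t by (intro mult_mono) auto
 have "?cs x <= ?cs x powr (1 / p)"
 proof (cases "?cs x = 0")
 case False
 have "?cs x powr 1 <= ?cs x powr (1 / p)" using psi p by (intro powr_mono') auto
 then show ?thesis using psi(1)[of x] by simp
 qed simp
 then have "?cs x * norm (G x) <= Y" unfolding Y_def by (intro mult_right_mono) auto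
 also have "... <= 4 * k * L + Y powr p * (4 * k * L) powr (1 - p)" by (rule Young_absorb(2)[OF p Y k(1) L])
 finally show "hinge' (ta x) / k * (?cs x * norm (G x)) <= 2 * ta x / k * (4 * k * L + Y powr p * (4 * k * L) powr (1 - p))"
 using h3 k t psi(1)[of x] by (intro mult_mono divide_right_mono) auto
 qed
 also have "... = ta x * (9 * L) + (2 / k) * (4 * k * L) powr (1 - p) * (ta x * Y powr p)" using k by (simp add: field_simps)
 also have "... <= 1 * (9 * L) + (2 / k) * (4 * k * L) powr (1 - p) * (ta x * Y powr p)"
 using t L by (intro add_right_mono mult_right_mono) auto
 finally have 2: "norm (?T x) <= 9 * L * indicator A x + (2 / k) * (4 * k * L) powr (1 - p) * e x"
 using True eY by simp
 have 3: "0 <= e x" using eY t by simp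
 have "ta x * (?cs x * norm (G x) powr p) <= 1 * (1 * norm (G x) powr p)"
 using t psi by (intro mult_mono) auto
 then have 4: "e x <= indicator (cball x0 r) x * norm (G x) powr p" using True x by (simp add: e_def)
 show ?thesis using 1 2 3 4 by blast
 qed
 qed
 have [measurable]: "?cs : BM" using C1_supp_continuous[OF C] by (rule borel_measurable_continuous_onI)
 have em [measurable]: "e : BM" unfolding e_def[abs_def] ta_def by measurable
 have ie: "integrable lborel e"
 proof (rule bint_bound)
 show "ILI x. indicator (cball x0 r) x * norm (G x) powr p" by (rule G_integrable) (use r in auto)
 show "AEL x. norm (e x) <= norm (indicator (cball x0 r) x * norm (G x) powr p)"
 using pt by eventually_elim auto
 qed measurable
 \<comment> \<open>For right-hand side 0 the supersolution inequality says that this pairing is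
   nonnegative, so the energy is bounded by the error term.\<close>
 have "0 <= (LI x. pflux p (G x) <.> ?T x)" using S(1) by simp
 also have "... <= (LI x. (1 / (4 * k)) * ((4 * k * L) powr p * indicator A x - e x))"
 proof (rule integral_mono_AE[OF S(3)])
 show "ILI x. (1 / (4 * k)) * ((4 * k * L) powr p * indicator A x - e x)"
 by (intro integrable_mult_right bint_diff iA ie)
 show "AEL x. pflux p (G x) <.> ?T x <= (1 / (4 * k)) * ((4 * k * L) powr p * indicator A x - e x)"
 using pt by eventually_elim blast
 qed
 also have "... = (1 / (4 * k)) * ((4 * k * L) powr p * measure lborel A - (LI x. e x))"
 using bint_minus[OF integrable_mult_right[OF iA, of "(4 * k * L) powr p"] ie] mA by simp
 finally have eb: "(LI x. e x) <= (4 * k * L) powr p * measure lborel A"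
 using k by (simp add: zero_le_mult_iff zero_le_divide_iff)
 note tr = translation_test[OF adm, folded f_def]
 \<comment> \<open>The constant is 9 + 8: the pointwise bound contributes 1 + 2 * 4 times L, and the
   energy bound contributes (2/k)(4kL).\<close>
 have Tb: "(LI x. norm (?T x)) <= 17 * L * measure lborel A"
 proof -
 have "(LI x. norm (?T x)) <= (LI x. 9 * L * indicator A x + (2 / k) * (4 * k * L) powr (1 - p) * e x)"
 proof (rule integral_mono_AE[OF tr(2)])
 show "ILI x. 9 * L * indicator A x + (2 / k) * (4 * k * L) powr (1 - p) * e x"
 by (intro integrable_mult_right bint_add iA ie)
 show "AEL x. norm (?T x) <= 9 * L * indicator A x + (2 / k) * (4 * k * L) powr (1 - p) * e x"
 using pt by eventually_elim blast
 qed
 also have "... = 9 * L * measure lborel A + (2 / k) * (4 * k * L) powr (1 - p) * (LI x. e x)"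
 using bint_plus[OF integrable_mult_right[OF iA, of "9 * L"] integrable_mult_right[OF ie, of "(2 / k) * (4 * k * L) powr (1 - p)"]]
 by (simp only: integral_mult_right_zero mA)
 also have "... <= 9 * L * measure lborel A + (2 / k) * (4 * k * L) powr (1 - p) * ((4 * k * L) powr p * measure lborel A)"
 using k by (intro add_left_mono mult_left_mono eb) auto
 also have "(2 / k) * (4 * k * L) powr (1 - p) * ((4 * k * L) powr p * measure lborel A) = 8 * L * measure lborel A"
 proof -
 have "(4 * k * L) powr (1 - p) * (4 * k * L) powr p = (4 * k * L) powr (1 - p + p)" by (rule powr_add[symmetric])
 also have "... = 4 * k * L" using k L by simp
 finally have "(2 / k) * ((4 * k * L) powr (1 - p) * (4 * k * L) powr p) * measure lborel A = (2 / k) * (4 * k * L) * measure lborel A" by simp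
 then show ?thesis using k by (simp add: mult.assoc)
 qed
 finally show ?thesis by simp
 qed
 have f0: "0 <= f x" for x unfolding f_def by (intro mult_nonneg_nonneg psi hinge_nonneg)
 have fA: "f x = 0" if "x ~: A" for x
 proof (cases "u x < k")
 case True
 then have "x ~: ball x0 r" using that by (simp add: A_def)
 then have "?cs x = 0" by (intro cap_eq_0[OF r(1)]) (use m in auto)
 then show ?thesis by (simp add: f_def)
 next
 case False
 then have "(k - u x) / k <= 0" using k by (simp add: divide_le_0_iff)
 then show ?thesis by (simp add: f_def hinge_nonpos)
 qed
 have FK: "(LI x. f x) <= 2 * s * (17 * L * measure lborel A)"
 proof (rule Faber_Krahn_L1[OF tr(1) f0 fA _ _ _ s big[folded A_def]])
 show "(LI x. \<bar>f (x + z) - f x\<bar>) <= norm z * (17 * L * measure lborel A)" for z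
 by (rule order_trans[OF tr(3) mult_left_mono[OF Tb]]) simp
 show "0 <= 17 * L * measure lborel A" using L by simp
 qed auto
 define A' where "A' = {x : ball x0 ro. u x < k'}"
 have [measurable]: "A' : sets borel" unfolding A'_def by measurable
 have A'fin: "emeasure lborel A' < \<infinity>"
 by (rule emeasure_bounded_finite) (auto simp: A'_def intro: bounded_subset[OF bounded_ball])
 have iA': "integrable lborel (indicator A' :: 'a => real)" using A'fin by (simp add: integrable_indicator_iff)
 define c where "c = (1 - ro / r) ^ m * ((1 - k' / k)^2 / 2)"
 have low: "AEL x. c * indicator A' x <= f x"
 using u0
 proof eventually_elim
 case (elim x)
 show ?case
 proof (cases "x : A'")
 case True
 then have x: "x : ball x0 ro" "u x < k'" by (auto simp: A'_def)
 have "x : D" using x ro r by (auto simp: subset_eq)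
 then have "0 <= u x" using elim by blast
 then have t: "0 <= (k - u x) / k" "(k - u x) / k <= 1" using x k by auto
 have "1 - k' / k <= (k - u x) / k" using x k by (simp add: field_simps)
 then have "(1 - k' / k)^2 <= ((k - u x) / k)^2" using k by (intro power_mono) auto
 then have "(1 - k' / k)^2 / 2 <= hinge ((k - u x) / k)" using hinge_ge[OF t] by simp
 moreover have "(1 - ro / r) ^ m <= ?cs x" using cap_lower[OF r(1) ro x(1)] .
 ultimately have "(1 - ro / r) ^ m * ((1 - k' / k)^2 / 2) <= ?cs x * hinge ((k - u x) / k)"
 using psi(1) by (intro mult_mono) auto
 then show ?thesis using True unfolding c_def f_def by simp
 next
 case False then show ?thesis using f0 by simp
 qed
 qed
 have "c * measure lborel A' = (LI x. c * indicator A' x)" by simp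
 also have "... <= (LI x. f x)"
 by (rule integral_mono_AE[OF integrable_mult_right[OF iA'] tr(1) low])
 finally show ?thesis using FK unfolding A_def A'_def L_def c_def by (simp add: mult.commute)
qed

end

text \<open>An averaged form of the density theorem. If every point of \<open>E\<close> were bad at
  radius \<open>r\<close>, integration over \<open>E\<close> and Tonelli would bound ei |B_r| |E| by
  half of itself, because small translations move \<open>E\<close> little in measure.\<close>

lemma density_ball:
 fixes E :: "'a::euclidean_space set"
 assumes E: "E : sets borel" "0 < emeasure lborel E" "emeasure lborel E < \<infinity>" and "0 < ei" "0 < r0"
 shows "EX r x. 0 < r & r < r0 & x : E & measure lborel (ball x r - E) <= ei * measure lborel (ball (0::'a) r)"
proof -
 note [measurable] = E(1)
 define m where "m = measure lborel E"
 have em: "emeasure lborel E = ennreal m" using E(3) unfolding m_def by (simp add: emeasure_eq_ennreal_measure)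
 have m: "m > 0" using E(2) unfolding em by simp
 have iE: "integrable lborel (indicator E :: 'a => real)" using E(3) by (simp add: integrable_indicator_iff)
 obtain d where d: "d > 0" "!!z. norm z < d ==> (LI x. norm (indicator E (x + z) - indicator E x :: real)) < ei / 2 * m"
 using L1_translation_continuous[OF iE, of "ei / 2 * m"] \<open>0 < ei\<close> m by auto
 define r where "r = min d r0 / 2"
 have r: "0 < r" "r < d" "r < r0" using d(1) \<open>0 < r0\<close> by (auto simp: r_def min_def)
 have [measurable]: "ball (0::'a) r : sets borel" by simp
 define b where "b = measure lborel (ball (0::'a) r)"
 have eb: "emeasure lborel (ball (0::'a) r) = ennreal b"
 unfolding b_def by (intro emeasure_eq_ennreal_measure) (use emeasure_bounded_finite[of "ball (0::'a) r"] in auto)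
 have b: "b > 0" unfolding b_def using r(1) content_ball_pos[of r 0] by simp
 have "EX x:E. measure lborel (ball x r - E) <= ei * b"
 proof (rule ccontr)
 assume "~ ?thesis"
 then have big: "ei * b < measure lborel (ball x r - E)" if "x : E" for x using that by force
 have shift: "emeasure lborel (ball x r - E) = (NLI z. indicator (ball 0 r) z * (1 - indicator E (x + z)))" for x
 proof -
 have "emeasure lborel (ball x r - E) = emeasure (distr lborel borel ((+) x)) (ball x r - E)" by (simp add: lborel_distr_plus)
 also have "... = emeasure lborel {z. x + z : ball x r - E}" by (subst emeasure_distr) (auto simp: vimage_def)
 also have "... = (NLI z. indicator {z. x + z : ball x r - E} z)"
 proof (rule nn_integral_indicator[symmetric])
 have "(+) x -` (ball x r - E) \<inter> space borel : sets borel"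
 by (rule measurable_sets[of _ borel borel]) auto
 then show "{z. x + z : ball x r - E} : sets lborel" by (simp add: vimage_def)
 qed
 also have "... = (NLI z. indicator (ball 0 r) z * (1 - indicator E (x + z)))"
 by (intro nn_integral_cong) (auto simp: dist_norm split: split_indicator)
 finally show ?thesis .
 qed
 have fin: "emeasure lborel (ball x r - E) < \<infinity>" for x
 by (rule emeasure_bounded_finite) (auto intro: bounded_subset[OF bounded_ball])
 have "ennreal (ei * b) * ennreal m = (NLI x. ennreal (ei * b) * indicator E x)"
 by (subst nn_integral_cmult_indicator) (auto simp: em)
 also have "... <= (NLI x. indicator E x * (NLI z. indicator (ball 0 r) z * (1 - indicator E (x + z))))"
 proof (rule nn_integral_mono)
 fix x :: 'a
 show "ennreal (ei * b) * indicator E x <= indicator E x * (NLI z. indicator (ball 0 r) z * (1 - indicator E (x + z)))"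
 proof (cases "x : E")
 case True
 have "ennreal (ei * b) <= emeasure lborel (ball x r - E)"
 using big[OF True] fin[of x] by (subst emeasure_eq_ennreal_measure) (auto intro!: ennreal_leI)
 then show ?thesis using True unfolding shift by simp
 qed simp
 qed
 also have "... = (NLI x. (NLI z. indicator (ball 0 r) z * (indicator E x * (1 - indicator E (x + z)))))"
 by (intro nn_integral_cong) (auto simp: nn_integral_cmult[symmetric] split: split_indicator)
 also have "... = (NLI z. (NLI x. indicator (ball 0 r) z * (indicator E x * (1 - indicator E (x + z)))))"
 by (rule lborel_pair.Fubini'[symmetric]) measurable
 also have "... <= (NLI z. ennreal (ei / 2 * m) * indicator (ball (0::'a) r) z)"
 proof (rule nn_integral_mono)
 fix z :: 'a
 show "(NLI x. indicator (ball 0 r) z * (indicator E x * (1 - indicator E (x + z)))) <= ennreal (ei / 2 * m) * indicator (ball (0::'a) r) z"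
 proof (cases "z : ball 0 r")
 case True
 have "(NLI x. indicator E x * (1 - indicator E (x + z))) <= (NLI x. ennreal (norm (indicator E (x + z) - indicator E x :: real)))"
 by (intro nn_integral_mono) (auto split: split_indicator)
 also have "... = ennreal (LI x. norm (indicator E (x + z) - indicator E x :: real))"
 using integrable_translate_diff[OF iE, of z] by (intro nn_integral_eq_integral) auto
 also have "... <= ennreal (ei / 2 * m)" using d(2)[of z] True r by (intro ennreal_leI) auto
 finally show ?thesis using True by simp
 qed simp
 qed
 also have "... = ennreal (ei / 2 * m) * ennreal b" by (subst nn_integral_cmult_indicator) (auto simp: eb)
 finally have "ennreal (ei * b * m) <= ennreal (ei / 2 * m * b)"
 proof -
 assume *: "ennreal (ei * b) * ennreal m <= ennreal (ei / 2 * m) * ennreal b"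
 have "ennreal (ei * b) * ennreal m = ennreal (ei * b * m)"
 using \<open>0 < ei\<close> m b by (intro ennreal_mult[symmetric]) auto
 moreover have "ennreal (ei / 2 * m) * ennreal b = ennreal (ei / 2 * m * b)"
 using \<open>0 < ei\<close> m b by (intro ennreal_mult[symmetric]) auto
 ultimately show ?thesis using * by simp
 qed
 then have "ei * b * m <= ei / 2 * m * b" using \<open>0 < ei\<close> m b by (subst (asm) ennreal_le_iff) auto
 moreover have "0 < ei * b * m" using \<open>0 < ei\<close> m b by simp
 ultimately show False by (simp add: mult.commute mult.left_commute)
 qed
 then show ?thesis using r unfolding b_def by blast
qed

context weak_diff
begin

text \<open>Radii and levels shrink together along r t_j and k t_j with t_j decreasing to 1/2. The
  radius in \<open>level_set_estimate\<close> is tied to the induction hypothesis, so each step is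
  linear in the measure with a fixed contraction factor.\<close>

lemma De_Giorgi:
 assumes sup: "supersolution (%_. 0)" and u0: "AEL x. x : D --> 0 <= u x"
 shows "EX th>0. ALL x0 r k. 0 < r --> cball x0 r <= D --> 0 < k -->
 measure lborel {x : ball x0 r. u x < k} <= th * measure lborel (ball (0::'a) r) -->
 (AEL x. x : ball x0 (r / 2) --> k / 2 <= u x)"
proof -
 define m where "m = nat (max 2 \<lceil>p\<rceil>)"
 have m: "2 <= m" "p <= real m" unfolding m_def by linarith+
 define n where "n = DIM('a)"
 have n: "0 < n" by (simp add: n_def)
 define \<omega> where "\<omega> = measure lborel (ball (0::'a) 1)"
 have vol: "measure lborel (ball x s) = s ^ n * \<omega>" if "0 <= s" for s and x :: 'a
 using content_ball[of s x] content_ball[of 1 "0::'a"] that by (simp add: \<omega>_def n_def)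
 have \<omega>: "\<omega> > 0" unfolding \<omega>_def using content_ball_pos[of 1 "0::'a"] by simp
 \<comment> \<open>The growth per step of the constants: the ratio 1 - t_(j+1)/t_j >= 2^(-j-2)
   enters to the power m through the cutoff and squared through \<open>hinge\<close>.\<close>
 define B where "B = (2::real) ^ (m + 2)"
 have B: "1 <= B" unfolding B_def by (rule one_le_power) simp
 then have B: "1 <= B" "0 < B" by auto
 \<comment> \<open>From 2 * 17 * 2m with the radius bounded below by r/2, giving 136 m, times the 2
   * 4^(m+2) left in the reciprocal of \<open>Q\<close>.\<close>
 define C where "C = 272 * real m * 4 ^ (m + 2)"
 have C: "C > 0" using m by (simp add: C_def)
 \<comment> \<open>Makes C si equal to the contraction factor 1/B^n.\<close>
 define si where "si = 1 / (C * B ^ n)"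
 have si: "si > 0" using C B by (simp add: si_def)
 \<comment> \<open>With this value the induction hypothesis says precisely that twice the measure is
   at most the volume of a ball of radius si r B^(-j).\<close>
 define th where "th = si ^ n / 2"
 have th: "th > 0" using si by (simp add: th_def)
 have "AEL x. x : ball x0 (r / 2) --> k / 2 <= u x"
 if r: "0 < r" "cball x0 r <= D" and k: "0 < k"
 and start: "measure lborel {x : ball x0 r. u x < k} <= th * measure lborel (ball (0::'a) r)" for x0 r k
 proof -
 define t where "t j = (1 + (1/2) ^ j) / (2::real)" for j
 have t: "1 / 2 < t j" "t j <= 1" for j
 unfolding t_def by (auto simp: power_le_one)
 have tS: "t (Suc j) < t j" for j unfolding t_def by (simp add: divide_strict_right_mono)
 have ratio: "(1 / 2) ^ (j + 2) <= 1 - t (Suc j) / t j" for j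
 proof -
 have "(1 / 2) ^ (j + 2) * t j <= (1 / 2) ^ (j + 2) * 1" using t(2) by (intro mult_left_mono) auto
 also have "... = t j - t (Suc j)" by (simp add: t_def field_simps)
 finally have "(1 / 2) ^ (j + 2) <= (t j - t (Suc j)) / t j" using t(1)[of j] by (simp add: pos_le_divide_eq)
 also have "... = 1 - t (Suc j) / t j" using t(1)[of j] by (simp add: diff_divide_distrib)
 finally show ?thesis .
 qed
 define a where "a j = measure lborel {x : ball x0 (r * t j). u x < k * t j}" for j
 have meas [measurable]: "{x : ball x0 r'. u x < k'} : sets borel" for r' k' by measurable
 have fin: "emeasure lborel {x : ball x0 r'. u x < k'} < \<infinity>" for r' k'
 by (rule emeasure_bounded_finite) (auto intro: bounded_subset[OF bounded_ball])
 have ea: "emeasure lborel {x : ball x0 (r * t j). u x < k * t j} = ennreal (a j)" for j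
 unfolding a_def by (rule emeasure_eq_ennreal_measure) (use fin[of "r * t j" "k * t j"] in simp)
 have dec: "a j <= th * (r ^ n * \<omega>) * (1 / B ^ n) ^ j" for j
 proof (induction j)
 case 0
 have "a 0 = measure lborel {x : ball x0 r. u x < k}" by (simp add: a_def t_def)
 then show ?case using start vol[of r 0] r by simp
 next
 case (Suc j)
 \<comment> \<open>Shrinking by 1/B compensates the factor B^j in the estimate; the volume shrinks
   by 1/B^n, matching the decay claimed for \<open>a\<close>.\<close>
 define s where "s = si * r * (1 / B) ^ j"
 have s: "s > 0" using si r B by (simp add: s_def)
 have "s ^ n * \<omega> = si ^ n * (r ^ n * \<omega>) * (1 / B ^ n) ^ j"
 by (simp add: s_def power_mult_distrib power_divide power_mult[symmetric] mult.commute)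
 moreover have "2 * a j <= 2 * (si ^ n / 2 * (r ^ n * \<omega>) * (1 / B ^ n) ^ j)" using Suc unfolding th_def by linarith
 ultimately have "2 * a j <= s ^ n * \<omega>" by linarith
 then have big: "emeasure lborel {x : ball x0 (r * t j). u x < k * t j} * 2 <= emeasure lborel (ball (0::'a) s)"
 proof -
 assume *: "2 * a j <= s ^ n * \<omega>"
 have "emeasure lborel (ball (0::'a) s) = ennreal (s ^ n * \<omega>)"
 using vol[of s 0] s emeasure_bounded_finite[of "ball (0::'a) s"]
 by (subst emeasure_eq_ennreal_measure) auto
 moreover have "ennreal (a j) * 2 = ennreal (2 * a j)" by (simp add: ennreal_mult'' mult.commute a_def)
 ultimately show ?thesis unfolding ea using * by (simp add: ennreal_leI)
 qed
 have rj: "0 < r * t j" "cball x0 (r * t j) <= D" "0 <= r * t (Suc j)" "r * t (Suc j) <= r * t j"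
 "0 < k * t j" "0 < k * t (Suc j)" "k * t (Suc j) <= k * t j"
 proof -
 have "r * t j <= r * 1" using t(2) r by (intro mult_left_mono) auto
 then show "cball x0 (r * t j) <= D" using r(2) by (auto simp: subset_eq)
 qed (use r k t(1)[of j] t(1)[of "Suc j"] tS[of j] in auto)
 have "a (Suc j) * ((1 - (r * t (Suc j)) / (r * t j)) ^ m * ((1 - (k * t (Suc j)) / (k * t j))^2 / 2))
 <= 2 * s * (17 * (2 * real m / (r * t j)) * a j)"
 unfolding a_def by (rule level_set_estimate[OF sup u0 rj m s big])
 then have E: "a (Suc j) * ((1 - t (Suc j) / t j) ^ (m + 2) / 2) <= 2 * s * (17 * (2 * real m / (r * t j)) * a j)"
 using r k by (simp add: power_add power2_eq_square mult_ac)
 have a0: "0 <= a i" for i by (simp add: a_def)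
 define Q where "Q = ((1 / 2) ^ (j + 2)) ^ (m + 2) / (2::real)"
 have Q: "Q > 0" by (simp add: Q_def)
 have "a (Suc j) * Q <= a (Suc j) * ((1 - t (Suc j) / t j) ^ (m + 2) / 2)"
 unfolding Q_def using ratio[of j] a0 by (intro mult_left_mono divide_right_mono power_mono) auto
 also note E
 also have "2 * s * (17 * (2 * real m / (r * t j)) * a j) <= 2 * s * (17 * (2 * real m / (r * (1/2))) * a j)"
 proof -
 have "r * (1/2) <= r * t j" using t(1)[of j] r by (intro mult_left_mono) auto
 then have "2 * real m / (r * t j) <= 2 * real m / (r * (1/2))" using r t(1)[of j] by (intro divide_left_mono) (auto intro: mult_pos_pos)
 then show ?thesis using s a0[of j] by (intro mult_left_mono mult_right_mono) auto
 qed
 also have "... = 136 * real m / r * s * a j" by simp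
 finally have F: "a (Suc j) * Q <= 136 * real m / r * s * a j" .
 have "1 / Q = 2 * (4 ^ (m + 2) * B ^ j)"
 proof -
 have "((1 / 2) ^ (j + 2)) ^ (m + 2) = 1 / ((2::real) ^ (j + 2)) ^ (m + 2)" by (simp only: power_one_over)
 also have "((2::real) ^ (j + 2)) ^ (m + 2) = 2 ^ ((j + 2) * (m + 2))" by (rule power_mult[symmetric])
 also have "(j + 2) * (m + 2) = (m + 2) * j + 2 * (m + 2)" by (simp add: algebra_simps)
 also have "(2::real) ^ ((m + 2) * j + 2 * (m + 2)) = B ^ j * 4 ^ (m + 2)"
 proof -
 have "(2::real) ^ (2 * (m + 2)) = (2 ^ 2) ^ (m + 2)" by (rule power_mult)
 moreover have "(2::real) ^ 2 = 4" by simp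
 moreover have "(2::real) ^ ((m + 2) * j) = B ^ j" unfolding B_def by (rule power_mult)
 moreover have "(2::real) ^ ((m + 2) * j + 2 * (m + 2)) = 2 ^ ((m + 2) * j) * 2 ^ (2 * (m + 2))" by (rule power_add)
 ultimately show ?thesis by (simp only:)
 qed
 finally show ?thesis by (simp add: Q_def)
 qed
 moreover have "a (Suc j) * Q * (1 / Q) <= (136 * real m / r * s * a j) * (1 / Q)"
 using F Q by (intro mult_right_mono) auto
 moreover have "a (Suc j) * Q * (1 / Q) = a (Suc j)" using Q by simp
 ultimately have "a (Suc j) <= (136 * real m / r * s * a j) * (2 * (4 ^ (m + 2) * B ^ j))" by (simp only:)
 also have "... = C * si * a j" using r B by (simp add: C_def s_def power_divide)
 also have "... = (1 / B ^ n) * a j" using C by (simp add: si_def)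
 also have "... <= (1 / B ^ n) * (th * (r ^ n * \<omega>) * (1 / B ^ n) ^ j)" using B Suc by (intro mult_left_mono) auto
 finally show ?case by simp
 qed
 have "measure lborel {x : ball x0 (r / 2). u x < k / 2} <= a j" for j
 proof -
 have "r / 2 <= r * t j" "k / 2 <= k * t j" using t(1)[of j] r k by auto
 then have "emeasure lborel {x : ball x0 (r / 2). u x < k / 2} <= emeasure lborel {x : ball x0 (r * t j). u x < k * t j}"
 by (intro emeasure_mono) auto
 then show ?thesis unfolding a_def measure_def using fin by (intro enn2real_mono) auto
 qed
 then have le: "measure lborel {x : ball x0 (r / 2). u x < k / 2} <= th * (r ^ n * \<omega>) * (1 / B ^ n) ^ j" for j
 using dec order_trans by blast
 have "1 < B" unfolding B_def by (rule one_less_power) auto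
 then have "B ^ n > 1" using n by (rule one_less_power)
 then have "(%j. th * (r ^ n * \<omega>) * (1 / B ^ n) ^ j) ----> th * (r ^ n * \<omega>) * 0"
 by (intro tendsto_intros LIMSEQ_realpow_zero) auto
 then have "measure lborel {x : ball x0 (r / 2). u x < k / 2} <= 0"
 using le by (intro LIMSEQ_le_const[of _ 0]) auto
 then have "emeasure lborel {x : ball x0 (r / 2). u x < k / 2} = 0"
 using fin[of "r / 2" "k / 2"] by (subst emeasure_eq_ennreal_measure) (auto simp: measure_le_0_iff)
 then have "AEL x. x ~: {x : ball x0 (r / 2). u x < k / 2}"
 using meas by (intro AE_not_in) (auto simp: null_sets_def)
 then show ?thesis by eventually_elim auto
 qed
 then show ?thesis using th by blast
qed

text \<open>Some superlevel set inside a compact subset of \<open>D\<close> has positive measure.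
  Around one of its points it nearly fills a small ball, which is the smallness assumption of
  \<open>De_Giorgi\<close>.\<close>

lemma positivity_start:
 assumes sup: "supersolution (%_. 0)" and u0: "AEL x. x : D --> 0 <= u x"
 and nz: "~ (AEL x. x : D --> u x = 0)"
 shows "EX y s c. 0 < s & ball y s <= D & 0 < c & (AEL x. x : ball y s --> c <= u x)"
proof -
 obtain th where th: "th > 0" "!!x0 r k. 0 < r ==> cball x0 r <= D ==> 0 < k ==>
 measure lborel {x : ball x0 r. u x < k} <= th * measure lborel (ball (0::'a) r) ==>
 (AEL x. x : ball x0 (r / 2) --> k / 2 <= u x)"
 using De_Giorgi[OF sup u0] by blast
 obtain C where C: "!!n::nat. compact (C n)" "!!n. C n <= D" "(\<Union>n. C n) = D"
 using open_Union_compact_subsets[OF open_D] by metis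
 define E where "E n = C n \<inter> {x. 1 / real (Suc n) <= u x}" for n
 have [measurable]: "C n : sets borel" for n using C(1) by (rule borel_compact)
 have Em: "C n \<inter> {x. c <= u x} : sets borel" for n c by measurable
 have "EX n N. emeasure lborel (C n \<inter> {x. 1 / real (Suc N) <= u x}) ~= 0"
 proof (rule ccontr)
 assume "~ ?thesis"
 then have "AEL x. x ~: C n \<inter> {x. 1 / real (Suc N) <= u x}" for n N
 using Em by (intro AE_not_in) (auto simp: null_sets_def)
 then have "AEL x. ALL n N. x ~: C n \<inter> {x. 1 / real (Suc N) <= u x}" unfolding AE_all_countable by blast
 then have "AEL x. x : D --> u x = 0"
 using u0
 proof eventually_elim
 case (elim x)
 show ?case
 proof
 assume x: "x : D"
 then obtain n where n: "x : C n" using C(3) by blast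
 have "~ 0 < u x"
 proof
 assume "0 < u x"
 then obtain N where "1 / real (Suc N) < u x" using reals_Archimedean[of "u x"] by (auto simp: inverse_eq_divide)
 moreover have "~ 1 / real (Suc N) <= u x" using elim(1) n by blast
 ultimately show False by linarith
 qed
 then show "u x = 0" using elim x by auto
 qed
 qed
 with nz show False by blast
 qed
 then obtain n N where nN: "emeasure lborel (C n \<inter> {x. 1 / real (Suc N) <= u x}) ~= 0" by blast
 define F where "F = C n \<inter> {x. 1 / real (Suc N) <= u x}"
 define k where "k = 1 / real (Suc N)"
 have k: "k > 0" by (simp add: k_def)
 obtain d where d: "0 < d" "(UN x:C n. cball x d) <= D"
 using compact_subset_open_imp_cball_epsilon_subset[OF C(1) open_D C(2)] by blast
 have "emeasure lborel F < \<infinity>" unfolding F_def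
 by (rule emeasure_bounded_finite) (auto intro: bounded_subset[OF compact_imp_bounded[OF C(1)]])
 moreover have "0 < emeasure lborel F" using nN unfolding F_def by (simp add: zero_less_iff_neq_zero)
 moreover have Fm: "F : sets borel" unfolding F_def by (rule Em)
 ultimately obtain r x where rx: "0 < r" "r < d" "x : F" "measure lborel (ball x r - F) <= th * measure lborel (ball (0::'a) r)"
 using density_ball[of F th d] th(1) d(1) by blast
 have sub: "cball x r <= D"
 proof -
 have "cball x r <= cball x d" using rx by auto
 moreover have "x : C n" using rx(3) by (simp add: F_def)
 ultimately show ?thesis using d(2) by blast
 qed
 have fin: "emeasure lborel (ball x r - F) < \<infinity>"
 by (rule emeasure_bounded_finite) (auto intro: bounded_subset[OF bounded_ball])
 have "measure lborel {z : ball x r. u z < k} <= measure lborel (ball x r - F)"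
 unfolding measure_def using fin Fm by (intro enn2real_mono emeasure_mono) (auto simp: F_def k_def)
 with rx(4) have "AEL z. z : ball x (r / 2) --> k / 2 <= u z"
 by (intro th(2)[OF rx(1) sub k]) simp
 moreover have "ball x (r / 2) <= D" using sub rx(1) by (auto simp: subset_eq)
 ultimately show ?thesis using rx(1) k by (intro exI[of _ x] exI[of _ "r / 2"] exI[of _ "k / 2"]) auto
qed

end

subsection \<open>The one-dimensional profile\<close>

lemma Bernoulli_nonpos_exponent:
 fixes be ro :: real
 assumes "be <= 0" "1 <= ro"
 shows "1 + be * (ro - 1) <= ro powr be"
proof -
 let ?f = "%t. t powr be - 1 - be * (t - 1)"
 have "?f 1 <= ?f ro"
 proof (rule DERIV_nonneg_imp_nondecreasing[OF assms(2)])
 fix t :: real assume t: "1 <= t" "t <= ro"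
 have "(?f has_real_derivative be * t powr (be - 1) - be) (at t)"
 using t by (auto intro!: derivative_eq_intros)
 moreover have "t powr (be - 1) <= 1" using t assms(1) powr_mono[of "be - 1" 0 t] by simp
 then have "be * 1 <= be * t powr (be - 1)" using assms(1) by (intro mult_left_mono_neg) auto
 ultimately show "EX y. (?f has_real_derivative y) (at t) & 0 <= y" by (intro exI conjI) auto
 qed
 then show ?thesis by simp
qed

lemma powr_second_order_lower:
 fixes be ro :: real
 assumes "0 < be" "be <= 1" "1 <= ro"
 shows "1 + be * (ro - 1) - be * (1 - be) / 2 * (ro - 1)^2 <= ro powr be"
proof -
 let ?f = "%t. t powr be - 1 - be * (t - 1) + be * (1 - be) / 2 * (t - 1)^2"
 have "?f 1 <= ?f ro"
 proof (rule DERIV_nonneg_imp_nondecreasing[OF assms(3)])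
 fix t :: real assume t: "1 <= t" "t <= ro"
 have "(?f has_real_derivative be * (t powr (be - 1) - (1 + (be - 1) * (t - 1)))) (at t)"
 using t by (auto intro!: derivative_eq_intros simp: field_simps)
 moreover have "0 <= be * (t powr (be - 1) - (1 + (be - 1) * (t - 1)))"
 using Bernoulli_nonpos_exponent[of "be - 1" t] assms t by simp
 ultimately show "EX y. (?f has_real_derivative y) (at t) & 0 <= y" by blast
 qed
 then show ?thesis by simp
qed

text \<open>Up to the factor (p - 1) w^(p-2), the right-hand side is what the one-dimensional
  operator produces from t^w. It vanishes at w = aa, with derivative aa p - p + 1 >= 0, which is 0
  at the critical exponent; the quadratic lower bound holds in all cases.\<close>

lemma profile_key_inequality:
 fixes p aa w :: real
 assumes p: "1 < p" and aa: "(p - 1) / p <= aa" "aa < 1" and w: "aa <= w"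
 shows "(w - aa)^2 / 2 <= w^2 - w + (1 - aa) * aa powr (p - 1) * w powr (2 - p)"
proof -
 have a0: "0 < aa" using p aa(1) by (smt (verit) divide_pos_pos)
 define x where "x = w / aa - 1"
 have x: "0 <= x" and wx: "w = aa * (1 + x)" using a0 w by (auto simp: x_def field_simps)
 have ap: "0 <= aa * p - p + 1" using p aa(1) by (simp add: field_simps)
 have pw: "aa powr (p - 1) * w powr (2 - p) = aa * (1 + x) powr (2 - p)"
 proof -
 have "aa powr (p - 1) * w powr (2 - p) = aa powr (p - 1) * aa powr (2 - p) * (1 + x) powr (2 - p)"
 unfolding wx using a0 x by (simp add: powr_mult)
 also have "aa powr (p - 1) * aa powr (2 - p) = aa powr (p - 1 + (2 - p))" by (rule powr_add[symmetric])
 also have "... = aa" using a0 by simp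
 finally show ?thesis .
 qed
 have "aa * x^2 / 2 <= aa * (1 + x)^2 - (1 + x) + (1 - aa) * (1 + x) powr (2 - p)"
 \<comment> \<open>For p >= 2 the power has nonpositive exponent and the tangent line suffices. For
   p < 2 it is concave, and the second-order loss is absorbed by half of the quadratic term.\<close>
 proof (cases "2 <= p")
 case True
 have "1 + (2 - p) * x <= (1 + x) powr (2 - p)" using Bernoulli_nonpos_exponent[of "2 - p" "1 + x"] True x by simp
 then have "(1 - aa) * (1 + (2 - p) * x) <= (1 - aa) * (1 + x) powr (2 - p)" using aa(2) by (intro mult_left_mono) auto
 moreover have "aa * (1 + x)^2 - (1 + x) + (1 - aa) * (1 + (2 - p) * x) = aa * x^2 + x * (aa * p - p + 1)"
 by (simp add: power2_eq_square algebra_simps)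
 moreover have "0 <= x * (aa * p - p + 1)" using x ap by simp
 moreover have "aa * x^2 / 2 <= aa * x^2" using a0 by simp
 ultimately show ?thesis by linarith
 next
 case False
 define be where "be = 2 - p"
 have be: "0 < be" "be <= 1" using False p by (auto simp: be_def)
 have "1 + be * x - be * (1 - be) / 2 * x^2 <= (1 + x) powr be" using powr_second_order_lower[OF be, of "1 + x"] x by simp
 then have "(1 - aa) * (1 + be * x - be * (1 - be) / 2 * x^2) <= (1 - aa) * (1 + x) powr (2 - p)"
 unfolding be_def[symmetric] using aa(2) by (intro mult_left_mono) auto
 moreover have "aa * (1 + x)^2 - (1 + x) + (1 - aa) * (1 + be * x - be * (1 - be) / 2 * x^2)
 = aa * x^2 + x * (aa * p - p + 1) - be * ((1 - aa) * (1 - be)) / 2 * x^2"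
 by (simp add: power2_eq_square be_def algebra_simps)
 moreover have "be * ((1 - aa) * (1 - be)) / 2 * x^2 <= aa * x^2 / 2"
 proof -
 have "(1 - aa) * (1 - be) = aa - (aa * p - p + 1)" by (simp add: be_def algebra_simps)
 then have "(1 - aa) * (1 - be) <= aa" using ap by simp
 then have "be * ((1 - aa) * (1 - be)) <= 1 * aa" using be aa(2) by (intro mult_mono) auto
 then have "be * ((1 - aa) * (1 - be)) / 2 * x^2 <= aa / 2 * x^2" by (intro mult_right_mono) auto
 then show ?thesis by simp
 qed
 moreover have "0 <= x * (aa * p - p + 1)" using x ap by simp
 ultimately show ?thesis by linarith
 qed
 then have "aa * (aa * x^2 / 2) <= aa * (aa * (1 + x)^2 - (1 + x) + (1 - aa) * (1 + x) powr (2 - p))"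
 using a0 by (intro mult_left_mono) auto
 moreover have "(w - aa)^2 / 2 = aa * (aa * x^2 / 2)" by (simp add: wx power2_eq_square algebra_simps)
 moreover have "w^2 - w + (1 - aa) * aa powr (p - 1) * w powr (2 - p)
 = aa * (aa * (1 + x)^2 - (1 + x) + (1 - aa) * (1 + x) powr (2 - p))"
 unfolding mult.assoc pw by (simp add: wx power2_eq_square algebra_simps)
 ultimately show ?thesis by simp
qed

text \<open>\<open>w = t F'/F\<close> for the profile \<open>F\<close> below solves \<open>t w' = ...\<close>, with room for errors of relative size \<open>t\<^sup>ga\<close>
 which is uniform in the cutoff scale \<open>ey\<close> and in \<open>ze > 0\<close>.\<close>

definition prof_z :: "real => real => real => real" where
 "prof_z ze ey t = 8 * (ze / 2) * ((ey / t) powr (ze / 2) / (1 - (ey / t) powr (ze / 2)))"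

definition prof_w :: "real => real => real => real => real => real => real" where
 "prof_w aa ga th ze ey t = aa + ze + th * ga * t powr ga + prof_z ze ey t"

text \<open>This is t w'. The cutoff part z satisfies the Riccati equation t z' = - (ze/2) z -
  z^2/8, which explains the last two terms.\<close>

definition prof_d :: "real => real => real => real => real => real" where
 "prof_d ga th ze ey t = th * ga^2 * t powr ga - ze / 2 * prof_z ze ey t - (prof_z ze ey t)^2 / 8"

text \<open>The power 8 of the cutoff is the reciprocal of the coefficient of z^2 in
  \<open>prof_d\<close>. It makes that loss small against the z^2/2 available from the quadratic
  gain, also after the mixed term with \<open>ze\<close> has been absorbed.\<close>

definition prof_F :: "real => real => real => real => real => real => real" where
 "prof_F aa ga th ze ey t = t powr (aa + ze) * exp (th * t powr ga) * max 0 (1 - (ey / t) powr (ze / 2)) ^ 8"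

lemma prof_q:
 fixes ey t ze :: real
 assumes "0 < ey" "ey < t" "0 < ze"
 shows "0 < (ey / t) powr (ze / 2)" "(ey / t) powr (ze / 2) < 1"
proof -
 show "0 < (ey / t) powr (ze / 2)" using assms by simp
 have "(ey / t) powr (ze / 2) < 1 powr (ze / 2)" using assms by (intro powr_less_mono2) auto
 then show "(ey / t) powr (ze / 2) < 1" by simp
qed

lemma prof_z_pos: "0 < ey ==> ey < t ==> 0 < ze ==> 0 < prof_z ze ey t"
 using prof_q[of ey t ze] by (simp add: prof_z_def)

lemma prof_q_DERIV:
 assumes "0 < ey" "0 < t"
 shows "((%t. (ey / t) powr k) has_real_derivative - (k * (ey / t) powr k / t)) (at t)"
proof -
 have "((%t. ey powr k * t powr (- k)) has_real_derivative ey powr k * (- k * t powr (- k - 1))) (at t)"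
 using assms by (auto intro!: derivative_eq_intros)
 moreover have "ey powr k * (- k * t powr (- k - 1)) = - (k * (ey / t) powr k / t)"
 proof -
 have "t powr (- k - 1) = t powr (- k) / t" using assms by (simp add: powr_diff)
 then show ?thesis using assms by (simp add: powr_divide powr_minus field_simps)
 qed
 moreover have "eventually (%s. (ey / s) powr k = ey powr k * s powr (- k)) (nhds t)"
 using eventually_nhds_in_open[of "{0<..}" t] assms
 by (auto elim!: eventually_mono simp: powr_divide powr_minus_divide)
 ultimately show ?thesis
 using DERIV_cong_ev[of t t "%t. (ey / t) powr k" "%t. ey powr k * t powr (- k)"] by auto
qed

lemma prof_w_DERIV:
 assumes "0 < ey" "ey < t" "0 < ze"
 shows "(prof_w aa ga th ze ey has_real_derivative prof_d ga th ze ey t / t) (at t)"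
proof -
 let ?q = "(ey / t) powr (ze / 2)"
 have t: "0 < t" using assms by simp
 note q = prof_q[OF assms]
 have 1: "((%t. th * ga * t powr ga) has_real_derivative th * ga^2 * t powr ga / t) (at t)"
 using t by (auto intro!: derivative_eq_intros simp: powr_diff power2_eq_square)
 have 2: "((%t. 1 - (ey / t) powr (ze / 2)) has_real_derivative ze / 2 * ?q / t) (at t)"
 by (rule derivative_eq_intros prof_q_DERIV[OF assms(1) t] refl)+ simp
 have "(prof_z ze ey has_real_derivative 8 * (ze / 2) *
 ((- (ze / 2 * ?q / t) * (1 - ?q) - ?q * (ze / 2 * ?q / t)) / ((1 - ?q) * (1 - ?q)))) (at t)"
 unfolding prof_z_def[abs_def]
 by (intro DERIV_cmult DERIV_divide prof_q_DERIV[OF assms(1) t] 2) (use q in simp)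
 moreover have "8 * (ze / 2) * ((- (ze / 2 * ?q / t) * (1 - ?q) - ?q * (ze / 2 * ?q / t)) / ((1 - ?q) * (1 - ?q)))
 = (- ze / 2 * prof_z ze ey t - (prof_z ze ey t)^2 / 8) / t"
 proof -
 define Q where "Q = ?q / (1 - ?q)"
 have z: "prof_z ze ey t = 8 * (ze / 2) * Q" by (simp add: prof_z_def Q_def)
 have "(- (ze / 2 * ?q / t) * (1 - ?q) - ?q * (ze / 2 * ?q / t)) / ((1 - ?q) * (1 - ?q)) = - (ze / 2 / t) * (?q / ((1 - ?q) * (1 - ?q)))"
 using q t by (simp add: field_simps)
 also have "?q / ((1 - ?q) * (1 - ?q)) = Q * (1 + Q)"
 using q unfolding Q_def by (simp add: field_simps)
 finally have e: "(- (ze / 2 * ?q / t) * (1 - ?q) - ?q * (ze / 2 * ?q / t)) / ((1 - ?q) * (1 - ?q)) = - (ze / 2 / t) * (Q * (1 + Q))" .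
 show ?thesis unfolding z e using t by (simp add: field_simps power2_eq_square)
 qed
 ultimately have 3: "(prof_z ze ey has_real_derivative (- ze / 2 * prof_z ze ey t - (prof_z ze ey t)^2 / 8) / t) (at t)" by simp
 have "(prof_w aa ga th ze ey has_real_derivative (0 + th * ga^2 * t powr ga / t + (- ze / 2 * prof_z ze ey t - (prof_z ze ey t)^2 / 8) / t)) (at t)"
 unfolding prof_w_def[abs_def] by (intro DERIV_add DERIV_const 1 3)
 moreover have "0 + th * ga^2 * t powr ga / t + (- ze / 2 * prof_z ze ey t - (prof_z ze ey t)^2 / 8) / t = prof_d ga th ze ey t / t"
 by (simp add: prof_d_def add_divide_distrib diff_divide_distrib)
 ultimately show ?thesis by simp
qed

lemma prof_F_pos: "0 < ey ==> ey < t ==> 0 < ze ==> 0 < prof_F aa ga th ze ey t"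
 using prof_q[of ey t ze] by (simp add: prof_F_def)

lemma prof_F_nonneg: "0 <= prof_F aa ga th ze ey t"
 by (simp add: prof_F_def)

lemma prof_F_eq_0:
 assumes "0 < ey" "0 < t" "t <= ey" "0 < ze"
 shows "prof_F aa ga th ze ey t = 0"
proof -
 have "1 powr (ze / 2) <= (ey / t) powr (ze / 2)" using assms by (intro powr_mono2) auto
 then show ?thesis by (simp add: prof_F_def)
qed

lemma prof_F_DERIV:
 assumes "0 < ey" "ey < t" "0 < ze"
 shows "(prof_F aa ga th ze ey has_real_derivative prof_w aa ga th ze ey t * prof_F aa ga th ze ey t / t) (at t)"
proof -
 let ?q = "%t. (ey / t) powr (ze / 2)"
 have t: "0 < t" using assms by simp
 note q = prof_q[OF assms]
 define a where "a t = t powr (aa + ze)" for t :: real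
 define b where "b t = exp (th * t powr ga)" for t :: real
 define c where "c t = (1 - ?q t) ^ 8" for t
 have da: "(a has_real_derivative (aa + ze) / t * a t) (at t)"
 unfolding a_def using t by (auto intro!: derivative_eq_intros simp: powr_diff)
 have db: "(b has_real_derivative th * ga * t powr ga / t * b t) (at t)"
 unfolding b_def using t by (auto intro!: derivative_eq_intros simp: powr_diff)
 have 2: "((%t. 1 - ?q t) has_real_derivative ze / 2 * ?q t / t) (at t)"
 by (rule derivative_eq_intros prof_q_DERIV[OF assms(1) t] refl)+ simp
 have "(c has_real_derivative of_nat 8 * (ze / 2 * ?q t / t * (1 - ?q t) ^ (8 - Suc 0))) (at t)"
 unfolding c_def[abs_def] by (rule DERIV_power[OF 2])
 moreover have "of_nat 8 * (ze / 2 * ?q t / t * (1 - ?q t) ^ (8 - Suc 0)) = prof_z ze ey t / t * c t"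
 proof -
 have "c t = (1 - ?q t) * (1 - ?q t) ^ 7" unfolding c_def by (simp flip: power_Suc)
 moreover have "8 * (ze / 2 * r / t * u ^ 7) = 8 * (ze / 2) * (r / u) / t * (u * u ^ 7)" if "u ~= 0" for r u :: real
 using that by simp
 ultimately show ?thesis using q by (simp add: prof_z_def)
 qed
 ultimately have dc: "(c has_real_derivative prof_z ze ey t / t * c t) (at t)" by (simp only:)
 have "((%t. a t * b t * c t) has_real_derivative
 (((aa + ze) / t * a t) * b t + (th * ga * t powr ga / t * b t) * a t) * c t + (prof_z ze ey t / t * c t) * (a t * b t)) (at t)"
 by (intro DERIV_mult da db dc)
 moreover have "(((aa + ze) / t * a t) * b t + (th * ga * t powr ga / t * b t) * a t) * c t + (prof_z ze ey t / t * c t) * (a t * b t)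
 = prof_w aa ga th ze ey t * (a t * b t * c t) / t"
 using t by (simp add: prof_w_def field_simps)
 moreover have F: "prof_F aa ga th ze ey s = a s * b s * c s" if "ey < s" for s
 using prof_q[OF assms(1) that assms(3)] by (simp add: prof_F_def a_def b_def c_def)
 moreover have "eventually (%s. prof_F aa ga th ze ey s = a s * b s * c s) (nhds t)"
 using eventually_nhds_in_open[of "{ey<..}" t] assms(2) F by (auto elim!: eventually_mono)
 ultimately show ?thesis
 using DERIV_cong_ev[of t t "prof_F aa ga th ze ey" "%t. a t * b t * c t"] F[OF assms(2)] by auto
qed

text \<open>From F' = w F/t one gets t^2 F''/F = t w' - w + w^2, and t w' is
  \<open>prof_d\<close>.\<close>

lemma prof_F1_DERIV:
 fixes aa ga th ze ey t :: real
 assumes "0 < ey" "ey < t" "0 < ze"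
 defines "w \<equiv> prof_w aa ga th ze ey t" and "d \<equiv> prof_d ga th ze ey t"
 shows "((%t. prof_w aa ga th ze ey t * prof_F aa ga th ze ey t / t) has_real_derivative
 (d - w + w^2) * prof_F aa ga th ze ey t / t^2) (at t)"
proof -
 have t: "t ~= 0" using assms by simp
 have "((%t. prof_w aa ga th ze ey t * prof_F aa ga th ze ey t / t) has_real_derivative
 (((d / t) * prof_F aa ga th ze ey t + (w * prof_F aa ga th ze ey t / t) * w) * t - (w * prof_F aa ga th ze ey t) * 1) / (t * t)) (at t)"
 unfolding w_def d_def
 by (intro DERIV_divide DERIV_mult prof_w_DERIV prof_F_DERIV assms(1-3) DERIV_ident t)
 moreover have "(((d / t) * prof_F aa ga th ze ey t + (w * prof_F aa ga th ze ey t / t) * w) * t - (w * prof_F aa ga th ze ey t) * 1) / (t * t)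
 = (d - w + w^2) * prof_F aa ga th ze ey t / t^2"
 using t by (simp add: field_simps power2_eq_square)
 ultimately show ?thesis by simp
qed

lemma prof_F_continuous: "0 < ey ==> continuous_on {0<..} (prof_F aa ga th ze ey)"
 unfolding prof_F_def by (intro continuous_intros) auto

lemma prof_measurable [measurable]:
 "prof_F aa ga th ze ey : BM" "prof_w aa ga th ze ey : BM"
 unfolding prof_F_def[abs_def] prof_w_def[abs_def] prof_z_def by measurable

lemma prof_F_strict_mono:
 assumes "0 < ey" "0 < ze" "0 <= aa" "0 <= th" "0 <= ga" "ey < s" "s < t"
 shows "prof_F aa ga th ze ey s < prof_F aa ga th ze ey t"
proof -
 have s0: "0 < s" using assms by simp
 have "s powr (aa + ze) < t powr (aa + ze)" using assms s0 by (intro powr_less_mono2) auto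
 moreover have "0 < max 0 (1 - (ey / s) powr (ze / 2)) ^ 8" using prof_q[OF assms(1,6,2)] by simp
 ultimately have "s powr (aa + ze) * exp (th * s powr ga) * max 0 (1 - (ey / s) powr (ze / 2)) ^ 8
 < t powr (aa + ze) * exp (th * s powr ga) * max 0 (1 - (ey / s) powr (ze / 2)) ^ 8"
 by (intro mult_strict_right_mono) auto
 also have "... <= t powr (aa + ze) * exp (th * t powr ga) * max 0 (1 - (ey / t) powr (ze / 2)) ^ 8"
 proof (intro mult_mono power_mono)
 show "exp (th * s powr ga) <= exp (th * t powr ga)" using assms s0 by (auto intro!: mult_left_mono powr_mono2)
 have "(ey / t) powr (ze / 2) <= (ey / s) powr (ze / 2)" using assms s0 by (intro powr_mono2 divide_left_mono) auto
 then show "max 0 (1 - (ey / s) powr (ze / 2)) <= max 0 (1 - (ey / t) powr (ze / 2))" by simp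
 qed auto
 finally show ?thesis by (simp add: prof_F_def)
qed

text \<open>Only exp(1) <= 3 is behind the bound. Against the value 4 cc imposed on \<open>u\<close>
  away from the boundary it leaves a margin cc.\<close>

lemma prof_F_upper:
 assumes "0 < ey" "0 <= aa + ze" "0 < t" "t <= 1" "th * t powr ga <= 1"
 shows "prof_F aa ga th ze ey t <= 3"
proof -
 have "t powr (aa + ze) <= 1 powr (aa + ze)" using assms by (intro powr_mono2) auto
 moreover have "exp (th * t powr ga) <= exp 1" using assms by simp
 moreover have "max 0 (1 - (ey / t) powr (ze / 2)) ^ 8 <= 1" by (rule power_le_one) auto
 ultimately have "prof_F aa ga th ze ey t <= 1 * exp 1 * 1"
 unfolding prof_F_def by (intro mult_mono) auto
 also have "... <= 3" using exp_le by simp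
 finally show ?thesis .
qed

text \<open>\<open>ey\<close> is tied to \<open>ze\<close> so that the cutoff factor tends to 1 as \<open>ze \<rightarrow> 0\<close>.\<close>

lemma prof_F_limit:
 assumes "0 < t" "0 <= th"
 shows "\<exists>L\<ge>t powr aa. ((%ze. prof_F aa ga th ze (exp (- 1 / ze^2)) t) ---> L) (at_right 0)"
proof -
 have 1: "((%ze. (exp (- 1 / ze^2) / t) powr (ze / 2)) ---> 0) (at_right 0)"
 proof -
 \<comment> \<open>The logarithm of the cutoff quotient is -1/(2 ze) up to a term tending to 0, so
   the quotient vanishes in the limit.\<close>
 have eq: "(exp (- 1 / ze^2) / t) powr (ze / 2) = exp (- inverse ze / 2 - ze / 2 * ln t)" if "ze > 0" for ze
 proof -
 have "ln (exp (- 1 / ze^2) / t) = - 1 / ze^2 - ln t" using assms by (simp add: ln_div)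
 then have "(exp (- 1 / ze^2) / t) powr (ze / 2) = exp (ze / 2 * (- 1 / ze^2 - ln t))" using assms by (simp add: powr_def)
 also have "ze / 2 * (- 1 / ze^2 - ln t) = - inverse ze / 2 - ze / 2 * ln t"
 using that by (simp add: field_simps power2_eq_square)
 finally show ?thesis .
 qed
 have "filterlim (%ze::real. inverse ze / 2) at_top (at_right 0)"
 using filterlim_tendsto_pos_mult_at_top[OF tendsto_const _ filterlim_inverse_at_top_right, of "1/2"] by simp
 then have "filterlim (%ze. ze / 2 * ln t + inverse ze / 2) at_top (at_right 0)"
 by (rule filterlim_tendsto_add_at_top[rotated, where c = "0 / 2 * ln t"]) (intro tendsto_intros, simp)
 then have "filterlim (%ze. - (ze / 2 * ln t + inverse ze / 2)) at_bot (at_right 0)"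
 by (simp add: filterlim_uminus_at_top)
 then have "filterlim (%ze. - (ze / 2 * ln t) + - (inverse ze / 2)) at_bot (at_right 0)"
 by simp
 then have "((%ze. exp (- (ze / 2 * ln t) + - (inverse ze / 2))) ---> 0) (at_right 0)"
 by (rule filterlim_compose[OF exp_at_bot])
 then have "((%ze. exp (- inverse ze / 2 - ze / 2 * ln t)) ---> 0) (at_right 0)"
 by (simp add: algebra_simps)
 then show ?thesis
 by (rule Lim_transform_eventually) (rule eventually_mono[OF eventually_at_right_less[of 0]], rule eq[symmetric], simp)
 qed
 have "((%ze. t powr (aa + ze) * exp (th * t powr ga) * max 0 (1 - (exp (- 1 / ze^2) / t) powr (ze / 2)) ^ 8)
 ---> t powr (aa + 0) * exp (th * t powr ga) * max 0 (1 - 0) ^ 8) (at_right 0)"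
 using assms by (intro tendsto_intros 1) auto
 then have "((%ze. prof_F aa ga th ze (exp (- 1 / ze^2)) t) ---> t powr aa * exp (th * t powr ga)) (at_right 0)"
 by (simp add: prof_F_def)
 moreover have "t powr aa * 1 <= t powr aa * exp (th * t powr ga)" using assms by (intro mult_left_mono) auto
 ultimately show ?thesis by auto
qed

text \<open>\<open>A\<close> stands for the geometric errors. The correction exp(th t^ga) beats the
  bounded part of these errors, and for small t the z^2 part is absorbed by the quadratic gain;
  \<open>ze\<close> and \<open>ey\<close> do not enter the constants.\<close>

lemma profile_gain:
 fixes p aa ga A :: real
 assumes p: "1 < p" and aa: "(p - 1) / p <= aa" "aa < 1" and ga: "0 < ga" "ga <= 1" and A: "0 <= A"
 shows "EX th ei. 0 < th & 0 < ei & ei <= 1 & th * ei powr ga <= 1 & (ALL ze ey t. 0 < ze --> ze <= 1 --> 0 < ey --> ey < t --> t < ei -->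
 (let w = prof_w aa ga th ze ey t; d = prof_d ga th ze ey t in
 aa <= w & A * t powr ga * (\<bar>d\<bar> + w^2) < d + w^2 - w + (1 - aa) * aa powr (p - 1) * w powr (2 - p)))"
proof -
 have a0: "0 < aa" using p aa(1) by (smt (verit) divide_pos_pos)
 \<comment> \<open>Then th ga^2 t^ga = (20 A + 1) t^ga, which exceeds the error 20 A t^ga coming
   from |d| + w^2 <= 20 + 3 z^2.\<close>
 define th where "th = (20 * A + 1) / ga^2"
 have th: "0 < th" using A ga by (simp add: th_def add_nonneg_pos)
 \<comment> \<open>The three bounds ensure ei <= 1, th t^ga <= 1 and 24 A t^ga <= 1; the last makes
   3 A t^ga z^2 at most z^2/8.\<close>
 define ei where "ei = (min 1 (min (1 / th) (1 / (24 * A + 24)))) powr (1 / ga)"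
 have m0: "0 < min 1 (min (1 / th) (1 / (24 * A + 24)))" using th A by simp
 have ei0: "0 < ei" unfolding ei_def using m0 by (simp only: powr_gt_zero)
 have eiga: "ei powr ga = min 1 (min (1 / th) (1 / (24 * A + 24)))"
 proof -
 have "1 / ga * ga = 1" using ga by simp
 then show ?thesis unfolding ei_def powr_powr by (simp only: powr_one[OF less_imp_le[OF m0]])
 qed
 have ei1: "ei <= 1"
 proof -
 have "ei <= 1 powr (1 / ga)" unfolding ei_def using ga m0 by (intro powr_mono2) auto
 then show ?thesis by simp
 qed
 have thei: "th * ei powr ga <= 1"
 proof -
 have "ei powr ga <= 1 / th" unfolding eiga by simp
 then show ?thesis using th by (simp add: field_simps)
 qed
 have Aei: "24 * A * ei powr ga <= 1"
 proof -
 have "ei powr ga <= 1 / (24 * A + 24)" unfolding eiga by simp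
 then have "(24 * A + 24) * ei powr ga <= 1" using A by (simp add: field_simps)
 moreover have "24 * A * ei powr ga <= (24 * A + 24) * ei powr ga" by (intro mult_right_mono) auto
 ultimately show ?thesis by linarith
 qed
 have main: "aa <= w & A * t powr ga * (\<bar>d\<bar> + w^2) < d + w^2 - w + (1 - aa) * aa powr (p - 1) * w powr (2 - p)"
 if ze: "0 < ze" "ze <= 1" and ey: "0 < ey" "ey < t" and t: "t < ei"
 and w: "w = prof_w aa ga th ze ey t" and d: "d = prof_d ga th ze ey t" for ze ey t w d
 proof -
 have t0: "0 < t" using ey by simp
 define z where "z = prof_z ze ey t"
 have z: "0 < z" unfolding z_def by (rule prof_z_pos[OF ey ze(1)])
 define ta where "ta = t powr ga"
 have ta0: "0 <= ta" by (simp add: ta_def)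
 have ta: "ta <= ei powr ga" unfolding ta_def using t t0 ga by (intro powr_mono2) auto
 have thta: "th * ta <= 1" using thei mult_left_mono[OF ta, of th] th by linarith
 have Ata: "24 * A * ta <= 1" using Aei mult_left_mono[OF ta, of "24 * A"] A by linarith
 define y where "y = th * ga * ta"
 have y0: "0 <= y" unfolding y_def using th ga ta0 by simp
 have y1: "y <= 1"
 proof -
 have "y = ga * (th * ta)" by (simp add: y_def)
 also have "... <= 1 * 1" using ga thta th ta0 by (intro mult_mono) auto
 finally show ?thesis by simp
 qed
 have wz: "w = aa + ze + y + z" by (simp add: w prof_w_def y_def ta_def z_def)
 have dz: "d = ga * y - ze / 2 * z - z^2 / 8" by (simp add: d prof_d_def y_def ta_def z_def power2_eq_square)
 have waa: "aa <= w" using wz ze y0 z by linarith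
 have "(w - aa)^2 / 2 <= w^2 - w + (1 - aa) * aa powr (p - 1) * w powr (2 - p)"
 by (rule profile_key_inequality[OF p aa waa])
 moreover have "ze^2 / 2 + z^2 / 2 <= (w - aa)^2 / 2"
 proof -
 have "(ze + z)^2 <= (w - aa)^2" using wz y0 ze z by (intro power_mono) auto
 moreover have "ze^2 + z^2 <= (ze + z)^2" using ze z by (simp add: power2_sum)
 ultimately show ?thesis by simp
 qed
 moreover have young: "ze / 2 * z <= ze^2 / 4 + z^2 / 4"
 using zero_le_power2[of "ze - z"] by (simp add: power2_diff)
 moreover have "ga * y = th * ga^2 * ta" by (simp add: y_def power2_eq_square)
 moreover have "th * ga^2 = 20 * A + 1" using ga by (simp add: th_def)
 ultimately have low: "ze^2 / 4 + z^2 / 8 + (20 * A + 1) * ta <= d + w^2 - w + (1 - aa) * aa powr (p - 1) * w powr (2 - p)"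
 using dz by (simp add: field_simps)
 have ze2: "ze^2 <= 1" using ze by (simp add: power_le_one)
 have "ga * y <= 1 * 1" using ga y0 y1 by (intro mult_mono) auto
 moreover have "0 <= ga * y" using ga y0 by simp
 moreover have "0 <= ze / 2 * z" "0 <= z^2" using ze z by auto
 ultimately have "\<bar>d\<bar> <= 2 + z^2" using dz young ze2 by linarith
 moreover have "w^2 <= 18 + 2 * z^2"
 proof -
 have "w^2 <= (3 + z)^2" using wz waa a0 aa(2) ze y1 by (intro power_mono) auto
 also have "... <= 18 + 2 * z^2" using zero_le_power2[of "3 - z"] by (simp add: power2_sum power2_diff)
 finally show ?thesis .
 qed
 ultimately have "\<bar>d\<bar> + w^2 <= 20 + 3 * z^2" by linarith
 then have "A * ta * (\<bar>d\<bar> + w^2) <= A * ta * (20 + 3 * z^2)" using A ta0 by (intro mult_left_mono) auto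
 also have "... = 20 * A * ta + (24 * A * ta) * (z^2 / 8)" by (simp add: algebra_simps)
 also have "... <= 20 * A * ta + 1 * (z^2 / 8)" by (intro add_left_mono mult_right_mono Ata) auto
 also have "... < ze^2 / 4 + z^2 / 8 + (20 * A + 1) * ta"
 proof -
 have "0 < ze^2 / 4" using ze by simp
 moreover have "(20 * A + 1) * ta = 20 * A * ta + ta" by (simp add: algebra_simps)
 ultimately show ?thesis using ta0 by linarith
 qed
 also note low
 finally show ?thesis using waa unfolding ta_def by blast
 qed
 show ?thesis
 by (rule exI[of _ th], rule exI[of _ ei]) (use th ei0 ei1 thei main in "auto simp: Let_def")
qed

text \<open>Here \<open>nv\<close> is the length of the gradient of \<open>level\<close>,
  \<open>E\<close> its scaled curvature term and \<open>si\<close> the quotient of t and the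
  distance to the power p. Since w >= aa, the terms w and w^(2-p) are bounded by multiples of w^2,
  so every error is at most a constant times ta (|d| + w^2).\<close>

lemma profile_strict_inequality:
 fixes p aa w d ta nv E si c1 c2 c3 c4 :: real
 assumes p: "1 < p" and aa: "0 < aa" "aa < 1" and w: "aa <= w" and ta: "0 <= ta" and nv: "0 < nv"
 and c: "\<bar>nv powr p - 1\<bar> <= c1 * ta" "nv powr (p - 2) <= c2" "\<bar>E\<bar> <= c3 * ta" "1 - c4 * ta <= si" "0 <= c3" "0 <= c4" "0 <= c1"
 and gain: "(c1 * (1 + 1 / aa) + (c2 * c3 / aa + hardy_lambda p aa * c4 * aa powr (- p)) / (p - 1)) * ta * (\<bar>d\<bar> + w^2)
 < d + w^2 - w + (1 - aa) * aa powr (p - 1) * w powr (2 - p)"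
 shows "0 < nv powr (p - 2) * ((p - 1) * (d - w + w^2) * nv^2 + w * E) + hardy_lambda p aa * si * w powr (2 - p)"
proof -
 let ?mm = "(1 - aa) * aa powr (p - 1)" and ?l = "hardy_lambda p aa"
 have la: "?l = (p - 1) * ?mm" by (simp add: hardy_lambda_def mult.commute mult.left_commute)
 have la0: "0 <= ?l" unfolding la using p aa by simp
 have w0: "0 < w" using w aa by simp
 have ww: "w <= w^2 / aa" using w aa w0 by (simp add: power2_eq_square field_simps)
 have wp: "w powr (2 - p) <= aa powr (- p) * w^2"
 proof -
 have "w powr (2 - p) = w powr 2 * w powr (- p)" by (simp flip: powr_add)
 also have "... <= w powr 2 * aa powr (- p)" using w aa p by (intro mult_left_mono powr_mono2') auto
 finally show ?thesis using w0 by (simp add: mult.commute)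
 qed
 have nv2: "nv powr (p - 2) * nv^2 = nv powr p"
 proof -
 have "nv powr (p - 2) * nv powr 2 = nv powr (p - 2 + 2)" by (rule powr_add[symmetric])
 then show ?thesis using nv by simp
 qed
 have e1: "(p - 1) * (d - w + w^2) * nv powr p \<ge> (p - 1) * (d - w + w^2) - (p - 1) * (c1 * ta * (\<bar>d\<bar> + w^2 / aa + w^2))"
 proof -
 have "\<bar>(d - w + w^2) * (nv powr p - 1)\<bar> <= (\<bar>d\<bar> + w^2 / aa + w^2) * (c1 * ta)"
 unfolding abs_mult
 proof (rule mult_mono[OF _ c(1)])
 have "0 <= w^2" by simp
 then show "\<bar>d - w + w^2\<bar> <= \<bar>d\<bar> + w^2 / aa + w^2" using ww w0 by linarith
 show "0 <= \<bar>d\<bar> + w^2 / aa + w^2" using aa by simp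
 qed simp
 then have "(d - w + w^2) - c1 * ta * (\<bar>d\<bar> + w^2 / aa + w^2) <= (d - w + w^2) * nv powr p"
 by (simp add: abs_le_iff algebra_simps)
 then have "(p - 1) * ((d - w + w^2) - c1 * ta * (\<bar>d\<bar> + w^2 / aa + w^2)) <= (p - 1) * ((d - w + w^2) * nv powr p)"
 using p by (intro mult_left_mono) auto
 then show ?thesis by (simp add: right_diff_distrib mult.assoc)
 qed
 have e2: "nv powr (p - 2) * (w * E) \<ge> - (c2 * c3 * ta * (w^2 / aa))"
 proof -
 have "\<bar>nv powr (p - 2) * (w * E)\<bar> = nv powr (p - 2) * (w * \<bar>E\<bar>)" using w0 by (simp add: abs_mult)
 also have "... <= c2 * (w^2 / aa * (c3 * ta))"
 using c ww w0 ta aa by (intro mult_mono) (auto intro: order_trans[OF powr_ge_zero c(2)])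
 also have "... = c2 * c3 * ta * (w^2 / aa)" by (simp add: ac_simps)
 finally show ?thesis by linarith
 qed
 have e3: "?l * si * w powr (2 - p) \<ge> ?l * w powr (2 - p) - ?l * c4 * ta * (aa powr (- p) * w^2)"
 proof -
 have "(1 - c4 * ta) * w powr (2 - p) <= si * w powr (2 - p)" using c(4) by (intro mult_right_mono) auto
 moreover have "c4 * ta * w powr (2 - p) <= c4 * ta * (aa powr (- p) * w^2)" using wp c(6) ta by (intro mult_left_mono) auto
 ultimately have "w powr (2 - p) - c4 * ta * (aa powr (- p) * w^2) <= si * w powr (2 - p)"
 by (simp add: left_diff_distrib)
 then have "?l * (w powr (2 - p) - c4 * ta * (aa powr (- p) * w^2)) <= ?l * (si * w powr (2 - p))"
 using la0 by (rule mult_left_mono)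
 then show ?thesis by (simp add: right_diff_distrib mult.assoc)
 qed
 define A where "A = c1 * (1 + 1 / aa) + (c2 * c3 / aa + ?l * c4 * aa powr (- p)) / (p - 1)"
 have c2: "0 <= c2" using c(2) powr_ge_zero order_trans by blast
 have "(p - 1) * (A * ta * (\<bar>d\<bar> + w^2)) < (p - 1) * (d + w^2 - w + ?mm * w powr (2 - p))"
 using gain p unfolding A_def by (intro mult_strict_left_mono) auto
 moreover have "(p - 1) * (c1 * ta * (\<bar>d\<bar> + w^2 / aa + w^2)) + c2 * c3 * ta * (w^2 / aa) + ?l * c4 * ta * (aa powr (- p) * w^2)
 <= (p - 1) * (A * ta * (\<bar>d\<bar> + w^2))"
 proof -
 have "(p - 1) * (A * ta * (\<bar>d\<bar> + w^2)) = (p - 1) * (c1 * ta * ((1 + 1 / aa) * (\<bar>d\<bar> + w^2)))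
 + (c2 * c3 / aa + ?l * c4 * aa powr (- p)) * ta * (\<bar>d\<bar> + w^2)"
 proof -
 have "(p - 1) * ((c1 * K + R / (p - 1)) * ta * X) = (p - 1) * (c1 * ta * (K * X)) + R * ta * X" for K R X
 using p by (simp add: field_simps)
 then show ?thesis unfolding A_def .
 qed
 moreover have "(p - 1) * (c1 * ta * (\<bar>d\<bar> + w^2 / aa + w^2)) <= (p - 1) * (c1 * ta * ((1 + 1 / aa) * (\<bar>d\<bar> + w^2)))"
 proof (intro mult_left_mono)
 have "(1 + 1 / aa) * (\<bar>d\<bar> + w^2) = \<bar>d\<bar> + w^2 + \<bar>d\<bar> / aa + w^2 / aa" by (simp add: algebra_simps add_divide_distrib)
 moreover have "0 <= \<bar>d\<bar> / aa" using aa by simp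
 ultimately show "\<bar>d\<bar> + w^2 / aa + w^2 <= (1 + 1 / aa) * (\<bar>d\<bar> + w^2)" by linarith
 qed (use p c(7) ta in auto)
 moreover have "(c2 * c3 / aa + ?l * c4 * aa powr (- p)) * ta * w^2 <= (c2 * c3 / aa + ?l * c4 * aa powr (- p)) * ta * (\<bar>d\<bar> + w^2)"
 using ta la0 c c2 aa by (intro mult_left_mono mult_nonneg_nonneg add_nonneg_nonneg) auto
 moreover have "(c2 * c3 / aa + ?l * c4 * aa powr (- p)) * ta * w^2 = c2 * c3 * ta * (w^2 / aa) + ?l * c4 * ta * (aa powr (- p) * w^2)"
 by (simp add: algebra_simps)
 ultimately show ?thesis by linarith
 qed
 moreover have "(p - 1) * (d + w^2 - w + ?mm * w powr (2 - p)) = (p - 1) * (d - w + w^2) + ?l * w powr (2 - p)"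
 by (simp add: la algebra_simps)
 moreover have "nv powr (p - 2) * ((p - 1) * (d - w + w^2) * nv^2 + w * E) = (p - 1) * (d - w + w^2) * nv powr p + nv powr (p - 2) * (w * E)"
 unfolding nv2[symmetric] by (simp add: algebra_simps)
 ultimately show ?thesis using e1 e2 e3 by linarith
qed

subsection \<open>Normals to a Hoelder boundary\<close>

lemma holder_expansion:
 fixes g :: "'a::euclidean_space => real"
 assumes G: "!!x. GDERIV g x :> G x" and H: "!!x y. norm (G x - G y) <= M * dist x y powr ga" and "0 <= M" "0 <= ga"
 shows "\<bar>g b - g a - (b - a) <.> G a\<bar> <= M * norm (b - a) powr (1 + ga)"
proof -
 let ?S = "closed_segment a b" and ?k = "M * norm (b - a) powr ga"
 have "norm (g b - g a - (%h. h <.> G a) (b - a)) <= norm (b - a) * ?k"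
 proof (rule differentiable_bound_linearization[of a b ?S g "%x h. h <.> G x" a])
 show "a + t *R (b - a) : ?S" if "t : {0..1}" for t :: real
 using that by (auto simp: in_segment algebra_simps intro!: exI[of _ t])
 show "(g has_derivative (%h. h <.> G x)) (at x within ?S)" for x
 using G[of x] unfolding gderiv_def by (rule has_derivative_at_withinI)
 show "onorm ((%h. h <.> G x) - (%h. h <.> G a)) <= ?k" if x: "x : ?S" for x
 proof (rule onorm_le)
 fix h :: 'a
 have "norm (((%h. h <.> G x) - (%h. h <.> G a)) h) <= norm h * norm (G x - G a)"
 using Cauchy_Schwarz_ineq2[of h "G x - G a"] by (simp add: inner_diff_right)
 also have "... <= norm h * ?k"
 proof (rule mult_left_mono)
 have "M * dist x a powr ga <= ?k"
 using segment_bound(1)[OF x] assms by (intro mult_left_mono powr_mono2) (auto simp: dist_norm)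
 then show "norm (G x - G a) <= ?k" using H[of x a] by linarith
 qed simp
 finally show "norm (((%h. h <.> G x) - (%h. h <.> G a)) h) <= ?k * norm h"
 by (simp only: mult.commute[of ?k])
 qed
 qed simp
 then show ?thesis by (cases "a = b") (auto simp: powr_add ac_simps)
qed

text \<open>Points with all admissible normals, instead of a normal field: no choice or continuity
  of the normal has to be discussed, and the two-sided cusp condition with fixed \<open>M\<close>
  and \<open>R\<close> cuts out a compact set.\<close>

definition normal_pairs :: "real => 'a::euclidean_space set => real => real => ('a \<times> 'a) set" where
 "normal_pairs ga Om M R = {(z, n). z : frontier Om & norm n = 1 & (ALL y. norm (y - z) < R -->
 (M * norm (y - z) powr (1 + ga) < (y - z) <.> n --> y : Om) &
 ((y - z) <.> n < - (M * norm (y - z) powr (1 + ga)) --> y ~: Om))}"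

text \<open>For fixed \<open>y\<close> the pairs satisfying one of the strict premises form an open
  set; the condition excludes such sets and is therefore closed.\<close>

lemma compact_normal_pairs:
 fixes Om :: "'a::euclidean_space set"
 assumes "bounded Om" "0 <= ga"
 shows "compact (normal_pairs ga Om M R)"
proof -
 define P where "P y = {q :: 'a \<times> 'a. norm (y - fst q) < R & M * norm (y - fst q) powr (1 + ga) < (y - fst q) <.> snd q}" for y
 define Q where "Q y = {q :: 'a \<times> 'a. norm (y - fst q) < R & (y - fst q) <.> snd q < - (M * norm (y - fst q) powr (1 + ga))}" for y
 have 1: "open (P y)" "open (Q y)" for y
 unfolding P_def Q_def using assms
 by (auto intro!: open_Collect_conj open_Collect_less continuous_intros continuous_on_powr')
 have eq: "normal_pairs ga Om M R = (frontier Om \<times> sphere 0 1) \<inter> ((INT y:- Om. - P y) \<inter> (INT y:Om. - Q y))"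
 by (auto simp: normal_pairs_def P_def Q_def)
 show ?thesis
 unfolding eq using 1 assms
 by (intro compact_Int_closed compact_Times compact_frontier_bounded compact_sphere closed_Int closed_INT) auto
qed

lemma frontier_chart:
 fixes Om :: "'a::euclidean_space set"
 assumes o: "open Om" and g: "continuous_on UNIV g"
 and c: "!!x. x : ball z0 r ==> x : Om \<longleftrightarrow> g (x - (x <.> n) *R n) < x <.> n"
 and z: "z : frontier Om" "z : ball z0 r"
 shows "g (z - (z <.> n) *R n) = z <.> n"
proof -
 have "z ~: Om" using z o by (simp add: frontier_def interior_open)
 moreover have "~ z <.> n < g (z - (z <.> n) *R n)"
 proof
 assume lt: "z <.> n < g (z - (z <.> n) *R n)"
 define S where "S = ball z0 r \<inter> {x. x <.> n < g (x - (x <.> n) *R n)}"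
 have "open S" unfolding S_def
 by (intro open_Int open_ball open_Collect_less continuous_intros continuous_on_compose2[OF g]) auto
 moreover have "z : S \<inter> closure Om" using z lt by (auto simp: S_def frontier_def)
 moreover have "S \<inter> Om = {}" using c by (fastforce simp: S_def)
 ultimately show False using open_Int_closure_eq_empty[of S Om] by auto
 qed
 ultimately show ?thesis using c[OF z(2)] by auto
qed

lemma normal_pairs_mono: "(z, n) : normal_pairs ga Om M R ==> M <= M' ==> R' <= R ==> (z, n) : normal_pairs ga Om M' R'"
 unfolding normal_pairs_def mem_Collect_eq case_prod_conv
 by (smt (verit, best) mult_right_mono powr_ge_zero)

text \<open>The vector \<open>N\<close> is the gradient at z of x -> x . n - g(projection of x).
  Since \<open>N <.> n = 1\<close> its length is at least 1, so after normalisation the Hoelder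
  constant of the chart still works.\<close>

lemma normal_at_chart:
 fixes Om :: "'a::euclidean_space set"
 assumes o: "open Om" and n: "norm n = 1" and G: "!!x. GDERIV g x :> G x"
 and H: "!!x y. norm (G x - G y) <= M * dist x y powr ga" and M: "0 <= M" "0 <= ga"
 and c: "!!x. x : ball z0 r ==> x : Om \<longleftrightarrow> g (x - (x <.> n) *R n) < x <.> n"
 and z: "z : frontier Om" "z : ball z0 (r / 2)"
 shows "EX m. (z, m) : normal_pairs ga Om M (r / 2)"
proof -
 have nn: "n <.> n = 1" using n by (simp add: dot_square_norm)
 define pr where "pr x = x - (x <.> n) *R n" for x
 have r: "0 < r" using z(2) by (metis mem_ball zero_le_dist order.strict_trans1 half_gt_zero_iff)
 have cg: "continuous_on UNIV g"
 using G by (auto simp: continuous_on_eq_continuous_at gderiv_def intro!: has_derivative_continuous)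
 have "g (pr z) = z <.> n"
 unfolding pr_def using z r by (intro frontier_chart[OF o cg c]) auto
 define N where "N = n - pr (G (pr z))"
 have "N <.> n = 1" by (simp add: N_def pr_def inner_diff_left nn)
 then have N: "1 <= norm N" using Cauchy_Schwarz_ineq2[of N n] n by simp
 then have N0: "0 < norm N" by linarith
 have exp: "\<bar>y <.> n - g (pr y) - (y - z) <.> N\<bar> <= M * norm (y - z) powr (1 + ga)" for y
 proof -
 have d: "pr y - pr z = pr (y - z)" by (simp add: pr_def algebra_simps)
 have "norm (pr (y - z)) <= norm (y - z)"
 proof (rule power2_le_imp_le)
 show "(norm (pr (y - z)))^2 <= (norm (y - z))^2"
 unfolding power2_norm_eq_inner pr_def by (simp add: inner_diff_left inner_diff_right nn inner_commute)
 qed simp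
 then have "M * norm (pr y - pr z) powr (1 + ga) <= M * norm (y - z) powr (1 + ga)"
 unfolding d using M by (intro mult_left_mono powr_mono2) auto
 moreover have "y <.> n - g (pr y) - (y - z) <.> N = - (g (pr y) - g (pr z) - (pr y - pr z) <.> G (pr z))"
 unfolding d \<open>g (pr z) = z <.> n\<close>
 by (simp add: N_def pr_def inner_diff_left inner_diff_right inner_commute algebra_simps)
 ultimately show ?thesis
 using holder_expansion[OF G H M, of "pr y" "pr z"] by simp
 qed
 have "(z, N /R norm N) : normal_pairs ga Om M (r / 2)"
 unfolding normal_pairs_def mem_Collect_eq case_prod_conv
 proof (intro conjI allI impI z(1))
 have "N ~= 0" using N by auto
 then show "norm (N /R norm N) = 1" by simp
 fix y assume y: "norm (y - z) < r / 2"
 have yb: "y : ball z0 r" using y z(2) dist_triangle[of z0 y z] by (simp add: dist_norm norm_minus_commute)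
 let ?e = "M * norm (y - z) powr (1 + ga)"
 \<comment> \<open>Multiplying the normalised condition by the length of \<open>N\<close> only
   enlarges the error allowance.\<close>
 have e: "?e <= ?e * norm N" using N M by (simp add: mult_left_mono[of 1 "norm N" ?e, simplified])
 have s: "(y - z) <.> (N /R norm N) = ((y - z) <.> N) / norm N" by (simp add: divide_inverse mult.commute)
 show "y : Om" if "?e < (y - z) <.> (N /R norm N)"
 proof -
 have "?e * norm N < (y - z) <.> N" using that N0 unfolding s by (simp only: pos_less_divide_eq)
 then show ?thesis using exp[of y] e c[OF yb] unfolding pr_def by linarith
 qed
 show "y ~: Om" if "(y - z) <.> (N /R norm N) < - ?e"
 proof -
 have "(y - z) <.> N < - (?e * norm N)" using that N0 unfolding s by (simp only: pos_divide_less_eq mult_minus_left)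
 then show ?thesis using exp[of y] e c[OF yb] unfolding pr_def by linarith
 qed
 qed
 then show ?thesis by blast
qed

lemma exists_normal_pairs:
 fixes Om :: "'a::euclidean_space set"
 assumes "open Om" "bounded Om" and b: "C1_holder_boundary ga Om" and "0 < ga"
 shows "\<exists>M\<ge>1. EX R>0. ALL z:frontier Om. EX n. (z, n) : normal_pairs ga Om M R"
proof -
 have "\<exists>M\<ge>1. EX r>0. ALL z:frontier Om. z : ball z0 r --> (EX n. (z, n) : normal_pairs ga Om M r)" if z0: "z0 : frontier Om" for z0
 proof -
 obtain r n g where r: "r > 0" and n: "norm n = 1" "C1_holder ga g"
 and c: "!!x. x : ball z0 r ==> x : Om \<longleftrightarrow> g (x - (x <.> n) *R n) < x <.> n"
 using b z0 unfolding C1_holder_boundary_def by metis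
 obtain G M where G: "!!x. GDERIV g x :> G x" and M: "!!x y. norm (G x - G y) <= M * dist x y powr ga"
 using n(2) unfolding C1_holder_def by metis
 have "norm (G x - G y) <= max 1 M * dist x y powr ga" for x y
 using M[of x y] by (rule order_trans) (auto intro: mult_right_mono)
 then have "EX m. (z, m) : normal_pairs ga Om (max 1 M) (r / 2)" if "z : frontier Om" "z : ball z0 (r / 2)" for z
 using assms that by (intro normal_at_chart[OF assms(1) n(1) G _ _ _ c]) auto
 then show ?thesis using r by (intro exI[of _ "max 1 M"] conjI exI[of _ "r / 2"]) auto
 qed
 then obtain Mf rf where f: "!!z0. z0 : frontier Om ==> 1 <= Mf z0 & 0 < rf z0 &
 (ALL z:frontier Om. z : ball z0 (rf z0) --> (EX n. (z, n) : normal_pairs ga Om (Mf z0) (rf z0)))"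
 by metis
 have "compact (frontier Om)" using assms by auto
 then obtain C where C: "C <= frontier Om" "finite C" "frontier Om <= (UN c:C. ball c (rf c))"
 by (rule compactE_image[of _ "frontier Om" "%c. ball c (rf c)"]) (use f in force)+
 define M' R' where "M' = Max (insert 1 (Mf ` C))" and "R' = Min (insert 1 (rf ` C))"
 have rf: "0 < rf c" if "c : C" for c using f[OF subsetD[OF C(1) that]] by simp
 have "1 <= M'" "0 < R'" using C(2) rf by (simp_all add: M'_def R'_def Min_gr_iff)
 moreover have "EX n. (z, n) : normal_pairs ga Om M' R'" if z: "z : frontier Om" for z
 proof -
 obtain c where c: "c : C" "z : ball c (rf c)" using subsetD[OF C(3) z] by (rule UN_E)
 note f[OF subsetD[OF C(1) c(1)], THEN conjunct2, THEN conjunct2, rule_format, OF z c(2)]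
 then obtain n where n: "(z, n) : normal_pairs ga Om (Mf c) (rf c)" ..
 have "Mf c <= M'" "R' <= rf c" using C(2) c(1) by (simp_all add: M'_def R'_def)
 then have "(z, n) : normal_pairs ga Om M' R'" by (rule normal_pairs_mono[OF n])
 then show ?thesis by (rule exI)
 qed
 ultimately have "0 < R' & (ALL z:frontier Om. EX n. (z, n) : normal_pairs ga Om M' R')" by simp
 then show ?thesis using \<open>1 <= M'\<close> by (metis (no_types))
qed

lemma ball_infdist_frontier:
 fixes x :: "'a::euclidean_space"
 assumes x: "x : Om"
 shows "ball x (infdist x (frontier Om)) <= Om"
proof
 fix y assume y: "y : ball x (infdist x (frontier Om))"
 show "y : Om"
 proof (rule ccontr)
 let ?B = "ball x (infdist x (frontier Om))"
 assume n: "y ~: Om"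
 have "x : ?B" using y by (metis centre_in_ball mem_ball zero_le_dist order.strict_trans1)
 then have "?B \<inter> frontier Om ~= {}" using x y n by (intro connected_Int_frontier connected_ball) blast+
 then obtain w where "w : ?B" "w : frontier Om" by blast
 then show False using infdist_le[of w "frontier Om" x] by simp
 qed
qed

lemma nearest_frontier:
 assumes "x : Om" "bounded Om" "open (Om :: 'a::euclidean_space set)"
 obtains z where "z : frontier Om" "norm (x - z) = infdist x (frontier Om)" "0 < infdist x (frontier Om)"
proof -
 have "frontier Om ~= {}" using assms not_bounded_UNIV[where ?'a = 'a] by (auto simp: frontier_eq_empty)
 then obtain z where z: "z : frontier Om" "infdist x (frontier Om) = dist x z" using infdist_attains_inf[of "frontier Om" x] by auto
 moreover have "z ~: Om" using z assms by (simp add: frontier_def interior_open)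
 ultimately show ?thesis using that[of z] assms by (metis dist_norm zero_less_dist_iff)
qed

text \<open>If the unit vector from \<open>z\<close> to \<open>x\<close> differed from
  \<open>n\<close>, moving \<open>z\<close> slightly in the direction of their difference would
  enter the ball around \<open>x\<close>, which lies in \<open>Om\<close>, while the normal
  condition puts the moved point outside \<open>Om\<close>.\<close>

lemma normal_pairs_nearest:
 fixes Om :: "'a::euclidean_space set"
 assumes x: "x : Om" and q: "(z, n) : normal_pairs ga Om M R" and "0 < R" "0 < ga"
 and d: "norm (x - z) = infdist x (frontier Om)" "0 < norm (x - z)"
 shows "(x - z) <.> n = norm (x - z)"
proof -
 let ?d = "norm (x - z)"
 have n: "norm n = 1" using q by (simp add: normal_pairs_def)
 \<comment> \<open>With \<open>k\<close> as the defect 1 - cos, one has v . (x - z) = |x - z| k and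
   v . n = -k: the step approaches \<open>x\<close> and at the same time leaves the domain to first
   order.\<close>
 define v where "v = (x - z) /R ?d - n"
 define k where "k = 1 - (x - z) <.> n / ?d"
 have "(x - z) <.> n <= ?d" using norm_cauchy_schwarz[of "x - z" n] n by simp
 then have k0: "0 <= k" unfolding k_def using d by (simp add: pos_divide_le_eq)
 have nn: "n <.> n = 1" and ee: "(x - z) <.> (x - z) = ?d * ?d" using n by (auto simp: dot_square_norm power2_eq_square)
 have ve: "v <.> (x - z) = ?d * k"
 proof -
 have "(w /R norm w - n) <.> w = norm w * (1 - w <.> n / norm w)" if "w <.> w = norm w * norm w" "0 < norm w" for w
 proof -
 have "(w /R norm w - n) <.> w = (w <.> w) / norm w - n <.> w" by (simp add: inner_diff_left divide_inverse mult.commute)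
 then have e: "(w /R norm w - n) <.> w = norm w - n <.> w" using that by simp
 show ?thesis unfolding e using that by (simp add: field_simps inner_commute[of n w])
 qed
 from this[OF ee d(2)] show ?thesis by (simp only: v_def k_def)
 qed
 have vn: "v <.> n = - k"
 proof -
 have "(w /R a - n) <.> n = w <.> n / a - n <.> n" for w a by (simp add: inner_diff_left divide_inverse mult.commute)
 from this[of ?d "x - z"] show ?thesis unfolding v_def k_def nn by simp
 qed
 have vv: "v <.> v = 2 * k"
 proof -
 have "v <.> (w /R a - n) = v <.> w / a - v <.> n" for w a by (simp add: inner_diff_right divide_inverse mult.commute)
 from this[of ?d "x - z"] have "v <.> v = ?d * k / ?d + k" unfolding v_def[symmetric] ve vn by simp
 then show ?thesis using d(2) by simp
 qed
 have "~ 0 < k"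
 proof
 assume k: "0 < k"
 have v: "0 < norm v" using vv k by (metis inner_zero_left less_irrefl mult_pos_pos zero_less_norm_iff zero_less_numeral)
 have t1: "((%s. M * (s powr ga * norm v powr (1 + ga))) ---> M * (0 * norm v powr (1 + ga))) (at_right 0)"
 by (intro tendsto_intros tendsto_zero_powrI[where b = ga]) (use \<open>0 < ga\<close> in "auto simp: eventually_at_right_less[THEN eventually_mono]")
 have t2: "((%s. s * norm v) ---> 0 * norm v) (at_right 0)" by (intro tendsto_intros)
 have "eventually (%s. M * (s powr ga * norm v powr (1 + ga)) < k & s * norm v < R & s < ?d & 0 < s) (at_right 0)"
 using order_tendstoD(2)[OF t1, of k] order_tendstoD(2)[OF t2, of R] k \<open>0 < R\<close> d
 by (intro eventually_conj eventually_at_right_less order_tendstoD(2)[OF tendsto_ident_at]) auto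
 then obtain s where s: "M * (s powr ga * norm v powr (1 + ga)) < k" "s * norm v < R" "s < ?d" "0 < s"
 by (metis (no_types, lifting) eventually_happens trivial_limit_at_right_real)
 let ?y = "z + s *R v"
 have "(norm (w - s *R v))^2 = (norm w)^2 - 2 * s * (v <.> w) + s * s * (v <.> v)" for w
 by (simp add: power2_norm_eq_inner inner_diff_left inner_diff_right inner_commute algebra_simps)
 from this[of "x - z"] have "(norm (x - ?y))^2 = ?d^2 - 2 * (s * k) * (?d - s)"
 unfolding ve vv by (simp add: diff_diff_eq right_diff_distrib mult_ac)
 also have "... < ?d^2" using s k by simp
 finally have "norm (x - ?y) < ?d" by (rule power2_less_imp_less) simp
 then have "?y : Om" using ball_infdist_frontier[OF x] d by (auto simp: dist_norm)
 moreover have "?y ~: Om"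
 proof -
 have "s * (M * (s powr ga * norm v powr (1 + ga))) < s * k" using s by (intro mult_strict_left_mono) auto
 then have "(?y - z) <.> n < - (M * norm (?y - z) powr (1 + ga))"
 using s by (simp add: vn powr_mult powr_add mult_ac)
 moreover have "norm (?y - z) < R" using s by simp
 ultimately show ?thesis using q unfolding normal_pairs_def by blast
 qed
 ultimately show False by blast
 qed
 then show ?thesis using k0 d by (simp add: k_def field_simps)
qed

subsection \<open>The barriers\<close>

text \<open>The factor 8 is twice the 4 that the estimate of the distance to the boundary needs, so
  a surplus 4 M |x - z|^(1 + ga) remains. Close to the base point the set where \<open>level\<close>
  is positive lies in the domain.\<close>

definition level :: "real => real => 'a::euclidean_space \<times> 'a => 'a => real" where
 "level ga M q x = (x - fst q) <.> snd q - 8 * M * norm (x - fst q) powr (1 + ga)"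

text \<open>The gradient of |y|^(1 + ga) is (1 + ga) |y|^(ga - 1) y, which is the flux with exponent
  1 + ga; its derivative is then already available as \<open>pflux'\<close>.\<close>

definition level_grad :: "real => real => 'a::euclidean_space \<times> 'a => 'a => 'a" where
 "level_grad ga M q x = snd q - (8 * M * (1 + ga)) *R pflux (1 + ga) (x - fst q)"

definition level_hess :: "real => real => 'a::euclidean_space \<times> 'a => 'a => 'a => 'a" where
 "level_hess ga M q x b = - ((8 * M * (1 + ga)) *R pflux' (1 + ga) (x - fst q) b)"

lemma level_C2_data:
 fixes q :: "'a::euclidean_space \<times> 'a"
 assumes "open W" "fst q ~: W" "0 < ga"
 shows "C2_data W (level ga M q) (level_grad ga M q) (level_hess ga M q)"
 unfolding C2_data_def
proof (intro conjI ballI allI)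
 show "level ga M q : BM" unfolding level_def by measurable
 show "level_grad ga M q : BM" unfolding level_grad_def pflux_def by measurable
 have ne: "x - fst q ~= 0" if "x : W" for x using that assms by auto
 show "continuous_on W (%x. level_hess ga M q x b)" for b
 unfolding level_hess_def pflux'_def using ne by (intro continuous_intros) auto
 fix x assume x: "x : W"
 let ?y = "x - fst q"
 have y: "0 < norm ?y" using ne[OF x] by simp
 have n: "(norm has_derivative (%e. e <.> sgn ?y)) (at ?y)"
 using GDERIV_norm[OF ne[OF x]] by (simp add: gderiv_def)
 have "((%x. norm (x - fst q)) has_derivative (%e. e <.> sgn ?y)) (at x)"
 by (rule has_derivative_compose[of "%x. x - fst q" "%e. e" x UNIV norm "%e. e <.> sgn ?y", OF _ n]) (auto intro!: derivative_eq_intros)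
 moreover have "((%t. t powr (1 + ga)) has_derivative (%h. h * ((1 + ga) * norm ?y powr ga))) (at (norm ?y))"
 using y has_real_derivative_powr[of "norm ?y" "1 + ga"] by (simp add: has_field_derivative_def mult_commute_abs)
 ultimately have "((%x. norm (x - fst q) powr (1 + ga)) has_derivative (%h. h <.> sgn ?y * ((1 + ga) * norm ?y powr ga))) (at x)"
 by (rule has_derivative_compose)
 then have "(level ga M q has_derivative (%h. h <.> snd q - 8 * M * (h <.> sgn ?y * ((1 + ga) * norm ?y powr ga)))) (at x)"
 unfolding level_def[abs_def]
 by (intro has_derivative_diff has_derivative_mult_right) (auto intro!: derivative_eq_intros)
 moreover have "h <.> snd q - 8 * M * (h <.> sgn ?y * ((1 + ga) * norm ?y powr ga)) = h <.> level_grad ga M q x" for h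
 proof -
 have "norm ?y powr (1 + ga - 2) = norm ?y powr ga / norm ?y" using y powr_diff[of "norm ?y" ga 1] by simp
 then show ?thesis by (simp add: level_grad_def pflux_def inner_diff_right sgn_div_norm divide_inverse mult_ac) (simp add: algebra_simps)
 qed
 ultimately show "GDERIV (level ga M q) x :> level_grad ga M q x" by (simp add: gderiv_def)
 have "((%x. pflux (1 + ga) (x - fst q)) has_derivative pflux' (1 + ga) ?y) (at x)"
 by (rule has_derivative_compose[of "%x. x - fst q" "%e. e" x UNIV "pflux (1 + ga)", OF _ pflux_has_derivative[OF ne[OF x]]]) (auto intro!: derivative_eq_intros)
 then show "(level_grad ga M q has_derivative level_hess ga M q x) (at x)"
 unfolding level_grad_def[abs_def] level_hess_def[abs_def] by (auto intro!: derivative_eq_intros)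
qed (fact assms)

lemma level_grad_near:
 assumes "0 <= ga" "ga <= 1" "0 <= M"
 shows "norm (level_grad ga M q x - snd q) <= 16 * M * norm (x - fst q) powr ga"
proof -
 have "norm (level_grad ga M q x - snd q) = 8 * M * (1 + ga) * norm (x - fst q) powr ga"
 using assms by (simp add: level_grad_def norm_pflux)
 also have "... <= 8 * M * 2 * norm (x - fst q) powr ga"
 using assms by (intro mult_right_mono mult_left_mono) auto
 finally show ?thesis by simp
qed

lemma level_hess_bound:
 assumes "0 < ga" "ga <= 1" "0 <= M"
 shows "norm (level_hess ga M q x b) <= 32 * M * norm (x - fst q) powr (ga - 1) * norm b"
proof (cases "x = fst q")
 case False
 let ?y = "x - fst q"
 have y: "0 < norm ?y" using False by simp
 have "\<bar>?y <.> b\<bar> * norm ?y <= norm ?y * norm b * norm ?y" using Cauchy_Schwarz_ineq2[of ?y b] by (intro mult_right_mono) auto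
 then have "norm ?y powr (ga - 3) * (\<bar>?y <.> b\<bar> * norm ?y) <= norm ?y powr (ga - 3) * (norm ?y powr 2 * norm b)"
 using y by (intro mult_left_mono) (auto simp: power2_eq_square mult_ac)
 also have "... = norm ?y powr (ga - 1) * norm b" using powr_add[of "norm ?y" "ga - 3" 2] by simp
 finally have "\<bar>ga - 1\<bar> * (norm ?y powr (ga - 3) * (\<bar>?y <.> b\<bar> * norm ?y)) <= 1 * (norm ?y powr (ga - 1) * norm b)"
 using assms by (intro mult_mono[of _ 1]) auto
 moreover have "norm (pflux' (1 + ga) ?y b) <= norm ?y powr (ga - 1) * norm b + \<bar>ga - 1\<bar> * (norm ?y powr (ga - 3) * (\<bar>?y <.> b\<bar> * norm ?y))"
 unfolding pflux'_def by (rule order_trans[OF norm_triangle_ineq]) (simp add: abs_mult mult_ac)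
 ultimately have "norm (pflux' (1 + ga) ?y b) <= 2 * (norm ?y powr (ga - 1) * norm b)" by linarith
 then have "8 * M * (1 + ga) * norm (pflux' (1 + ga) ?y b) <= 8 * M * 2 * (2 * (norm ?y powr (ga - 1) * norm b))"
 using assms by (intro mult_mono[of "8 * M * (1 + ga)"] mult_left_mono) auto
 then show ?thesis using assms by (simp add: level_hess_def abs_mult mult_ac)
qed (simp add: level_hess_def pflux'_def)

text \<open>The nearest boundary point lies within twice |x - z| of the base point and outside
  \<open>Om\<close>. The normal condition there costs M (2 |x - z|)^(1 + ga), at most half of what
  \<open>level\<close> subtracts.\<close>

lemma level_bounds:
 fixes Om :: "'a::euclidean_space set"
 assumes q: "q : normal_pairs ga Om M R" and o: "open Om" and ga: "0 < ga" "ga <= 1" and M: "0 < M"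
 and x: "2 * norm (x - fst q) < R" and l: "0 < level ga M q x"
 shows "x : Om" "level ga M q x + 4 * M * norm (x - fst q) powr (1 + ga) <= infdist x (frontier Om)"
 "infdist x (frontier Om) <= norm (x - fst q)" "x ~= fst q"
proof -
 let ?r = "norm (x - fst q)" and ?z = "fst q" and ?n = "snd q"
 have z: "?z : frontier Om" and n: "norm ?n = 1" using q by (auto simp: normal_pairs_def)
 have in1: "norm (y - ?z) < R ==> M * norm (y - ?z) powr (1 + ga) < (y - ?z) <.> ?n ==> y : Om" for y
 using q by (auto simp: normal_pairs_def)
 have "0 <= M * ?r powr (1 + ga)" using M by simp
 then have "M * ?r powr (1 + ga) < (x - ?z) <.> ?n" using l unfolding level_def by linarith
 moreover have "?r < R" using x norm_ge_zero[of "x - ?z"] by linarith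
 ultimately show "x : Om" by (rule in1[rotated])
 show d: "infdist x (frontier Om) <= ?r" using infdist_le[OF z, of x] by (simp add: dist_norm)
 show "x ~= ?z" using l by (auto simp: level_def)
 obtain w where w: "w : frontier Om" "infdist x (frontier Om) = dist x w"
 using infdist_attains_inf[of "frontier Om" x] z by auto
 have "w ~: Om" using w(1) o by (simp add: frontier_def interior_open)
 \<comment> \<open>The distance to the boundary is at most |x - z|, hence the factor 2; the
   assumption 2 |x - z| < R makes the normal condition applicable.\<close>
 have wz: "norm (w - ?z) <= 2 * ?r"
 proof -
 have "norm (w - ?z) <= norm (w - x) + ?r" using norm_triangle_ineq[of "w - x" "x - ?z"] by simp
 then show ?thesis using d w(2) by (simp only: dist_norm norm_minus_commute[of w x])
 qed
 have "(w - ?z) <.> ?n <= M * norm (w - ?z) powr (1 + ga)"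
 proof (rule ccontr)
 assume "~ (w - ?z) <.> ?n <= M * norm (w - ?z) powr (1 + ga)"
 moreover have "norm (w - ?z) < R" using wz x by linarith
 ultimately show False using in1[of w] \<open>w ~: Om\<close> by simp
 qed
 also have "... <= M * (2 * ?r) powr (1 + ga)" using wz M ga by (intro mult_left_mono powr_mono2) auto
 also have "... <= M * (4 * ?r powr (1 + ga))"
 proof -
 have "(2::real) powr (1 + ga) <= 2 powr 2" using ga by (intro powr_mono) auto
 then have "2 powr (1 + ga) * ?r powr (1 + ga) <= 4 * ?r powr (1 + ga)" by (intro mult_right_mono) auto
 then show ?thesis using M by (intro mult_left_mono) (simp_all add: powr_mult)
 qed
 finally have "(w - ?z) <.> ?n <= 4 * M * ?r powr (1 + ga)" by simp
 moreover have "(x - w) <.> ?n <= infdist x (frontier Om)"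
 using norm_cauchy_schwarz[of "x - w" ?n] n w(2) by (simp add: dist_norm)
 moreover have "(x - ?z) <.> ?n = (x - w) <.> ?n + (w - ?z) <.> ?n" by (simp add: inner_diff_left)
 ultimately show "level ga M q x + 4 * M * ?r powr (1 + ga) <= infdist x (frontier Om)"
 unfolding level_def by linarith
qed

text \<open>Hypothesis 1 comes from \<open>level_bounds\<close>, hypothesis 2 says that no higher
  barrier is based at the nearest point. Together they give r <= 2 d, and smallness gives d <= 2 t:
  the point lies in a cone over the base point.\<close>

lemma touching_scale:
 fixes r d t M ga :: real
 assumes ga: "0 < ga" "ga <= 1" and "0 < M" "0 < d" "0 < t" "0 <= r"
 and 1: "t + 4 * M * r powr (1 + ga) <= d" and 2: "d - 8 * M * d powr (1 + ga) <= t" and 3: "16 * M * d powr ga <= 1 / 2"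
 shows "r <= 4 * t" "d <= t * (1 + 32 * M * t powr ga)"
proof -
 have dd: "d powr (1 + ga) = d * d powr ga" using \<open>0 < d\<close> by (simp add: powr_add)
 have two: "2 * y powr (1 + ga) <= (2 * y) powr (1 + ga)" "(2 * y) powr (1 + ga) <= 4 * y powr (1 + ga)" if "0 < y" for y :: real
 proof -
 have "(2::real) powr 1 <= 2 powr (1 + ga)" "(2::real) powr (1 + ga) <= 2 powr 2" using ga by (intro powr_mono; simp)+
 then show "2 * y powr (1 + ga) <= (2 * y) powr (1 + ga)" "(2 * y) powr (1 + ga) <= 4 * y powr (1 + ga)"
 using that mult_right_mono[of 2 "2 powr (1 + ga)" "y powr (1 + ga)"] mult_right_mono[of "2 powr (1 + ga)" 4 "y powr (1 + ga)"]
 by (simp_all add: powr_mult)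
 qed
 have "8 * M * d powr (1 + ga) <= d * (1 / 4)"
 proof -
 have "8 * M * d powr ga <= 1 / 4" using 3 by linarith
 then have "d * (8 * M * d powr ga) <= d * (1 / 4)" using \<open>0 < d\<close> by (intro mult_left_mono) auto
 then show ?thesis unfolding dd by (simp only: mult_ac)
 qed
 then have dt: "d <= 2 * t" using 2 \<open>0 < d\<close> by linarith
 have "4 * M * r powr (1 + ga) <= 8 * M * d powr (1 + ga)" using 1 2 by linarith
 then have "(4 * M) * r powr (1 + ga) <= (4 * M) * (2 * d powr (1 + ga))" by linarith
 then have "r powr (1 + ga) <= 2 * d powr (1 + ga)"
 by (rule mult_left_le_imp_le) (use \<open>0 < M\<close> in simp)
 also have "... <= (2 * d) powr (1 + ga)" by (rule two) fact
 finally have "~ 2 * d < r" using powr_less_mono2[of "1 + ga" "2 * d" r] ga \<open>0 < d\<close> by auto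
 then show "r <= 4 * t" using dt by linarith
 have "d powr (1 + ga) <= (2 * t) powr (1 + ga)" using dt \<open>0 < d\<close> ga by (intro powr_mono2) auto
 also have "... <= 4 * t powr (1 + ga)" by (rule two) fact
 also have "t powr (1 + ga) = t * t powr ga" using \<open>0 < t\<close> by (simp add: powr_add)
 finally have "(8 * M) * d powr (1 + ga) <= (8 * M) * (4 * (t * t powr ga))" using \<open>0 < M\<close> by (intro mult_left_mono) auto
 moreover have "t * (1 + 32 * M * t powr ga) = t + (8 * M) * (4 * (t * t powr ga))" by (simp add: distrib_left)
 ultimately show "d <= t * (1 + 32 * M * t powr ga)" using 2 by linarith
qed

lemma powr_near_one:
 fixes p s :: real
 assumes "1 <= p" "\<bar>s - 1\<bar> <= 1 / 2"
 shows "\<bar>s powr p - 1\<bar> <= p * 2 powr p * \<bar>s - 1\<bar>"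
proof -
 have "norm (s powr p - 1 powr p) <= p * 2 powr p * norm (s - 1)"
 proof (rule field_differentiable_bound[of "{1/2..3/2}" "%s. s powr p" "%s. p * s powr (p - 1)"])
 fix z :: real assume z: "z : {1/2..3/2}"
 show "((%s. s powr p) has_field_derivative p * z powr (p - 1)) (at z within {1/2..3/2})"
 by (rule has_field_derivative_at_within[OF has_real_derivative_powr]) (use z in auto)
 have "z powr (p - 1) <= 2 powr (p - 1)" using z assms by (intro powr_mono2) auto
 also have "... <= 2 powr p" by (intro powr_mono) auto
 finally show "norm (p * z powr (p - 1)) <= p * 2 powr p" using assms by (simp add: abs_mult mult_left_mono)
 next
 have "1 / 2 <= s" "s <= 3 / 2" using assms(2) by linarith+
 then show "s : {1/2..3/2}" "1 : {1/2..3/2::real}" by auto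
 qed simp
 then show ?thesis by simp
qed

lemma powr_le_two_powr_abs:
 fixes s k :: real
 assumes "\<bar>s - 1\<bar> <= 1 / 2"
 shows "s powr k <= 2 powr \<bar>k\<bar>"
proof -
 have s: "1 / 2 <= s" "s <= 2" using assms by linarith+
 show ?thesis
 proof (cases "0 <= k")
 case True
 then show ?thesis using powr_mono2[of k s 2] s by auto
next
 case False
 then have "s powr k <= (1 / 2) powr k" using s by (intro powr_mono2') auto
 also have "... = 2 powr \<bar>k\<bar>" using False by (simp add: powr_divide powr_minus_divide)
 finally show ?thesis .
qed
qed

text \<open>The error constant of \<open>profile_strict_inequality\<close> with c1 = 64 M p 2^p, c2
  = 2^|p - 2|, c3 = 32 M m (1 + |p - 2|) and c4 = 32 M p, where \<open>m\<close> is the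
  dimension.\<close>

definition barrier_const :: "real => real => real => real => real" where
 "barrier_const p aa M m = 64 * M * (p * 2 powr p) * (1 + 1 / aa) +
 (2 powr \<bar>p - 2\<bar> * (32 * M * m * (1 + \<bar>p - 2\<bar>)) / aa + hardy_lambda p aa * (p * (32 * M)) * aa powr (- p)) / (p - 1)"

text \<open>In the cone given by \<open>touching_scale\<close>, the deviations from a half-space are
  all of relative size t^ga: the length of the gradient, the curvature of the level sets, and the
  quotient of t and the distance. The gain of the profile dominates them.\<close>

lemma barrier_strict:
 fixes q :: "'a::euclidean_space \<times> 'a" and x and p aa ga M t d w e F0 :: real
 defines "N \<equiv> level_grad ga M q x"
 assumes p: "1 < p" and aa: "0 < aa" "aa < 1" and ga: "0 < ga" "ga <= 1" and M: "0 < M" and n: "norm (snd q) = 1"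
 and s: "0 < t" "t <= norm (x - fst q)" "norm (x - fst q) <= 4 * t" "16 * M * norm (x - fst q) powr ga <= 1 / 2"
 "0 < d" "d <= t * (1 + 32 * M * t powr ga)"
 and w: "aa <= w" and F0: "0 < F0"
 and gain: "barrier_const p aa M (real DIM('a)) * t powr ga * (\<bar>e\<bar> + w^2) < e + w^2 - w + (1 - aa) * aa powr (p - 1) * w powr (2 - p)"
 shows "N ~= 0"
 "0 < plap p ((w * F0 / t) *R N) (%b. ((e - w + w^2) * F0 / t^2 * (N <.> b)) *R N + (w * F0 / t) *R level_hess ga M q x b)
 + hardy_lambda p aa / d powr p * F0 powr (p - 1)"
proof -
 let ?r = "norm (x - fst q)" and ?ta = "t powr ga" and ?m = "real DIM('a)"
 define La where "La = level_hess ga M q x"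
 define nv where "nv = norm N"
 have r0: "0 < ?r" using s(1,2) by (rule less_le_trans)
 have dn: "\<bar>nv - 1\<bar> <= 16 * M * ?r powr ga"
 proof -
 have "\<bar>nv - norm (snd q)\<bar> <= norm (N - snd q)" unfolding nv_def by (rule norm_triangle_ineq3)
 also have "... <= 16 * M * ?r powr ga" unfolding N_def using ga M by (intro level_grad_near) auto
 finally show ?thesis by (simp only: n)
 qed
 have "?r powr ga <= (4 * t) powr ga" using s ga by (intro powr_mono2) auto
 also have "... = 4 powr ga * ?ta" using s(1) by (simp add: powr_mult)
 also have "... <= 4 powr 1 * ?ta" using ga by (intro mult_right_mono powr_mono) auto
 also have "... = 4 * ?ta" by simp
 finally have "16 * M * ?r powr ga <= 16 * M * (4 * ?ta)" using M by (intro mult_left_mono) auto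
 then have n1: "\<bar>nv - 1\<bar> <= 64 * M * ?ta" and n2: "\<bar>nv - 1\<bar> <= 1 / 2" using dn s(4) by linarith+
 have nv: "0 < nv" using n2 by linarith
 then show N0: "N ~= 0" by (auto simp: nv_def)
 \<comment> \<open>The curvature bracket from \<open>plap_composition\<close>. The Hessian of
   \<open>level\<close> is of order r^(ga - 1); since t <= r and ga <= 1, t X is of order
   t^ga.\<close>
 define X where "X = (SUM b:Basis. La b <.> b) + (p - 2) * (SUM b:Basis. (N <.> La b) * (N <.> b)) / nv^2"
 define k where "k = 32 * M * ?r powr (ga - 1)"
 have k0: "0 <= k" using M by (simp add: k_def)
 have La: "norm (La b) <= k" if "b : Basis" for b
 using level_hess_bound[of ga M q x b] ga M that by (simp add: La_def k_def)
 have "\<bar>SUM b:Basis. La b <.> b\<bar> <= ?m * k"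
 proof (rule order_trans[OF sum_abs])
 have "(SUM b:Basis. \<bar>La b <.> b\<bar>) <= (SUM b:(Basis::'a set). k)"
 using La by (intro sum_mono order_trans[OF Basis_le_norm]) auto
 then show "(SUM b:Basis. \<bar>La b <.> b\<bar>) <= ?m * k" by simp
 qed
 moreover have "\<bar>(p - 2) * (SUM b:Basis. (N <.> La b) * (N <.> b)) / nv^2\<bar> <= \<bar>p - 2\<bar> * (?m * k)"
 proof -
 have "\<bar>SUM b:Basis. (N <.> La b) * (N <.> b)\<bar> <= (SUM b:(Basis::'a set). (nv * k) * nv)"
 proof (intro order_trans[OF sum_abs] sum_mono)
 fix b :: 'a assume b: "b : Basis"
 have "\<bar>N <.> La b\<bar> <= nv * k"
 using Cauchy_Schwarz_ineq2[of N "La b"] mult_left_mono[OF La[OF b], of nv] nv unfolding nv_def by linarith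
 then show "\<bar>(N <.> La b) * (N <.> b)\<bar> <= (nv * k) * nv"
 unfolding abs_mult using b nv k0 by (intro mult_mono) (auto simp: Basis_le_norm nv_def)
 qed
 then have "\<bar>SUM b:Basis. (N <.> La b) * (N <.> b)\<bar> <= (?m * k) * nv^2" by (simp add: power2_eq_square mult_ac)
 then have "\<bar>SUM b:Basis. (N <.> La b) * (N <.> b)\<bar> / nv^2 <= ?m * k" using nv by (simp add: pos_divide_le_eq)
 then have "\<bar>p - 2\<bar> * (\<bar>SUM b:Basis. (N <.> La b) * (N <.> b)\<bar> / nv^2) <= \<bar>p - 2\<bar> * (?m * k)" by (intro mult_left_mono) auto
 then show ?thesis by (simp add: abs_mult)
 qed
 ultimately have "\<bar>X\<bar> <= ?m * k + \<bar>p - 2\<bar> * (?m * k)" unfolding X_def by linarith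
 then have "t * \<bar>X\<bar> <= t * (?m * k + \<bar>p - 2\<bar> * (?m * k))" using s by (intro mult_left_mono) auto
 also have "... = 32 * M * ?m * (1 + \<bar>p - 2\<bar>) * (t * ?r powr (ga - 1))" by (simp add: k_def algebra_simps)
 also have "... <= 32 * M * ?m * (1 + \<bar>p - 2\<bar>) * ?ta"
 proof (intro mult_left_mono)
 have "t * ?r powr (ga - 1) <= t * t powr (ga - 1)" using s ga by (intro mult_left_mono powr_mono2') auto
 also have "... = ?ta" using s powr_add[of t 1 "ga - 1"] by simp
 finally show "t * ?r powr (ga - 1) <= ?ta" .
 qed (use M in auto)
 finally have c3: "\<bar>t * X\<bar> <= 32 * M * ?m * (1 + \<bar>p - 2\<bar>) * ?ta" using s by (simp add: abs_mult)
 have c4: "1 - p * (32 * M) * ?ta <= (t / d) powr p"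
 proof -
 have "1 + (- p) * ((1 + 32 * M * ?ta) - 1) <= (1 + 32 * M * ?ta) powr (- p)"
 using p M by (intro Bernoulli_nonpos_exponent) auto
 also have "... <= (d / t) powr (- p)" using s p by (intro powr_mono2') (auto simp: pos_divide_le_eq mult.commute)
 also have "... = (t / d) powr p" using s by (simp add: powr_divide powr_minus_divide)
 finally show ?thesis by (simp add: mult_ac)
 qed
 have c1: "\<bar>nv powr p - 1\<bar> <= 64 * M * (p * 2 powr p) * ?ta"
 proof -
 have "\<bar>nv powr p - 1\<bar> <= p * 2 powr p * \<bar>nv - 1\<bar>" using p by (intro powr_near_one[OF _ n2]) simp
 also have "... <= p * 2 powr p * (64 * M * ?ta)" by (rule mult_left_mono[OF n1]) (use p in simp)
 finally show ?thesis by (simp only: mult_ac)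
 qed
 have main: "0 < nv powr (p - 2) * ((p - 1) * (e - w + w^2) * nv^2 + w * (t * X)) + hardy_lambda p aa * (t / d) powr p * w powr (2 - p)"
 using gain unfolding barrier_const_def
 by (intro profile_strict_inequality[OF p aa w _ nv c1 powr_le_two_powr_abs[OF n2] c3 c4]) (use M p in auto)
 have w0: "0 < w" using w aa by simp
 \<comment> \<open>With w^(p-2) this is the common homogeneity factor of the p-Laplacian term and
   the potential term; dividing by it leaves the scale-free inequality \<open>main\<close>.\<close>
 define A where "A = F0 powr (p - 1) / t powr p"
 have A: "0 < A" using F0 s by (simp add: A_def)
 have e1: "(w * F0 / t * nv) powr (p - 2) * F0 / t^2 = A * w powr (p - 2) * nv powr (p - 2)"
 proof -
 have "F0 powr (p - 1) = F0 powr (p - 2) * F0" using F0 powr_add[of F0 "p - 2" 1] by simp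
 moreover have "t powr p = t powr (p - 2) * t^2" using s powr_add[of t "p - 2" 2] by simp
 moreover have "(w * F0 / t * nv) powr (p - 2) = w powr (p - 2) * F0 powr (p - 2) / t powr (p - 2) * nv powr (p - 2)"
 using s F0 w0 nv by (simp add: powr_mult powr_divide)
 moreover have "w1 * f1 / t1 * n1 * F0 / t^2 = f1 * F0 / (t1 * t^2) * w1 * n1" for w1 f1 t1 n1 :: real by simp
 ultimately show ?thesis unfolding A_def by (simp only:)
 qed
 have e2: "hardy_lambda p aa / d powr p * F0 powr (p - 1) = A * w powr (p - 2) * (hardy_lambda p aa * (t / d) powr p * w powr (2 - p))"
 proof -
 have "w powr (p - 2) * w powr (2 - p) = 1" using w0 by (simp flip: powr_add)
 then have "A * w powr (p - 2) * (hardy_lambda p aa * (t / d) powr p * w powr (2 - p)) = A * (hardy_lambda p aa * (t / d) powr p)"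
 by (simp add: mult_ac)
 then show ?thesis using s by (auto simp: A_def powr_divide)
 qed
 have "(\<bar>w * F0 / t\<bar> * nv) powr (p - 2) * ((p - 1) * ((e - w + w^2) * F0 / t^2) * nv^2 + (w * F0 / t) * X)
 = (w * F0 / t * nv) powr (p - 2) * F0 / t^2 * ((p - 1) * (e - w + w^2) * nv^2 + w * (t * X))"
 proof -
 have "P * ((p - 1) * (E * F0 / t^2) * nv^2 + (w * F0 / t) * X) = P * F0 / t^2 * ((p - 1) * E * nv^2 + w * (t * X))" for P E :: real
 using s by (simp add: field_simps power2_eq_square)
 moreover have "\<bar>w * F0 / t\<bar> = w * F0 / t" using w0 F0 s by simp
 ultimately show ?thesis by (simp only:)
 qed
 also have "... + hardy_lambda p aa / d powr p * F0 powr (p - 1) = A * w powr (p - 2) *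
 (nv powr (p - 2) * ((p - 1) * (e - w + w^2) * nv^2 + w * (t * X)) + hardy_lambda p aa * (t / d) powr p * w powr (2 - p))"
 unfolding e1 e2 by (simp add: distrib_left mult.assoc)
 also have "0 < ..." using A w0 main by (intro mult_pos_pos) auto
 finally have pos: "0 < (\<bar>w * F0 / t\<bar> * nv) powr (p - 2) * ((p - 1) * ((e - w + w^2) * F0 / t^2) * nv^2 + (w * F0 / t) * X)
 + hardy_lambda p aa / d powr p * F0 powr (p - 1)" .
 have "w * F0 / t ~= 0" using w0 F0 s by simp
 show "0 < plap p ((w * F0 / t) *R N) (%b. ((e - w + w^2) * F0 / t^2 * (N <.> b)) *R N + (w * F0 / t) *R level_hess ga M q x b)
 + hardy_lambda p aa / d powr p * F0 powr (p - 1)"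
 by (subst plap_composition[OF \<open>w * F0 / t ~= 0\<close> N0]) (rule pos[unfolded X_def nv_def La_def])
qed

text \<open>The normalisation \<open>cc\<close> is taken on the region where a barrier is positive
  although |x - z| >= e/2; by \<open>level_bounds\<close> the distance to the boundary is bounded
  below there. It depends neither on \<open>ze\<close> nor on \<open>ey\<close>.\<close>

locale barrier = weak_diff D p u G for D :: "'a::euclidean_space set" and p u G +
 fixes Om :: "'a set" and aa ga M R e th :: real and h :: "'a => real" and cc :: real
 assumes ga: "0 < ga" "ga <= 1" and aa: "0 < aa" "aa < 1" and M: "0 < M" and th: "0 < th"
 and Om: "open Om" "bounded Om"
 and e: "0 < e" "e <= 1" "2 * e < R" "16 * M * e powr ga <= 1 / 2" "th * e powr ga <= 1"
 and D_sub: "D <= Om" and D_near: "!!x. x : Om ==> infdist x (frontier Om) <= 2 * e ==> x : D"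
 and normals: "!!z. z : frontier Om ==> EX n. (z, n) : normal_pairs ga Om M R"
 and sup: "supersolution h"
 and h: "AEL x. x : D --> hardy_lambda p aa / infdist x (frontier Om) powr p * u x powr (p - 1) <= h x"
 and pos: "!!K. compact K ==> K <= D ==> EX c>0. AEL x. x : K --> c <= u x"
 and gain: "!!ze ey t. 0 < ze ==> ze <= 1 ==> 0 < ey ==> ey < t ==> t <= e ==>
 aa <= prof_w aa ga th ze ey t &
 barrier_const p aa M (real DIM('a)) * t powr ga * (\<bar>prof_d ga th ze ey t\<bar> + (prof_w aa ga th ze ey t)^2) <
 prof_d ga th ze ey t + (prof_w aa ga th ze ey t)^2 - prof_w aa ga th ze ey t +
 (1 - aa) * aa powr (p - 1) * prof_w aa ga th ze ey t powr (2 - p)"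
 and cc: "0 < cc" "AEL x. x : Om --> 4 * M * (e / 2) powr (1 + ga) <= infdist x (frontier Om) -->
 infdist x (frontier Om) <= 2 * e --> 4 * cc <= u x"
begin

abbreviation "dl x \<equiv> infdist x (frontier Om)"
abbreviation "NP \<equiv> normal_pairs ga Om M R"
abbreviation "lev \<equiv> level ga M"

lemma lev:
 assumes "q : NP" "norm (x - fst q) <= e" "0 < lev q x"
 shows "x : Om" "lev q x + 4 * M * norm (x - fst q) powr (1 + ga) <= dl x" "dl x <= norm (x - fst q)" "x ~= fst q" "x : D"
 "lev q x <= dl x"
proof -
 have "2 * norm (x - fst q) < R" using assms e by linarith
 note l = level_bounds[OF assms(1) Om(1) ga M this assms(3)]
 show "x : Om" "lev q x + 4 * M * norm (x - fst q) powr (1 + ga) <= dl x" "dl x <= norm (x - fst q)" "x ~= fst q" by (fact l)+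
 have "dl x <= 2 * e" using l(3) assms(2) e by linarith
 then show "x : D" by (rule D_near[OF l(1)])
 have "0 <= 4 * M * norm (x - fst q) powr (1 + ga)" using M by simp
 then show "lev q x <= dl x" using l(2) by linarith
qed

lemma continuous_lev: "continuous_on UNIV (%w. lev (fst w) (snd w))"
 unfolding level_def using ga by (intro continuous_intros continuous_on_powr') auto

lemma isCont_lev2: "isCont (%w. lev (fst w) (snd w)) w"
 using continuous_lev unfolding continuous_on_eq_continuous_at[OF open_UNIV] by (rule bspec) simp

lemma isCont_lev: "isCont (lev q) x"
proof -
 have "isCont (%y. (q, y)) x" by (intro continuous_intros)
 moreover have "isCont (%w. lev (fst w) (snd w)) (q, x)" by (rule isCont_lev2)
 ultimately show ?thesis using isCont_o2[of x "%y. (q, y)" "%w. lev (fst w) (snd w)"] by simp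
qed

lemma isCont_dl: "isCont dl x"
 by (intro continuous_intros)

lemma local_lower:
 assumes "0 < m"
 shows "EX c>0. AEL x. x : Om --> m <= dl x --> dl x <= 2 * e --> c <= u x"
proof -
 define K where "K = closure Om \<inter> ({x. m <= dl x} \<inter> {x. dl x <= 2 * e})"
 have "compact K" unfolding K_def using Om
 by (intro compact_Int_closed closed_Int closed_Collect_le continuous_intros) auto
 moreover have "K <= D"
 proof
 fix x assume x: "x : K"
 have "x ~: frontier Om" using x assms by (auto simp: K_def)
 then have "x : Om" using x Om(1) by (auto simp: K_def frontier_def interior_open)
 then show "x : D" using x by (intro D_near) (auto simp: K_def)
 qed
 ultimately obtain c where "c > 0" "AEL x. x : K --> c <= u x" using pos by blast
 then show ?thesis
 by (intro exI[of _ c] conjI) (auto elim!: eventually_mono simp: K_def intro: closure_subset[THEN subsetD])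
qed

definition V :: "real => real => 'a \<times> 'a => 'a => real" where
 "V ze ey q x = cc * prof_F aa ga th ze ey (lev q x)"

text \<open>The exceptional null set may depend on \<open>q\<close>. Uncountably many base points
  are therefore handled by compactness and at the end by a countable dense set.\<close>

definition below :: "real => real => real => bool" where
 "below ze ey k \<longleftrightarrow> (ALL q:NP. AEL x. norm (x - fst q) <= e --> ey < lev q x --> k * V ze ey q x <= u x)"

lemma V_nonneg: "0 <= V ze ey q x"
 using cc(1) by (simp add: V_def prof_F_nonneg)

lemma V_upper:
 assumes "q : NP" "norm (x - fst q) <= e" "0 < lev q x" "0 < ey" "0 <= ze"
 shows "V ze ey q x <= 3 * cc"
proof -
 have le: "lev q x <= e" using lev(3,6)[OF assms(1-3)] assms(2) by linarith
 have "lev q x powr ga <= e powr ga" using le assms(3) ga by (intro powr_mono2) auto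
 then have "th * lev q x powr ga <= th * e powr ga" using th by (intro mult_left_mono) auto
 then have "prof_F aa ga th ze ey (lev q x) <= 3" using assms le e aa by (intro prof_F_upper) auto
 then show ?thesis using cc(1) by (simp add: V_def)
qed

lemma isCont_V:
 assumes "0 < ey" "0 < lev (fst w) (snd w)"
 shows "isCont (%w. V ze ey (fst w) (snd w)) w"
proof -
 have "isCont (prof_F aa ga th ze ey) (lev (fst w) (snd w))"
 using prof_F_continuous[OF assms(1)] assms(2) by (simp add: continuous_on_eq_continuous_at)
 moreover have "isCont (%w. lev (fst w) (snd w)) w" by (rule isCont_lev2)
 ultimately have "isCont (%w. prof_F aa ga th ze ey (lev (fst w) (snd w))) w" by (rule isCont_o2[rotated])
 then show ?thesis unfolding V_def by (rule isCont_mult[OF continuous_const])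
qed

lemma eventually_ball:
 assumes "eventually P (nhds (x::'b::metric_space))"
 shows "EX r>0. ALL y:ball x r. P y"
 using assms by (auto simp: eventually_nhds_metric dist_commute)

lemma eventually_nhds_isCont:
 "isCont f x ==> f x < (a::real) ==> eventually (%y. f y < a) (nhds x)"
 "isCont f x ==> a < f x ==> eventually (%y. a < f y) (nhds x)"
 by (auto simp: isCont_def eventually_nhds_conv_at intro: order_tendstoD)

lemma near_constant:
 assumes x: "x : Om" "m < dl x" "dl x <= e" and b: "AEL y. y : Om --> m <= dl y --> dl y <= 2 * e --> c <= u y"
 shows "EX r>0. AEL y. y : ball x r --> c <= u y"
proof -
 have "eventually (%y. y : Om & m < dl y & dl y < 2 * e) (nhds x)"
 using x e Om(1) by (intro eventually_conj eventually_nhds_isCont isCont_dl eventually_nhds_in_open) auto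
 from eventually_ball[OF this] obtain r where r: "r > 0" "ALL y:ball x r. y : Om & m < dl y & dl y < 2 * e" by blast
 have "AEL y. y : ball x r --> c <= u y"
 using b by eventually_elim (use r(2) in force)
 then show ?thesis using r(1) by blast
qed

context
 fixes ze ey :: real
 assumes z: "0 < ze" "ze <= 1" and et: "0 < ey"
begin

text \<open>Here \<open>q1\<close> is based at a nearest boundary point and its level at
  \<open>x\<close> is no higher, so the barrier of \<open>q\<close> is a strict subsolution near
  \<open>x\<close> and \<open>strong_touching\<close> separates it from \<open>u\<close>.\<close>

lemma strict_case:
 assumes k: "0 < k" and bel: "below ze ey k" and q: "q : NP" and x: "norm (x - fst q) < e" "ey < lev q x"
 and x1: "norm (x - fst q1) = dl x" "lev q1 x <= lev q x" and q1: "q1 : NP"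
 shows "EX r>0. EX s>0. AEL y. y : ball x r --> k * V ze ey q y + s <= u y"
proof -
 let ?t = "lev q x" and ?r = "norm (x - fst q)" and ?d = "dl x"
 have t: "0 < ?t" using x et by simp
 have q': "norm (x - fst q) <= e" using x by simp
 note L = lev[OF q q' t]
 have d: "0 < ?d" using L(6) t by linarith
 have n: "norm (snd q) = 1" using q by (auto simp: normal_pairs_def)
 have lev1: "lev q1 x = ?d - 8 * M * ?d powr (1 + ga)"
 proof -
 have "(x - fst q1) <.> snd q1 = norm (x - fst q1)"
 by (rule normal_pairs_nearest[of x Om "fst q1" "snd q1" ga M R]) (use q1 x1 d L(1) e ga in auto)
 then show ?thesis using x1(1) by (simp add: level_def)
 qed
 have small: "16 * M * y powr ga <= 1 / 2" if "0 <= y" "y <= e" for y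
 proof -
 have "16 * M * y powr ga <= 16 * M * e powr ga" using that M ga by (intro mult_left_mono powr_mono2) auto
 then show ?thesis using e by linarith
 qed
 have s3: "16 * M * ?d powr ga <= 1 / 2" using d L(3) q' by (intro small) auto
 \<comment> \<open>On the normal through the nearest point the level is exactly d - 8 M d^(1 + ga),
   which supplies the second hypothesis.\<close>
 have sc: "?r <= 4 * ?t" "?d <= ?t * (1 + 32 * M * ?t powr ga)"
 using touching_scale[OF ga M d t norm_ge_zero L(2) _ s3] x1(2) lev1 by auto
 define F where "F t = k * cc * prof_F aa ga th ze ey t" for t
 define F1 where "F1 t = k * cc * (prof_w aa ga th ze ey t * prof_F aa ga th ze ey t / t)" for t
 define F2 where "F2 t = k * cc * ((prof_d ga th ze ey t - prof_w aa ga th ze ey t + (prof_w aa ga th ze ey t)^2) * prof_F aa ga th ze ey t / t^2)" for t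
 have FV: "F (lev q y) = k * V ze ey q y" for y by (simp add: F_def V_def)
 have F0: "0 < F ?t" using k cc(1) prof_F_pos[OF et x(2) z(1)] by (simp add: F_def)
 define v where "v y = hardy_lambda p aa / dl y powr p * F (lev q y) powr (p - 1)" for y
 have te: "?t <= e" using L(3,6) q' by linarith
 note gn = gain[OF z et x(2) te]
 let ?w = "prof_w aa ga th ze ey ?t" and ?e = "prof_d ga th ze ey ?t" and ?N = "level_grad ga M q"
 have tr: "?t <= ?r" using L(3,6) by linarith
 have rs: "16 * M * ?r powr ga <= 1 / 2" using q' by (intro small) auto
 note strict = barrier_strict[OF p aa ga M n t tr sc(1) rs d sc(2) gn[THEN conjunct1] F0 gn[THEN conjunct2]]
 have F12: "F1 ?t = ?w * F ?t / ?t" "F2 ?t = (?e - ?w + ?w^2) * F ?t / ?t^2" by (simp_all add: F_def F1_def F2_def)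
 define P where "P = plap p (F1 ?t *R ?N x) (%b. (F2 ?t * (?N x <.> b)) *R ?N x + F1 ?t *R level_hess ga M q x b)"
 have Pv: "0 < P + v x" using strict(2) unfolding P_def v_def F12 .
 \<comment> \<open>The midpoint between - P and v x. As a constant it is below the right-hand side
   near \<open>x\<close>, because u >= F there, and it still makes the barrier strict at
   \<open>x\<close>.\<close>
 define be where "be = (v x - P) / 2"
 have be: "0 < P + be" "be < v x" using Pv by (auto simp: be_def field_simps)
 define W0 where "W0 = {y. norm (y - fst q) < e & ey < lev q y}"
 have clev: "continuous_on UNIV (lev q)" by (intro continuous_at_imp_continuous_on ballI isCont_lev)
 have oW0: "open W0" unfolding W0_def
 by (intro open_Collect_conj open_Collect_less continuous_intros clev)
 have W0: "y : Om" "y : D" "y ~= fst q" "0 < dl y" if "y : W0" for y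
 proof -
 have 1: "norm (y - fst q) <= e" "0 < lev q y" using that et by (auto simp: W0_def)
 show "y : Om" "y : D" "y ~= fst q" using lev[OF q 1] by auto
 show "0 < dl y" using lev(6)[OF q 1] 1 by linarith
 qed
 have "continuous_on W0 v"
 unfolding v_def[abs_def] F_def
 proof (intro continuous_intros)
 show "continuous_on W0 (%y. prof_F aa ga th ze ey (lev q y))"
 by (rule continuous_on_compose2[OF prof_F_continuous[OF et] continuous_on_subset[OF clev]]) (use et in "auto simp: W0_def")
 have "0 < F (lev q y)" if "y : W0" for y
 using that k cc(1) prof_F_pos[OF et _ z(1)] by (auto simp: F_def W0_def)
 then show "ALL y:W0. k * cc * prof_F aa ga th ze ey (lev q y) ~= 0" unfolding F_def by force
 qed (use W0 in "auto dest!: W0(4)")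
 then have "open (W0 \<inter> v -` {be<..})" by (intro continuous_open_preimage oW0) auto
 moreover define W where "W = W0 \<inter> v -` {be<..}"
 ultimately have oW: "open W" by simp
 have C2l: "C2_data W (lev q) ?N (level_hess ga M q)"
 by (rule level_C2_data[OF oW _ ga(1)]) (use W0(3) in "auto simp: W_def")
 have C2: "C2_data W (%y. F (lev q y)) (%y. F1 (lev q y) *R ?N y)
 (%y b. (F2 (lev q y) * (?N y <.> b)) *R ?N y + F1 (lev q y) *R level_hess ga M q y b)"
 proof (rule C2_data_compose[OF C2l, of "{ey<..}"])
 show "(F has_real_derivative F1 t) (at t)" if "t : {ey<..}" for t
 unfolding F_def[abs_def] F1_def using that by (intro DERIV_cmult prof_F_DERIV et z) auto
 show "(F1 has_real_derivative F2 t) (at t)" if "t : {ey<..}" for t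
 unfolding F1_def[abs_def] F2_def using that by (intro DERIV_cmult prof_F1_DERIV et z) auto
 have ne: "1 - (ey / t) powr (ze / 2) ~= 0" "t ~= 0" "ey / t ~= 0" if "ey < t" for t
 using prof_q[OF et that z(1)] et that by auto
 have cz: "continuous_on {ey<..} (prof_z ze ey)"
 unfolding prof_z_def[abs_def] using ne by (intro continuous_intros) auto
 have cw: "continuous_on {ey<..} (prof_w aa ga th ze ey)"
 unfolding prof_w_def[abs_def] using ne by (intro continuous_intros cz) auto
 have cd: "continuous_on {ey<..} (prof_d ga th ze ey)"
 unfolding prof_d_def[abs_def] using ne by (intro continuous_intros cz) auto
 have cF: "continuous_on {ey<..} (prof_F aa ga th ze ey)"
 using et by (intro continuous_on_subset[OF prof_F_continuous]) auto
 show "continuous_on {ey<..} F2"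
 unfolding F2_def[abs_def] using ne by (intro continuous_intros cw cd cF) auto
 show "F : BM" "F1 : BM" unfolding F_def[abs_def] F1_def[abs_def] by measurable
 qed (auto simp: W_def W0_def)
 have bel': "AEL y. y : W --> F (lev q y) <= u y"
 using bel[unfolded below_def, rule_format, OF q] by eventually_elim (auto simp: W_def W0_def FV)
 have "EX r>0. EX s>0. AEL y. y : ball x r --> F (lev q y) + s <= u y"
 proof (rule strong_touching[OF sup _ C2])
 show "W <= D" using W0(2) by (auto simp: W_def)
 show "x : W" using x be by (auto simp: W_def W0_def)
 have "?w * F ?t / ?t ~= 0" using F0 t gn aa by auto
 then show "F1 ?t *R ?N x ~= 0" using strict(1) unfolding F12 by simp
 show "0 < plap p (F1 ?t *R ?N x) (%b. (F2 ?t * (?N x <.> b)) *R ?N x + F1 ?t *R level_hess ga M q x b) + be"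
 using be(1) by (simp only: P_def)
 show "AEL y. y : W --> F (lev q y) <= u y" by (rule bel')
 show "AEL y. y : W --> be <= h y"
 using h bel'
 proof eventually_elim
 case (elim y)
 show ?case
 proof
 assume y: "y : W"
 then have y0: "y : W0" "be < v y" by (auto simp: W_def)
 have "0 <= F (lev q y)" using k V_nonneg[of ze ey q y] by (simp add: FV)
 then have "F (lev q y) powr (p - 1) <= u y powr (p - 1)" using elim y p by (intro powr_mono2) auto
 moreover have "0 <= hardy_lambda p aa" using p aa by (simp add: hardy_lambda_def)
 ultimately have "v y <= hardy_lambda p aa / dl y powr p * u y powr (p - 1)"
 unfolding v_def by (intro mult_left_mono divide_nonneg_nonneg) auto
 then show "be <= h y" using y0 elim W0(2)[OF y0(1)] by auto
 qed
 qed
 qed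
 then show ?thesis by (simp only: FV)
qed

text \<open>Three reasons for a gap: at the cutoff level the barrier is 0; at distance at least e/2
  from the base point \<open>u\<close> is at least 4 cc against 3 cc; elsewhere the barrier of a
  nearest boundary point decides.\<close>

lemma slack:
 assumes k: "0 < k" "k <= 1" and bel: "below ze ey k" and q: "q : NP" and x: "norm (x - fst q) <= e" "ey <= lev q x"
 shows "EX r>0. EX s>0. AEL y. y : ball x r --> k * V ze ey q x + s <= u y"
proof -
 have t: "0 < lev q x" using x et by simp
 note L = lev[OF q x(1) t]
 have de: "dl x <= e" using L(3) x(1) by linarith
 have cV: "isCont (V ze ey q') y" if "0 < lev q' y" for q' y
 using isCont_o2[of y "%y. (q', y)" "%w. V ze ey (fst w) (snd w)"] isCont_V[OF et, of "(q', y)"] that by (auto intro: continuous_intros)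
 have kV: "k * V ze ey q x <= 3 * cc"
 using mult_mono[OF k(2) V_upper[OF q x(1) t et, of ze]] z V_nonneg by simp
 consider "lev q x = ey" | "e / 2 <= norm (x - fst q)" | "norm (x - fst q) < e / 2" "ey < lev q x"
 using x(2) by linarith
 then show ?thesis
 proof cases
 case 1
 obtain c where c: "c > 0" "AEL x. x : Om --> ey / 2 <= dl x --> dl x <= 2 * e --> c <= u x"
 using local_lower[of "ey / 2"] et by auto
 have "ey / 2 < dl x" using L(6) 1 et by simp
 from near_constant[OF L(1) this de c(2)] obtain r where "r > 0" "AEL y. y : ball x r --> c <= u y" by blast
 moreover have "V ze ey q x = 0" using prof_F_eq_0[OF et, of ey ze] et z 1 by (simp add: V_def)
 ultimately show ?thesis using c(1) by (intro exI[of _ r] conjI exI[of _ c]) auto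
 next
 case 2
 have "4 * M * (e / 2) powr (1 + ga) <= 4 * M * norm (x - fst q) powr (1 + ga)"
 using 2 M e ga by (intro mult_left_mono powr_mono2) auto
 then have "4 * M * (e / 2) powr (1 + ga) < dl x" using L(2) t by linarith
 from near_constant[OF L(1) this de cc(2)] obtain r where r: "r > 0" "AEL y. y : ball x r --> 4 * cc <= u y" by blast
 have "AEL y. y : ball x r --> k * V ze ey q x + cc <= u y" using r(2) by eventually_elim (use kV in auto)
 then show ?thesis using r(1) cc(1) by blast
 next
 case 3
 obtain z1 where z1: "z1 : frontier Om" "norm (x - z1) = dl x" by (rule nearest_frontier[OF L(1) Om(2,1)])
 obtain n1 where q1: "(z1, n1) : NP" using normals[OF z1(1)] by blast
 show ?thesis
 proof (cases "lev (z1, n1) x <= lev q x")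
 case True
 obtain r s where r: "r > 0" "s > 0" "AEL y. y : ball x r --> k * V ze ey q y + s <= u y"
 using strict_case[OF k(1) bel q _ 3(2) _ True q1] 3 z1(2) e by auto
 have "eventually (%y. k * V ze ey q x - s / 2 < k * V ze ey q y) (nhds x)"
 using r(2) by (intro eventually_nhds_isCont continuous_intros cV t) auto
 from eventually_ball[OF this] obtain r' where r': "r' > 0" "ALL y:ball x r'. k * V ze ey q x - s / 2 < k * V ze ey q y" by blast
 have "AEL y. y : ball x (min r r') --> k * V ze ey q x + s / 2 <= u y"
 using r(3) by eventually_elim (use r'(2) in force)
 then show ?thesis using r r' by (intro exI[of _ "min r r'"] conjI exI[of _ "s / 2"]) auto
 next
 \<comment> \<open>The nearest-point barrier is strictly higher at \<open>x\<close> by monotonicity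
   of the profile, and \<open>u\<close> lies above it by \<open>below\<close>; this already leaves
   room over the barrier of \<open>q\<close>.\<close>
 case False
 let ?q1 = "(z1, n1)"
 have lt: "lev q x < lev ?q1 x" using False by simp
 have "V ze ey q x < V ze ey ?q1 x"
 unfolding V_def using prof_F_strict_mono[OF et z(1) _ _ _ 3(2) lt, of aa th ga] aa th ga cc(1) by (intro mult_strict_left_mono) auto
 define s where "s = k * (V ze ey ?q1 x - V ze ey q x) / 2"
 have s: "0 < s" using k \<open>V ze ey q x < V ze ey ?q1 x\<close> by (simp add: s_def)
 have l0: "0 < lev ?q1 x" "ey < lev ?q1 x" using lt t 3(2) by auto
 have zx: "norm (x - z1) < e" using 3(1) z1(2) L(3) e by linarith
 have "k * V ze ey q x + s < k * V ze ey ?q1 x" using s by (simp add: s_def field_simps)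
 then have "eventually (%y. ey < lev ?q1 y & norm (y - z1) < e & k * V ze ey q x + s < k * V ze ey ?q1 y) (nhds x)"
 using l0 zx by (intro eventually_conj eventually_nhds_isCont continuous_intros cV isCont_lev) auto
 from eventually_ball[OF this] obtain r where
 r: "r > 0" "ALL y:ball x r. ey < lev ?q1 y & norm (y - z1) < e & k * V ze ey q x + s < k * V ze ey ?q1 y" by blast
 have "AEL y. y : ball x r --> k * V ze ey q x + s <= u y"
 using bel[unfolded below_def, rule_format, OF q1] by eventually_elim (use r(2) in force)
 then show ?thesis using r(1) s by blast
 qed
 qed
qed

text \<open>The gap of \<open>slack\<close> is made uniform by compactness in the pair of base data
  and point. The set \<open>T\<close> includes the cutoff level itself, where the barrier vanishes,
  so that it is closed.\<close>

lemma below_step: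
 assumes k: "0 < k" "k <= 1" and bel: "below ze ey k"
 shows "EX d>0. below ze ey (k + d)"
proof -
 define T where "T = {w. fst w : NP & norm (snd w - fst (fst w)) <= e & ey <= lev (fst w) (snd w)}"
 have "bounded (frontier Om)" using compact_imp_bounded[OF compact_frontier_bounded[OF Om(2)]] .
 then obtain B where B: "!!z. z : frontier Om ==> norm z <= B" by (auto simp: bounded_iff)
 have eq: "T = (NP \<times> cball 0 (B + e)) \<inter> ({w. norm (snd w - fst (fst w)) <= e} \<inter> {w. ey <= lev (fst w) (snd w)})"
 proof -
 have "norm y <= B + e" if "q : NP" "norm (y - fst q) <= e" for q y
 using B[of "fst q"] that norm_triangle_ineq[of "y - fst q" "fst q"] by (auto simp: normal_pairs_def)
 then show ?thesis by (auto simp: T_def)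
 qed
 have "compact T" unfolding eq using ga Om
 by (intro compact_Int_closed compact_Times compact_normal_pairs compact_cball closed_Int closed_Collect_le continuous_intros continuous_lev) auto
 define P where "P w r s \<longleftrightarrow> (ALL q:NP. q : ball (fst w) r --> (AEL y. y : ball (snd w) r --> norm (y - fst q) <= e --> ey < lev q y --> k * V ze ey q y + s <= u y))" for w r s
 have "EX r>0. EX s>0. P w r s" if w: "w : T" for w
 proof -
 have w': "fst w : NP" "norm (snd w - fst (fst w)) <= e" "ey <= lev (fst w) (snd w)" using w by (auto simp: T_def)
 obtain r s where r: "r > 0" "s > 0" "AEL y. y : ball (snd w) r --> k * V ze ey (fst w) (snd w) + s <= u y"
 using slack[OF k bel w'] by blast
 have "eventually (%v. k * V ze ey (fst v) (snd v) < k * V ze ey (fst w) (snd w) + s / 2) (nhds w)"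
 using r(2) w'(3) et by (intro eventually_nhds_isCont continuous_intros isCont_V) auto
 from eventually_ball[OF this] obtain r' where
 r': "r' > 0" "ALL v:ball w r'. k * V ze ey (fst v) (snd v) < k * V ze ey (fst w) (snd w) + s / 2" by blast
 show ?thesis
 proof (rule exI[of _ "min r (r' / 2)"], rule conjI, use r r' in simp, rule exI[of _ "s / 2"], rule conjI, use r in simp, unfold P_def, intro ballI impI)
 fix q assume q: "q : NP" "q : ball (fst w) (min r (r' / 2))"
 show "AEL y. y : ball (snd w) (min r (r' / 2)) --> norm (y - fst q) <= e --> ey < lev q y --> k * V ze ey q y + s / 2 <= u y"
 using r(3)
 proof eventually_elim
 case (elim y)
 show ?case
 proof (intro impI)
 assume y: "y : ball (snd w) (min r (r' / 2))"
 have "dist w (q, y) <= dist (fst w) q + dist (snd w) y"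
 using sqrt_sum_squares_le_sum[of "dist (fst w) q" "dist (snd w) y"] by (simp add: dist_prod_def[of w])
 then have "(q, y) : ball w r'" using q(2) y by simp
 then have "k * V ze ey q y < k * V ze ey (fst w) (snd w) + s / 2" using r'(2) by fastforce
 moreover have "k * V ze ey (fst w) (snd w) + s <= u y" using elim y by simp
 ultimately show "k * V ze ey q y + s / 2 <= u y" by linarith
 qed
 qed
 qed
 qed
 then obtain rf sf where rs: "!!w. w : T ==> 0 < rf w & 0 < sf w & P w (rf w) (sf w)"
 by metis
 define A where "A w = ball (fst w) (rf w) \<times> ball (snd w) (rf w)" for w
 have "!!w. w : T ==> open (A w)" by (simp add: A_def open_Times)
 moreover have "T <= (UN w:T. A w)"
 proof
 fix w assume w: "w : T"
 then have "w : A w" using rs[OF w] by (simp add: A_def mem_Times_iff)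
 then show "w : (UN w:T. A w)" using w by blast
 qed
 ultimately obtain C where C: "C <= T" "finite C" "T <= (UN w:C. A w)" by (rule compactE_image[OF \<open>compact T\<close>])
 define s where "s = Min (insert 1 (sf ` C))"
 have sf: "0 < sf w" if "w : C" for w using rs[OF subsetD[OF C(1) that]] by simp
 have s: "0 < s" using C(2) sf by (simp add: s_def)
 have sle: "s <= sf w" if "w : C" for w using C(2) that by (simp add: s_def)
 \<comment> \<open>The barrier is at most 3 cc, so this increase of the multiplier costs at most
   \<open>s\<close>.\<close>
 have "below ze ey (k + s / (3 * cc))"
 unfolding below_def
 proof
 fix q assume q: "q : NP"
 have "AEL y. ALL w:C. q : ball (fst w) (rf w) --> y : ball (snd w) (rf w) --> norm (y - fst q) <= e --> ey < lev q y --> k * V ze ey q y + sf w <= u y"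
 proof (rule AE_finite_allI[OF C(2)])
 fix w assume w: "w : C"
 show "AEL y. q : ball (fst w) (rf w) --> y : ball (snd w) (rf w) --> norm (y - fst q) <= e --> ey < lev q y --> k * V ze ey q y + sf w <= u y"
 proof (cases "q : ball (fst w) (rf w)")
 case True
 from rs[OF subsetD[OF C(1) w], THEN conjunct2, THEN conjunct2, unfolded P_def, rule_format, OF q True] show ?thesis
 by eventually_elim simp
 qed simp
 qed
 then show "AEL y. norm (y - fst q) <= e --> ey < lev q y --> (k + s / (3 * cc)) * V ze ey q y <= u y"
 proof eventually_elim
 case (elim y)
 show ?case
 proof (intro impI)
 assume y: "norm (y - fst q) <= e" "ey < lev q y"
 then have "(q, y) : T" using q by (simp add: T_def)
 then obtain w where w: "w : C" "(q, y) : A w" using C(3) by blast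
 then have 1: "k * V ze ey q y + sf w <= u y" using elim y by (simp add: A_def)
 have "V ze ey q y <= 3 * cc" using y et z by (intro V_upper q) auto
 then have "s / (3 * cc) * V ze ey q y <= s / (3 * cc) * (3 * cc)" using s cc(1) by (intro mult_left_mono) auto
 then have "s / (3 * cc) * V ze ey q y <= s" using cc(1) by simp
 then show "(k + s / (3 * cc)) * V ze ey q y <= u y" using 1 sle[OF w(1)] unfolding distrib_right by linarith
 qed
 qed
 qed
 moreover have "0 < s / (3 * cc)" using s cc(1) by simp
 ultimately show ?thesis by blast
qed

lemma below_antimono:
 assumes "below ze ey k" "k' <= k" shows "below ze ey k'"
 unfolding below_def
proof
 fix q assume "q : NP"
 from assms(1)[unfolded below_def, rule_format, OF this]
 show "AEL x. norm (x - fst q) <= e --> ey < lev q x --> k' * V ze ey q x <= u x"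
 by eventually_elim (meson V_nonneg assms(2) mult_right_mono order_trans)
qed

text \<open>The initial multiplier depends on the cutoff \<open>ey\<close>, because \<open>u\<close>
  is bounded below only away from the boundary; the continuity argument removes this
  dependence.\<close>

lemma below_start: "EX k>0. k <= 1 & below ze ey k"
proof -
 obtain c where c: "c > 0" "AEL x. x : Om --> ey <= dl x --> dl x <= 2 * e --> c <= u x"
 using local_lower[OF et] by blast
 define k where "k = min 1 (c / (3 * cc))"
 have k: "0 < k" "k * (3 * cc) <= c" using c(1) cc(1) by (auto simp: k_def min_def field_simps)
 have "below ze ey k"
 unfolding below_def
 proof
 fix q assume q: "q : NP"
 show "AEL x. norm (x - fst q) <= e --> ey < lev q x --> k * V ze ey q x <= u x"
 using c(2)
 proof eventually_elim
 case (elim x)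
 show ?case
 proof (intro impI)
 assume x: "norm (x - fst q) <= e" "ey < lev q x"
 then have t: "0 < lev q x" using et by simp
 note L = lev[OF q x(1) t]
 have "k * V ze ey q x <= k * (3 * cc)" using k z by (intro mult_left_mono V_upper q x t et) auto
 moreover have "ey <= dl x" "dl x <= 2 * e" using L(3,6) x e by auto
 ultimately show "k * V ze ey q x <= u x" using elim L(1) k(2) by auto
 qed
 qed
 qed
 then show ?thesis using k(1) by (intro exI[of _ k]) (simp add: k_def)
qed

text \<open>The supremum of the admissible multipliers up to 1 is itself admissible, by a countable
  limit of almost everywhere inequalities. By \<open>below_step\<close> it cannot be smaller than
  1.\<close>

lemma below_1: "below ze ey 1"
proof -
 define S where "S = {k. 0 < k & k <= 1 & below ze ey k}"
 define K where "K = Sup S"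
 obtain k0 where k0: "k0 : S" using below_start by (auto simp: S_def)
 have bdd: "bdd_above S" by (intro bdd_aboveI[of _ 1]) (auto simp: S_def)
 have K: "0 < K" "K <= 1"
 proof -
 have "0 < k0" using k0 by (simp add: S_def)
 moreover have "k0 <= K" unfolding K_def by (rule cSup_upper[OF k0 bdd])
 ultimately show "0 < K" by linarith
 show "K <= 1" unfolding K_def by (rule cSup_least) (use k0 in "auto simp: S_def")
 qed
 have less: "below ze ey k" if "k < K" for k
 proof -
 have "EX k':S. k < k'" by (rule less_cSupD[OF _ that[unfolded K_def]]) (use k0 in auto)
 then obtain k' where "k' : S" "k < k'" ..
 then show ?thesis using below_antimono by (auto simp: S_def)
 qed
 have bK: "below ze ey K"
 unfolding below_def
 proof
 fix q assume q: "q : NP"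
 have "AEL x. norm (x - fst q) <= e --> ey < lev q x --> (K - 1 / real (Suc n)) * V ze ey q x <= u x" for n
 using less[of "K - 1 / real (Suc n)", unfolded below_def, rule_format, OF _ q] by simp
 then have "AEL x. ALL n. norm (x - fst q) <= e --> ey < lev q x --> (K - 1 / real (Suc n)) * V ze ey q x <= u x"
 unfolding AE_all_countable ..
 then show "AEL x. norm (x - fst q) <= e --> ey < lev q x --> K * V ze ey q x <= u x"
 proof eventually_elim
 case (elim x)
 have "(%n. (K - 1 / real (Suc n)) * V ze ey q x) ----> (K - 0) * V ze ey q x"
 using LIMSEQ_inverse_real_of_nat by (intro tendsto_intros) (simp add: inverse_eq_divide)
 then show ?case using elim by (auto intro: LIMSEQ_le_const2)
 qed
 qed
 show ?thesis
 proof (cases "K < 1")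
 case True
 obtain d where d: "d > 0" "below ze ey (K + d)" using below_step[OF K bK] by blast
 then have "below ze ey (min 1 (K + d))" by (intro below_antimono[OF d(2)]) simp
 then have "min 1 (K + d) : S" using K d by (simp add: S_def)
 then have "min 1 (K + d) <= K" unfolding K_def by (rule cSup_upper[OF _ bdd])
 then show ?thesis using True d by simp
 qed (use bK K in auto)
qed

end

text \<open>A countable dense set of base data and a sequence of cutoffs give one common null set.
  Off it, the barrier at the nearest boundary point survives by continuity, its level is at least
  half the distance, and the cutoff is removed in the limit.\<close>

lemma lower_bound:
 "AEL x. x : Om --> dl x < e --> cc * (dl x / 2) powr aa <= u x"
proof -
 obtain Q where Q: "countable Q" "Q <= NP" "NP <= closure Q" by (rule separable)
 define Z where "Z n = 1 / real (Suc n)" for n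
 define H where "H n = exp (- 1 / (Z n)^2)" for n
 have Z: "0 < Z n" "Z n <= 1" "0 < H n" for n by (auto simp: Z_def H_def)
 have "AEL x. ALL q:Q. ALL n. norm (x - fst q) <= e --> H n < lev q x --> V (Z n) (H n) q x <= u x"
 unfolding AE_ball_countable[OF Q(1)] AE_all_countable
 proof (intro ballI allI)
 fix q n assume "q : Q"
 then have "q : NP" using Q(2) by blast
 from below_1[OF Z, unfolded below_def, rule_format, OF this]
 show "AEL x. norm (x - fst q) <= e --> H n < lev q x --> V (Z n) (H n) q x <= u x" by simp
 qed
 then show ?thesis
 proof eventually_elim
 case (elim x)
 show ?case
 proof (intro impI)
 assume x: "x : Om" "dl x < e"
 obtain z1 where z1: "z1 : frontier Om" "norm (x - z1) = dl x" "0 < dl x" by (rule nearest_frontier[OF x(1) Om(2,1)])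
 obtain n1 where q1: "(z1, n1) : NP" using normals[OF z1(1)] by blast
 let ?q = "(z1, n1)"
 have R0: "0 < R" using e by linarith
 have "(x - z1) <.> n1 = norm (x - z1)" by (rule normal_pairs_nearest[OF x(1) q1 R0 ga(1)]) (use z1 in auto)
 then have l1: "lev ?q x = dl x - dl x * (8 * M * dl x powr ga)" using z1 by (simp add: level_def powr_add mult_ac)
 have "16 * M * dl x powr ga <= 16 * M * e powr ga" using x z1 M ga by (intro mult_left_mono powr_mono2) auto
 then have "dl x * (8 * M * dl x powr ga) <= dl x * (1 / 2)" using e z1 by (intro mult_left_mono) auto
 then have l: "dl x / 2 <= lev ?q x" "0 < lev ?q x" using l1 z1(3) by auto
 \<comment> \<open>The pair \<open>?q\<close> need not belong to \<open>Q\<close>. A violation at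
   \<open>?q\<close> would, by continuity in the base data, also occur at a nearby element of
   \<open>Q\<close>.\<close>
 have V: "V (Z n) (H n) ?q x <= u x" if n: "H n < lev ?q x" for n
 proof (rule ccontr)
 assume "~ V (Z n) (H n) ?q x <= u x"
 then have "u x < V (Z n) (H n) ?q x" by simp
 moreover have "isCont (%q. V (Z n) (H n) q x) ?q"
 using isCont_o2[of ?q "%q. (q, x)" "%w. V (Z n) (H n) (fst w) (snd w)"] isCont_V[OF Z(3), of "(?q, x)"] l by (auto intro: continuous_intros)
 moreover have "isCont (%q. lev q x) ?q"
 using isCont_o2[of ?q "%q. (q, x)" "%w. lev (fst w) (snd w)"] continuous_lev by (auto simp: continuous_on_eq_continuous_at intro: continuous_intros)
 moreover have "isCont (%q. norm (x - fst q)) ?q" by (intro continuous_intros)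
 ultimately have "eventually (%q. u x < V (Z n) (H n) q x & H n < lev q x & norm (x - fst q) < e) (nhds ?q)"
 using n x z1 by (intro eventually_conj eventually_nhds_isCont) auto
 from eventually_ball[OF this] obtain r where r: "r > 0" "ALL q:ball ?q r. u x < V (Z n) (H n) q x & H n < lev q x & norm (x - fst q) < e" by blast
 have "?q : closure Q" using q1 Q(3) by blast
 then obtain q where "q : Q" "dist q ?q < r" using r(1) unfolding closure_approachable by blast
 then show False using r(2) elim by (force simp: dist_commute)
 qed
 have fz: "filterlim Z (at_right 0) sequentially"
 unfolding filterlim_at Z_def using LIMSEQ_inverse_real_of_nat by (auto simp: inverse_eq_divide)
 obtain L where L: "lev ?q x powr aa <= L" "((%ze. prof_F aa ga th ze (exp (- 1 / ze^2)) (lev ?q x)) ---> L) (at_right 0)"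
 using prof_F_limit[OF l(2), of th aa ga] th by auto
 have "(%n. prof_F aa ga th (Z n) (H n) (lev ?q x)) ----> L"
 unfolding H_def by (rule filterlim_compose[OF L(2) fz])
 then have VL: "(%n. V (Z n) (H n) ?q x) ----> cc * L" unfolding V_def by (intro tendsto_intros)
 have H0: "H ----> 0"
 proof (rule tendsto_sandwich[OF _ _ tendsto_const])
 show "eventually (%n. H n <= Z n) sequentially"
 proof (intro always_eventually allI)
 fix n
 have "1 / (Z n)^2 = (real (Suc n))^2" by (simp add: Z_def power_divide)
 moreover have "real (Suc n) <= (real (Suc n))^2" by (rule self_le_power) auto
 ultimately have "1 + real (Suc n) <= exp (1 / (Z n)^2)" using exp_ge_add_one_self[of "1 / (Z n)^2"] by linarith
 then have "inverse (exp (1 / (Z n)^2)) <= inverse (real (Suc n))" by (intro le_imp_inverse_le) auto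
 then show "H n <= Z n" by (simp add: H_def Z_def exp_minus inverse_eq_divide)
 qed
 show "Z ----> 0" unfolding Z_def using LIMSEQ_inverse_real_of_nat by (simp add: inverse_eq_divide)
 qed (use Z(3) in "auto intro: always_eventually less_imp_le")
 have "eventually (%n. V (Z n) (H n) ?q x <= u x) sequentially"
 by (rule eventually_mono[OF order_tendstoD(2)[OF H0 l(2)] V])
 then have "cc * L <= u x" by (rule tendsto_upperbound[OF VL]) simp
 moreover have "(dl x / 2) powr aa <= lev ?q x powr aa" using l z1(3) aa by (intro powr_mono2) auto
 ultimately show "cc * (dl x / 2) powr aa <= u x" using L(1) cc(1) mult_left_mono[of "(dl x / 2) powr aa" L cc] by linarith
 qed
 qed
qed

end

context weak_diff
begin

theorem boundary_lower_bound:
 assumes Om: "open Om" "bounded Om" "C1_holder_boundary ga Om" and ga: "0 < ga" "ga <= 1"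
 and aa: "(p - 1) / p <= aa" "aa < 1"
 and D: "D <= Om" "0 < e0" "!!x. x : Om ==> infdist x (frontier Om) < e0 ==> x : D"
 and sup: "supersolution h"
 and h: "AEL x. x : D --> hardy_lambda p aa / infdist x (frontier Om) powr p * u x powr (p - 1) <= h x"
 and pos: "!!K. compact K ==> K <= D ==> EX c>0. AEL x. x : K --> c <= u x"
 shows "EX c>0. EX ei>0. AEL x. x : Om --> infdist x (frontier Om) < ei --> c * infdist x (frontier Om) powr aa <= u x"
proof -
 have a0: "0 < aa" using p aa(1) by (smt (verit) divide_pos_pos)
 obtain M R where M: "M \<ge> 1" "R > 0" "!!z. z : frontier Om ==> EX n. (z, n) : normal_pairs ga Om M R"
 using exists_normal_pairs[OF Om ga(1)] by blast
 have "0 <= barrier_const p aa M (real DIM('a))"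
 using p a0 aa(2) M(1) unfolding barrier_const_def hardy_lambda_def
 by (intro add_nonneg_nonneg mult_nonneg_nonneg divide_nonneg_nonneg) auto
 from profile_gain[OF p aa ga this] obtain th e1 where g: "0 < th" "0 < e1" "e1 <= 1" "th * e1 powr ga <= 1"
 and gain: "!!ze ey t. 0 < ze ==> ze <= 1 ==> 0 < ey ==> ey < t ==> t < e1 ==>
 aa <= prof_w aa ga th ze ey t &
 barrier_const p aa M (real DIM('a)) * t powr ga * (\<bar>prof_d ga th ze ey t\<bar> + (prof_w aa ga th ze ey t)^2) <
 prof_d ga th ze ey t + (prof_w aa ga th ze ey t)^2 - prof_w aa ga th ze ey t +
 (1 - aa) * aa powr (p - 1) * prof_w aa ga th ze ey t powr (2 - p)"
 unfolding Let_def by (elim exE conjE) blast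
 \<comment> \<open>e1/2 makes t <= e strictly below e1, e0/3 and R/3 give 2e < e0 and 2e < R, and
   the last entry yields 16 M e^ga <= 1/2.\<close>
 define e where "e = min (min (e1 / 2) (e0 / 3)) (min (R / 3) ((1 / (32 * M)) powr (1 / ga)))"
 have e: "0 < e" "e <= e1 / 2" "e <= e0 / 3" "e <= R / 3" "e <= (1 / (32 * M)) powr (1 / ga)"
 using g D(2) M by (auto simp: e_def)
 have eM: "16 * M * e powr ga <= 1 / 2"
 proof -
 have "e powr ga <= ((1 / (32 * M)) powr (1 / ga)) powr ga" using e ga by (intro powr_mono2) auto
 also have "... = 1 / (32 * M)" using ga M by (simp add: powr_powr)
 finally show ?thesis using M by (simp add: field_simps)
 qed
 have eth: "th * e powr ga <= 1"
 proof -
 have "th * e powr ga <= th * e1 powr ga" using e g ga by (intro mult_left_mono powr_mono2) auto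
 then show ?thesis using g by linarith
 qed
 define K where "K = closure Om \<inter> ({x. 4 * M * (e / 2) powr (1 + ga) <= infdist x (frontier Om)} \<inter> {x. infdist x (frontier Om) <= 2 * e})"
 have "compact K" unfolding K_def using Om
 by (intro compact_Int_closed closed_Int closed_Collect_le continuous_intros) auto
 moreover have "K <= D"
 proof
 fix x assume x: "x : K"
 have "0 < 4 * M * (e / 2) powr (1 + ga)" using M e by simp
 then have "x ~: frontier Om" using x by (auto simp: K_def)
 then have "x : Om" using x Om(1) by (auto simp: K_def frontier_def interior_open)
 then show "x : D" using x e D(2) by (intro D(3)) (auto simp: K_def)
 qed
 ultimately obtain c where c: "c > 0" "AEL x. x : K --> c <= u x" using pos by blast
 interpret b: barrier D p u G Om aa ga M R e th h "c / 4"
 proof unfold_locales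
 show "AEL x. x : Om --> 4 * M * (e / 2) powr (1 + ga) <= infdist x (frontier Om) --> infdist x (frontier Om) <= 2 * e --> 4 * (c / 4) <= u x"
 using c(2) by eventually_elim (auto simp: K_def intro: closure_subset[THEN subsetD])
 show "x : D" if "x : Om" "infdist x (frontier Om) <= 2 * e" for x
 using that e D(2) by (intro D(3)) auto
 show "aa <= prof_w aa ga th ze ey t &
 barrier_const p aa M (real DIM('a)) * t powr ga * (\<bar>prof_d ga th ze ey t\<bar> + (prof_w aa ga th ze ey t)^2) <
 prof_d ga th ze ey t + (prof_w aa ga th ze ey t)^2 - prof_w aa ga th ze ey t +
 (1 - aa) * aa powr (p - 1) * prof_w aa ga th ze ey t powr (2 - p)"
 if "0 < ze" "ze <= 1" "0 < ey" "ey < t" "t <= e" for ze ey t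
 using that e g by (intro gain) auto
 qed (use ga a0 aa(2) M g Om e eM eth D(1) sup h pos c(1) in "auto")
 have "AEL x. x : Om --> infdist x (frontier Om) < e --> (c / 4 * (1 / 2) powr aa) * infdist x (frontier Om) powr aa <= u x"
 using b.lower_bound by eventually_elim (auto simp: powr_divide infdist_nonneg)
 moreover have "0 < c / 4 * (1 / 2) powr aa" using c(1) by simp
 ultimately show ?thesis using e(1) by blast
qed

end

subsection \<open>Weak gradients and Borel representatives\<close>

lemma lebesgue_measurable_AE:
 fixes f g :: "'a::euclidean_space => 'b::topological_space"
 assumes g: "g : BM" and ae: "AEL x. f x = g x"
 shows "f : borel_measurable lebesgue"
proof (rule measurableI)
 fix A :: "'b set" assume A: "A : sets borel"
 have 1: "AE x in lebesgue. x : g -` A \<longleftrightarrow> x : f -` A"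
 using AE_completion[OF ae] by eventually_elim auto
 have 2: "g -` A : sets lebesgue" using measurable_sets[OF g A] by simp
 show "f -` A \<inter> space lebesgue : sets lebesgue"
 using completion.in_sets_AE[OF 1 2] by simp
qed simp

lemma set_lebesgue_lborel:
 fixes f :: "'a::euclidean_space => 'b::euclidean_space"
 assumes [measurable]: "D : sets borel" "g : BM" and ae: "AEL x. x : D --> f x = g x"
 shows "(LINT x:D|lebesgue. f x) = (LI x. indicator D x *R g x)"
 "set_integrable lebesgue D f \<longleftrightarrow> (ILI x. indicator D x *R g x)"
proof -
 have ae': "AEL x. indicator D x *R f x = indicator D x *R g x"
 using ae by eventually_elim (auto split: split_indicator)
 have gm: "(%x. indicator D x *R g x) : BM" by measurable
 note fm = lebesgue_measurable_AE[OF gm ae']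
 have gl: "(%x. indicator D x *R g x) : borel_measurable lebesgue" using gm by (intro measurable_completion) simp
 show "(LINT x:D|lebesgue. f x) = (LI x. indicator D x *R g x)"
 unfolding set_lebesgue_integral_def using gm
 by (subst integral_cong_AE[OF fm gl AE_completion[OF ae']]) (simp add: integral_completion)
 show "set_integrable lebesgue D f \<longleftrightarrow> (ILI x. indicator D x *R g x)"
 unfolding set_integrable_def using gm
 by (subst integrable_cong_AE[OF fm gl AE_completion[OF ae']]) (simp add: integrable_completion)
qed

text \<open>Each component, multiplied by the indicator of \<open>D\<close>, is measurable for the
  completed measure and hence almost everywhere equal to a Borel function.\<close>

lemma borel_representative:
 fixes f :: "'a::euclidean_space => 'b::euclidean_space"
 assumes D: "D : sets borel" and f: "f : borel_measurable (lebesgue_on D)"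
 shows "EX g:BM. AEL x. x : D --> f x = g x"
proof -
 have "EX g:BM. AEL x. x : D --> f x <.> b = g x" for b
 proof -
 have "(%x. f x <.> b) : borel_measurable (lebesgue_on D)" using f by measurable
 then have "(%x. indicator D x *R (f x <.> b)) : borel_measurable lebesgue"
 using D by (subst borel_measurable_restrict_space_iff[symmetric]) auto
 from completion_ex_borel_measurable_real[OF this] obtain g where "g : BM"
 "AEL x. indicator D x *R (f x <.> b) = g x" by auto
 then show ?thesis by (intro bexI[of _ g]) (auto elim!: eventually_mono)
 qed
 then obtain g where g: "!!b. g b : BM" "!!b. AEL x. x : D --> f x <.> b = g b x" by metis
 have "AEL x. ALL b:Basis. x : D --> f x <.> b = g b x" by (rule AE_finite_allI) (auto intro: g)
 then have ae: "AEL x. x : D --> f x = (SUM b:Basis. g b x *R b)"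
 proof eventually_elim
 case (elim x)
 have "(SUM b:Basis. (f x <.> b) *R b) = (SUM b:Basis. g b x *R b)" if "x : D" using elim that by (intro sum.cong) auto
 then show ?case by (simp add: euclidean_representation)
 qed
 note [measurable] = g(1)
 have "(%x. SUM b:Basis. g b x *R b) : BM" by measurable
 then show ?thesis using ae by (intro bexI[of _ "%x. SUM b:Basis. g b x *R b"])
qed

lemma test_measurable:
 assumes "vp : test_functions D"
 shows "vp : BM" "grad vp : BM" "x ~: D ==> vp x = 0" "x ~: D ==> grad vp x = 0"
proof -
 obtain K where K: "smooth vp" "compact K" "K <= D" "!!x. x ~: K ==> vp x = 0" "C1_supp K vp (grad vp)"
 using assms by (elim test_functionsE) blast
 show "vp : BM" "grad vp : BM"
 using smooth_continuous[OF K(1)] smooth_continuous_grad[OF K(1)] by (auto intro: borel_measurable_continuous_onI)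
 show "x ~: D ==> vp x = 0" "x ~: D ==> grad vp x = 0" using K C1_supp_grad_0[OF K(5)] by blast+
qed

lemma has_weak_gradient_lborel:
 assumes D: "open D" and G: "has_weak_gradient D u G" and [measurable]: "v : BM" "H : BM"
 and ae: "AEL x. x : D --> u x = v x" "AEL x. x : D --> G x = H x" and ph: "vp : test_functions D"
 shows "(LI x. v x *R grad vp x) = - (LI x. vp x *R H x)"
proof -
 note t = test_measurable[OF ph]
 note [measurable] = t(1,2) and [measurable] = borel_open[OF D]
 have "(LINT x:D|lebesgue. u x *R grad vp x) = (LI x. indicator D x *R (v x *R grad vp x))"
 by (rule set_lebesgue_lborel) (use ae(1) in "auto elim!: eventually_mono")
 also have "(%x. indicator D x *R (v x *R grad vp x)) = (%x. v x *R grad vp x)"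
 using t(4) by (auto split: split_indicator)
 finally have 1: "(LINT x:D|lebesgue. u x *R grad vp x) = (LI x. v x *R grad vp x)" .
 have "(LINT x:D|lebesgue. vp x *R G x) = (LI x. indicator D x *R (vp x *R H x))"
 by (rule set_lebesgue_lborel) (use ae(2) in "auto elim!: eventually_mono")
 also have "(%x. indicator D x *R (vp x *R H x)) = (%x. vp x *R H x)"
 using t(3) by (auto split: split_indicator)
 finally have 2: "(LINT x:D|lebesgue. vp x *R G x) = (LI x. vp x *R H x)" .
 show ?thesis using G ph unfolding has_weak_gradient_def 1[symmetric] 2[symmetric] by blast
qed

lemma Lp_loc_lborel:
 fixes f :: "'a::euclidean_space => 'b::euclidean_space"
 assumes [measurable]: "g : BM" and ae: "AEL x. x : D --> f x = g x" and K: "compact K" "K <= D"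
 shows "set_integrable lebesgue K (%x. norm (f x) powr q) \<longleftrightarrow> (ILI x. indicator K x * norm (g x) powr q)"
proof -
 have "AEL x. x : K --> norm (f x) powr q = norm (g x) powr q" using ae by eventually_elim (use K in auto)
 from set_lebesgue_lborel(2)[OF _ _ this] show ?thesis using K by (simp add: borel_compact)
qed

text \<open>The entry into the locale. The chosen \<open>weak_grad\<close> is a weak gradient
  because one exists, and Borel representatives satisfy the same identities.\<close>

lemma W1p_loc_weak_diff:
 assumes p: "1 < p" and D: "open D" and u: "u : W1p_loc p D"
 obtains v G where "weak_diff D p v G" "AEL x. x : D --> u x = v x" "AEL x. x : D --> weak_grad D u x = G x"
proof -
 obtain H where L: "Lp_loc p D u" "Lp_loc p D (weak_grad D u)" and H: "has_weak_gradient D u H"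
 using u by (auto simp: W1p_loc_def)
 have w: "has_weak_gradient D u (weak_grad D u)" unfolding weak_grad_def by (rule someI[of "has_weak_gradient D u", OF H])
 obtain v where v: "v : BM" "AEL x. x : D --> u x = v x"
 using borel_representative[of D u] L D by (auto simp: Lp_loc_def)
 obtain G where G: "G : BM" "AEL x. x : D --> weak_grad D u x = G x"
 using borel_representative[of D "weak_grad D u"] L D by (auto simp: Lp_loc_def)
 have "weak_diff D p v G"
 proof
 show "ILI x. indicator K x * \<bar>v x\<bar> powr p" if "compact K" "K <= D" for K
 using Lp_loc_lborel[OF v that, of p] L that by (auto simp: Lp_loc_def)
 show "ILI x. indicator K x * norm (G x) powr p" if "compact K" "K <= D" for K
 using Lp_loc_lborel[OF G that, of p] L that by (auto simp: Lp_loc_def)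
 qed (use p D v G has_weak_gradient_lborel[OF D w v(1) G(1) v(2) G(2)] in auto)
 then show ?thesis using v G that by blast
qed

text \<open>The fundamental lemma of the calculus of variations. Reflected mollifiers are test
  functions, so all small mollifications of \<open>F\<close> vanish on \<open>K\<close>, while they
  converge to \<open>F\<close> in L^1.\<close>

lemma test_integrals_0:
 fixes F :: "'a::euclidean_space => 'a"
 assumes D: "open D" and [measurable]: "F : BM"
 and F: "!!K. compact K ==> K <= D ==> (ILI x. indicator K x *R F x)"
 and 0: "!!vp. vp : test_functions D ==> (LI x. vp x *R F x) = 0"
 shows "AEL x. x : D --> F x = 0"
proof -
 have K: "AEL x. x : K --> F x = 0" if K: "compact K" "K <= D" for K
 proof -
 obtain d K' where d: "0 < d" and K': "compact K'" "K' <= D" "K <= K'" and KK': "!!x. x : K ==> cball x d <= K'"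
 proof (rule compact_thickening[OF K D], goal_cases)
 case (1 d K') show ?case by (rule 1(1)[OF 1(2,3,4,6,5)])
 qed
 note [measurable] = borel_compact[OF K(1)] borel_compact[OF K'(1)]
 define f where "f x = indicator K' x *R F x" for x
 have f: "integrable lborel f" unfolding f_def by (rule F[OF K'(1,2)])
 have m0: "mollify e f x = 0" if e: "0 < e" "e <= d" and x: "x : K" for e x
 proof -
 have sub: "cball x e <= K'" using KK'[OF x] e by auto
 have z: "mollifier e (x - y) = 0" if "y ~: cball x e" for y
 using that by (intro mollifier_eq_0[OF e(1)]) (simp add: dist_norm norm_minus_commute)
 have "(%y. mollifier e (x - y)) : test_functions D"
 by (rule test_functionsI[OF _ compact_cball _ z]) (use sub K' in "auto intro: smooth_reflect mollifier_smooth[OF e(1)]")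
 from 0[OF this] have "(LI y. mollifier e (x - y) *R F y) = 0" .
 also have "(%y. mollifier e (x - y) *R F y) = (%y. mollifier e (x - y) *R f y)"
 proof
 show "mollifier e (x - y) *R F y = mollifier e (x - y) *R f y" for y
 using sub z[of y] by (cases "y : K'") (auto simp: f_def subset_eq)
 qed
 finally show ?thesis by (simp add: mollify_eq_convolution[OF e(1)])
 qed
 have "(LI x. indicator K x * norm (F x)) <= ei" if ep: "0 < ei" for ei
 proof -
 obtain d1 where d1: "d1 > 0" "!!z. norm z < d1 ==> (LI x. norm (f (x + z) - f x)) < ei"
 using L1_translation_continuous[OF f ep] by blast
 have "EX d>0. ALL e. 0 < e & e < d --> (ILI x. 1 * norm (mollify e f x - f x)) &
 (LI x. 1 * norm (mollify e f x - f x)) <= ei"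
 by (rule mollify_weighted[OF f _ _ ep d1(1)]) (use d1(2) integrable_translate(1)[OF f] f in auto)
 then obtain d2 where d2: "d2 > 0" "!!e. 0 < e ==> e < d2 ==> (ILI x. norm (mollify e f x - f x)) &
 (LI x. norm (mollify e f x - f x)) <= ei" by auto
 define e where "e = min d (d2 / 2)"
 have e: "0 < e" "e <= d" "e < d2" using d d2(1) by (auto simp: e_def)
 have "(LI x. indicator K x * norm (F x)) <= (LI x. norm (mollify e f x - f x))"
 proof (rule integral_mono)
 have "ILI x. norm (indicator K x *R F x)" using F[OF K] by (rule integrable_norm)
 then show "ILI x. indicator K x * norm (F x)" by simp
 show "ILI x. norm (mollify e f x - f x)" using d2(2)[OF e(1,3)] by blast
 show "indicator K x * norm (F x) <= norm (mollify e f x - f x)" for x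
 using m0[OF e(1,2), of x] K'(3) by (auto simp: f_def split: split_indicator)
 qed
 then show ?thesis using d2(2)[OF e(1,3)] by linarith
 qed
 then have "(LI x. indicator K x * norm (F x)) <= 0" by (rule field_le_epsilon[of _ 0, simplified])
 moreover have "ILI x. norm (indicator K x *R F x)" using F[OF K] by (rule integrable_norm)
 moreover have "0 <= (LI x. indicator K x * norm (F x))" by (rule bint_nonneg) simp
 ultimately have "AEL x. indicator K x * norm (F x) = 0"
 by (subst integral_nonneg_eq_0_iff_AE[symmetric]) auto
 then show ?thesis by eventually_elim auto
 qed
 obtain C :: "nat => 'a set" where C: "!!n. compact (C n)" "!!n. C n <= D" "(\<Union>n. C n) = D"
 using open_Union_compact_subsets[OF D] by metis
 have "AEL x. ALL n. x : C n --> F x = 0" unfolding AE_all_countable using K[OF C(1,2)] by blast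
 then show ?thesis by eventually_elim (use C(3) in blast)
qed

context weak_diff
begin

lemma Lp_locI:
 fixes f :: "'a => 'b::euclidean_space"
 assumes f: "f : BM" and i: "!!K. compact K ==> K <= D ==> (ILI x. indicator K x * norm (f x) powr q)"
 shows "Lp_loc q D f"
proof -
 have "f : borel_measurable (lebesgue_on D)" by (intro measurable_restrict_space1 measurable_completion) (simp add: f)
 then show ?thesis using Lp_loc_lborel[OF f, of D f] i by (simp add: Lp_loc_def)
qed

text \<open>The choice operator in \<open>weak_grad\<close> may select another gradient. Both
  satisfy the same identity against all test functions, so their difference vanishes almost
  everywhere by \<open>test_integrals_0\<close>.\<close>

lemma W1p_loc: "u : W1p_loc p D" and weak_grad_eq: "AEL x. x : D --> weak_grad D u x = G x"
proof -
 have q: "Lp_loc 1 D u" "Lp_loc 1 D G"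
 using integrable_indicator_powr_le[OF _ u_measurable _ _ u_integrable[folded real_norm_def], of _ 1]
 integrable_indicator_powr_le[OF _ G_measurable _ _ G_integrable, of _ 1] p
 by (auto intro!: Lp_locI)
 have w: "has_weak_gradient D u G"
 unfolding has_weak_gradient_def
 proof (intro conjI q ballI)
 fix vp assume ph: "vp : test_functions D"
 note t = test_measurable[OF ph]
 note [measurable] = t(1,2) and [measurable] = borel_open[OF open_D]
 have "(LINT x:D|lebesgue. u x *R grad vp x) = (LI x. indicator D x *R (u x *R grad vp x))"
 by (rule set_lebesgue_lborel) auto
 also have "(%x. indicator D x *R (u x *R grad vp x)) = (%x. u x *R grad vp x)"
 using t(4) by (auto split: split_indicator)
 finally have 1: "(LINT x:D|lebesgue. u x *R grad vp x) = (LI x. u x *R grad vp x)" .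
 have "(LINT x:D|lebesgue. vp x *R G x) = (LI x. indicator D x *R (vp x *R G x))"
 by (rule set_lebesgue_lborel) auto
 also have "(%x. indicator D x *R (vp x *R G x)) = (%x. vp x *R G x)"
 using t(3) by (auto split: split_indicator)
 finally show "(LINT x:D|lebesgue. u x *R grad vp x) = - (LINT x:D|lebesgue. vp x *R G x)"
 unfolding 1 using weak[OF ph] by simp
 qed
 then have w': "has_weak_gradient D u (weak_grad D u)" unfolding weak_grad_def by (rule someI[of "has_weak_gradient D u"])
 then have L: "Lp_loc 1 D (weak_grad D u)" by (simp add: has_weak_gradient_def)
 obtain H where H: "H : BM" "AEL x. x : D --> weak_grad D u x = H x"
 using borel_representative[of D "weak_grad D u"] L open_D by (auto simp: Lp_loc_def)
 note [measurable] = H(1)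
 have iH: "ILI x. indicator K x *R H x" if K: "compact K" "K <= D" for K
 proof -
 have "ILI x. indicator K x * norm (H x) powr 1"
 using Lp_loc_lborel[OF H K, of 1] L K by (simp add: Lp_loc_def)
 then show ?thesis by (intro integrable_restrict_compact[OF K(1) H(1), of 1]) auto
 qed
 have eq: "AEL x. x : D --> H x - G x = 0"
 proof (rule test_integrals_0[OF open_D])
 show "ILI x. indicator K x *R (H x - G x)" if "compact K" "K <= D" for K
 using iH[OF that] G_restrict[OF that] by (simp add: scaleR_diff_right)
 fix vp assume ph: "vp : test_functions D"
 obtain K where K: "smooth vp" "compact K" "K <= D" "!!x. x ~: K ==> vp x = 0" "C1_supp K vp (grad vp)"
 using ph by (elim test_functionsE) blast
 obtain B where B: "!!x. norm (vp x) <= B" using bounded_continuous_supp[OF smooth_continuous[OF K(1)] K(2,4)] by blast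
 note [measurable] = test_measurable(1)[OF ph]
 have i: "ILI x. vp x *R F x" if F: "ILI x. indicator K x *R F x" and [measurable]: "F : BM" for F :: "'a => 'a"
 proof (rule bint_bound)
 show "ILI x. B * norm (indicator K x *R F x)" using integrable_norm[OF F] by simp
 show "AEL x. norm (vp x *R F x) <= norm (B * norm (indicator K x *R F x))"
 proof (intro AE_I2)
 fix x
 have "\<bar>vp x\<bar> * norm (F x) <= \<bar>B\<bar> * norm (F x)" using B[of x] by (intro mult_right_mono) auto
 then show "norm (vp x *R F x) <= norm (B * norm (indicator K x *R F x))"
 using K(4)[of x] by (cases "x : K") (auto simp: abs_mult)
 qed
 qed measurable
 have "(LI x. vp x *R (H x - G x)) = (LI x. vp x *R H x) - (LI x. vp x *R G x)"
 unfolding scaleR_diff_right using i[OF iH[OF K(2,3)]] i[OF G_restrict[OF K(2,3)]] by (intro bint_minus) auto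
 also have "... = 0"
 using has_weak_gradient_lborel[OF open_D w' u_measurable H(1) _ H(2) ph] weak[OF ph] by simp
 finally show "(LI x. vp x *R (H x - G x)) = 0" .
 qed measurable
 show ae: "AEL x. x : D --> weak_grad D u x = G x" using H(2) eq by eventually_elim auto
 have "Lp_loc p D u" using u_integrable by (intro Lp_locI) auto
 moreover have "Lp_loc p D (weak_grad D u)" using L G_integrable Lp_loc_lborel[OF G_measurable ae] by (simp add: Lp_loc_def)
 ultimately show "u : W1p_loc p D" using w by (auto simp: W1p_loc_def)
qed

end

subsection \<open>Positive solutions\<close>

lemma infdist_measurable [measurable]: "(%x. infdist x S) : BM"
 by (intro borel_measurable_continuous_onI continuous_intros)

lemma hardy_weight_bounded:
 assumes "open Om" "bounded (Om :: 'a::euclidean_space set)" "compact K" "K <= Om"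
 shows "EX B. ALL x:K. \<bar>l / infdist x (frontier Om) powr p\<bar> <= B"
proof -
 have "infdist x (frontier Om) > 0" if "x : K" for x using nearest_frontier[of x Om] that assms by blast
 then have "continuous_on K (%x. l / infdist x (frontier Om) powr p)" by (intro continuous_intros) force+
 from compact_imp_bounded[OF compact_continuous_image[OF this assms(3)]] show ?thesis by (auto simp: bounded_iff)
qed

context weak_diff
begin

lemma loc_integrable_mult_powr:
 assumes [measurable]: "k : BM" "f : BM"
 and k: "!!K. compact K ==> K <= D ==> EX B. ALL x:K. \<bar>k x\<bar> <= B" and f: "!!x. \<bar>f x\<bar> <= \<bar>u x\<bar> powr (p - 1)"
 shows "loc_integrable D (%x. k x * f x)"
 unfolding loc_integrable_def
proof (intro conjI allI impI)
 fix K assume K: "compact K" "K <= D"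
 note [measurable] = borel_compact[OF K(1)]
 obtain B where B: "!!x. x : K ==> \<bar>k x\<bar> <= B" using k[OF K] by blast
 show "ILI x. indicator K x * (k x * f x)"
 proof (rule bint_bound)
 show "ILI x. B * (indicator K x * norm (u x) powr (p - 1))"
 using integrable_indicator_powr_le[OF K(1) u_measurable _ _ u_integrable[OF K, folded real_norm_def], of "p - 1"] p
 by (intro integrable_mult_right) auto
 show "AEL x. norm (indicator K x * (k x * f x)) <= norm (B * (indicator K x * norm (u x) powr (p - 1)))"
 proof (intro AE_I2)
 fix x
 have "\<bar>k x\<bar> * \<bar>f x\<bar> <= B * \<bar>u x\<bar> powr (p - 1)" "0 <= B" if "x : K"
 proof -
 show "0 <= B" using B[OF that] by linarith
 then show "\<bar>k x\<bar> * \<bar>f x\<bar> <= B * \<bar>u x\<bar> powr (p - 1)" using B[OF that] f[of x] by (intro mult_mono) auto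
 qed
 then show "norm (indicator K x * (k x * f x)) <= norm (B * (indicator K x * norm (u x) powr (p - 1)))"
 by (auto simp: abs_mult split: split_indicator)
 qed
 qed measurable
qed measurable

end

theorem solution_lower_bound:
 fixes Om :: "'a::euclidean_space set"
 assumes p: "1 < p" and ga: "0 < ga" "ga <= 1" and Om: "open Om" "bounded Om" "C1_holder_boundary ga Om"
 and aa: "(p - 1) / p <= aa" "aa < 1" and U: "open U" "frontier Om <= U"
 and cu: "continuous_on (closure (Om \<inter> U) - frontier Om) u" and pu: "!!x. x : closure (Om \<inter> U) - frontier Om ==> 0 < u x"
 and sol: "weak_solution p (Om \<inter> U) (%x. - (hardy_lambda p aa / infdist x (frontier Om) powr p)) u"
 shows "EX C>0. ALL x:Om \<inter> U. infdist x (frontier Om) powr aa <= C * u x"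
proof -
 define D where "D = Om \<inter> U"
 define d where "d x = infdist x (frontier Om)" for x
 define l where "l = hardy_lambda p aa"
 have oD: "open D" using Om U by (simp add: D_def open_Int)
 have a0: "0 < aa" using p aa(1) by (smt (verit) divide_pos_pos)
 have [measurable]: "d : BM" unfolding d_def by measurable
 have cd: "continuous_on S d" for S unfolding d_def by (intro continuous_intros)
 have dpos: "0 < d x" if "x : Om" for x using nearest_frontier[OF that Om(2,1)] unfolding d_def by blast
 have sub: "D <= closure D - frontier Om"
 using closure_subset[of D] Om(1) by (auto simp: D_def frontier_def interior_open)
 have cuD: "continuous_on D u" and puD: "!!x. x : D ==> 0 < u x"
 using continuous_on_subset[OF cu] pu sub by (auto simp: D_def)
 have uW: "u : W1p_loc p D" using sol by (simp add: weak_solution_def D_def)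
 obtain v G where wd: "weak_diff D p v G" and v: "AEL x. x : D --> u x = v x" and G: "AEL x. x : D --> weak_grad D u x = G x"
 by (rule W1p_loc_weak_diff[OF p oD uW])
 interpret w: weak_diff D p v G by (rule wd)
 note [measurable] = borel_open[OF oD]
 define h where "h x = l / d x powr p * (\<bar>v x\<bar> powr (p - 2) * v x)" for x
 have [measurable]: "h : BM" unfolding h_def[abs_def] by measurable
 have sup: "w.supersolution h"
 unfolding w.supersolution_def
 proof (intro conjI ballI impI)
 have "\<bar>v x\<bar> powr (p - 2) * \<bar>v x\<bar> = \<bar>v x\<bar> powr (p - 1)" for x
 using powr_add[of "\<bar>v x\<bar>" "p - 2" 1] by simp
 then show "loc_integrable D h"
 unfolding h_def[abs_def] using hardy_weight_bounded[OF Om(1,2), of _ l p]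
 by (intro w.loc_integrable_mult_powr) (auto simp: d_def D_def abs_mult)
 fix vp assume ph: "vp : test_functions D"
 note t = test_measurable[OF ph]
 note [measurable] = t(1,2)
 have "(LINT x:D|lebesgue. norm (weak_grad D u x) powr (p - 2) * (weak_grad D u x <.> grad vp x))
 = (LI x. indicator D x *R (norm (G x) powr (p - 2) * (G x <.> grad vp x)))"
 by (rule set_lebesgue_lborel) (use G in "auto elim!: eventually_mono")
 also have "(%x. indicator D x *R (norm (G x) powr (p - 2) * (G x <.> grad vp x))) = (%x. pflux p (G x) <.> grad vp x)"
 using t(4) by (auto simp: pflux_def split: split_indicator)
 finally have 1: "(LINT x:D|lebesgue. norm (weak_grad D u x) powr (p - 2) * (weak_grad D u x <.> grad vp x)) = (LI x. pflux p (G x) <.> grad vp x)" .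
 have "(LINT x:D|lebesgue. - (l / d x powr p) * \<bar>u x\<bar> powr (p - 2) * u x * vp x) = (LI x. indicator D x *R (- (h x * vp x)))"
 by (rule set_lebesgue_lborel) (use v in "auto elim!: eventually_mono simp: h_def")
 also have "(%x. indicator D x *R (- (h x * vp x))) = (%x. - (h x * vp x))"
 using t(3) by (auto split: split_indicator)
 finally have "(LINT x:D|lebesgue. - (l / d x powr p) * \<bar>u x\<bar> powr (p - 2) * u x * vp x) = - (LI x. h x * vp x)" by simp
 then show "(LI x. h x * vp x) <= (LI x. pflux p (G x) <.> grad vp x)"
 using sol ph 1 unfolding weak_solution_def D_def[symmetric] d_def[symmetric] l_def[symmetric] by force
 qed
 have hl: "AEL x. x : D --> l / d x powr p * v x powr (p - 1) <= h x"
 using v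
 proof eventually_elim
 case (elim x)
 then show ?case using puD[of x] powr_add[of "v x" "p - 2" 1] by (auto simp: h_def)
 qed
 \<comment> \<open>For a continuous positive solution this is the minimum over \<open>K\<close>; no
   propagation of positivity is involved here.\<close>
 have ps: "EX c>0. AEL x. x : K --> c <= v x" if K: "compact K" "K <= D" for K
 proof (cases "K = {}")
 case False
 obtain y where y: "y : K" "!!x. x : K ==> u y <= u x"
 using continuous_attains_inf[OF K(1) False continuous_on_subset[OF cuD K(2)]] by blast
 have "AEL x. x : K --> u y <= v x" using v by eventually_elim (use y K in force)
 then show ?thesis using puD y K by blast
 qed (auto intro: exI[of _ 1])
 have "EX e0>0. ALL x:Om. d x < e0 --> x : D"
 proof -
 obtain e where e: "e > 0" "(UN x:frontier Om. ball x e) <= U"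
 by (rule compact_subset_open_imp_ball_epsilon_subset[OF compact_frontier_bounded[OF Om(2)] U])
 have "x : D" if x: "x : Om" "d x < e" for x
 proof -
 obtain z where "z : frontier Om" "norm (x - z) = d x" unfolding d_def by (rule nearest_frontier[OF x(1) Om(2,1)])
 then have "x : (UN x:frontier Om. ball x e)" using x by (intro UN_I[of z]) (auto simp: dist_norm norm_minus_commute)
 from subsetD[OF e(2) this] show ?thesis using x(1) by (simp add: D_def)
 qed
 then show ?thesis using e(1) by blast
 qed
 then obtain e0 where e0: "e0 > 0" "!!x. x : Om ==> d x < e0 ==> x : D" by blast
 have DOm: "D <= Om" by (simp add: D_def)
 have "EX c>0. EX e>0. AEL x. x : Om --> d x < e --> c * d x powr aa <= v x"
 by (rule w.boundary_lower_bound[OF Om ga aa, of e0 h, folded d_def l_def, OF DOm e0(1) _ sup hl]) (rule e0(2) ps; assumption)+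
 then obtain c e where c: "c > 0" "e > 0" "AEL x. x : Om --> d x < e --> c * d x powr aa <= v x"
 by blast
 \<comment> \<open>The set near the boundary where the pointwise bound fails. It is open by
   continuity of \<open>u\<close> and null by the almost everywhere bound, hence empty.\<close>
 define S where "S = D \<inter> (%x. u x - c * d x powr aa) -` {..<0} \<inter> {x. d x < e}"
 have cS: "continuous_on D (%x. u x - c * d x powr aa)"
 using dpos by (intro continuous_intros cuD cd) (force simp: D_def)
 have "open S" unfolding S_def
 by (rule open_Int[OF continuous_open_preimage[OF cS oD open_lessThan] open_Collect_less[OF cd continuous_on_const]])
 moreover have "AEL x. x ~: S" using v c(3) by eventually_elim (auto simp: S_def D_def)
 ultimately have S: "S = {}" by (intro AE_not_in_open)
 have near: "d x powr aa <= 1 / c * u x" if "x : D" "d x < e" for x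
 proof -
 have "x ~: S" using S by blast
 then show ?thesis using that c(1) by (auto simp: S_def field_simps)
 qed
 \<comment> \<open>The part at distance at least \<open>e\<close> is compact in the set on which
   \<open>u\<close> is assumed continuous and positive, so the quotient d^aa/u is bounded
   there.\<close>
 define K where "K = closure D \<inter> {x. e <= d x}"
 have K: "compact K" "K <= closure D - frontier Om"
 proof -
 have "bounded D" using Om(2) by (auto simp: D_def intro: bounded_subset)
 then show "compact K" unfolding K_def by (intro compact_Int_closed closed_Collect_le continuous_intros cd) auto
 show "K <= closure D - frontier Om" using c(2) by (auto simp: K_def d_def)
 qed
 have "continuous_on K (%x. d x powr aa / u x)"
 using K(2) pu c(2) by (intro continuous_intros cd continuous_on_subset[OF cu]) (force simp: K_def D_def)+
 from compact_imp_bounded[OF compact_continuous_image[OF this K(1)]]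
 obtain B where B: "!!x. x : K ==> \<bar>d x powr aa / u x\<bar> <= B" by (auto simp: bounded_iff)
 have far: "d x powr aa <= B * u x" if "x : D" "e <= d x" for x
 proof -
 have "x : K" using that closure_subset by (auto simp: K_def)
 from order_trans[OF abs_ge_self B[OF this]] have "d x powr aa / u x <= B" .
 then show ?thesis using puD[OF that(1)] by (simp add: field_simps)
 qed
 have "d x powr aa <= max (1 / c) B * u x" if x: "x : D" for x
 proof -
 have "1 / c * u x <= max (1 / c) B * u x" "B * u x <= max (1 / c) B * u x"
 by (rule mult_right_mono; use puD[OF x] in simp)+
 then show ?thesis using near[OF x] far[OF x] by force
 qed
 moreover have "0 < max (1 / c) B" using c(1) by (simp add: less_max_iff_disj)
 ultimately show ?thesis unfolding d_def D_def by blast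
qed

subsection \<open>Non-integrability of the reciprocal distance\<close>

text \<open>In a boundary chart the distance is at most the height over the graph. Dyadic layers of
  height m/2^k have volume proportional to m/2^k by translation invariance, so each contributes the
  same positive amount to the integral.\<close>

lemma inverse_distance_not_integrable:
 fixes Om :: "'a::euclidean_space set" and f :: "'a => real"
 assumes Om: "open Om" and b: "C1_holder_boundary ga Om" and z: "z : frontier Om" and ep: "0 < ei"
 and f: "integrable lborel f" "!!x. 0 <= f x"
 and ae: "AEL x. x : Om --> infdist x (frontier Om) < ei --> 1 / infdist x (frontier Om) <= f x"
 shows False
proof -
 obtain r n g where r: "r > 0" and n: "norm n = 1" "C1_holder ga g"
 and c: "!!x. x : ball z r ==> x : Om \<longleftrightarrow> g (x - (x <.> n) *R n) < x <.> n"
 using b z unfolding C1_holder_boundary_def by metis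
 have nn: "n <.> n = 1" using n by (simp add: dot_square_norm)
 obtain G where "!!x. GDERIV g x :> G x" using n(2) unfolding C1_holder_def by blast
 then have cg: "continuous_on UNIV g"
 by (auto simp: continuous_on_eq_continuous_at gderiv_def intro!: has_derivative_continuous)
 define pr where "pr x = x - (x <.> n) *R n" for x
 define h where "h x = x <.> n - g (pr x)" for x
 have cpr: "continuous_on UNIV pr" unfolding pr_def by (intro continuous_intros)
 have ch: "continuous_on UNIV h" unfolding h_def by (intro continuous_intros continuous_on_compose2[OF cg cpr]) auto
 have [measurable]: "h : BM" "pr : BM"
 using ch cpr by (auto intro: borel_measurable_continuous_onI)
 have prn: "pr (x + t *R n) = pr x" and hn: "h (x + t *R n) = h x + t" for x t
 by (auto simp: h_def pr_def nn algebra_simps)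
 have hz: "h z = 0" unfolding h_def pr_def using frontier_chart[OF Om cg c z] r by simp
 define m where "m = min r ei / 3"
 have m: "0 < m" "3 * m <= r" "3 * m <= ei" using r ep by (auto simp: m_def)
 have "isCont g (pr z)" using cg by (simp add: continuous_on_eq_continuous_at)
 then obtain s0 where s0: "s0 > 0" "!!y. dist y (pr z) < s0 ==> dist (g y) (g (pr z)) < m"
 using m(1) unfolding continuous_at_eps_delta by blast
 define s where "s = min s0 m"
 have s: "0 < s" "s <= m" "s <= s0" using s0 m by (auto simp: s_def)
 define E where "E t = {x. norm (pr x - pr z) < s & 0 < h x & h x <= t}" for t
 have [measurable]: "E t : sets borel" for t unfolding E_def by measurable
 have near: "norm (x - z) < 3 * m" if x: "x : E m \<or> (norm (pr x - pr z) < s & 0 <= h x & h x <= m)" for x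
 proof -
 have "norm (pr x - pr z) < s" "0 <= h x" "h x <= m" using x by (auto simp: E_def)
 moreover from this have "\<bar>g (pr x) - g (pr z)\<bar> < m" using s0(2)[of "pr x"] s by (simp add: dist_norm)
 moreover have "(x - z) <.> n = h x + (g (pr x) - g (pr z))" using hz by (simp add: h_def inner_diff_left)
 moreover have "x - z = (pr x - pr z) + ((x - z) <.> n) *R n" by (simp add: pr_def algebra_simps)
 then have "norm (x - z) <= norm (pr x - pr z) + \<bar>(x - z) <.> n\<bar>" using n(1) norm_triangle_ineq by (metis mult.right_neutral norm_scaleR real_norm_def)
 ultimately show ?thesis using s(2) by linarith
 qed
 have inb: "x : ball z r" if "norm (x - z) < 3 * m" for x using that m by (simp add: dist_norm norm_minus_commute)
 have low: "x : Om & infdist x (frontier Om) < ei & infdist x (frontier Om) <= h x & 0 < infdist x (frontier Om)" if x: "x : E m" for x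
 proof -
 have x': "norm (x - z) < 3 * m" "0 < h x" "h x <= m" "norm (pr x - pr z) < s" using x near[of x] by (auto simp: E_def)
 have xOm: "x : Om" using c[OF inb[OF x'(1)]] x'(2) by (simp add: h_def pr_def)
 \<comment> \<open>The foot of \<open>x\<close> on the graph in direction \<open>n\<close>. It is a
   limit of points of \<open>Om\<close> just above it and does not lie in \<open>Om\<close>, hence
   it is a boundary point at distance \<open>h x\<close>.\<close>
 define y where "y = x + (- h x) *R n"
 have y: "h y = 0" "pr y = pr x" unfolding y_def hn prn by simp_all
 have yz: "norm (y - z) < 3 * m" using x' m(1) y by (intro near) auto
 have "y ~: Om" using c[OF inb[OF yz]] y(1) by (simp add: h_def pr_def)
 moreover have "y : closure Om"
 unfolding closure_approachable
 proof (intro allI impI)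
 fix e :: real assume e: "0 < e"
 define t where "t = min (e / 2) (h x)"
 have t: "0 < t" "t < e" "t <= h x" using e x'(2) by (auto simp: t_def)
 have "norm (pr (y + t *R n) - pr z) < s & 0 <= h (y + t *R n) & h (y + t *R n) <= m"
 unfolding hn prn using y t x' by simp
 then have "y + t *R n : ball z r" by (intro inb near) simp
 from c[OF this] have "y + t *R n : Om" using hn[of y t] y(1) t(1) by (simp add: h_def pr_def)
 moreover have "dist (y + t *R n) y < e" using t n(1) by (simp add: dist_norm)
 ultimately show "EX w:Om. dist w y < e" by blast
 qed
 ultimately have yf: "y : frontier Om" using Om by (simp add: frontier_def interior_open)
 have "infdist x (frontier Om) <= h x" using infdist_le[OF yf, of x] x'(2) n(1) by (simp add: y_def dist_norm)
 moreover have "infdist x (frontier Om) < ei" using infdist_le[OF z, of x] x'(1) m(3) by (simp add: dist_norm)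
 moreover have "x ~: frontier Om" using xOm Om by (simp add: frontier_def interior_open)
 then have "0 < infdist x (frontier Om)" using z by (intro infdist_pos_not_in_closed) auto
 ultimately show ?thesis using xOm by blast
 qed
 have iE: "ILI x. (indicator (E t) x :: real)" if "t <= m" for t
 proof -
 have "E t <= ball z (3 * m)" using near that by (force simp: E_def dist_norm norm_minus_commute)
 then have "emeasure lborel (E t) < \<infinity>" by (intro emeasure_bounded_finite bounded_subset[OF bounded_ball])
 then show ?thesis by (simp add: integrable_indicator_iff)
 qed
 define mm where "mm t = ((LI x. indicator (E t) x) :: real)" for t
 \<comment> \<open>The slab \<open>E t\<close> is the disjoint union of its lower half and a
   translate of it along \<open>n\<close>; this replaces Fubini in graph coordinates.\<close>
 have dbl: "mm t = 2 * mm (t / 2)" if t: "0 < t" "t <= m" for t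
 proof -
 have "indicator (E t) x = indicator (E (t / 2)) x + (indicator (E (t / 2)) (x + (- (t / 2)) *R n) :: real)" for x
 unfolding E_def using prn[of x "- (t / 2)"] hn[of x "- (t / 2)"] t by (auto split: split_indicator)
 then have "mm t = (LI x. indicator (E (t / 2)) x + indicator (E (t / 2)) (x + (- (t / 2)) *R n))" by (simp add: mm_def)
 also have "... = mm (t / 2) + (LI x. indicator (E (t / 2)) (x + (- (t / 2)) *R n))"
 unfolding mm_def using t by (intro bint_plus iE integrable_translate(1)[OF iE]) auto
 also have "(LI x. indicator (E (t / 2)) (x + (- (t / 2)) *R n)) = mm (t / 2)"
 unfolding mm_def by (rule integrable_translate(2))
 finally show ?thesis by simp
 qed
 have mmm: "0 < mm m"
 proof (rule ccontr)
 assume "~ 0 < mm m"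
 moreover have "0 <= mm m" unfolding mm_def by (rule bint_nonneg) simp
 ultimately have "((LI x. indicator (E m) x) :: real) = 0" unfolding mm_def by linarith
 then have "AEL x. (indicator (E m) x :: real) = 0"
 by (subst (asm) integral_nonneg_eq_0_iff_AE[OF iE]) auto
 moreover define S where "S = {x. norm (pr x - pr z) < s & 0 < h x & h x < m}"
 ultimately have "AEL x. x ~: S" by (auto elim!: eventually_mono simp: E_def split: split_indicator_asm)
 moreover have "open S" unfolding S_def
 by (intro open_Collect_conj open_Collect_less continuous_intros ch cpr)
 ultimately have "S = {}" by (rule AE_not_in_open)
 moreover have "z + (m / 2) *R n : S" using m(1) s(1) by (simp add: S_def prn hn hz)
 ultimately show False by blast
 qed
 define T where "T k = m / 2 ^ k" for k :: nat
 have T: "0 < T k" "T k <= m" "T (Suc k) = T k / 2" for k using m(1) by (auto simp: T_def field_simps)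
 have mmT: "mm (T k) = mm m / 2 ^ k" for k
 proof (induction k)
 case (Suc k)
 then show ?case using dbl[OF T(1,2), of k] by (simp add: T(3))
 qed (simp add: T_def)
 have iEf: "ILI x. indicator A x * f x" if [measurable]: "A : sets borel" for A
 using f(2) by (intro bint_bound[OF f(1)]) (use borel_measurable_integrable[OF f(1)] in "auto split: split_indicator")
 \<comment> \<open>A layer between T k and half of it has volume mm m/2^(k+1), and the integrand
   there is at least 2^k/m.\<close>
 have step: "(LI x. indicator (E m - E (T k)) x * f x) \<ge> real k * (mm m / (2 * m))" for k
 proof (induction k)
 case 0
 then show ?case using f(2) by (simp add: bint_nonneg)
 next
 case (Suc k)
 have sub: "E (T (Suc k)) <= E (T k)" "E (T k) <= E m" using T[of k] unfolding T(3) by (auto simp: E_def)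
 have "mm m / (2 * m) = (mm (T k) - mm (T (Suc k))) / T k" using m(1) by (simp add: mmT) (simp add: T_def field_simps)
 also have "... = (LI x. (indicator (E (T k)) x - indicator (E (T (Suc k))) x) / T k)"
 unfolding mm_def using iE[OF T(2)] by simp
 also have "... <= (LI x. indicator (E (T k) - E (T (Suc k))) x * f x)"
 proof (rule integral_mono_AE)
 show "AEL x. (indicator (E (T k)) x - indicator (E (T (Suc k))) x) / T k <= indicator (E (T k) - E (T (Suc k))) x * f x"
 using ae
 proof eventually_elim
 case (elim x)
 show ?case
 proof (cases "x : E (T k) - E (T (Suc k))")
 case True
 then have x: "x : E m" "h x <= T k" using sub by (auto simp: E_def)
 note lw = low[OF x(1)]
 have "1 / T k <= 1 / infdist x (frontier Om)" using lw x(2) by (intro divide_left_mono mult_pos_pos T(1)) auto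
 then show ?thesis using True elim lw by (auto intro: order_trans)
 qed (use sub in "auto split: split_indicator")
 qed
 show "ILI x. (indicator (E (T k)) x - indicator (E (T (Suc k))) x) / T k" using iE[OF T(2)] by simp
 qed (intro iEf, measurable)
 finally have "mm m / (2 * m) <= (LI x. indicator (E (T k) - E (T (Suc k))) x * f x)" .
 moreover have "(LI x. indicator (E m - E (T (Suc k))) x * f x)
 = (LI x. indicator (E m - E (T k)) x * f x + indicator (E (T k) - E (T (Suc k))) x * f x)"
 using sub by (intro bint_cong) (auto split: split_indicator)
 moreover have "... = (LI x. indicator (E m - E (T k)) x * f x) + (LI x. indicator (E (T k) - E (T (Suc k))) x * f x)"
 by (intro bint_plus iEf) measurable
 ultimately show ?case using Suc unfolding of_nat_Suc distrib_right by linarith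
 qed
 have up: "(LI x. indicator (E m - E (T k)) x * f x) <= (LI x. f x)" for k
 using f(2) by (intro integral_mono iEf f(1)) (auto split: split_indicator)
 have q: "0 < mm m / (2 * m)" using mmm m(1) by simp
 obtain k :: nat where "(LI x. f x) / (mm m / (2 * m)) < real k" using reals_Archimedean2 by blast
 then have "(LI x. f x) < real k * (mm m / (2 * m))" unfolding pos_divide_less_eq[OF q] .
 then show False using step[of k] up[of k] by linarith
qed

subsection \<open>The modulus of a minimizer\<close>

context weak_diff
begin

text \<open>Bounded smooth approximations of the modulus are inserted into the chain rule through
  \<open>field_test\<close> with a constant vector field, whose divergence is 0; dominated
  convergence then gives the weak gradient of |u|.\<close>

lemma weak_diff_abs: "weak_diff D p (%x. \<bar>u x\<bar>) (%x. sgn (u x) *R G x)"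
proof
 have [measurable]: "(sgn :: real => real) : BM" unfolding sgn_real_def[abs_def] by measurable
 show "(%x. \<bar>u x\<bar>) : BM" "(%x. sgn (u x) *R G x) : BM" by measurable
 show "1 < p" "open D" by (fact p open_D)+
 show "ILI x. indicator K x * \<bar>\<bar>u x\<bar>\<bar> powr p" if "compact K" "K <= D" for K
 using u_integrable[OF that] by simp
 show "ILI x. indicator K x * norm (sgn (u x) *R G x) powr p" if K: "compact K" "K <= D" for K
 proof (rule integrable_dominated[OF G_integrable[OF K]])
 note [measurable] = borel_compact[OF K(1)]
 show "(%x. indicator K x * norm (sgn (u x) *R G x) powr p) : borel_measurable lborel" by measurable
 show "norm (indicator K x * norm (sgn (u x) *R G x) powr p) <= indicator K x * norm (G x) powr p" for x
 by (auto simp: sgn_real_def split: split_indicator)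
 qed
 fix vp assume ph: "vp : test_functions D"
 obtain K where K: "smooth vp" "compact K" "K <= D" "!!x. x ~: K ==> vp x = 0" "C1_supp K vp (grad vp)"
 using ph by (elim test_functionsE) blast
 note z = K(4) C1_supp_grad_0[OF K(5)]
 obtain B where B: "!!x. norm (vp x) <= B" "!!x. norm (grad vp x) <= B"
 using C1_supp_bounds[OF K(5)] by auto
 note [measurable] = test_measurable(1,2)[OF ph] borel_compact[OF K(2)]
 have iu: "ILI x. indicator K x * \<bar>u x\<bar>" using integrable_abs[OF u_restrict[OF K(2,3)]] by (simp add: abs_mult)
 have iG: "ILI x. indicator K x * norm (G x)" using integrable_norm[OF G_restrict[OF K(2,3)]] by simp
 have i1: "integrable lborel (indicator K :: 'a => real)"
 using emeasure_compact_finite[OF K(2)] by (simp add: integrable_indicator_iff)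
 define g where "g x = \<bar>u x\<bar> *R grad vp x + vp x *R (sgn (u x) *R G x)" for x
 have "(LI x. b <.> g x) = 0" for b
 proof -
 define i where "i n = 1 / real (Suc n)" for n
 define r where "r n s = sqrt (s^2 + i n)" for n and s :: real
 \<comment> \<open>The square root smooths the modulus at 0, and the denominator makes the function
   bounded by 1/i n, as \<open>admissible_test\<close> requires; the derivative stays below 1
   uniformly.\<close>
 define H where "H n s = r n s / (1 + i n * r n s)" for n and s :: real
 define H' where "H' n s = s / r n s / (1 + i n * r n s)^2" for n and s :: real
 have i: "0 < i n" "i n <= 1" for n by (auto simp: i_def)
 have r: "0 < r n s" "\<bar>s\<bar> <= r n s" "r n s <= \<bar>s\<bar> + 1" for n s
 proof -
 show "0 < r n s" unfolding r_def using i by (simp add: add_nonneg_pos)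
 show "\<bar>s\<bar> <= r n s" unfolding r_def using i[of n] by (intro real_le_rsqrt) simp
 show "r n s <= \<bar>s\<bar> + 1" unfolding r_def using i[of n] by (intro real_le_lsqrt) (auto simp: power2_sum)
 qed
 have q: "1 <= 1 + i n * r n s" for n s using i[of n] r(1)[of n s] by simp
 have Hb: "\<bar>H n s\<bar> <= \<bar>s\<bar> + 1" "\<bar>H n s\<bar> <= 1 / i n" "\<bar>H' n s\<bar> <= 1" for n s
 proof -
 have "\<bar>H n s\<bar> <= r n s" unfolding H_def using q[of n s] r(1)[of n s] by (auto simp: divide_le_eq mult_le_cancel_left1)
 then show "\<bar>H n s\<bar> <= \<bar>s\<bar> + 1" using r(3)[of n s] by linarith
 have "H n s <= r n s / (i n * r n s)" unfolding H_def using r(1)[of n s] i[of n] by (intro divide_left_mono mult_pos_pos add_pos_pos) auto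
 also have "... = 1 / i n" using r(1)[of n s] by simp
 finally have "H n s <= 1 / i n" .
 moreover have "0 <= H n s" unfolding H_def using r(1)[of n s] q[of n s] by (intro divide_nonneg_nonneg) auto
 ultimately show "\<bar>H n s\<bar> <= 1 / i n" by simp
 have "\<bar>s / r n s\<bar> <= 1" using r(1)[of n s] r(2)[of s n] by (simp add: divide_le_eq)
 moreover have "1 <= (1 + i n * r n s)^2" using q[of n s] by (simp add: one_le_power)
 moreover have "\<bar>a / Q\<bar> <= 1" if "\<bar>a\<bar> <= 1" "1 <= Q" for a Q :: real using that by (simp add: divide_le_eq)
 ultimately show "\<bar>H' n s\<bar> <= 1" unfolding H'_def by blast
 qed
 have rD: "(r n has_real_derivative s / r n s) (at s)" for n s
 proof -
 have "0 < s^2 + i n" using i[of n] by (simp add: add_nonneg_pos)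
 then show ?thesis unfolding r_def[abs_def] by (auto intro!: derivative_eq_intros simp: field_simps)
 qed
 have HD: "(H n has_real_derivative H' n s) (at s)" for n s
 proof -
 have "(H n has_real_derivative ((s / r n s) * (1 + i n * r n s) - r n s * (0 + i n * (s / r n s))) / ((1 + i n * r n s) * (1 + i n * r n s))) (at s)"
 unfolding H_def[abs_def] using q[of n s] by (intro DERIV_divide DERIV_add DERIV_const DERIV_cmult rD) auto
 moreover have "(s / r n s) * (1 + i n * r n s) - r n s * (0 + i n * (s / r n s)) = s / r n s" by (simp add: algebra_simps)
 ultimately show ?thesis unfolding H'_def power2_eq_square by simp
 qed
 have cr: "continuous_on UNIV (r n)" for n unfolding r_def by (intro continuous_intros)
 have ne: "r n s ~= 0" "(1 + i n * r n s)^2 ~= 0" for n s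
 proof -
 show "r n s ~= 0" using r(1)[of n s] by simp
 have "1 + i n * r n s ~= 0" using q[of n s] by linarith
 then show "(1 + i n * r n s)^2 ~= 0" by simp
 qed
 have cH': "continuous_on UNIV (H' n)" for n
 unfolding H'_def by (intro continuous_intros cr ballI ne)
 have adm: "admissible_test K vp (grad vp) D (H n) (H' n) (%_. 0) (%_. 0)" for n
 unfolding admissible_test_def
 proof (intro conjI allI ballI K open_D order_refl HD cH' continuous_intros)
 show "EX B. ALL t. \<bar>H n t\<bar> <= B & \<bar>H' n t\<bar> <= B"
 using Hb(2,3)[of n] i[of n] by (intro exI[of _ "1 / i n"]) (force intro: order_trans[of _ 1])
 qed (auto simp: gderiv_def)
 define f where "f n x = b <.> (H n (- u x) *R grad vp x + (vp x * H' n (- u x)) *R (- G x))" for n x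
 have "(LI x. f n x) = 0" for n
 using field_test(1)[OF adm, of "%_. b" "%_ _. 0" n] by (simp add: test_field_def test_grad_def f_def)
 moreover have "(%n. (LI x. f n x)) ----> (LI x. b <.> g x)"
 proof (rule integral_dominated_convergence[where w = "%x. norm b * B * (indicator K x * \<bar>u x\<bar> + indicator K x + indicator K x * norm (G x))"])
 have [measurable]: "H n : BM" "H' n : BM" for n
 using DERIV_continuous_on[OF has_field_derivative_at_within[OF HD]] cH' by (auto intro: borel_measurable_continuous_onI)
 show "f n : borel_measurable lborel" for n unfolding f_def[abs_def] by measurable
 show "(%x. b <.> g x) : borel_measurable lborel" unfolding g_def[abs_def] by measurable
 show "ILI x. norm b * B * (indicator K x * \<bar>u x\<bar> + indicator K x + indicator K x * norm (G x))"
 using iu iG i1 by (intro integrable_mult_right bint_add)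
 show "AEL x. norm (f n x) <= norm b * B * (indicator K x * \<bar>u x\<bar> + indicator K x + indicator K x * norm (G x))" for n
 proof (intro AE_I2)
 fix x
 show "norm (f n x) <= norm b * B * (indicator K x * \<bar>u x\<bar> + indicator K x + indicator K x * norm (G x))"
 proof (cases "x : K")
 case True
 have "norm (H n (- u x) *R grad vp x + (vp x * H' n (- u x)) *R (- G x)) <= \<bar>H n (- u x)\<bar> * norm (grad vp x) + \<bar>vp x\<bar> * \<bar>H' n (- u x)\<bar> * norm (G x)"
 by (rule order_trans[OF norm_triangle_ineq]) (simp add: abs_mult)
 also have "... <= (\<bar>u x\<bar> + 1) * B + B * 1 * norm (G x)"
 using B[of x] Hb(1)[of n "- u x"] Hb(3)[of n "- u x"] by (intro add_mono mult_mono) auto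
 finally have "norm (H n (- u x) *R grad vp x + (vp x * H' n (- u x)) *R (- G x)) <= B * (\<bar>u x\<bar> + 1 + norm (G x))"
 by (simp add: algebra_simps)
 from mult_left_mono[OF this norm_ge_zero[of b]] Cauchy_Schwarz_ineq2[of b "H n (- u x) *R grad vp x + (vp x * H' n (- u x)) *R (- G x)"]
 show ?thesis using True unfolding f_def by (simp add: mult.assoc)
 qed (simp add: f_def z)
 qed
 show "AEL x. (%n. f n x) ----> b <.> g x"
 proof (intro AE_I2)
 fix x
 have i0: "i ----> 0" unfolding i_def using LIMSEQ_inverse_real_of_nat by (simp add: inverse_eq_divide)
 have "(%n. r n (- u x)) ----> sqrt ((- u x)^2 + 0)" unfolding r_def by (intro tendsto_intros i0)
 then have rl: "(%n. r n (- u x)) ----> \<bar>u x\<bar>" by simp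
 have "(%n. H n (- u x)) ----> \<bar>u x\<bar> / (1 + 0 * \<bar>u x\<bar>)" unfolding H_def by (intro tendsto_intros rl i0) simp
 then have Hl: "(%n. H n (- u x)) ----> \<bar>u x\<bar>" by simp
 have Hl': "(%n. H' n (- u x)) ----> - sgn (u x)"
 proof (cases "u x = 0")
 case False
 have "(%n. H' n (- u x)) ----> - u x / \<bar>u x\<bar> / (1 + 0 * \<bar>u x\<bar>)^2"
 unfolding H'_def using False by (intro tendsto_intros rl i0) auto
 then show ?thesis by (simp add: sgn_if abs_if split: if_splits)
 qed (simp add: H'_def)
 have "(%n. f n x) ----> b <.> (\<bar>u x\<bar> *R grad vp x + (vp x * - sgn (u x)) *R (- G x))"
 unfolding f_def by (intro tendsto_intros Hl Hl')
 then show "(%n. f n x) ----> b <.> g x" by (simp add: g_def)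
 qed
 qed
 ultimately show ?thesis by (simp add: LIMSEQ_const_iff)
 qed
 moreover have i2: "ILI x. \<bar>u x\<bar> *R grad vp x" "ILI x. vp x *R (sgn (u x) *R G x)"
 proof -
 show "ILI x. \<bar>u x\<bar> *R grad vp x"
 proof (rule integrable_dominated[OF integrable_mult_right[OF iu, of B]])
 show "norm (\<bar>u x\<bar> *R grad vp x) <= B * (indicator K x * \<bar>u x\<bar>)" for x
 using mult_left_mono[OF B(2), of "\<bar>u x\<bar>" x] z(2)[of x] by (cases "x : K") (auto simp: mult.commute)
 qed measurable
 show "ILI x. vp x *R (sgn (u x) *R G x)"
 proof (rule integrable_dominated[OF integrable_mult_right[OF iG, of B]])
 show "norm (vp x *R (sgn (u x) *R G x)) <= B * (indicator K x * norm (G x))" for x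
 using mult_right_mono[OF B(1), of "norm (G x)" x] z(1)[of x] order_trans[OF norm_ge_zero B(1)]
 by (cases "x : K") (auto simp: sgn_real_def)
 qed measurable
 qed
 have gi: "integrable lborel g" unfolding g_def[abs_def] by (intro bint_add i2)
 have "(LI x. g x) <.> (LI x. g x) = (LI x. (LI x. g x) <.> g x)" using gi by simp
 ultimately have "(LI x. g x) = 0" by simp
 then show "(LI x. \<bar>u x\<bar> *R grad vp x) = - (LI x. vp x *R (sgn (u x) *R G x))"
 unfolding g_def bint_plus[OF i2] by (simp add: eq_neg_iff_add_eq_0)
qed

lemma weak_diff_add_test:
 assumes ps: "cs : test_functions D"
 shows "weak_diff D p (%x. u x + s * cs x) (%x. G x + s *R grad cs x)"
proof
 obtain L where L: "smooth cs" "compact L" "L <= D" "!!x. x ~: L ==> cs x = 0" "C1_supp L cs (grad cs)"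
 using ps by (elim test_functionsE) blast
 obtain B where B: "!!x. norm (cs x) <= B" "!!x. norm (grad cs x) <= B" using C1_supp_bounds[OF L(5)] by auto
 note [measurable] = test_measurable(1,2)[OF ps]
 show "(%x. u x + s * cs x) : BM" "(%x. G x + s *R grad cs x) : BM" by measurable
 show "1 < p" "open D" by (fact p open_D)+
 have dom: "ILI x. indicator K x * norm (f x + s *R g x) powr p"
 if K: "compact K" "ILI x. indicator K x * norm (f x) powr p" and [measurable]: "f : BM" "g : BM"
 and g: "!!x. norm (g x) <= B" for K and f g :: "'a => 'b::euclidean_space"
 proof (rule integrable_dominated)
 note [measurable] = borel_compact[OF K(1)]
 have "integrable lborel (indicator K :: 'a => real)"
 using emeasure_compact_finite[OF K(1)] by (simp add: integrable_indicator_iff)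
 then show "ILI x. 2 powr p * (indicator K x * norm (f x) powr p) + 2 powr p * (\<bar>s\<bar> * B) powr p * indicator K x"
 using K(2) by (intro bint_add integrable_mult_right)
 show "(%x. indicator K x * norm (f x + s *R g x) powr p) : borel_measurable lborel" by measurable
 fix x
 have "norm (f x + s *R g x) powr p <= (norm (f x) + \<bar>s\<bar> * B) powr p"
 using norm_triangle_ineq[of "f x" "s *R g x"] mult_left_mono[OF g, of "\<bar>s\<bar>" x] p by (intro powr_mono2) auto
 also have "... <= 2 powr p * (norm (f x) powr p + (\<bar>s\<bar> * B) powr p)"
 using p order_trans[OF norm_ge_zero g] by (intro powr_add_le) auto
 finally show "norm (indicator K x * norm (f x + s *R g x) powr p) <= 2 powr p * (indicator K x * norm (f x) powr p) + 2 powr p * (\<bar>s\<bar> * B) powr p * indicator K x"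
 by (auto simp: distrib_left split: split_indicator)
 qed
 show "ILI x. indicator K x * \<bar>u x + s * cs x\<bar> powr p" if "compact K" "K <= D" for K
 using dom[of K u cs] u_integrable[OF that] that(1) B(1) by simp
 show "ILI x. indicator K x * norm (G x + s *R grad cs x) powr p" if "compact K" "K <= D" for K
 using dom[of K G "grad cs"] G_integrable[OF that] that(1) B(2) by simp
 fix vp assume ph: "vp : test_functions D"
 obtain K where K: "smooth vp" "compact K" "K <= D" "!!x. x ~: K ==> vp x = 0" "C1_supp K vp (grad vp)"
 using ph by (elim test_functionsE) blast
 obtain C where C: "!!x. norm (vp x) <= C" "!!x. norm (grad vp x) <= C" using C1_supp_bounds[OF K(5)] by auto
 note z = K(4) C1_supp_grad_0[OF K(5)]
 note [measurable] = test_measurable(1,2)[OF ph]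
 have i1: "ILI x. u x *R grad vp x"
 proof (rule integrable_dominated[OF integrable_mult_right[OF integrable_norm[OF u_restrict[OF K(2,3)]], of C]])
 show "norm (u x *R grad vp x) <= C * norm (indicator K x * u x)" for x
 using mult_left_mono[OF C(2), of "\<bar>u x\<bar>" x] z(2)[of x] by (cases "x : K") (auto simp: mult.commute)
 qed measurable
 have i2: "ILI x. vp x *R G x"
 proof (rule integrable_dominated[OF integrable_mult_right[OF integrable_norm[OF G_restrict[OF K(2,3)]], of C]])
 show "norm (vp x *R G x) <= C * norm (indicator K x *R G x)" for x
 using mult_right_mono[OF C(1), of "norm (G x)" x] z(1)[of x] by (cases "x : K") auto
 qed measurable
 have c: "continuous_on UNIV vp" "continuous_on UNIV (grad vp)" "continuous_on UNIV cs" "continuous_on UNIV (grad cs)"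
 by (intro smooth_continuous smooth_continuous_grad K L)+
 have i3: "ILI x. cs x *R grad vp x" "ILI x. vp x *R grad cs x"
 using c by (auto intro!: integrable_continuous_supp[OF _ K(2)] continuous_intros simp: z)
 have "(LI x. cs x *R grad vp x) = - (LI x. vp x *R grad cs x)"
 proof -
 have eq: "b <.> (LI x. cs x *R grad vp x) = - (b <.> (LI x. vp x *R grad cs x))" for b
 proof -
 \<comment> \<open>The vector identity is checked one direction at a time with the field
   \<open>cs\<close> times a fixed \<open>b\<close>, whose divergence is b . grad cs.\<close>
 have "(LI x. (cs x *R b) <.> grad vp x) = - (LI x. (SUM e:Basis. ((e <.> grad cs x) *R b) <.> e) * vp x)"
 proof (rule integral_by_parts(1)[OF K(5) open_UNIV])
 show "((%x. cs x *R b) has_derivative (%e. (e <.> grad cs x) *R b)) (at x)" for x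
 using smooth_GDERIV[OF L(1), of x] unfolding gderiv_def by (rule has_derivative_scaleR_left)
 show "continuous_on UNIV (%x. (v <.> grad cs x) *R b)" for v by (intro continuous_intros c)
 qed simp
 moreover have "(SUM e:Basis. ((e <.> grad cs x) *R b) <.> e) = b <.> grad cs x" for x
 unfolding euclidean_inner[of b "grad cs x"] by (intro sum.cong) (auto simp: inner_commute)
 ultimately show ?thesis using i3 by (simp add: mult.commute flip: integral_inner_right)
 qed
 show ?thesis by (rule vector_eq_ldot[THEN iffD1]) (use eq in simp)
 qed
 moreover have a: "ILI x. s *R (cs x *R grad vp x)" "ILI x. s *R (vp x *R grad cs x)"
 by (rule integrable_scaleR_right, rule i3)+
 have "(LI x. u x *R grad vp x + s *R (cs x *R grad vp x)) = (LI x. u x *R grad vp x) + s *R (LI x. cs x *R grad vp x)"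
 "(LI x. vp x *R G x + s *R (vp x *R grad cs x)) = (LI x. vp x *R G x) + s *R (LI x. vp x *R grad cs x)"
 unfolding bint_plus[OF i1 a(1)] bint_plus[OF i2 a(2)] integral_scaleR_right by (rule refl)+
 ultimately have "(LI x. u x *R grad vp x + s *R (cs x *R grad vp x)) = - (LI x. vp x *R G x + s *R (vp x *R grad cs x))"
 using weak[OF ph] by (simp only: scaleR_minus_right minus_add_distrib)
 then show "(LI x. (u x + s * cs x) *R grad vp x) = - (LI x. vp x *R (G x + s *R grad cs x))"
 by (simp add: scaleR_add_left scaleR_add_right mult.commute)
qed

end

lemma isCont_pflux:
 assumes "1 < p"
 shows "isCont (pflux p) xe"
proof (cases "xe = 0")
 case True
 have "continuous_on UNIV (%xe :: 'a. norm xe powr (p - 1))" using assms by (intro continuous_on_powr' continuous_intros) auto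
 then have "isCont (%xe :: 'a. norm xe powr (p - 1)) 0" by (simp add: continuous_on_eq_continuous_at)
 then have "((%xe :: 'a. norm (pflux p xe)) ---> 0) (at 0)" using assms by (simp add: isCont_def norm_pflux)
 then show ?thesis unfolding True isCont_def by (simp add: tendsto_norm_zero_cancel pflux_def[of p 0])
qed (rule has_derivative_continuous[OF pflux_has_derivative])

context weak_diff
begin

text \<open>Off \<open>K\<close> the integrand is unchanged, and on \<open>K\<close> the weight is
  bounded by \<open>A\<close>, so the elementary bound for powers of sums suffices.\<close>

lemma competitor_integrable:
 fixes f g :: "'a => 'b::euclidean_space"
 assumes [measurable]: "k : BM" "f : BM" "g : BM"
 and k: "!!x. 0 <= k x" "!!x. x : K ==> k x <= A" and K: "compact K" and g: "!!x. norm (g x) <= B" "!!x. x ~: K ==> g x = 0"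
 and f: "ILI x. indicator D x * (k x * norm (f x) powr p)"
 shows "ILI x. indicator D x * (k x * norm (f x + s *R g x) powr p)"
proof (rule integrable_dominated)
 note [measurable] = borel_open[OF open_D] borel_compact[OF K]
 have "integrable lborel (indicator K :: 'a => real)"
 using emeasure_compact_finite[OF K] by (simp add: integrable_indicator_iff)
 then show "ILI x. 2 powr p * (indicator D x * (k x * norm (f x) powr p)) + 2 powr p * (A * (\<bar>s\<bar> * B) powr p) * indicator K x + indicator D x * (k x * norm (f x) powr p)"
 using f by (intro bint_add integrable_mult_right)
 show "(%x. indicator D x * (k x * norm (f x + s *R g x) powr p)) : borel_measurable lborel" by measurable
 fix x
 have B: "0 <= B" using order_trans[OF norm_ge_zero g(1)] .
 show "norm (indicator D x * (k x * norm (f x + s *R g x) powr p)) <=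
 2 powr p * (indicator D x * (k x * norm (f x) powr p)) + 2 powr p * (A * (\<bar>s\<bar> * B) powr p) * indicator K x + indicator D x * (k x * norm (f x) powr p)"
 proof (cases "x : K & x : D")
 case True
 have "norm (f x + s *R g x) powr p <= (norm (f x) + \<bar>s\<bar> * B) powr p"
 using norm_triangle_ineq[of "f x" "s *R g x"] mult_left_mono[OF g(1), of "\<bar>s\<bar>" x] p by (intro powr_mono2) auto
 also have "... <= 2 powr p * (norm (f x) powr p + (\<bar>s\<bar> * B) powr p)"
 using p B by (intro powr_add_le) auto
 finally have "k x * norm (f x + s *R g x) powr p <= k x * (2 powr p * (norm (f x) powr p + (\<bar>s\<bar> * B) powr p))"
 using k(1) by (rule mult_left_mono)
 also have "... = 2 powr p * (k x * norm (f x) powr p) + 2 powr p * (k x * (\<bar>s\<bar> * B) powr p)" by (simp add: algebra_simps)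
 also have "... <= 2 powr p * (k x * norm (f x) powr p) + 2 powr p * (A * (\<bar>s\<bar> * B) powr p)"
 using k(2)[of x] True by (intro add_left_mono mult_left_mono mult_right_mono) auto
 finally have "k x * norm (f x + s *R g x) powr p <= 2 powr p * (k x * norm (f x) powr p) + 2 powr p * (A * (\<bar>s\<bar> * B) powr p)" .
 moreover have "0 <= k x * norm (f x) powr p" "0 <= k x * norm (f x + s *R g x) powr p" using k(1)[of x] by auto
 ultimately show ?thesis using True by simp
 next
 case False
 have "0 <= A" if "x : K" using k(1)[of x] k(2)[OF that] by linarith
 then show ?thesis using False g(2)[of x] k(1)[of x] by (auto simp: abs_mult split: split_indicator)
 qed
qed

text \<open>The energy need not be differentiated. Convexity bounds the change of the potential term
  from below at \<open>u\<close>, and the change of the gradient term from above at the perturbed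
  gradient; dividing by p s and letting s tend to 0 gives the weak inequality.\<close>

lemma energy_supersolution:
 assumes [measurable]: "k : BM" and k: "!!x. 0 <= k x" "!!K. compact K ==> K <= D ==> EX B. ALL x:K. \<bar>k x\<bar> <= B"
 and u: "!!x. 0 <= u x" and iu: "ILI x. indicator D x * (k x * norm (u x) powr p)"
 and iG: "ILI x. indicator D x * (1 * norm (G x) powr p)"
 and min: "!!vp s. vp : test_functions D ==> (!!x. 0 <= vp x) ==> 0 < s ==>
 (ILI x. indicator D x * (k x * norm (u x + s *R vp x) powr p)) ==>
 (ILI x. indicator D x * (1 * norm (G x + s *R grad vp x) powr p)) ==>
 (LI x. indicator D x * (1 * norm (G x) powr p)) - (LI x. indicator D x * (k x * norm (u x) powr p)) <=
 (LI x. indicator D x * (1 * norm (G x + s *R grad vp x) powr p)) - (LI x. indicator D x * (k x * norm (u x + s *R vp x) powr p))"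
 shows "supersolution (%x. k x * u x powr (p - 1))"
 unfolding supersolution_def
proof (intro conjI ballI impI)
 show li: "loc_integrable D (%x. k x * u x powr (p - 1))"
 using u k by (intro loc_integrable_mult_powr) auto
 fix vp assume ph: "vp : test_functions D" and "ALL x. 0 <= vp x"
 then have ph0: "!!x. 0 <= vp x" by simp
 obtain K where K: "smooth vp" "compact K" "K <= D" "!!x. x ~: K ==> vp x = 0" "C1_supp K vp (grad vp)"
 using ph by (elim test_functionsE) blast
 obtain B where B: "!!x. norm (vp x) <= B" "!!x. norm (grad vp x) <= B" using C1_supp_bounds[OF K(5)] by auto
 have B0: "0 <= B" using order_trans[OF norm_ge_zero B(1)] .
 note z = K(4) C1_supp_grad_0[OF K(5)]
 note [measurable] = test_measurable(1,2)[OF ph] borel_compact[OF K(2)] borel_open[OF open_D]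
 obtain A where A: "!!x. x : K ==> \<bar>k x\<bar> <= A" using k(2)[OF K(2,3)] by blast
 have A': "k x <= A" if "x : K" for x using A[OF that] by simp
 have i1: "ILI x. k x * u x powr (p - 1) * vp x"
 proof (rule integrable_dominated)
 show "ILI x. B * norm (indicator K x * (k x * u x powr (p - 1)))"
 using li K by (simp add: loc_integrable_def)
 show "norm (k x * u x powr (p - 1) * vp x) <= B * norm (indicator K x * (k x * u x powr (p - 1)))" for x
 using mult_left_mono[OF B(1), of "\<bar>k x * u x powr (p - 1)\<bar>" x] z(1)[of x] by (cases "x : K") (auto simp: abs_mult mult_ac)
 qed measurable
 define w where "w x = B * (indicator K x + 2 powr p * (indicator K x * norm (G x) powr p + B powr p * indicator K x))" for x
 have iw: "integrable lborel w"
 proof -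
 have "integrable lborel (indicator K :: 'a => real)"
 using emeasure_compact_finite[OF K(2)] by (simp add: integrable_indicator_iff)
 then show ?thesis unfolding w_def[abs_def] using G_integrable[OF K(2,3)]
 by (intro integrable_mult_right bint_add)
 qed
 have dom: "norm (pflux p (G x + s *R grad vp x) <.> grad vp x) <= w x" if s: "0 <= s" "s <= 1" for s x
 proof (cases "x : K")
 case True
 let ?t = "norm (G x + s *R grad vp x)"
 have "?t <= norm (G x) + B"
 using norm_triangle_ineq[of "G x" "s *R grad vp x"] mult_mono[OF s(2) B(2)[of x]] s by simp
 then have "?t powr p <= (norm (G x) + B) powr p" using p by (intro powr_mono2) auto
 also have "... <= 2 powr p * (norm (G x) powr p + B powr p)" using p B0 by (intro powr_add_le) auto
 finally have 1: "?t powr p <= 2 powr p * (norm (G x) powr p + B powr p)" .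
 have "?t powr (p - 1) <= 1 + ?t powr p"
 proof (cases "?t <= 1")
 case True
 then have "?t powr (p - 1) <= 1 powr (p - 1)" using p by (intro powr_mono2) auto
 then show ?thesis by (simp add: add_increasing2)
 next
 case False
 then have "?t powr (p - 1) <= ?t powr p" by (intro powr_mono) auto
 then show ?thesis by simp
 qed
 then have "?t powr (p - 1) * norm (grad vp x) <= (1 + 2 powr p * (norm (G x) powr p + B powr p)) * B"
 using 1 B(2)[of x] by (intro mult_mono) auto
 moreover have "norm (pflux p (G x + s *R grad vp x) <.> grad vp x) <= ?t powr (p - 1) * norm (grad vp x)"
 using Cauchy_Schwarz_ineq2[of "pflux p (G x + s *R grad vp x)" "grad vp x"] by (simp add: norm_pflux)
 ultimately show ?thesis using True by (simp add: w_def mult.commute)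
 qed (simp add: w_def z)
 have i2: "ILI x. pflux p (G x + s *R grad vp x) <.> grad vp x" if s: "0 <= s" "s <= 1" for s
 by (rule integrable_dominated[OF iw _ dom[OF s]]) measurable
 have key: "(LI x. k x * u x powr (p - 1) * vp x) <= (LI x. pflux p (G x + s *R grad vp x) <.> grad vp x)" if s: "0 < s" "s <= 1" for s
 proof -
 have c1: "ILI x. indicator D x * (k x * norm (u x + s *R vp x) powr p)"
 by (rule competitor_integrable[OF _ _ _ k(1) A' K(2) B(1) z(1) iu]) auto
 have c2: "ILI x. indicator D x * (1 * norm (G x + s *R grad vp x) powr p)"
 by (rule competitor_integrable[where k = "%_. 1" and A = 1, OF _ _ _ _ _ K(2) B(2) z(2) iG]) auto
 have "(LI x. (p * s) * (k x * u x powr (p - 1) * vp x))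
 <= (LI x. indicator D x * (k x * norm (u x + s *R vp x) powr p) - indicator D x * (k x * norm (u x) powr p))"
 proof (intro integral_mono integrable_mult_right i1 bint_diff c1 iu)
 fix x
 show "(p * s) * (k x * u x powr (p - 1) * vp x) <= indicator D x * (k x * norm (u x + s *R vp x) powr p) - indicator D x * (k x * norm (u x) powr p)"
 proof (cases "x : D")
 case True
 have "pflux p (u x) = u x powr (p - 1)" using u[of x] powr_add[of "u x" "p - 2" 1] by (simp add: pflux_def)
 then have "p * (u x powr (p - 1) * (s * vp x)) <= norm (u x + s *R vp x) powr p - norm (u x) powr p"
 using pflux_convexity[OF p, of "u x" "u x + s *R vp x"] by simp
 from mult_left_mono[OF this k(1)[of x]] show ?thesis using True by (simp add: right_diff_distrib mult_ac)
 next
 case False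
 then have "x ~: K" using K(3) by blast
 then show ?thesis using False z(1) by simp
 qed
 qed
 also have "... = (LI x. indicator D x * (k x * norm (u x + s *R vp x) powr p)) - (LI x. indicator D x * (k x * norm (u x) powr p))"
 by (rule bint_minus[OF c1 iu])
 also have "... <= (LI x. indicator D x * (1 * norm (G x + s *R grad vp x) powr p)) - (LI x. indicator D x * (1 * norm (G x) powr p))"
 using min[OF ph ph0 s(1) c1 c2] by linarith
 also have "... = (LI x. indicator D x * (1 * norm (G x + s *R grad vp x) powr p) - indicator D x * (1 * norm (G x) powr p))"
 by (rule bint_minus[symmetric, OF c2 iG])
 \<comment> \<open>The tangent inequality is taken at the perturbed gradient, because this is the
   side giving an upper bound; continuity of the flux removes the perturbation afterwards.\<close>
 also have "... <= (LI x. (p * s) * (pflux p (G x + s *R grad vp x) <.> grad vp x))"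
 proof (intro integral_mono integrable_mult_right i2 bint_diff c2 iG)
 fix x
 show "indicator D x * (1 * norm (G x + s *R grad vp x) powr p) - indicator D x * (1 * norm (G x) powr p) <= (p * s) * (pflux p (G x + s *R grad vp x) <.> grad vp x)"
 using pflux_convexity[OF p, of "G x + s *R grad vp x" "G x"] z(2)[of x] subsetD[OF K(3), of x]
 by (cases "x : D"; cases "x : K") (auto simp: mult_ac)
 qed (use s in auto)
 finally have "(p * s) * (LI x. k x * u x powr (p - 1) * vp x) <= (p * s) * (LI x. pflux p (G x + s *R grad vp x) <.> grad vp x)"
 by simp
 then show ?thesis by (rule mult_left_le_imp_le) (use p s in simp)
 qed
 define i where "i n = 1 / real (Suc n)" for n
 have i: "0 < i n" "i n <= 1" for n by (auto simp: i_def)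
 have i0: "i ----> 0" unfolding i_def using LIMSEQ_inverse_real_of_nat by (simp add: inverse_eq_divide)
 have "(%n. (LI x. pflux p (G x + i n *R grad vp x) <.> grad vp x)) ----> (LI x. pflux p (G x) <.> grad vp x)"
 proof (rule integral_dominated_convergence[OF _ _ iw])
 show "AEL x. norm (pflux p (G x + i n *R grad vp x) <.> grad vp x) <= w x" for n
 using dom[of "i n"] i[of n] by (intro AE_I2) auto
 show "AEL x. (%n. pflux p (G x + i n *R grad vp x) <.> grad vp x) ----> pflux p (G x) <.> grad vp x"
 proof (intro AE_I2 tendsto_inner tendsto_const)
 fix x
 have "(%n. G x + i n *R grad vp x) ----> G x + 0 *R grad vp x" by (intro tendsto_intros i0)
 then show "(%n. pflux p (G x + i n *R grad vp x)) ----> pflux p (G x)"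
 by (intro isCont_tendsto_compose[OF isCont_pflux[OF p]]) simp
 qed
 qed measurable
 then show "(LI x. k x * u x powr (p - 1) * vp x) <= (LI x. pflux p (G x) <.> grad vp x)"
 by (rule LIMSEQ_le_const) (use key i in blast)
qed

end

lemma hardy_inequality:
 assumes wd: "weak_diff Om p f F" and H: "0 < hardy_const p Om" and nz: "~ (AEL x. x : Om --> f x = 0)"
 and i: "ILI x. indicator Om x * (\<bar>f x\<bar> powr p * infdist x (frontier Om) powr (- p))"
 "ILI x. indicator Om x * norm (F x) powr p"
 shows "hardy_const p Om * (LI x. indicator Om x * (\<bar>f x\<bar> powr p * infdist x (frontier Om) powr (- p)))
 <= (LI x. indicator Om x * norm (F x) powr p)"
proof -
 interpret weak_diff Om p f F by (rule wd)
 note [measurable] = borel_open[OF open_D]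
 have ae: "AEL x. x : Om --> norm (weak_grad Om f x) powr p = norm (F x) powr p"
 using weak_grad_eq by eventually_elim auto
 note g = set_lebesgue_lborel[OF _ _ ae]
 note q = set_lebesgue_lborel[of Om "%x. \<bar>f x\<bar> powr p * infdist x (frontier Om) powr (- p)" "%x. \<bar>f x\<bar> powr p * infdist x (frontier Om) powr (- p)"]
 have "f : W1p_tilde p Om" unfolding W1p_tilde_def using W1p_loc g(2) q(2) i by simp
 moreover have "~ (AE x in lebesgue_on Om. f x = 0)"
 using nz by (simp add: AE_restrict_space_iff AE_completion_iff)
 ultimately have f: "f : hardy_admissible p Om" by (simp add: hardy_admissible_def)
 have "bdd_below (hardy_quotient p Om ` hardy_admissible p Om)"
 unfolding hardy_quotient_def set_lebesgue_integral_def
 by (intro bdd_belowI2[of _ 0] divide_nonneg_nonneg bint_nonneg) auto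
 then have "hardy_const p Om <= hardy_quotient p Om f" unfolding hardy_const_def using f by (rule cINF_lower)
 then have le: "hardy_const p Om <= (LI x. indicator Om x * norm (F x) powr p) /
 (LI x. indicator Om x * (\<bar>f x\<bar> powr p * infdist x (frontier Om) powr (- p)))"
 unfolding hardy_quotient_def using g(1) q(1) by simp
 have "0 <= (LI x. indicator Om x * (\<bar>f x\<bar> powr p * infdist x (frontier Om) powr (- p)))"
 by (rule bint_nonneg) simp
 \<comment> \<open>A vanishing denominator would make the quotient the default value 0,
   contradicting the positive lower bound.\<close>
 moreover have "(LI x. indicator Om x * (\<bar>f x\<bar> powr p * infdist x (frontier Om) powr (- p))) ~= 0" using le H by auto
 ultimately have "0 < (LI x. indicator Om x * (\<bar>f x\<bar> powr p * infdist x (frontier Om) powr (- p)))" by linarith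
 from pos_le_divide_eq[OF this] le show ?thesis by blast
qed

theorem minimizer_strict:
 fixes Om :: "'a::euclidean_space set"
 assumes p: "1 < p" and ga: "0 < ga" "ga <= 1" and Om: "open Om" "bounded Om" "C1_holder_boundary ga Om" "connected Om"
 and mn: "hardy_minimizer p Om w"
 shows "hardy_const p Om < hardy_c p"
proof (rule ccontr)
 assume "~ hardy_const p Om < hardy_c p"
 moreover define H where "H = hardy_const p Om"
 ultimately have Hc: "hardy_c p <= H" by simp
 have "0 < hardy_c p" using p by (simp add: hardy_c_def)
 then have H: "0 < H" using Hc by linarith
 define d where "d x = infdist x (frontier Om)" for x
 have [measurable]: "d : BM" unfolding d_def by measurable
 note [measurable] = borel_open[OF Om(1)]
 have w: "w : W1p_tilde p Om" "~ (AEL x. x : Om --> w x = 0)" "hardy_quotient p Om w = H"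
 using mn by (auto simp: hardy_minimizer_def hardy_admissible_def H_def AE_restrict_space_iff AE_completion_iff)
 then have wW: "w : W1p_loc p Om" by (simp add: W1p_tilde_def)
 obtain v G where wd: "weak_diff Om p v G" and v: "AEL x. x : Om --> w x = v x" and G: "AEL x. x : Om --> weak_grad Om w x = G x"
 by (rule W1p_loc_weak_diff[OF p Om(1) wW])
 interpret a: weak_diff Om p v G by (rule wd)
 define u where "u x = \<bar>v x\<bar>" for x
 define F where "F x = sgn (v x) *R G x" for x
 have wb: "weak_diff Om p u F" using a.weak_diff_abs by (simp add: u_def[abs_def] F_def[abs_def])
 interpret b: weak_diff Om p u F by (rule wb)
 define h where "h x = \<bar>v x\<bar> powr p * d x powr (- p)" for x
 have "AEL x. x : Om --> \<bar>w x\<bar> powr p * d x powr (- p) = h x" using v by eventually_elim (auto simp: h_def)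
 note hh = set_lebesgue_lborel[OF _ _ this]
 have "AEL x. x : Om --> norm (weak_grad Om w x) powr p = norm (G x) powr p" using G by eventually_elim auto
 note gg = set_lebesgue_lborel[OF _ _ this]
 have [measurable]: "h : BM" unfolding h_def[abs_def] by measurable
 have ih: "ILI x. indicator Om x * h x" and iG: "ILI x. indicator Om x * norm (G x) powr p"
 using w(1) hh(2) gg(2) unfolding W1p_tilde_def d_def[symmetric] by auto
 define N where "N = (LI x. indicator Om x * norm (G x) powr p)"
 define I where "I = (LI x. indicator Om x * h x)"
 have "N / I = H" using w(3) hh(1) gg(1) unfolding hardy_quotient_def N_def I_def d_def[symmetric] by simp
 \<comment> \<open>If \<open>I\<close> were 0, the quotient would be 0 by default, against 0 <
   H.\<close>
 then have NI: "N = H * I" using H by (cases "I = 0") (auto simp: field_simps)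
 have unz: "~ (AEL x. x : Om --> u x = 0)"
 proof
 assume "AEL x. x : Om --> u x = 0"
 then have "AEL x. x : Om --> w x = 0" using v by eventually_elim (auto simp: u_def)
 then show False using w(2) by blast
 qed
 define k where "k x = H / d x powr p" for x
 have [measurable]: "k : BM" unfolding k_def[abs_def] by measurable
 have k0: "0 <= k x" for x using H by (simp add: k_def)
 have kb: "EX B. ALL x:K. \<bar>k x\<bar> <= B" if "compact K" "K <= Om" for K
 unfolding k_def d_def by (rule hardy_weight_bounded[OF Om(1,2) that])
 have kh: "k x * \<bar>t\<bar> powr p = H * (\<bar>t\<bar> powr p * d x powr (- p))" for x t by (simp add: k_def powr_minus_divide)
 have sgnG: "indicator Om x * norm (F x) powr p <= indicator Om x * norm (G x) powr p" for x
 by (auto simp: F_def sgn_real_def split: split_indicator)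
 have iF: "ILI x. indicator Om x * norm (F x) powr p"
 by (rule integrable_dominated[OF iG]) (use sgnG in auto)
 have sup: "b.supersolution (%x. k x * u x powr (p - 1))"
 proof (rule b.energy_supersolution)
 show iu: "ILI x. indicator Om x * (k x * norm (u x) powr p)"
 using integrable_mult_right[OF ih, of H] by (simp add: u_def kh h_def mult_ac)
 have "(LI x. indicator Om x * (1 * norm (F x) powr p)) <= N"
 unfolding N_def using sgnG iF iG by (intro integral_mono) auto
 moreover have "(LI x. indicator Om x * (k x * norm (u x) powr p)) = H * I"
 unfolding I_def by (subst integral_mult_right_zero[symmetric]) (simp add: u_def kh h_def mult_ac)
 ultimately have E: "(LI x. indicator Om x * (1 * norm (F x) powr p)) - (LI x. indicator Om x * (k x * norm (u x) powr p)) <= 0"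
 using NI by linarith
 fix vp :: "'a => real" and s :: real
 assume ph: "vp : test_functions Om" "!!x. 0 <= vp x" "0 < s"
 and i1: "ILI x. indicator Om x * (k x * norm (u x + s *R vp x) powr p)"
 and i2: "ILI x. indicator Om x * (1 * norm (F x + s *R grad vp x) powr p)"
 have eq: "indicator Om x * (k x * norm (u x + s *R vp x) powr p) = H * (indicator Om x * (\<bar>u x + s * vp x\<bar> powr p * d x powr (- p)))" for x
 by (simp add: kh mult_ac)
 \<comment> \<open>The difference of the two energies is nonnegative at each competitor by the Hardy
   inequality, and nonpositive at the modulus by \<open>E\<close>; this is the minimality
   required.\<close>
 have "H * (LI x. indicator Om x * (\<bar>u x + s * vp x\<bar> powr p * d x powr (- p))) <= (LI x. indicator Om x * norm (F x + s *R grad vp x) powr p)"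
 unfolding H_def d_def
 proof (rule hardy_inequality[OF b.weak_diff_add_test[OF ph(1)]])
 show "0 < hardy_const p Om" using H by (simp add: H_def)
 show "~ (AEL x. x : Om --> u x + s * vp x = 0)"
 proof
 assume "AEL x. x : Om --> u x + s * vp x = 0"
 then have "AEL x. x : Om --> u x = 0"
 proof eventually_elim
 case (elim x)
 have "0 <= u x" "0 <= s * vp x" using ph by (auto simp: u_def)
 then show ?case using elim by linarith
 qed
 then show False using unz by blast
 qed
 show "ILI x. indicator Om x * (\<bar>u x + s * vp x\<bar> powr p * infdist x (frontier Om) powr (- p))"
 using i1 H unfolding eq d_def[symmetric] by simp
 qed (use i2 in simp)
 then show "(LI x. indicator Om x * (1 * norm (F x) powr p)) - (LI x. indicator Om x * (k x * norm (u x) powr p))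
 <= (LI x. indicator Om x * (1 * norm (F x + s *R grad vp x) powr p)) - (LI x. indicator Om x * (k x * norm (u x + s *R vp x) powr p))"
 unfolding eq using E by simp
 qed (use k0 kb iF in "auto simp: u_def")
 have sup0: "b.supersolution (%_. 0)"
 by (rule b.supersolution_mono[OF sup]) (use k0 in "auto simp: loc_integrable_def")
 have u0: "AEL x. x : Om --> 0 <= u x" by (simp add: u_def)
 obtain y s c where st: "0 < s" "ball y s <= Om" "0 < c" "AEL x. x : ball y s --> c <= u x"
 using b.positivity_start[OF sup0 u0 unz] by (elim exE conjE)
 define al where "al = (p - 1) / p"
 have al: "(p - 1) / p <= al" "al < 1" "al * p = p - 1" using p by (auto simp: al_def)
 \<comment> \<open>At the critical exponent the curve \<open>hardy_lambda\<close> takes the value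
   \<open>hardy_c\<close>, so the assumed lower bound on the Hardy constant makes the modulus
   comparable with the critical barrier.\<close>
 have hl: "hardy_lambda p al = hardy_c p"
 proof -
 have "hardy_c p = ((p - 1) / p) powr (p - 1) * ((p - 1) / p)" using powr_add[of "(p - 1) / p" "p - 1" 1] p by (simp add: hardy_c_def)
 moreover have "(p - 1) * (1 - (p - 1) / p) = (p - 1) / p" using p by (simp add: field_simps)
 moreover have "hardy_lambda p al = ((p - 1) / p) powr (p - 1) * ((p - 1) * (1 - (p - 1) / p))" by (simp only: hardy_lambda_def al_def mult_ac)
 ultimately show ?thesis by (simp only:)
 qed
 have "EX c>0. EX e>0. AEL x. x : Om --> d x < e --> c * d x powr al <= u x"
 unfolding d_def
 proof (rule b.boundary_lower_bound[OF Om(1-3) ga al(1,2) order_refl zero_less_one _ sup])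
 show "AEL x. x : Om --> hardy_lambda p al / infdist x (frontier Om) powr p * u x powr (p - 1) <= k x * u x powr (p - 1)"
 unfolding hl k_def d_def using Hc by (intro AE_I2 impI mult_right_mono divide_right_mono) auto
 show "EX c>0. AEL x. x : K --> c <= u x" if "compact K" "K <= Om" for K
 by (rule b.positive_on_compact[OF Om(4) sup0 u0 st that])
 qed
 then obtain c e where c: "c > 0" "e > 0" "AEL x. x : Om --> d x < e --> c * d x powr al <= u x" by blast
 have "Om ~= {}" using unz by auto
 then obtain x0 where x0: "x0 : Om" by blast
 obtain z where z: "z : frontier Om" by (rule nearest_frontier[OF x0 Om(2,1)])
 show False
 proof (rule inverse_distance_not_integrable[OF Om(1,3) z c(2), of "%x. c powr (- p) * (indicator Om x * h x)"])
 show "ILI x. c powr (- p) * (indicator Om x * h x)" using ih by simp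
 show "0 <= c powr (- p) * (indicator Om x * h x)" for x by (simp add: h_def)
 show "AEL x. x : Om --> infdist x (frontier Om) < e --> 1 / infdist x (frontier Om) <= c powr (- p) * (indicator Om x * h x)"
 using c(3) unfolding d_def[symmetric]
 proof eventually_elim
 case (elim x)
 show ?case
 proof (intro impI)
 assume x: "x : Om" "d x < e"
 have d: "0 < d x" unfolding d_def by (rule nearest_frontier[OF x(1) Om(2,1)])
 \<comment> \<open>Since al p = p - 1, the lower bound makes the weighted p-th power of
   \<open>u\<close> at least c^p/d, which is not integrable near the boundary.\<close>
 have "(c * d x powr al) powr p <= u x powr p" using elim x c(1) p by (intro powr_mono2) auto
 also have "(c * d x powr al) powr p = c powr p * d x powr (p - 1)" using c(1) al(3) by (simp add: powr_mult powr_powr)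
 finally have "c powr (- p) * (c powr p * d x powr (p - 1) * d x powr (- p)) <= c powr (- p) * (u x powr p * d x powr (- p))"
 by (intro mult_left_mono mult_right_mono) auto
 moreover have "c powr (- p) * c powr p = 1" using c(1) by (simp flip: powr_add)
 moreover have "d x powr (p - 1) * d x powr (- p) = 1 / d x" using d by (simp flip: powr_add)
 ultimately have "1 / d x <= c powr (- p) * (u x powr p * d x powr (- p))"
 by (metis (no_types, lifting) mult.assoc mult_1)
 then show "1 / d x <= c powr (- p) * (indicator Om x * h x)" using x(1) by (simp add: h_def u_def)
 qed
 qed
 qed
qed

theorem theorem5p1:
  fixes \<Omega> :: "'a::euclidean_space set" and p \<gamma> :: real
  assumes "DIM('a) \<ge> 2" and "1 < p" and "0 < \<gamma>" and "\<gamma> \<le> 1"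
    and "open \<Omega>" and "connected \<Omega>" and "bounded \<Omega>" and "C1_holder_boundary \<gamma> \<Omega>"
  shows "(\<forall>lam \<alpha> U u.
            0 < lam \<and> lam \<le> hardy_const p \<Omega> \<and>
            (p - 1) / p \<le> \<alpha> \<and> \<alpha> < 1 \<and> hardy_lambda p \<alpha> = lam \<and>
            open U \<and> frontier \<Omega> \<subseteq> U \<and>
            continuous_on (closure (\<Omega> \<inter> U) - frontier \<Omega>) u \<and>
            (\<forall>x \<in> closure (\<Omega> \<inter> U) - frontier \<Omega>. 0 < u x) \<and>
            weak_solution p (\<Omega> \<inter> U) (\<lambda>x. - (lam / bdry_dist \<Omega> x powr p)) u
            \<longrightarrow> (\<exists>C>0. \<forall>x \<in> \<Omega> \<inter> U. bdry_dist \<Omega> x powr \<alpha> \<le> C * u x))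
         \<and> (\<forall>u. hardy_minimizer p \<Omega> u \<longrightarrow> hardy_const p \<Omega> < hardy_c p)"
  using solution_lower_bound[OF assms(2-5,7,8)] minimizer_strict[OF assms(2-5,7,8,6)] by blast

end
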